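(* Let $K/Q$ be a Galois extension of number fields with Galois group $\Gamma$, and let $T=\{v_1,\dots,v_{|T|}\}$ be a finite set of places of $Q$ containing all archimedean places, with decomposition groups $\Gamma_{v_i}\subset\Gamma$ of $v_i$ in $K/Q$. Let $\Delta=|\mathrm{Cl}_T(Q)||\mu(K)||\Gamma|$, $Z=\prod_{p\nmid\Delta}\mathbb{Z}_p$, and $B=Z[\Gamma]/(\sum_{\gamma\in\Gamma}\gamma)$. Then for all sufficiently large $n$: (a) there are elements $r_i\in B^n$ for $1\le i\le n$ and $r_j\in(B^n)^{\Gamma_{v_{j-n}}}$ for $n+1\le j\le n+|T|$ such that, as $\Gamma$-modules, $$\mathrm{Cl}_T(K)_{\Delta'}\cong B^n/[r_1,r_2,\dots,r_{n+|T|}];$$ (b) there are elements $r_i\in\mathcal{F}_n(\Gamma)^{\mathrm{ab}}_{\Delta'}$ for $1\le i\le n$, $r_{n+1}\in(\mathcal{F}_n(\Gamma)^{\mathrm{ab}}_{\Delta'})^{\Gamma_{v_1}}$, and $r_j\in(\mathcal{F}_n(\Gamma)^{\mathrm{ab}}_{\Delta'})^{\Gamma_{v_{j-n}}}$ for $n+2\le j\le n+|T|$ such that, as $\Gamma$-modules, $$\mathrm{Cl}_T(K)_{\Delta'}\cong\mathcal{F}_n(\Gamma)^{\mathrm{ab}}_{\Delta'}\big/\big[r_i^{-1}\gamma(r_i),\ r_j\big]_{1\le i\le n+1,\ n+2\le j\le n+|T|,\ \gamma\in\Gamma}.$$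
   Context: $\mathrm{Cl}_T(K)$ is the class group of $K$ modulo the classes of the finite primes of $K$ lying above $T$, with its natural $\Gamma$-action; similarly $\mathrm{Cl}_T(Q)$. $\mu(K)$ is the group of roots of unity of $K$. For a profinite group $G$, $G_{\Delta'}$ is its maximal quotient of (supernatural) order coprime to $\Delta$, and $G^{\mathrm{ab}}$ its abelianization. For a $\Gamma$-module $M$ and $\Gamma_0\subset\Gamma$, $M^{\Gamma_0}$ is the submodule of $\Gamma_0$-fixed elements. $\mathcal{F}_n(\Gamma)$ is the closed subgroup, generated by all $x_{i,\gamma}^{-1}\gamma'(x_{i,\gamma})$, of the free profinite pro-$|\Gamma|'$ group on $x_{i,\gamma}$ ($1\le i\le n$, $\gamma\in\Gamma$) with $\Gamma$-action $\gamma'(x_{i,\gamma})=x_{i,\gamma'\gamma}$; here pro-$|\Gamma|'$ means all finite quotients have order coprime to $|\Gamma|$. Brackets $[\cdots]$ denote the closed $\Gamma$-stable subgroup (in $B^n$: the $Z[\Gamma]$-submodule) generated by the listed elements. *)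

theory Defs
  imports
    "HOL-Analysis.Analysis"
    "HOL-Algebra.Algebra"
    "HOL-Computational_Algebra.Computational_Algebra"
begin

hide_const (open) Polynomial.order

section \<open>Groups and topological groups with an action\<close>

record ('a, 'g) act_group = "'a monoid" +
  act :: "'g \<Rightarrow> 'a \<Rightarrow> 'a"

record ('a, 'g) top_group = "('a, 'g) act_group" +
  topo :: "'a topology"

definition fixed_points :: "('a, 'g, 'm) act_group_scheme \<Rightarrow> 'g set \<Rightarrow> 'a set" where
  "fixed_points G S = {x \<in> carrier G. \<forall>\<gamma>\<in>S. act G \<gamma> x = x}"

definition equivariant_iso ::
  "'g set \<Rightarrow> ('a, 'g, 'm) act_group_scheme \<Rightarrow> ('b, 'g, 'n) act_group_scheme \<Rightarrow> bool" where
  "equivariant_iso S G H \<longleftrightarrow>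
     (\<exists>f\<in>iso G H. \<forall>\<gamma>\<in>S. \<forall>x\<in>carrier G. f (act G \<gamma> x) = act H \<gamma> (f x))"

definition act_quot :: "('a, 'g, 'm) act_group_scheme \<Rightarrow> 'a set \<Rightarrow> ('a set, 'g) act_group" where
  "act_quot G N = monoid.extend (G Mod N) (act_group.fields (\<lambda>\<gamma> C. act G \<gamma> ` C))"

text \<open>The elements of \<^term>\<open>rcosets\<^bsub>G\<^esub> N\<close> are sets, so the preimage of a set \<open>U\<close> of cosets
  under the projection is \<open>\<Union>U\<close>.\<close>

definition quot_topology :: "('a, 'g, 'm) top_group_scheme \<Rightarrow> 'a set \<Rightarrow> 'a set topology" where
  "quot_topology G N = topology (\<lambda>U. U \<subseteq> rcosets\<^bsub>G\<^esub> N \<and> openin (topo G) (\<Union>U))"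

lemma openin_quot_topology:
  assumes "group G" "subgroup N G"
  shows "openin (quot_topology G N) U \<longleftrightarrow> U \<subseteq> rcosets\<^bsub>G\<^esub> N \<and> openin (topo G) (\<Union>U)"
proof -
  have "istopology (\<lambda>U. U \<subseteq> rcosets\<^bsub>G\<^esub> N \<and> openin (topo G) (\<Union>U))"
    unfolding istopology_def
  proof (intro conjI allI impI)
    fix S T assume S: "S \<subseteq> rcosets\<^bsub>G\<^esub> N \<and> openin (topo G) (\<Union>S)"
      and T: "T \<subseteq> rcosets\<^bsub>G\<^esub> N \<and> openin (topo G) (\<Union>T)"
    have disj: "A = B" if "A \<in> rcosets\<^bsub>G\<^esub> N" "B \<in> rcosets\<^bsub>G\<^esub> N" "x \<in> A" "x \<in> B" for A B x
      using group.rcos_disjoint[OF assms] that by (auto simp: pairwise_def disjnt_def)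
    have "\<Union>(S \<inter> T) = \<Union>S \<inter> \<Union>T"
    proof
      show "\<Union>S \<inter> \<Union>T \<subseteq> \<Union>(S \<inter> T)"
      proof
        fix x assume "x \<in> \<Union>S \<inter> \<Union>T"
        then obtain A B where AB: "A \<in> S" "x \<in> A" "B \<in> T" "x \<in> B" by blast
        then have "A = B" using disj S T by blast
        then show "x \<in> \<Union>(S \<inter> T)" using AB by blast
      qed
    qed blast
    then show "openin (topo G) (\<Union>(S \<inter> T))" using S T by auto
  next
    fix \<K> assume *: "\<forall>K\<in>\<K>. K \<subseteq> rcosets\<^bsub>G\<^esub> N \<and> openin (topo G) (\<Union>K)"
    have "\<Union>(\<Union>\<K>) = (\<Union>K\<in>\<K>. \<Union>K)" by blast
    then show "openin (topo G) (\<Union>(\<Union>\<K>))" using * by auto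
  qed auto
  then show ?thesis unfolding quot_topology_def by (simp add: topology_inverse')
qed

definition top_quot :: "('a, 'g, 'm) top_group_scheme \<Rightarrow> 'a set \<Rightarrow> ('a set, 'g) top_group" where
  "top_quot G N = act_group.extend (act_quot G N) (top_group.fields (quot_topology G N))"

definition top_sub :: "('a, 'g) top_group \<Rightarrow> 'a set \<Rightarrow> ('a, 'g) top_group" where
  "top_sub G H = G\<lparr>carrier := H, topo := subtopology (topo G) H\<rparr>"

definition closed_generate :: "('a, 'g, 'm) top_group_scheme \<Rightarrow> 'a set \<Rightarrow> 'a set" where
  "closed_generate G S = \<Inter>{H. subgroup H G \<and> closedin (topo G) H \<and> S \<subseteq> H}"

definition closed_stable_generate ::
  "'g set \<Rightarrow> ('a, 'g, 'm) top_group_scheme \<Rightarrow> 'a set \<Rightarrow> 'a set" where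
  "closed_stable_generate S G Y =
     \<Inter>{H. subgroup H G \<and> closedin (topo G) H \<and> (\<forall>\<gamma>\<in>S. \<forall>x\<in>H. act G \<gamma> x \<in> H) \<and> Y \<subseteq> H}"

definition abelianization :: "('a, 'g, 'm) top_group_scheme \<Rightarrow> ('a set, 'g) top_group" where
  "abelianization G = top_quot G (Abstract_Topology.closure_of (topo G) (derived G (carrier G)))"

text \<open>The order of a profinite group is the supernatural number
  \<open>lcm {[G : U] | U open}\<close>; it is coprime to \<open>d\<close> iff each of these indices is.\<close>

definition order_coprime :: "('a, 'g, 'm) top_group_scheme \<Rightarrow> nat \<Rightarrow> bool" where
  "order_coprime G d \<longleftrightarrow>
     (\<forall>U. subgroup U G \<and> openin (topo G) U \<longrightarrow> coprime (card (rcosets\<^bsub>G\<^esub> U)) d)"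

text \<open>The maximal quotient \<open>G\<^sub>d\<^sub>'\<close> of order coprime to \<open>d\<close>.  It is also used for the class group,
  which is finite and carries the discrete topology.\<close>

definition prime_to_quot :: "nat \<Rightarrow> ('a, 'g, 'm) top_group_scheme \<Rightarrow> ('a set, 'g) top_group" where
  "prime_to_quot d G =
     top_quot G (\<Inter>{N. N \<lhd> G \<and> closedin (topo G) N \<and> order_coprime (top_quot G N) d})"


section \<open>Free pro-\<open>|\<Gamma>|'\<close> groups and \<open>\<F>\<^sub>n(\<Gamma>)\<close>\<close>

text \<open>The free profinite group on \<open>A\<close> in the class of finite groups of order coprime to \<open>m\<close> is
  realised as the closed subgroup generated by the tautological tuples \<open>(\<phi> x)\<close>
  in the product, over all such finite groups \<open>H\<close> (with carrier in \<^typ>\<open>nat\<close>) and all maps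
  \<open>\<phi> : A \<rightarrow> H\<close>, of the discrete groups \<open>H\<close>.\<close>

definition free_index :: "nat \<Rightarrow> 'x set \<Rightarrow> (nat monoid \<times> ('x \<Rightarrow> nat)) set" where
  "free_index m A = {(H, \<phi>). group H \<and> finite (carrier H) \<and> coprime (order H) m
                             \<and> \<phi> \<in> A \<rightarrow>\<^sub>E carrier H}"

definition free_gen :: "nat \<Rightarrow> 'x set \<Rightarrow> 'x \<Rightarrow> (nat monoid \<times> ('x \<Rightarrow> nat) \<Rightarrow> nat)" where
  "free_gen m A x = (\<lambda>(H, \<phi>)\<in>free_index m A. \<phi> x)"

text \<open>The action of \<open>\<Gamma>\<close> on \<open>A\<close> is a parameter \<open>a\<close>; \<open>\<gamma>\<close> acts on the product by permuting the
  coordinates, sending the coordinate at \<open>(H, \<phi> \<circ> a \<gamma>)\<close> to the one at \<open>(H, \<phi>)\<close>, so that the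
  generator of index \<open>x\<close> goes to that of index \<open>a \<gamma> x\<close>.\<close>

definition free_ambient ::
  "nat \<Rightarrow> 'x set \<Rightarrow> ('g \<Rightarrow> 'x \<Rightarrow> 'x) \<Rightarrow> (nat monoid \<times> ('x \<Rightarrow> nat) \<Rightarrow> nat, 'g) top_group" where
  "free_ambient m A a = monoid.extend (product_group (free_index m A) fst)
     \<lparr>act = (\<lambda>\<gamma> f. \<lambda>(H, \<phi>)\<in>free_index m A. f (H, \<lambda>x\<in>A. \<phi> (a \<gamma> x))),
      topo = product_topology (\<lambda>(H, \<phi>). discrete_topology (carrier H)) (free_index m A)\<rparr>"

definition free_pro ::
  "nat \<Rightarrow> 'x set \<Rightarrow> ('g \<Rightarrow> 'x \<Rightarrow> 'x) \<Rightarrow> (nat monoid \<times> ('x \<Rightarrow> nat) \<Rightarrow> nat, 'g) top_group" where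
  "free_pro m A a =
     top_sub (free_ambient m A a) (closed_generate (free_ambient m A a) (free_gen m A ` A))"


lemma ne_empty: "x \<in> S \<Longrightarrow> S \<noteq> {}" by blast

lemma group_extend:
  assumes "group G"
  shows "group (monoid.extend G e)"
proof -
  interpret group G by fact
  show ?thesis
    by (rule groupI) (auto simp: monoid.defs m_assoc intro: l_inv_ex)
qed

lemma free_ambient_simps:
  "carrier (free_ambient m A a) = (\<Pi>\<^sub>E q\<in>free_index m A. carrier (fst q))"
  "mult (free_ambient m A a) = (\<lambda>x y. \<lambda>q\<in>free_index m A. x q \<otimes>\<^bsub>fst q\<^esub> y q)"
  "act (free_ambient m A a) = (\<lambda>\<gamma> f. \<lambda>(H, \<phi>)\<in>free_index m A. f (H, \<lambda>x\<in>A. \<phi> (a \<gamma> x)))"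
  "topo (free_ambient m A a) =
     product_topology (\<lambda>(H, \<phi>). discrete_topology (carrier H)) (free_index m A)"
  by (simp_all add: free_ambient_def monoid.defs)

lemma free_ambient_group: "group (free_ambient m A a)"
  unfolding free_ambient_def by (rule group_extend, rule product_group) (auto simp: free_index_def)

lemma topspace_free_ambient:
  "topspace (topo (free_ambient m A a)) = carrier (free_ambient m A a)"
  by (simp add: free_ambient_simps case_prod_beta)

lemma free_gen_in_ambient: "x \<in> A \<Longrightarrow> free_gen m A x \<in> carrier (free_ambient m A a)"
  by (auto simp: free_gen_def free_ambient_simps free_index_def PiE_iff)

lemma subgroup_closed_generate:
  assumes "group G" "topspace (topo G) = carrier G" "S \<subseteq> carrier G"
  shows "subgroup (closed_generate G S) G"
  unfolding closed_generate_def
proof (rule group.subgroups_Inter[OF assms(1)])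
  have "carrier G \<in> {H. subgroup H G \<and> closedin (topo G) H \<and> S \<subseteq> H}"
    using assms(3) group.subgroup_self[OF assms(1)] closedin_topspace[of "topo G"]
    unfolding assms(2) by blast
  then show "{H. subgroup H G \<and> closedin (topo G) H \<and> S \<subseteq> H} \<noteq> {}" by (rule ne_empty)
qed blast

lemma free_pro_simps:
  "carrier (free_pro m A a) = closed_generate (free_ambient m A a) (free_gen m A ` A)"
  "mult (free_pro m A a) = mult (free_ambient m A a)"
  "act (free_pro m A a) = act (free_ambient m A a)"
  "topo (free_pro m A a) =
     subtopology (topo (free_ambient m A a)) (carrier (free_pro m A a))"
  by (simp_all add: free_pro_def top_sub_def)

lemma free_gen_in_free_pro: "x \<in> A \<Longrightarrow> free_gen m A x \<in> carrier (free_pro m A a)"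
  by (auto simp: free_pro_simps closed_generate_def)

lemma subgroup_free_pro: "subgroup (carrier (free_pro m A a)) (free_ambient m A a)"
  unfolding free_pro_simps
  by (rule subgroup_closed_generate[OF free_ambient_group topspace_free_ambient])
    (auto intro: free_gen_in_ambient)

lemma free_pro_ambient: "carrier (free_pro m A a) \<subseteq> carrier (free_ambient m A a)"
  using subgroup_free_pro by (rule subgroup.subset)

lemma act_free_gen:
  assumes "x \<in> A" "a \<gamma> \<in> A \<rightarrow> A"
  shows "act (free_pro m A a) \<gamma> (free_gen m A x) = free_gen m A (a \<gamma> x)"
proof -
  have "(H, \<lambda>x\<in>A. \<phi> (a \<gamma> x)) \<in> free_index m A" if "(H, \<phi>) \<in> free_index m A" for H \<phi>
    using that assms(2) by (auto simp: free_index_def Pi_iff PiE_iff)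
  then show ?thesis
    using assms(1) by (simp add: free_pro_simps free_ambient_simps free_gen_def restrict_def fun_eq_iff)
qed

text \<open>The universal property of the free group with respect to finite groups of order coprime
  to \<open>m\<close>: a map \<open>\<phi> : A \<rightarrow> H\<close> extends to a unique continuous homomorphism.\<close>

lemma free_pro_exists_hom:
  fixes H :: "('h, 'm) monoid_scheme"
  assumes "group H" "finite (carrier H)" "coprime (order H) m" "\<phi> \<in> A \<rightarrow> carrier H"
  shows "\<exists>f\<in>hom (free_pro m A a) H.
           continuous_map (topo (free_pro m A a)) (discrete_topology (carrier H)) f \<and>
           (\<forall>x\<in>A. f (free_gen m A x) = \<phi> x)"
proof -
  interpret H: group H by fact
  obtain h :: "'h \<Rightarrow> nat" where "bij_betw h (carrier H) {0..<card (carrier H)}"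
    using ex_bij_betw_finite_nat[OF assms(2)] by blast
  then have inj: "inj_on h (carrier H)" by (rule bij_betw_imp_inj_on)
  define g where "g = inv_into (carrier H) h"
  have gh[simp]: "g (h x) = x" if "x \<in> carrier H" for x using inj that by (simp add: g_def)
  define M :: "nat monoid" where "M = \<lparr>carrier = h ` carrier H, monoid.mult = (\<lambda>x y. h (g x \<otimes>\<^bsub>H\<^esub> g y)),
    one = h \<one>\<^bsub>H\<^esub>\<rparr>"
  have "h \<in> hom H M" by (auto simp: hom_def M_def)
  from H.hom_imp_img_group[OF this] have M: "group M" by (simp add: M_def)
  have ordM: "order M = order H" using inj by (simp add: order_def M_def card_image)
  define q where "q = (M, \<lambda>x\<in>A. h (\<phi> x))"
  have q: "q \<in> free_index m A"
    using M assms ordM by (auto simp: q_def free_index_def M_def PiE_iff)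
  define f where "f = (\<lambda>y :: nat monoid \<times> ('a \<Rightarrow> nat) \<Rightarrow> nat. g (y q))"
  have yq: "y q \<in> h ` carrier H" if "y \<in> carrier (free_pro m A a)" for y
  proof -
    have "y \<in> carrier (free_ambient m A a)" using that free_pro_ambient by blast
    then have "y q \<in> carrier (fst q)" using q by (auto simp: free_ambient_simps PiE_iff)
    then show ?thesis by (simp add: q_def M_def)
  qed
  show ?thesis
  proof (intro bexI conjI ballI)
    show "f \<in> hom (free_pro m A a) H"
    proof (rule homI)
      fix x y assume x: "x \<in> carrier (free_pro m A a)" and y: "y \<in> carrier (free_pro m A a)"
      show "f (x \<otimes>\<^bsub>free_pro m A a\<^esub> y) = f x \<otimes>\<^bsub>H\<^esub> f y"
        using yq[OF x] yq[OF y] q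
        by (auto simp: f_def free_pro_simps free_ambient_simps) (auto simp: q_def M_def)
      show "f x \<in> carrier H" using yq[OF x] by (auto simp: f_def)
    qed
    have "continuous_map (topo (free_ambient m A a)) (discrete_topology (carrier M)) (\<lambda>y. y q)"
      using continuous_map_product_projection[OF q, of "\<lambda>(H, \<phi>). discrete_topology (carrier H)"]
      by (simp add: free_ambient_simps q_def)
    then have "continuous_map (topo (free_pro m A a)) (discrete_topology (carrier M)) (\<lambda>y. y q)"
      unfolding free_pro_simps(4) by (rule continuous_map_from_subtopology)
    moreover have "continuous_map (discrete_topology (carrier M)) (discrete_topology (carrier H)) g"
      by (auto simp: M_def)
    ultimately have "continuous_map (topo (free_pro m A a)) (discrete_topology (carrier H)) (g \<circ> (\<lambda>y. y q))"
      by (rule continuous_map_compose)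
    then show "continuous_map (topo (free_pro m A a)) (discrete_topology (carrier H)) f"
      by (simp add: f_def o_def)
    fix x assume x: "x \<in> A"
    then have "free_gen m A x q = h (\<phi> x)"
      using q by (simp add: free_gen_def) (simp add: q_def)
    then show "f (free_gen m A x) = \<phi> x" using assms(4) x by (simp add: f_def Pi_iff)
  qed
qed

lemma free_pro_unique_hom:
  assumes "group H"
    and "f \<in> hom (free_pro m A a) H" "f' \<in> hom (free_pro m A a) H"
    and "continuous_map (topo (free_pro m A a)) (discrete_topology (carrier H)) f"
    and "continuous_map (topo (free_pro m A a)) (discrete_topology (carrier H)) f'"
    and eq: "\<And>x. x \<in> A \<Longrightarrow> f (free_gen m A x) = f' (free_gen m A x)"
    and y: "y \<in> carrier (free_pro m A a)"
  shows "f y = f' y"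
proof -
  let ?F = "free_pro m A a" and ?P = "free_ambient m A a"
  let ?E = "{x \<in> carrier ?F. f x = f' x}"
  have top: "topspace (topo ?F) = carrier ?F"
    unfolding free_pro_simps(4) topspace_subtopology topspace_free_ambient
    using free_pro_ambient by blast
  have cl: "closedin (topo ?P) (carrier ?F)"
    unfolding free_pro_simps(1) closed_generate_def
  proof (rule closedin_Inter)
    have "closedin (topo ?P) (carrier ?P)" by (metis closedin_topspace topspace_free_ambient)
    moreover have "free_gen m A ` A \<subseteq> carrier ?P" by (auto intro: free_gen_in_ambient)
    ultimately have "carrier ?P \<in> {H. subgroup H ?P \<and> closedin (topo ?P) H \<and> free_gen m A ` A \<subseteq> H}"
      using group.subgroup_self[OF free_ambient_group] by simp
    then show "{H. subgroup H ?P \<and> closedin (topo ?P) H \<and> free_gen m A ` A \<subseteq> H} \<noteq> {}"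
      by (rule ne_empty)
  qed auto
  have "closedin (topo ?F) {x \<in> topspace (topo ?F). f x = f' x}"
    by (rule closedin_continuous_maps_eq[OF _ assms(4,5)]) simp
  then have "closedin (topo ?P) ?E"
    unfolding top using cl unfolding free_pro_simps(4) by (rule closedin_trans_full)
  moreover have "subgroup ?E ?P"
  proof -
    interpret P: group ?P by (rule free_ambient_group)
    have gF: "group (?P\<lparr>carrier := carrier ?F\<rparr>)"
      using subgroup.subgroup_is_group[OF subgroup_free_pro P.is_group] .
    have fh: "f \<in> hom (?P\<lparr>carrier := carrier ?F\<rparr>) H" "f' \<in> hom (?P\<lparr>carrier := carrier ?F\<rparr>) H"
      using assms(2,3) by (simp_all add: hom_def free_pro_simps(2))
    interpret f: group_hom "?P\<lparr>carrier := carrier ?F\<rparr>" H f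
      using gF assms(1) fh by (simp add: group_hom_def group_hom_axioms_def)
    interpret f': group_hom "?P\<lparr>carrier := carrier ?F\<rparr>" H f'
      using gF assms(1) fh by (simp add: group_hom_def group_hom_axioms_def)
    interpret S: subgroup "carrier ?F" ?P by (rule subgroup_free_pro)
    show ?thesis
    proof (rule P.subgroupI)
      show "?E \<subseteq> carrier ?P" by (rule subset_trans[OF _ S.subset]) blast
      have "\<one>\<^bsub>?P\<^esub> \<in> ?E" using f.hom_one f'.hom_one S.one_closed by simp
      then show "?E \<noteq> {}" by (rule ne_empty)
      fix x assume x: "x \<in> ?E"
      then have "f (inv\<^bsub>?P\<^esub> x) = f' (inv\<^bsub>?P\<^esub> x)"
        using f.hom_inv[of x] f'.hom_inv[of x] P.m_inv_consistent[OF subgroup_free_pro, of x] by simp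
      then show "inv\<^bsub>?P\<^esub> x \<in> ?E" using x S.m_inv_closed[of x] by simp
      fix y assume "y \<in> ?E"
      then show "x \<otimes>\<^bsub>?P\<^esub> y \<in> ?E" using x f.hom_mult[of x y] f'.hom_mult[of x y] S.m_closed[of x y] by simp
    qed
  qed
  moreover have "free_gen m A ` A \<subseteq> ?E" using eq free_gen_in_free_pro by fastforce
  ultimately have "?E \<in> {H. subgroup H ?P \<and> closedin (topo ?P) H \<and> free_gen m A ` A \<subseteq> H}"
    by blast
  then have "closed_generate ?P (free_gen m A ` A) \<subseteq> ?E"
    unfolding closed_generate_def by (rule Inter_lower)
  then show ?thesis using y unfolding free_pro_simps(1) by blast
qed

definition gen_shift :: "('g, 'm) monoid_scheme \<Rightarrow> 'g \<Rightarrow> nat \<times> 'g \<Rightarrow> nat \<times> 'g" where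
  "gen_shift \<Gamma> \<gamma> = (\<lambda>(i, \<delta>). (i, \<gamma> \<otimes>\<^bsub>\<Gamma>\<^esub> \<delta>))"

definition F_group ::
  "nat \<Rightarrow> 'g monoid \<Rightarrow> (nat monoid \<times> (nat \<times> 'g \<Rightarrow> nat) \<Rightarrow> nat, 'g) top_group" where
  "F_group n \<Gamma> =
     (let A = {1..n} \<times> carrier \<Gamma>;
          F = free_pro (order \<Gamma>) A (gen_shift \<Gamma>);
          x = free_gen (order \<Gamma>) A
      in top_sub F (closed_generate F
           {inv\<^bsub>F\<^esub> (x (i, \<gamma>)) \<otimes>\<^bsub>F\<^esub> act F \<gamma>' (x (i, \<gamma>)) | i \<gamma> \<gamma>'.
              i \<in> {1..n} \<and> \<gamma> \<in> carrier \<Gamma> \<and> \<gamma>' \<in> carrier \<Gamma>}))"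


section \<open>The ring \<open>B\<close> and the module \<open>B\<^sup>n\<close>\<close>

text \<open>\<open>\<int>\<^sub>p\<close> as the inverse limit of the rings \<open>\<int>/p\<^sup>k\<close>, \<open>k \<ge> 0\<close>.\<close>

definition padic_int_ring :: "nat \<Rightarrow> (nat \<Rightarrow> int) ring" where
  "padic_int_ring p = \<lparr>
     carrier = {x. \<forall>k. x k \<in> {0..<int p ^ k} \<and> x (Suc k) mod int p ^ k = x k},
     monoid.mult = (\<lambda>x y k. x k * y k mod int p ^ k),
     one = (\<lambda>k. 1 mod int p ^ k),
     ring.zero = (\<lambda>k. 0),
     ring.add = (\<lambda>x y k. (x k + y k) mod int p ^ k)\<rparr>"

lemma padic_int_cring:
  assumes "p > 0"
  shows "cring (padic_int_ring p)"
proof -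
  have pos: "0 < int p ^ k" for k using assms by simp
  have mm: "(a mod int p ^ Suc k) mod int p ^ k = a mod int p ^ k" for a k
    by (rule mod_mod_cancel) simp
  define C where "C = {x :: nat \<Rightarrow> int. \<forall>k. x k \<in> {0..<int p ^ k} \<and> x (Suc k) mod int p ^ k = x k}"
  have small: "x k mod int p ^ k = x k" if "x \<in> C" for x k
    using that by (auto simp: C_def)
  have Ck: "x (Suc k) mod int p ^ k = x k" if "x \<in> C" for x k
    using that by (auto simp: C_def)
  have C: "(\<lambda>k. a k mod int p ^ k) \<in> C" if "\<And>k. a (Suc k) mod int p ^ k = a k mod int p ^ k" for a
    using pos that mm by (auto simp: C_def)
  have addC: "(\<lambda>k. (x k + y k) mod int p ^ k) \<in> C" if "x \<in> C" "y \<in> C" for x y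
    by (rule C) (metis Ck that mod_add_eq)
  have multC: "(\<lambda>k. (x k * y k) mod int p ^ k) \<in> C" if "x \<in> C" "y \<in> C" for x y
    by (rule C) (metis Ck that mod_mult_eq)
  have oneC: "(\<lambda>k. 1 mod int p ^ k) \<in> C"
    by (rule C) simp
  have zeroC: "(\<lambda>k. 0) \<in> C" using pos by (auto simp: C_def)
  have negC: "(\<lambda>k. (- x k) mod int p ^ k) \<in> C" if "x \<in> C" for x
    by (rule C) (metis Ck that mod_minus_eq)
  have carr: "carrier (padic_int_ring p) = C" by (simp add: padic_int_ring_def C_def)
  show ?thesis
  proof (rule cringI)
    show "abelian_group (padic_int_ring p)"
    proof (rule abelian_groupI, unfold carr)
      fix x assume x: "x \<in> C"
      show "\<exists>y\<in>C. y \<oplus>\<^bsub>padic_int_ring p\<^esub> x = \<zero>\<^bsub>padic_int_ring p\<^esub>"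
        by (rule bexI[OF _ negC[OF x]]) (auto simp: padic_int_ring_def mod_simps)
    qed (auto simp: padic_int_ring_def addC zeroC mod_simps small algebra_simps)
    show "comm_monoid (padic_int_ring p)"
      by (rule comm_monoidI, unfold carr)
        (auto simp: padic_int_ring_def multC oneC mod_simps small algebra_simps)
  qed (auto simp: carr, auto simp: padic_int_ring_def mod_simps algebra_simps)
qed

definition product_ring :: "'i set \<Rightarrow> ('i \<Rightarrow> ('a, 'm) ring_scheme) \<Rightarrow> ('i \<Rightarrow> 'a) ring" where
  "product_ring I R = \<lparr>
     carrier = (\<Pi>\<^sub>E i\<in>I. carrier (R i)),
     monoid.mult = (\<lambda>x y. \<lambda>i\<in>I. x i \<otimes>\<^bsub>R i\<^esub> y i),
     one = (\<lambda>i\<in>I. \<one>\<^bsub>R i\<^esub>),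
     ring.zero = (\<lambda>i\<in>I. \<zero>\<^bsub>R i\<^esub>),
     ring.add = (\<lambda>x y. \<lambda>i\<in>I. x i \<oplus>\<^bsub>R i\<^esub> y i)\<rparr>"

lemma product_ring_cring:
  assumes "\<And>i. i \<in> I \<Longrightarrow> cring (R i)"
  shows "cring (product_ring I R)"
proof -
  note [simp] = product_ring_def
  have r: "ring (R i)" if "i \<in> I" for i using assms[OF that] by (rule cring.axioms)
  have m: "monoid (R i)" if "i \<in> I" for i using r[OF that] by (rule ring.is_monoid)
  have ag: "abelian_group (R i)" if "i \<in> I" for i using r[OF that] by (rule ring.is_abelian_group)
  have am: "abelian_monoid (R i)" if "i \<in> I" for i using ag[OF that] by (rule abelian_group.axioms)
  show ?thesis
  proof (rule cringI)
    show "abelian_group (product_ring I R)"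
    proof (rule abelian_groupI)
      fix x assume x: "x \<in> carrier (product_ring I R)"
      show "\<exists>y\<in>carrier (product_ring I R). y \<oplus>\<^bsub>product_ring I R\<^esub> x = \<zero>\<^bsub>product_ring I R\<^esub>"
        by (rule bexI[of _ "\<lambda>i\<in>I. \<ominus>\<^bsub>R i\<^esub> x i"])
          (use x ag in \<open>auto simp: PiE_iff abelian_group.l_neg abelian_group.a_inv_closed\<close>)
    qed (auto simp: PiE_iff fun_eq_iff restrict_def extensional_def
         abelian_monoid.a_closed[OF am] abelian_monoid.zero_closed[OF am] abelian_monoid.a_assoc[OF am]
         abelian_monoid.a_comm[OF am] abelian_monoid.l_zero[OF am]
         abelian_monoid.r_zero[OF am] abelian_monoid.a_lcomm[OF am])
    show "comm_monoid (product_ring I R)"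
      by (rule comm_monoidI)
        (auto simp: PiE_iff fun_eq_iff restrict_def extensional_def
         monoid.m_closed[OF m] monoid.one_closed[OF m] monoid.m_assoc[OF m] monoid.l_one[OF m]
         cring.cring_simprules(14)[OF assms]
         monoid.r_one[OF m] comm_monoid.m_lcomm[OF cring.axioms(2)[OF assms]])
  qed (auto simp: PiE_iff fun_eq_iff restrict_def extensional_def ring.ring_simprules(13)[OF r])
qed

definition Z_ring :: "nat \<Rightarrow> (nat \<Rightarrow> nat \<Rightarrow> int) ring" where
  "Z_ring d = product_ring {p. Factorial_Ring.prime p \<and> \<not> p dvd d} padic_int_ring"

lemma Z_ring_cring: "cring (Z_ring d)"
  unfolding Z_ring_def
  by (rule product_ring_cring, rule padic_int_cring) (auto intro: prime_gt_0_nat)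

definition group_ring :: "('r, 'm) ring_scheme \<Rightarrow> ('g, 'n) monoid_scheme \<Rightarrow> ('g \<Rightarrow> 'r) ring" where
  "group_ring R \<Gamma> = \<lparr>
     carrier = (\<Pi>\<^sub>E \<gamma>\<in>carrier \<Gamma>. carrier R),
     monoid.mult = (\<lambda>x y. \<lambda>\<gamma>\<in>carrier \<Gamma>.
       (\<Oplus>\<^bsub>R\<^esub>\<delta>\<in>carrier \<Gamma>. x \<delta> \<otimes>\<^bsub>R\<^esub> y (inv\<^bsub>\<Gamma>\<^esub> \<delta> \<otimes>\<^bsub>\<Gamma>\<^esub> \<gamma>))),
     one = (\<lambda>\<gamma>\<in>carrier \<Gamma>. if \<gamma> = \<one>\<^bsub>\<Gamma>\<^esub> then \<one>\<^bsub>R\<^esub> else \<zero>\<^bsub>R\<^esub>),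
     ring.zero = (\<lambda>\<gamma>\<in>carrier \<Gamma>. \<zero>\<^bsub>R\<^esub>),
     ring.add = (\<lambda>x y. \<lambda>\<gamma>\<in>carrier \<Gamma>. x \<gamma> \<oplus>\<^bsub>R\<^esub> y \<gamma>)\<rparr>"

lemma (in abelian_monoid) finsum_swap:
  assumes "finite A" "finite B" "\<And>i j. i \<in> A \<Longrightarrow> j \<in> B \<Longrightarrow> f i j \<in> carrier G"
  shows "(\<Oplus>i\<in>A. \<Oplus>j\<in>B. f i j) = (\<Oplus>j\<in>B. \<Oplus>i\<in>A. f i j)"
  using assms(1,3)
proof (induction A rule: finite_induct)
  case empty
  then show ?case by simp
next
  case (insert a A)
  have "(\<Oplus>i\<in>insert a A. \<Oplus>j\<in>B. f i j) = (\<Oplus>j\<in>B. f a j) \<oplus> (\<Oplus>i\<in>A. \<Oplus>j\<in>B. f i j)"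
    using insert by (intro finsum_insert) (auto intro!: finsum_closed)
  also have "\<dots> = (\<Oplus>j\<in>B. f a j) \<oplus> (\<Oplus>j\<in>B. \<Oplus>i\<in>A. f i j)"
    using insert by simp
  also have "\<dots> = (\<Oplus>j\<in>B. f a j \<oplus> (\<Oplus>i\<in>A. f i j))"
    using insert by (intro finsum_addf[symmetric]) (auto intro!: finsum_closed)
  also have "\<dots> = (\<Oplus>j\<in>B. \<Oplus>i\<in>insert a A. f i j)"
    using insert by (intro finsum_cong') (auto intro!: finsum_insert[symmetric] a_closed finsum_closed)
  finally show ?case .
qed

lemma group_ring_ring:
  assumes "ring R" "group \<Gamma>" "finite (carrier \<Gamma>)"
  shows "ring (group_ring R \<Gamma>)"
proof -
  interpret R: ring R by fact
  interpret G: group \<Gamma> by fact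
  note fin[simp] = assms(3)
  let ?RG = "group_ring R \<Gamma>"
  define C where "C = (\<Pi>\<^sub>E \<gamma>\<in>carrier \<Gamma>. carrier R)"
  have carr: "carrier ?RG = C" by (simp add: C_def group_ring_def)
  have ext: "x = y" if "x \<in> C" "y \<in> C" "\<And>g. g \<in> carrier \<Gamma> \<Longrightarrow> x g = y g" for x y
    using that unfolding C_def by (rule PiE_ext)
  have [simp]: "x g \<in> carrier R" if "x \<in> C" "g \<in> carrier \<Gamma>" for x g
    using that by (auto simp: C_def)
  have addC: "x \<oplus>\<^bsub>?RG\<^esub> y \<in> C" if "x \<in> C" "y \<in> C" for x y
    using that by (auto simp: group_ring_def C_def PiE_iff)
  have add: "(x \<oplus>\<^bsub>?RG\<^esub> y) g = x g \<oplus>\<^bsub>R\<^esub> y g" if "g \<in> carrier \<Gamma>" for x y g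
    using that by (simp add: group_ring_def)
  have multC: "x \<otimes>\<^bsub>?RG\<^esub> y \<in> C" if "x \<in> C" "y \<in> C" for x y
    using that by (auto simp: group_ring_def C_def PiE_iff intro!: R.finsum_closed)
  have mult: "(x \<otimes>\<^bsub>?RG\<^esub> y) g = (\<Oplus>\<^bsub>R\<^esub>d\<in>carrier \<Gamma>. x d \<otimes>\<^bsub>R\<^esub> y (inv\<^bsub>\<Gamma>\<^esub> d \<otimes>\<^bsub>\<Gamma>\<^esub> g))"
    if "g \<in> carrier \<Gamma>" for x y g
    using that by (simp add: group_ring_def)
  have oneC: "\<one>\<^bsub>?RG\<^esub> \<in> C" by (auto simp: group_ring_def C_def)
  have one: "\<one>\<^bsub>?RG\<^esub> g = (if g = \<one>\<^bsub>\<Gamma>\<^esub> then \<one>\<^bsub>R\<^esub> else \<zero>\<^bsub>R\<^esub>)" if "g \<in> carrier \<Gamma>" for g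
    using that by (simp add: group_ring_def)
  have zeroC: "\<zero>\<^bsub>?RG\<^esub> \<in> C" by (auto simp: group_ring_def C_def)
  have zero: "\<zero>\<^bsub>?RG\<^esub> g = \<zero>\<^bsub>R\<^esub>" if "g \<in> carrier \<Gamma>" for g
    using that by (simp add: group_ring_def)
  show ?thesis
  proof (rule ringI)
    show "abelian_group ?RG"
    proof (rule abelian_groupI, unfold carr)
      fix x assume x: "x \<in> C"
      have C': "(\<lambda>g\<in>carrier \<Gamma>. \<ominus>\<^bsub>R\<^esub> x g) \<in> C" using x by (auto simp: C_def)
      show "\<exists>y\<in>C. y \<oplus>\<^bsub>?RG\<^esub> x = \<zero>\<^bsub>?RG\<^esub>"
        by (rule bexI[OF _ C'], rule ext) (use x C' in \<open>auto simp: addC zeroC add zero R.l_neg\<close>)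
    qed (auto intro!: ext simp: addC zeroC add zero R.a_assoc R.a_comm R.a_lcomm)
    show "monoid ?RG"
    proof (rule monoidI, unfold carr)
      fix x y z assume xyz: "x \<in> C" "y \<in> C" "z \<in> C"
      show "(x \<otimes>\<^bsub>?RG\<^esub> y) \<otimes>\<^bsub>?RG\<^esub> z = x \<otimes>\<^bsub>?RG\<^esub> (y \<otimes>\<^bsub>?RG\<^esub> z)"
      proof (rule ext)
        fix g assume g: "g \<in> carrier \<Gamma>"
        have "((x \<otimes>\<^bsub>?RG\<^esub> y) \<otimes>\<^bsub>?RG\<^esub> z) g =
          (\<Oplus>\<^bsub>R\<^esub>d\<in>carrier \<Gamma>. (\<Oplus>\<^bsub>R\<^esub>e\<in>carrier \<Gamma>. x e \<otimes>\<^bsub>R\<^esub> y (inv\<^bsub>\<Gamma>\<^esub> e \<otimes>\<^bsub>\<Gamma>\<^esub> d)) \<otimes>\<^bsub>R\<^esub> z (inv\<^bsub>\<Gamma>\<^esub> d \<otimes>\<^bsub>\<Gamma>\<^esub> g))"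
          unfolding mult[OF g] using xyz g by (intro R.finsum_cong') (auto simp: mult intro!: R.finsum_closed)
        also have "\<dots> = (\<Oplus>\<^bsub>R\<^esub>d\<in>carrier \<Gamma>. \<Oplus>\<^bsub>R\<^esub>e\<in>carrier \<Gamma>.
            x e \<otimes>\<^bsub>R\<^esub> y (inv\<^bsub>\<Gamma>\<^esub> e \<otimes>\<^bsub>\<Gamma>\<^esub> d) \<otimes>\<^bsub>R\<^esub> z (inv\<^bsub>\<Gamma>\<^esub> d \<otimes>\<^bsub>\<Gamma>\<^esub> g))"
          using xyz g by (intro R.finsum_cong') (auto intro!: R.finsum_closed R.finsum_ldistr)
        also have "\<dots> = (\<Oplus>\<^bsub>R\<^esub>e\<in>carrier \<Gamma>. \<Oplus>\<^bsub>R\<^esub>d\<in>carrier \<Gamma>.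
            x e \<otimes>\<^bsub>R\<^esub> y (inv\<^bsub>\<Gamma>\<^esub> e \<otimes>\<^bsub>\<Gamma>\<^esub> d) \<otimes>\<^bsub>R\<^esub> z (inv\<^bsub>\<Gamma>\<^esub> d \<otimes>\<^bsub>\<Gamma>\<^esub> g))"
          using xyz g by (intro R.finsum_swap) auto
        also have "\<dots> = (\<Oplus>\<^bsub>R\<^esub>e\<in>carrier \<Gamma>. x e \<otimes>\<^bsub>R\<^esub> (y \<otimes>\<^bsub>?RG\<^esub> z) (inv\<^bsub>\<Gamma>\<^esub> e \<otimes>\<^bsub>\<Gamma>\<^esub> g))"
        proof (intro R.finsum_cong')
          fix e assume e: "e \<in> carrier \<Gamma>"
          have inj: "inj_on (\<lambda>d. e \<otimes>\<^bsub>\<Gamma>\<^esub> d) (carrier \<Gamma>)" using e by (auto simp: inj_on_def)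
          have img: "(\<lambda>d. e \<otimes>\<^bsub>\<Gamma>\<^esub> d) ` carrier \<Gamma> = carrier \<Gamma>"
            using e G.surj_const_mult by auto
          let ?f = "\<lambda>d. x e \<otimes>\<^bsub>R\<^esub> y (inv\<^bsub>\<Gamma>\<^esub> e \<otimes>\<^bsub>\<Gamma>\<^esub> d) \<otimes>\<^bsub>R\<^esub> z (inv\<^bsub>\<Gamma>\<^esub> d \<otimes>\<^bsub>\<Gamma>\<^esub> g)"
          have "(\<Oplus>\<^bsub>R\<^esub>d\<in>carrier \<Gamma>. ?f d) = (\<Oplus>\<^bsub>R\<^esub>d\<in>carrier \<Gamma>. ?f (e \<otimes>\<^bsub>\<Gamma>\<^esub> d))"
            using R.finsum_reindex[OF _ inj, of ?f] xyz g e by (simp add: img Pi_def)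
          also have "\<dots> = (\<Oplus>\<^bsub>R\<^esub>d\<in>carrier \<Gamma>. x e \<otimes>\<^bsub>R\<^esub> (y d \<otimes>\<^bsub>R\<^esub> z (inv\<^bsub>\<Gamma>\<^esub> d \<otimes>\<^bsub>\<Gamma>\<^esub> (inv\<^bsub>\<Gamma>\<^esub> e \<otimes>\<^bsub>\<Gamma>\<^esub> g))))"
            using xyz g e by (intro R.finsum_cong')
              (auto simp: R.m_assoc G.inv_mult_group G.m_assoc G.inv_solve_left' simp flip: G.m_assoc[of "inv\<^bsub>\<Gamma>\<^esub> e" e])
          also have "\<dots> = x e \<otimes>\<^bsub>R\<^esub> (\<Oplus>\<^bsub>R\<^esub>d\<in>carrier \<Gamma>. y d \<otimes>\<^bsub>R\<^esub> z (inv\<^bsub>\<Gamma>\<^esub> d \<otimes>\<^bsub>\<Gamma>\<^esub> (inv\<^bsub>\<Gamma>\<^esub> e \<otimes>\<^bsub>\<Gamma>\<^esub> g)))"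
            using xyz g e by (intro R.finsum_rdistr[symmetric]) auto
          finally show "(\<Oplus>\<^bsub>R\<^esub>d\<in>carrier \<Gamma>. ?f d) = x e \<otimes>\<^bsub>R\<^esub> (y \<otimes>\<^bsub>?RG\<^esub> z) (inv\<^bsub>\<Gamma>\<^esub> e \<otimes>\<^bsub>\<Gamma>\<^esub> g)"
            using e g by (simp add: mult)
        qed (use xyz g multC in auto)
        also have "\<dots> = (x \<otimes>\<^bsub>?RG\<^esub> (y \<otimes>\<^bsub>?RG\<^esub> z)) g" using g by (simp add: mult)
        finally show "((x \<otimes>\<^bsub>?RG\<^esub> y) \<otimes>\<^bsub>?RG\<^esub> z) g = (x \<otimes>\<^bsub>?RG\<^esub> (y \<otimes>\<^bsub>?RG\<^esub> z)) g" .
      qed (use xyz in \<open>auto intro!: multC\<close>)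
    next
      fix x assume x: "x \<in> C"
      show "\<one>\<^bsub>?RG\<^esub> \<otimes>\<^bsub>?RG\<^esub> x = x"
      proof (rule ext)
        fix g assume g: "g \<in> carrier \<Gamma>"
        have "(\<one>\<^bsub>?RG\<^esub> \<otimes>\<^bsub>?RG\<^esub> x) g =
          (\<Oplus>\<^bsub>R\<^esub>d\<in>carrier \<Gamma>. if \<one>\<^bsub>\<Gamma>\<^esub> = d then x (inv\<^bsub>\<Gamma>\<^esub> d \<otimes>\<^bsub>\<Gamma>\<^esub> g) else \<zero>\<^bsub>R\<^esub>)"
          unfolding mult[OF g] using x g by (intro R.finsum_cong') (auto simp: one)
        also have "\<dots> = x g" using x g by (subst R.finsum_singleton) auto
        finally show "(\<one>\<^bsub>?RG\<^esub> \<otimes>\<^bsub>?RG\<^esub> x) g = x g" .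
      qed (use x in \<open>auto intro!: multC oneC\<close>)
      show "x \<otimes>\<^bsub>?RG\<^esub> \<one>\<^bsub>?RG\<^esub> = x"
      proof (rule ext)
        fix g assume g: "g \<in> carrier \<Gamma>"
        have eq: "inv\<^bsub>\<Gamma>\<^esub> d \<otimes>\<^bsub>\<Gamma>\<^esub> g = \<one>\<^bsub>\<Gamma>\<^esub> \<longleftrightarrow> g = d" if "d \<in> carrier \<Gamma>" for d
          using g that by (metis G.inv_solve_left' G.one_closed G.r_one)
        have "(x \<otimes>\<^bsub>?RG\<^esub> \<one>\<^bsub>?RG\<^esub>) g = (\<Oplus>\<^bsub>R\<^esub>d\<in>carrier \<Gamma>. if g = d then x d else \<zero>\<^bsub>R\<^esub>)"
          unfolding mult[OF g] using x g by (intro R.finsum_cong') (auto simp: one eq)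
        also have "\<dots> = x g" using x g by (subst R.finsum_singleton) auto
        finally show "(x \<otimes>\<^bsub>?RG\<^esub> \<one>\<^bsub>?RG\<^esub>) g = x g" .
      qed (use x in \<open>auto intro!: multC oneC\<close>)
    qed (auto intro: multC oneC)
    fix x y z assume "x \<in> carrier ?RG" "y \<in> carrier ?RG" "z \<in> carrier ?RG"
    then have xyz: "x \<in> C" "y \<in> C" "z \<in> C" by (auto simp: carr)
    show "(x \<oplus>\<^bsub>?RG\<^esub> y) \<otimes>\<^bsub>?RG\<^esub> z = x \<otimes>\<^bsub>?RG\<^esub> z \<oplus>\<^bsub>?RG\<^esub> y \<otimes>\<^bsub>?RG\<^esub> z"
    proof (rule ext)
      fix g assume g: "g \<in> carrier \<Gamma>"
      let ?h = "\<lambda>u d. u d \<otimes>\<^bsub>R\<^esub> z (inv\<^bsub>\<Gamma>\<^esub> d \<otimes>\<^bsub>\<Gamma>\<^esub> g)"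
      have "((x \<oplus>\<^bsub>?RG\<^esub> y) \<otimes>\<^bsub>?RG\<^esub> z) g = (\<Oplus>\<^bsub>R\<^esub>d\<in>carrier \<Gamma>. ?h x d \<oplus>\<^bsub>R\<^esub> ?h y d)"
        unfolding mult[OF g] using xyz g by (intro R.finsum_cong') (auto simp: add R.l_distr)
      also have "\<dots> = (\<Oplus>\<^bsub>R\<^esub>d\<in>carrier \<Gamma>. ?h x d) \<oplus>\<^bsub>R\<^esub> (\<Oplus>\<^bsub>R\<^esub>d\<in>carrier \<Gamma>. ?h y d)"
        using xyz g by (intro R.finsum_addf) auto
      finally show "((x \<oplus>\<^bsub>?RG\<^esub> y) \<otimes>\<^bsub>?RG\<^esub> z) g = (x \<otimes>\<^bsub>?RG\<^esub> z \<oplus>\<^bsub>?RG\<^esub> y \<otimes>\<^bsub>?RG\<^esub> z) g"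
        by (simp add: add[OF g] mult[OF g])
    qed (use xyz in \<open>auto intro!: multC addC\<close>)
    show "z \<otimes>\<^bsub>?RG\<^esub> (x \<oplus>\<^bsub>?RG\<^esub> y) = z \<otimes>\<^bsub>?RG\<^esub> x \<oplus>\<^bsub>?RG\<^esub> z \<otimes>\<^bsub>?RG\<^esub> y"
    proof (rule ext)
      fix g assume g: "g \<in> carrier \<Gamma>"
      let ?h = "\<lambda>u d. z d \<otimes>\<^bsub>R\<^esub> u (inv\<^bsub>\<Gamma>\<^esub> d \<otimes>\<^bsub>\<Gamma>\<^esub> g)"
      have "(z \<otimes>\<^bsub>?RG\<^esub> (x \<oplus>\<^bsub>?RG\<^esub> y)) g = (\<Oplus>\<^bsub>R\<^esub>d\<in>carrier \<Gamma>. ?h x d \<oplus>\<^bsub>R\<^esub> ?h y d)"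
        unfolding mult[OF g] using xyz g by (intro R.finsum_cong') (auto simp: add R.r_distr)
      also have "\<dots> = (\<Oplus>\<^bsub>R\<^esub>d\<in>carrier \<Gamma>. ?h x d) \<oplus>\<^bsub>R\<^esub> (\<Oplus>\<^bsub>R\<^esub>d\<in>carrier \<Gamma>. ?h y d)"
        using xyz g by (intro R.finsum_addf) auto
      finally show "(z \<otimes>\<^bsub>?RG\<^esub> (x \<oplus>\<^bsub>?RG\<^esub> y)) g = (z \<otimes>\<^bsub>?RG\<^esub> x \<oplus>\<^bsub>?RG\<^esub> z \<otimes>\<^bsub>?RG\<^esub> y) g"
        by (simp add: add[OF g] mult[OF g])
    qed (use xyz in \<open>auto intro!: multC addC\<close>)
  qed
qed

definition group_elem ::
  "('r, 'm) ring_scheme \<Rightarrow> ('g, 'n) monoid_scheme \<Rightarrow> 'g \<Rightarrow> ('g \<Rightarrow> 'r)" where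
  "group_elem R \<Gamma> \<gamma> = (\<lambda>\<delta>\<in>carrier \<Gamma>. if \<delta> = \<gamma> then \<one>\<^bsub>R\<^esub> else \<zero>\<^bsub>R\<^esub>)"

definition norm_ideal :: "('r, 'm) ring_scheme \<Rightarrow> ('g, 'n) monoid_scheme \<Rightarrow> ('g \<Rightarrow> 'r) set" where
  "norm_ideal R \<Gamma> =
     (let RG = group_ring R \<Gamma> in Idl\<^bsub>RG\<^esub> {\<Oplus>\<^bsub>RG\<^esub>\<gamma>\<in>carrier \<Gamma>. group_elem R \<Gamma> \<gamma>})"

definition B_ring :: "('r, 'm) ring_scheme \<Rightarrow> ('g, 'n) monoid_scheme \<Rightarrow> ('g \<Rightarrow> 'r) set ring" where
  "B_ring R \<Gamma> = group_ring R \<Gamma> Quot norm_ideal R \<Gamma>"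

text \<open>The scalar \<open>c \<in> Z[\<Gamma>]\<close> acts on \<open>B\<^sup>n\<close> through its image in \<open>B\<close>.\<close>

definition B_scalar :: "('r, 'm) ring_scheme \<Rightarrow> ('g, 'n) monoid_scheme \<Rightarrow> nat \<Rightarrow>
    ('g \<Rightarrow> 'r) \<Rightarrow> (nat \<Rightarrow> ('g \<Rightarrow> 'r) set) \<Rightarrow> (nat \<Rightarrow> ('g \<Rightarrow> 'r) set)" where
  "B_scalar R \<Gamma> n c v =
     (\<lambda>i\<in>{1..n}. (norm_ideal R \<Gamma> +>\<^bsub>group_ring R \<Gamma>\<^esub> c) \<otimes>\<^bsub>B_ring R \<Gamma>\<^esub> v i)"

definition B_module :: "('r, 'm) ring_scheme \<Rightarrow> ('g, 'n) monoid_scheme \<Rightarrow> nat \<Rightarrow>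
    (nat \<Rightarrow> ('g \<Rightarrow> 'r) set, 'g) act_group" where
  "B_module R \<Gamma> n = monoid.extend (product_group {1..n} (\<lambda>_. add_monoid (B_ring R \<Gamma>)))
     (act_group.fields (\<lambda>\<gamma>. B_scalar R \<Gamma> n (group_elem R \<Gamma> \<gamma>)))"

definition B_span :: "('r, 'm) ring_scheme \<Rightarrow> ('g, 'n) monoid_scheme \<Rightarrow> nat \<Rightarrow>
    (nat \<Rightarrow> ('g \<Rightarrow> 'r) set) set \<Rightarrow> (nat \<Rightarrow> ('g \<Rightarrow> 'r) set) set" where
  "B_span R \<Gamma> n S =
     \<Inter>{M. subgroup M (B_module R \<Gamma> n) \<and> S \<subseteq> M \<and>
          (\<forall>c\<in>carrier (group_ring R \<Gamma>). \<forall>v\<in>M. B_scalar R \<Gamma> n c v \<in> M)}"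


section \<open>Number fields\<close>

text \<open>The number field \<open>K\<close> is a type \<^typ>\<open>'k\<close> of class \<^class>\<open>field_char_0\<close> with
  \<open>number_field TYPE('k)\<close>; its subfields are subsets of \<^typ>\<open>'k\<close>.\<close>

definition ring_on :: "'k::field_char_0 set \<Rightarrow> 'k ring" where
  "ring_on F = \<lparr>carrier = F, monoid.mult = (*), one = 1, ring.zero = 0, ring.add = (+)\<rparr>"

definition number_field :: "'k::field_char_0 itself \<Rightarrow> bool" where
  "number_field _ \<longleftrightarrow>
     (\<exists>S. finite S \<and> module.span (\<lambda>q x. of_rat q * x) S = (UNIV :: 'k set))"

definition galois_group :: "'k::field_char_0 set \<Rightarrow> ('k \<Rightarrow> 'k) monoid" where
  "galois_group Q = \<lparr>
     carrier = {\<sigma> \<in> ring_iso (ring_on UNIV) (ring_on UNIV). \<forall>x\<in>Q. \<sigma> x = x},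
     monoid.mult = (\<circ>), one = id\<rparr>"

definition galois_ext :: "'k::field_char_0 set \<Rightarrow> bool" where
  "galois_ext Q \<longleftrightarrow> {x. \<forall>\<sigma>\<in>carrier (galois_group Q). \<sigma> x = x} = Q"

definition roots_of_unity :: "'k::field_char_0 set" where
  "roots_of_unity = {x. \<exists>n>0. x ^ n = 1}"

definition integers :: "'k::field_char_0 set \<Rightarrow> 'k set" where
  "integers F = {x \<in> F. algebraic_int x}"

definition prime_ideals :: "'k::field_char_0 set \<Rightarrow> 'k set set" where
  "prime_ideals F = {P. primeideal P (ring_on (integers F)) \<and> P \<noteq> {0}}"

text \<open>A finite place is a nonzero prime ideal of the ring of integers; an archimedean place is
  the absolute value \<open>|\<phi>(_)|\<close> attached to an embedding \<open>\<phi> : F \<rightarrow> \<complex>\<close> (so complex conjugate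
  embeddings define the same place).\<close>

datatype 'k place = Finite_Place "'k set" | Arch_Place "'k \<Rightarrow> real"

definition arch_places :: "'k::field_char_0 set \<Rightarrow> 'k place set" where
  "arch_places F = {Arch_Place (\<lambda>x\<in>F. cmod (\<phi> x)) | \<phi>.
     \<phi> \<in> ring_hom (ring_on F) (ring_on (UNIV :: complex set))}"

definition places :: "'k::field_char_0 set \<Rightarrow> 'k place set" where
  "places F = Finite_Place ` prime_ideals F \<union> arch_places F"

fun place_below :: "'k set \<Rightarrow> 'k place \<Rightarrow> 'k place" where
  "place_below Q (Finite_Place P) = Finite_Place (P \<inter> Q)"
| "place_below Q (Arch_Place a) = Arch_Place (restrict a Q)"

fun place_fixed_by :: "('k \<Rightarrow> 'k) \<Rightarrow> 'k place \<Rightarrow> bool" where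
  "place_fixed_by \<sigma> (Finite_Place P) \<longleftrightarrow> \<sigma> ` P = P"
| "place_fixed_by \<sigma> (Arch_Place a) \<longleftrightarrow> a \<circ> \<sigma> = a"

text \<open>\<open>w\<close> is a place of \<open>K\<close>; as \<open>w\<close> varies over the places above a place \<open>v\<close> of \<open>Q\<close>, these are
  the (conjugate) decomposition groups of \<open>v\<close>.\<close>

definition decomposition_group ::
  "'k::field_char_0 set \<Rightarrow> 'k place \<Rightarrow> ('k \<Rightarrow> 'k) set" where
  "decomposition_group Q w = {\<sigma> \<in> carrier (galois_group Q). place_fixed_by \<sigma> w}"


subsection \<open>Class groups\<close>

definition fractional_ideals :: "'k::field_char_0 set \<Rightarrow> 'k set set" where
  "fractional_ideals F = {I. I \<subseteq> F \<and> I \<noteq> {0} \<and> 0 \<in> I \<and>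
     (\<forall>x\<in>I. \<forall>y\<in>I. x + y \<in> I) \<and> (\<forall>c\<in>integers F. \<forall>x\<in>I. c * x \<in> I) \<and>
     (\<exists>d\<in>integers F - {0}. \<forall>x\<in>I. d * x \<in> integers F)}"

definition ideal_mult :: "'k::field_char_0 set \<Rightarrow> 'k set \<Rightarrow> 'k set" where
  "ideal_mult I J = {\<Sum>i<m. a i * b i | (m::nat) a b. \<forall>i<m. a i \<in> I \<and> b i \<in> J}"

definition ideal_group :: "'k::field_char_0 set \<Rightarrow> ('k set, 'k \<Rightarrow> 'k) top_group" where
  "ideal_group F = \<lparr>carrier = fractional_ideals F, monoid.mult = ideal_mult, one = integers F,
     act = (\<lambda>\<sigma> I. \<sigma> ` I), topo = discrete_topology (fractional_ideals F)\<rparr>"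

definition principal_ideals :: "'k::field_char_0 set \<Rightarrow> 'k set set" where
  "principal_ideals F = {(\<lambda>x. a * x) ` integers F | a. a \<in> F - {0}}"

definition class_group :: "'k::field_char_0 set \<Rightarrow> ('k set set, 'k \<Rightarrow> 'k) top_group" where
  "class_group F = top_quot (ideal_group F) (principal_ideals F)"

text \<open>Here \<open>T\<close> is a set of places of \<open>Q \<subseteq> F\<close>.\<close>

definition T_class_group ::
  "'k::field_char_0 set \<Rightarrow> 'k place set \<Rightarrow> 'k set \<Rightarrow> ('k set set set, 'k \<Rightarrow> 'k) top_group" where
  "T_class_group Q T F = top_quot (class_group F) (generate (class_group F)
     {principal_ideals F #>\<^bsub>ideal_group F\<^esub> P | P.
        P \<in> prime_ideals F \<and> place_below Q (Finite_Place P) \<in> T})"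

end

theory Submission
  imports Defs "HOL-Library.Function_Algebras" "Jordan_Normal_Form.Char_Poly" "HOL-Number_Theory.Number_Theory"
begin

hide_const (open) Polynomial.order

text \<open>
  The extra relations \<open>r\<^sub>n\<^sub>+\<^sub>1, r\<^sub>n\<^sub>+\<^sub>2, \<dots>\<close> may be taken trivial, so it is enough to present the module
  \<open>M = Cl\<^sub>T(K)\<^sub>\<Delta>\<^sub>'\<close> by \<open>n\<close> generators and \<open>n\<close> relations.  This only uses that \<open>M\<close> is finite of order prime
  to \<open>\<Delta>\<close> and killed by the norm element of \<open>\<Gamma>\<close>.  Finiteness is Hurwitz's argument.  The norm of an ideal
  class is the extension of a class of \<open>Q\<close>, by Gauss's lemma for the product of the conjugates of a
  polynomial whose coefficients generate the ideal, hence is killed by \<open>|Cl\<^sub>T(Q)|\<close>.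

  A finite module of order prime to \<open>|\<Gamma>|\<close> is built up by adjoining one generator at a time, each at the cost of
  one relation: as \<open>F\<^sub>p[\<Gamma>]\<close> is semisimple, the annihilator of an element of order \<open>p\<close> is generated by an
  idempotent, which lifts modulo \<open>p\<^sup>2\<close>.  The relations for the primes dividing \<open>|M|\<close> are glued by the
  Chinese remainder theorem.  In part (b) the elements \<open>\<Prod>\<^sub>\<delta> a\<^sub>i(\<delta>, 1)\<close> with \<open>a\<^sub>i(\<gamma>, \<delta>) = x\<^sub>i\<^sub>,\<^sub>\<gamma>\<^sup>-\<^sup>1 x\<^sub>i\<^sub>,\<^sub>\<delta>\<close>
  play the role of a basis, because \<open>|\<Gamma>|\<close> is invertible.
\<close>

section \<open>Orders of number fields\<close>

text \<open>Part (a) has coefficients in a product of p-adic rings, while part (b) takes place in a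
  topological group on which no such ring acts by construction. The algebra is therefore done with
  vectors of integers: a relation is an integer function of an index and a group element,
  \<open>presented\<close> tolerates a denominator \<open>e\<close> prime to a set of primes, and
  each target has only to satisfy the four closure rules of \<open>spn\<close>. A new generator
  \<open>y\<close> with \<open>y^p\<close> already reached has as annihilator a left ideal
  containing \<open>p\<close>. Its idempotent generator modulo \<open>p\<close> is not enough, since
  \<open>p\<close> itself has to be generated; a generator modulo \<open>p^2\<close> is, because
  \<open>p^2\<close> is \<open>p\<close> times an element of the ideal and Nakayama's lemma applies.
  In part (b) the relators are \<open>r^-1 gamma(r)\<close> rather than \<open>r\<close>. Nothing is
  lost: their product over the group is \<open>r\<close> to the power \<open>-|Gamma|\<close> times
  the norm of \<open>r\<close>, the norm is trivial on the abelianised group, and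
  \<open>|Gamma|\<close> is invertible.\<close>

lemma algebraic_int_eigen:
 fixes x :: "'k::field_char_0" and w :: "nat => 'k" and a :: "nat => nat => int"
 assumes eq: "!!i. i < n ==> x * w i = (\<Sum>j<n. of_int (a i j) * w j)" and nz: "i0 < n" "w i0 ~= 0"
 shows "algebraic_int x"
proof -
 define A where "A = mat n n (%(i, j). a i j)"
 have A: "A : carrier_mat n n" by (simp add: A_def)
 have eq': "of_int_hom.mat_hom A *\<^sub>v vec n w = x \<cdot>\<^sub>v vec n w"
  by (rule eq_vecI) (auto simp: A_def scalar_prod_def eq lessThan_atLeast0)
 have "vec n w ~= 0\<^sub>v n" using nz by (metis index_vec index_zero_vec(1))
 then have "eigenvalue (of_int_hom.mat_hom A) x"
  unfolding eigenvalue_def eigenvector_def using eq' A by (intro exI[of _ "vec n w"]) auto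
 then have root: "poly (char_poly (of_int_hom.mat_hom A)) x = 0"
  using eigenvalue_root_char_poly[of "of_int_hom.mat_hom A" n x] A by simp
 have hom: "char_poly (of_int_hom.mat_hom A) = map_poly of_int (char_poly A)"
  using of_int_hom.char_poly_hom[OF A] .
 show ?thesis
 proof (rule algebraic_int.intros)
  show "Polynomial.lead_coeff (char_poly (of_int_hom.mat_hom A) :: 'k poly) = 1"
   using degree_monic_char_poly[of "of_int_hom.mat_hom A :: 'k mat" n] A by simp
  show "ALL i. Polynomial.coeff (char_poly (of_int_hom.mat_hom A) :: 'k poly) i : \<int>" unfolding hom by simp
 qed (rule root)
qed

section \<open>Integrality through finitely generated additive groups\<close>

definition zspan :: "'k::field_char_0 set => 'k set" where
 "zspan W = {(\<Sum>w\<in>W. of_int (c w) * w) | c. True}"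

lemma zspanI: "(\<Sum>w\<in>W. of_int (c w) * w) : zspan W" unfolding zspan_def by blast

lemma zspan_add: "x : zspan W ==> y : zspan W ==> x + y : zspan W"
proof -
 assume "x : zspan W" "y : zspan W"
 then obtain c d where "x = (\<Sum>w\<in>W. of_int (c w) * w)" "y = (\<Sum>w\<in>W. of_int (d w) * w)" unfolding zspan_def by blast
 then have e: "x + y = (\<Sum>w\<in>W. of_int (c w + d w) * w)" by (simp add: sum.distrib algebra_simps)
 show ?thesis unfolding e by (rule zspanI)
qed

lemma zspan_scale: "x : zspan W ==> of_int k * x : zspan W"
proof -
 assume "x : zspan W"
 then obtain c where "x = (\<Sum>w\<in>W. of_int (c w) * w)" unfolding zspan_def by blast
 then have e: "of_int k * x = (\<Sum>w\<in>W. of_int (k * c w) * w)" by (simp add: sum_distrib_left mult.assoc)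
 show ?thesis unfolding e by (rule zspanI)
qed

lemma zspan_zero: "0 : zspan W"
 using zspanI[of "%_. 0" W] by simp

lemma zspan_sum: "(!!i. i : I ==> f i : zspan W) ==> sum f I : zspan W"
 by (induction I rule: infinite_finite_induct) (auto simp: zspan_zero zspan_add)

lemma zspan_gen: "finite W ==> w : W ==> w : zspan W"
proof -
 assume W: "finite W" "w : W"
 have "(\<Sum>v\<in>W. of_int (if v = w then 1 else 0) * v) = (\<Sum>v\<in>W. if v = w then v else 0)" by (rule sum.cong) auto
 also have "\<dots> = w" using W by simp
 finally show ?thesis using zspanI[of "%v. if v = w then 1 else 0" W] by simp
qed

lemma zspan_least:
 assumes "W \<subseteq> B" "0 : B" "!!x y. x : B ==> y : B ==> x + y : B" "!!k x. x : B ==> of_int k * x : B"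
 shows "zspan W \<subseteq> B"
proof -
 have "sum f I : B" if "!!i. i : I ==> f i : B" for f :: "'a => 'a" and I
  using that by (induction I rule: infinite_finite_induct) (auto simp: assms)
 then show ?thesis using assms(1,4) by (auto simp: zspan_def subset_iff)
qed

lemma zspan_mult: "(!!w. w : W ==> x * w : zspan W) ==> z : zspan W ==> x * z : zspan W"
proof -
 assume a: "!!w. w : W ==> x * w : zspan W" and "z : zspan W"
 then obtain c where "z = (\<Sum>w\<in>W. of_int (c w) * w)" unfolding zspan_def by blast
 then have "x * z = (\<Sum>w\<in>W. of_int (c w) * (x * w))" by (simp add: sum_distrib_left mult_ac)
 also have "\<dots> : zspan W" by (intro zspan_sum zspan_scale a)
 finally show ?thesis .
qed

lemma algebraic_int_stable:
 assumes W: "finite W" "w0 : W" "w0 ~= 0" and st: "!!w. w : W ==> x * w : zspan W"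
 shows "algebraic_int x"
proof -
 obtain e where e: "bij_betw e {..<card W} W" using ex_bij_betw_nat_finite[OF W(1)] by (auto simp: lessThan_atLeast0)
 have "ALL w:W. EX c. x * w = (\<Sum>v\<in>W. of_int (c v) * v)" using st unfolding zspan_def by blast
 then obtain c where c: "ALL w:W. x * w = (\<Sum>v\<in>W. of_int (c w v) * v)" using bchoice[of W] by metis
 have eW: "e i : W" if "i < card W" for i using e that by (auto simp: bij_betw_def)
 have "w0 : e ` {..<card W}" using e W(2) by (simp add: bij_betw_def)
 then obtain i0 where i0: "i0 < card W" "e i0 = w0" by auto
 show ?thesis
 proof (rule algebraic_int_eigen[where n = "card W" and w = e and a = "%i j. c (e i) (e j)"])
  fix i assume "i < card W"
  then have "x * e i = (\<Sum>v\<in>W. of_int (c (e i) v) * v)" by (intro c[THEN bspec] eW)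
  also have "\<dots> = (\<Sum>j<card W. of_int (c (e i) (e j)) * e j)"
   by (rule sum.reindex_bij_betw[OF e, symmetric])
  finally show "x * e i = (\<Sum>j<card W. of_int (c (e i) (e j)) * e j)" .
 qed (use i0 W(3) in auto)
qed

lemma algebraic_intD:
 fixes x :: "'k::field_char_0"
 assumes "algebraic_int x"
 obtains m and c :: "nat => int" where "x ^ m = (\<Sum>i<m. of_int (c i) * x ^ i)" "m > 0"
proof -
 obtain p where p: "Polynomial.lead_coeff p = 1" "ALL i. Polynomial.coeff p i : \<int>" "poly p x = 0" using assms by (auto elim: algebraic_int.cases)
 have "ALL i. EX k. Polynomial.coeff p i = of_int k" using p(2) by (auto elim: Ints_cases)
 then obtain k where k: "!!i. Polynomial.coeff p i = of_int (k i)" by metis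
 have pos: "Polynomial.degree p > 0" using p(1,3) by (metis degree_eq_zeroE lead_coeff_pCons(2) neq0_conv one_neq_zero poly_const_conv coeff_pCons_0 degree_pCons_0)
 have "0 = (\<Sum>i\<le>Polynomial.degree p. Polynomial.coeff p i * x ^ i)" using p(3) by (simp add: poly_altdef)
 also have "\<dots> = (\<Sum>i<Polynomial.degree p. Polynomial.coeff p i * x ^ i) + x ^ Polynomial.degree p"
  using p(1) by (simp flip: lessThan_Suc_atMost)
 finally have "x ^ Polynomial.degree p = - (\<Sum>i<Polynomial.degree p. Polynomial.coeff p i * x ^ i)" by (simp add: eq_neg_iff_add_eq_0 add.commute)
 also have "\<dots> = (\<Sum>i<Polynomial.degree p. of_int (- k i) * x ^ i)" by (simp add: k sum_negf)
 finally show ?thesis using pos by (rule that)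
qed

text \<open>The products \<open>x^i y^j\<close> below the degrees of the two monic equations span an
  additive group that is stable under \<open>x\<close> and under \<open>y\<close>, because the
  equations rewrite the top powers. Positivity of the degrees puts the nonzero element
  \<open>1\<close> among the generators, as \<open>algebraic_int_stable\<close> requires.\<close>

lemma algebraic_int_add_mult:
 fixes x y :: "'k::field_char_0"
 assumes "algebraic_int x" "algebraic_int y"
 shows "algebraic_int (x + y)" "algebraic_int (x * y)"
proof -
 obtain m c where m: "x ^ m = (\<Sum>i<m. of_int (c i) * x ^ i)" "m > 0" using algebraic_intD[OF assms(1)] by blast
 obtain n d where n: "y ^ n = (\<Sum>i<n. of_int (d i) * y ^ i)" "n > 0" using algebraic_intD[OF assms(2)] by blast
 let ?W = "(%(i, j). x ^ i * y ^ j) ` ({..<m} \<times> {..<n})"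
 have fin: "finite ?W" by simp
 have gen: "x ^ i * y ^ j : zspan ?W" if "i < m" "j < n" for i j by (rule zspan_gen[OF fin]) (use that in auto)
 have one: "1 : ?W" using m(2) n(2) by (auto intro!: image_eqI[of _ _ "(0, 0)"])
 have X: "x * w : zspan ?W" if w: "w : ?W" for w
 proof -
  obtain i j where ij: "i < m" "j < n" "w = x ^ i * y ^ j" using w by auto
  show ?thesis
  proof (cases "Suc i < m")
   case True
   then show ?thesis using gen[of "Suc i" j] ij by (simp add: mult_ac)
  next
   case False
   then have "m = Suc i" using ij(1) by simp
   then have "x * w = x ^ m * y ^ j" using ij(3) by simp
   also have "\<dots> = (\<Sum>i<m. of_int (c i) * (x ^ i * y ^ j))" unfolding m(1) by (simp add: sum_distrib_right sum_distrib_left mult_ac)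
   also have "\<dots> : zspan ?W" using ij by (intro zspan_sum zspan_scale gen) auto
   finally show ?thesis .
  qed
 qed
 have Y: "y * w : zspan ?W" if w: "w : ?W" for w
 proof -
  obtain i j where ij: "i < m" "j < n" "w = x ^ i * y ^ j" using w by auto
  show ?thesis
  proof (cases "Suc j < n")
   case True
   then show ?thesis using gen[of i "Suc j"] ij by (simp add: mult_ac)
  next
   case False
   then have "n = Suc j" using ij(2) by simp
   then have "y * w = x ^ i * y ^ n" using ij(3) by simp
   also have "\<dots> = (\<Sum>j<n. of_int (d j) * (x ^ i * y ^ j))" unfolding n(1) by (simp add: sum_distrib_left mult_ac)
   also have "\<dots> : zspan ?W" using ij by (intro zspan_sum zspan_scale gen) auto
   finally show ?thesis .
  qed
 qed
 show "algebraic_int (x + y)"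
  by (rule algebraic_int_stable[OF fin one]) (simp_all add: distrib_right zspan_add X Y)
 show "algebraic_int (x * y)"
  by (rule algebraic_int_stable[OF fin one]) (simp_all add: mult.assoc zspan_mult[OF X] Y)
qed

lemma common_denominator:
 assumes "finite (S :: rat set)"
 shows "\<exists>s::int. s > 0 \<and> (ALL q:S. of_int s * q : \<int>)"
 using assms
proof (induction rule: finite_induct)
 case empty
 show ?case by (rule exI[of _ 1]) simp
next
 case (insert q S)
 then obtain s where s: "s > 0" "ALL q:S. of_int s * q : \<int>" by blast
 obtain a b where ab: "b > 0" "q = of_int a / of_int b" using quotient_of_div[of q] quotient_of_denom_pos by (metis prod.exhaust)
 have "of_int (s * b) * q = of_int (s * a)" using ab by simp
 then have "of_int (s * b) * q : \<int>" by (metis Ints_of_int)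
 moreover have "of_int (s * b) * q' : \<int>" if "q' : S" for q'
 proof -
  have "of_int (s * b) * q' = of_int b * (of_int s * q')" by simp
  then show ?thesis using s(2) that by (metis Ints_mult Ints_of_int)
 qed
 ultimately show ?case using s(1) ab(1) by (intro exI[of _ "s * b"]) auto
qed

section \<open>Subfields with a rational basis\<close>

locale subfld =
 fixes F :: "'k::field_char_0 set"
 assumes F0: "0 : F" and F1: "1 : F" and Fadd: "x : F ==> y : F ==> x + y : F"
  and Fmul: "x : F ==> y : F ==> x * y : F" and Fneg: "x : F ==> - x : F"
  and Finv: "x : F ==> inverse x : F"
begin

lemma Fdiff: "x : F ==> y : F ==> x - y : F" using Fadd[of x "- y"] Fneg by simp
lemma Fdiv: "x : F ==> y : F ==> x / y : F" using Fmul[of x "inverse y"] Finv by (simp add: field_simps)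
lemma Fnat: "of_nat k : F" by (induction k) (auto simp: F0 F1 Fadd)
lemma Fint: "of_int k : F" by (cases k) (auto intro: Fneg Fnat simp del: of_nat_Suc)
lemma Frat: "of_rat q : F"
proof -
 obtain a b where "q = of_int a / of_int b" using quotient_of_div[of q] by (metis prod.exhaust)
 then show ?thesis using Fdiv[OF Fint Fint, of a b] by (simp add: of_rat_divide)
qed
lemma Fsum: "(!!i. i : I ==> f i : F) ==> sum f I : F"
 by (induction I rule: infinite_finite_induct) (auto simp: F0 Fadd)
lemma Fpow: "x : F ==> x ^ k : F" by (induction k) (auto simp: F1 Fmul)

end

text \<open>A rational basis \<open>w\<close> with its dual coordinates \<open>co\<close>. Both are
  parameters, so that scaling the basis is a mere change of instance; arguments outside
  \<open>F\<close> and indices from \<open>n\<close> on are left unconstrained.\<close>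

locale based_field = subfld F for F :: "'k::field_char_0 set" +
 fixes n :: nat and w :: "nat => 'k" and co :: "'k => nat => rat"
 assumes w_in: "i < n ==> w i : F"
  and expand: "x : F ==> x = (\<Sum>i<n. of_rat (co x i) * w i)"
  and co_add: "x : F ==> y : F ==> i < n ==> co (x + y) i = co x i + co y i"
  and co_scale: "x : F ==> i < n ==> co (of_rat q * x) i = q * co x i"
  and co_w: "i < n ==> j < n ==> co (w i) j = (if i = j then 1 else 0)"
begin

lemma co_zero: "i < n ==> co 0 i = 0" using co_scale[OF F0, of i 0] by simp
lemma co_sum: "finite I ==> (!!a. a : I ==> f a : F) ==> i < n ==> co (sum f I) i = (\<Sum>a\<in>I. co (f a) i)"
 by (induction I rule: finite_induct) (auto simp: co_zero co_add Fsum)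
lemma co_int: "x : F ==> i < n ==> co (of_int k * x) i = of_int k * co x i" using co_scale[of x i "of_int k"] by simp
lemma co_comb: "i < n ==> co (\<Sum>j<n. of_rat (q j) * w j) i = q i"
 by (subst co_sum) (auto simp: Fmul Frat w_in co_scale co_w if_distrib cong: if_cong)
lemma co_diff: "x : F ==> y : F ==> i < n ==> co (x - y) i = co x i - co y i"
 using co_add[of x "of_int (-1) * y" i] co_int[of y i "-1"] by (simp add: Fneg)
lemma n_pos: "n > 0" using expand[OF F1] by (cases n) auto

text \<open>A common denominator \<open>s\<close> of the matrix of multiplication by
  \<open>x\<close> turns it into an integer matrix, which has \<open>s * x\<close> as eigenvalue and
  the basis as eigenvector.\<close>

lemma integral_multiple:
 assumes x: "x : F"
 shows "\<exists>s::int. s > 0 \<and> algebraic_int (of_int s * x)"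
proof -
 have "finite ((%(i, j). co (x * w i) j) ` ({..<n} \<times> {..<n}))" by simp
 from common_denominator[OF this] obtain s where s: "s > 0" "!!i j. i < n ==> j < n ==> of_int s * co (x * w i) j : \<int>" by fastforce
 define a where "a i j = (if i < n \<and> j < n then \<lfloor>of_int s * co (x * w i) j\<rfloor> else 0)" for i j
 have a: "of_int (a i j) = of_int s * co (x * w i) j" if "i < n" "j < n" for i j
  using s(2)[OF that] that by (auto simp: a_def elim: Ints_cases)
 have nz: "\<exists>i<n. w i ~= 0" using co_w co_zero n_pos by (metis one_neq_zero)
 then obtain i0 where "i0 < n" "w i0 ~= 0" by blast
 then have "algebraic_int (of_int s * x)"
 proof (rule algebraic_int_eigen[rotated])
  fix i assume i: "i < n"
  have "of_int s * x * w i = of_int s * (\<Sum>j<n. of_rat (co (x * w i) j) * w j)"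
   using expand[OF Fmul[OF x w_in[OF i]]] by (simp add: mult.assoc)
  also have "\<dots> = (\<Sum>j<n. of_rat (of_int s * co (x * w i) j) * w j)" by (simp add: sum_distrib_left of_rat_mult mult.assoc)
  also have "\<dots> = (\<Sum>j<n. of_int (a i j) * w j)" by (rule sum.cong) (auto simp: a[OF i, symmetric])
  finally show "of_int s * x * w i = (\<Sum>j<n. of_int (a i j) * w j)" .
 qed
 then show ?thesis using s(1) by blast
qed

lemma rescale:
 assumes "!!i. i < n ==> t i > (0::int)"
 shows "based_field F n (%i. of_int (t i) * w i) (%x i. co x i / of_int (t i))"
proof unfold_locales
 fix x assume x: "x : F"
 have "(\<Sum>i<n. of_rat (co x i / of_int (t i)) * (of_int (t i) * w i)) = (\<Sum>i<n. of_rat (co x i) * w i)"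
  by (rule sum.cong) (use assms in \<open>auto simp: of_rat_divide less_imp_neq[symmetric]\<close>)
 then show "x = (\<Sum>i<n. of_rat (co x i / of_int (t i)) * (of_int (t i) * w i))" using expand[OF x] by simp
next
 fix i j assume "i < n" "j < n"
 then show "co (of_int (t i) * w i) j / of_int (t j) = (if i = j then 1 else 0)"
  using assms[of j] by (auto simp: co_int w_in co_w)
qed (auto simp: Fmul Fint w_in co_add co_scale add_divide_distrib)

end

text \<open>A maximal rationally independent subset of \<open>F\<close> is finite because the whole
  field is finitely spanned; each of its elements is then scaled by a positive integer that makes it
  integral.\<close>

lemma (in subfld) exists_basis:
 assumes "number_field TYPE('k)"
 shows "EX n w co. based_field F n w co \<and> (\<forall>i<n. algebraic_int (w i))"
proof -
 interpret V: vector_space "%(q::rat) (x::'k). of_rat q * x"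
  by unfold_locales (auto simp: of_rat_add of_rat_mult algebra_simps)
 obtain S :: "'k set" where S: "finite S" "V.span S = UNIV" using assms unfolding number_field_def by blast
 obtain B where B: "B \<subseteq> F" "V.independent B" "F \<subseteq> V.span B" using V.maximal_independent_subset[of F] by blast
 have finB: "finite B" using V.independent_span_bound[OF S(1) B(2)] S(2) by simp
 obtain e where e: "bij_betw e {..<card B} B" using ex_bij_betw_nat_finite[OF finB] by (auto simp: lessThan_atLeast0)
 have eB: "e i : B" if "i < card B" for i using e that by (auto simp: bij_betw_def)
 have 1: "based_field F (card B) e (%x i. V.representation B x (e i))"
 proof unfold_locales
  fix x assume x: "x : F"
  have "x = (\<Sum>b\<in>B. of_rat (V.representation B x b) * b)"
   using V.sum_representation_eq[OF B(2) _ finB subset_refl, of x] x B(3) by auto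
  also have "\<dots> = (\<Sum>i<card B. of_rat (V.representation B x (e i)) * e i)" by (rule sum.reindex_bij_betw[OF e, symmetric])
  finally show "x = (\<Sum>i<card B. of_rat (V.representation B x (e i)) * e i)" .
  fix i q show "V.representation B (of_rat q * x) (e i) = q * V.representation B x (e i)"
   using V.representation_scale[OF B(2) subsetD[OF B(3) x], of q] by simp
  fix y assume "y : F"
  then show "V.representation B (x + y) (e i) = V.representation B x (e i) + V.representation B y (e i)"
   using V.representation_add[OF B(2) subsetD[OF B(3)] subsetD[OF B(3) x], of y] by simp
 next
  fix i j assume ij: "i < card B" "j < card B"
  then have "e i = e j \<longleftrightarrow> i = j" using e by (auto simp: bij_betw_def inj_on_def)
  then show "V.representation B (e i) (e j) = (if i = j then 1 else 0)"
   using V.representation_basis[OF B(2) eB[OF ij(1)]] by (auto simp: fun_eq_iff)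
 qed (use eB B(1) in auto)
 then interpret E: based_field F "card B" e "%x i. V.representation B x (e i)" .
 have "ALL i. \<exists>s::int. i < card B --> s > 0 \<and> algebraic_int (of_int s * e i)" using E.integral_multiple E.w_in by blast
 then obtain t :: "nat => int" where "ALL i. i < card B --> t i > 0 \<and> algebraic_int (of_int (t i) * e i)" by (metis (full_types))
 then show ?thesis using E.rescale[of t] by blast
qed

locale number_fld = based_field + assumes w_int: "i < n ==> algebraic_int (w i)"
begin

abbreviation "RO \<equiv> integers F"

lemma RO_F: "x : RO ==> x : F" and RO_int: "x : RO ==> algebraic_int x" by (auto simp: integers_def)
lemma RO_add: "x : RO ==> y : RO ==> x + y : RO" by (simp add: integers_def Fadd algebraic_int_add_mult)
lemma RO_mul: "x : RO ==> y : RO ==> x * y : RO" by (simp add: integers_def Fmul algebraic_int_add_mult)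
lemma RO_ofint: "of_int k : RO" by (simp add: integers_def Fint int_imp_algebraic_int)
lemma RO_0: "0 : RO" using RO_ofint[of 0] by simp
lemma RO_1: "1 : RO" using RO_ofint[of 1] by simp
lemma RO_neg: "x : RO ==> - x : RO" using RO_mul[OF RO_ofint[of "-1"]] by simp
lemma RO_diff: "x : RO ==> y : RO ==> x - y : RO" using RO_add[of x "- y"] RO_neg by simp
lemma RO_sum: "(!!i. i : I ==> f i : RO) ==> sum f I : RO"
 by (induction I rule: infinite_finite_induct) (auto simp: RO_0 RO_add)
lemma RO_pow: "x : RO ==> x ^ k : RO" by (induction k) (auto simp: RO_1 RO_mul)

text \<open>The lattice spanned by the integral basis. It need not be closed under multiplication;
  it serves as a subgroup of \<open>RO\<close> with explicit coordinates, and
  \<open>exists_mm\<close> shows that it contains a multiple of \<open>RO\<close>.\<close>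

definition "Lam = {x : F. \<forall>i<n. co x i : \<int>}"

lemma Lam_RO: "x : Lam ==> x : RO"
proof -
 assume x: "x : Lam"
 then have "of_rat (co x i) * w i : RO" if "i < n" for i
 proof -
  have "co x i : \<int>" using x that unfolding Lam_def by simp
  then obtain k where "co x i = of_int k" by (rule Ints_cases)
  then show ?thesis using RO_mul[OF RO_ofint[of k], of "w i"] w_in w_int that by (simp add: integers_def)
 qed
 then have "(\<Sum>i<n. of_rat (co x i) * w i) : RO" by (intro RO_sum) auto
 then show ?thesis using expand[of x] x by (simp add: Lam_def)
qed

lemma clear_denominator: "x : F ==> \<exists>s::int. s > 0 \<and> of_int s * x : Lam"
proof -
 assume x: "x : F"
 have "finite (co x ` {..<n})" by simp
 from common_denominator[OF this] obtain s where "s > 0" "\<forall>i<n. of_int s * co x i : \<int>" by auto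
 then show ?thesis using x by (intro exI[of _ s]) (simp add: Lam_def Fmul Fint co_int)
qed

section \<open>The absolute norm\<close>

definition R :: "'a => rat mat" where "R x = mat n n (%(i, j). co (x * w i) j)"
definition nr :: "'a => rat" where "nr x = \<bar>det (R x)\<bar>"

lemma R_carrier: "R x : carrier_mat n n" by (simp add: R_def)

text \<open>Row \<open>i\<close> of \<open>R x\<close> holds the coordinates of
  \<open>x * w i\<close>. With this row convention products come out reversed, which determinants do
  not see.\<close>

lemma R_mult: assumes x: "x : F" and y: "y : F" shows "R (x * y) = R y * R x"
proof (rule eq_matI)
 fix i j assume "i < dim_row (R y * R x)" "j < dim_col (R y * R x)"
 then have ij: "i < n" "j < n" by (simp_all add: R_def)
 have "x * y * w i = x * (\<Sum>l<n. of_rat (co (y * w i) l) * w l)"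
  using expand[OF Fmul[OF y w_in[OF ij(1)]]] by (simp add: mult.assoc)
 also have "\<dots> = (\<Sum>l<n. of_rat (co (y * w i) l) * (x * w l))" by (simp add: sum_distrib_left mult_ac)
 finally have e: "x * y * w i = (\<Sum>l<n. of_rat (co (y * w i) l) * (x * w l))" .
 have "co (x * y * w i) j = (\<Sum>l<n. co (of_rat (co (y * w i) l) * (x * w l)) j)"
  unfolding e by (rule co_sum) (use ij x in \<open>auto intro!: Fmul Frat w_in\<close>)
 also have "\<dots> = (\<Sum>l<n. co (y * w i) l * co (x * w l) j)" by (rule sum.cong) (use x ij in \<open>auto simp: co_scale Fmul w_in\<close>)
 finally show "R (x * y) $$ (i, j) = (R y * R x) $$ (i, j)"
  using ij by (simp add: R_def scalar_prod_def lessThan_atLeast0)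
qed (simp_all add: R_def)

lemma det_R_mult: "x : F ==> y : F ==> det (R (x * y)) = det (R x) * det (R y)"
 unfolding R_mult using det_mult[OF R_carrier R_carrier] by (simp add: mult.commute)
lemma det_R_one: "det (R 1) = 1"
proof -
 have "R 1 = 1\<^sub>m n" by (rule eq_matI) (auto simp: R_def co_w)
 then show ?thesis by simp
qed
lemma det_R_pow: "x : F ==> det (R (x ^ k)) = det (R x) ^ k"
 by (induction k) (simp_all add: det_R_one det_R_mult Fpow)
lemma nr_mult: "x : F ==> y : F ==> nr (x * y) = nr x * nr y" by (simp add: nr_def det_R_mult abs_mult)
lemma nr_one: "nr 1 = 1" by (simp add: nr_def det_R_one)
lemma nr_pos: "x : F ==> x ~= 0 ==> nr x > 0"
proof -
 assume "x : F" "x ~= 0"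
 then have "nr x * nr (inverse x) = 1" using nr_mult[of x "inverse x"] Finv nr_one by simp
 then have "nr x ~= 0" by auto
 then show ?thesis by (simp add: nr_def)
qed

lemma det_int: "A : carrier_mat n n ==> (!!i j. i < n ==> j < n ==> A $$ (i, j) : \<int>) ==> det (A :: rat mat) : \<int>"
 by (auto simp: det_def' permutes_in_image intro!: Ints_sum Ints_mult Ints_prod)

text \<open>In lowest terms \<open>r = a / b\<close> the denominator of \<open>r^k\<close> is
  \<open>b^k\<close>. All these powers divide the fixed number \<open>s\<close>, so they are bounded
  and \<open>b = 1\<close>.\<close>

lemma rat_int_if_bounded_denominator:
 fixes r :: rat
 assumes s: "s > (0::int)" and int: "!!k. of_int s * r ^ k : \<int>"
 shows "r : \<int>"
proof -
 obtain a b where ab: "b > 0" "coprime a b" "r = of_int a / of_int b"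
  using quotient_of_div[of r] quotient_of_denom_pos quotient_of_coprime by (metis prod.exhaust)
 have "b ^ k dvd s" for k
 proof -
  obtain z where "of_int s * r ^ k = of_int z" using int[of k] by (auto elim: Ints_cases)
  then have "(of_int (s * a ^ k) :: rat) = of_int (z * b ^ k)" using ab by (simp add: power_divide field_simps)
  then have "s * a ^ k = z * b ^ k" by (simp only: of_int_eq_iff)
  then have "b ^ k dvd s * a ^ k" by simp
  moreover have "coprime (b ^ k) (a ^ k)" using ab(2) by (simp add: coprime_commute)
  ultimately show ?thesis by (simp add: coprime_dvd_mult_left_iff)
 qed
 then have le: "b ^ k \<le> s" for k using s by (simp add: zdvd_imp_le)
 have "b = 1"
 proof (rule ccontr)
  assume "b ~= 1"
  then have "2 \<le> b" using ab(1) by simp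
  then have "2 ^ nat s \<le> b ^ nat s" by (intro power_mono) auto
  moreover have "int (nat s) < int (2 ^ nat s)" unfolding of_nat_less_iff by (rule less_exp)
  then have "int (nat s) < 2 ^ nat s" by simp
  ultimately show False using le[of "nat s"] s by simp
 qed
 then show ?thesis using ab by simp
qed

text \<open>The monic equation expresses every power of \<open>x\<close> through finitely many of
  them, so one \<open>s\<close> is a common denominator for the matrices of all powers. Then
  \<open>s^n\<close> clears the denominators of all powers of the determinant.\<close>

lemma nr_integral: assumes x: "x : RO" shows "nr x : \<int>"
proof -
 have xF: "x : F" by (rule RO_F[OF x])
 obtain m c where m: "x ^ m = (\<Sum>i<m. of_int (c i) * x ^ i)" "m > 0" using algebraic_intD[OF RO_int[OF x]] by blast
 have "finite ((%(l, i, j). co (x ^ l * w i) j) ` ({..<m} \<times> {..<n} \<times> {..<n}))" by simp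
 from common_denominator[OF this] obtain s where s: "s > 0"
  "!!l i j. l < m ==> i < n ==> j < n ==> of_int s * co (x ^ l * w i) j : \<int>" by fastforce
 have all: "of_int s * co (x ^ k * w i) j : \<int>" if ij: "i < n" "j < n" for i j k
 proof (induction k rule: less_induct)
  case (less k)
  show ?case
  proof (cases "k < m")
   case False
   have "x ^ k = x ^ m * x ^ (k - m)" using False by (simp flip: power_add)
   also have "\<dots> * w i = (\<Sum>l<m. of_int (c l) * (x ^ (l + (k - m)) * w i))"
    unfolding m(1) by (simp add: sum_distrib_right sum_distrib_left power_add mult_ac)
   finally have "co (x ^ k * w i) j = (\<Sum>l<m. of_int (c l) * co (x ^ (l + (k - m)) * w i) j)"
    using ij xF by (simp add: co_sum co_int Fmul Fint Fpow w_in)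
   then have "of_int s * co (x ^ k * w i) j = (\<Sum>l<m. of_int (c l) * (of_int s * co (x ^ (l + (k - m)) * w i) j))"
    by (simp add: sum_distrib_left mult_ac)
   also have "\<dots> : \<int>"
   proof (rule Ints_sum)
    fix l assume "l : {..<m}"
    then have "l + (k - m) < k" using False by simp
    then show "of_int (c l) * (of_int s * co (x ^ (l + (k - m)) * w i) j) : \<int>"
     by (rule Ints_mult[OF Ints_of_int less.IH])
   qed
   finally show ?thesis .
  qed (use s(2) ij in auto)
 qed
 have "of_int (s ^ n) * det (R x) ^ k : \<int>" for k
 proof -
  have "of_int (s ^ n) * det (R x) ^ k = det (of_int s \<cdot>\<^sub>m R (x ^ k))"
   using det_smult[of "of_int s" "R (x ^ k)"] R_carrier[of "x ^ k"] xF by (simp add: det_R_pow)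
  also have "\<dots> : \<int>" by (rule det_int) (use all in \<open>auto simp: R_def\<close>)
  finally show ?thesis .
 qed
 then have "det (R x) : \<int>" by (rule rat_int_if_bounded_denominator[rotated]) (use s(1) in simp)
 then show ?thesis unfolding nr_def by (rule Ints_abs)
qed

text \<open>The matrix entries are linear in the coordinates of \<open>x\<close>. If these are at
  most \<open>1 / L\<close>, the entries are at most \<open>K / L\<close>, and so is each of the
  \<open>n!\<close> products in the determinant, because \<open>K \<le> L\<close> and
  \<open>n > 0\<close>. Hence \<open>L > n! K\<close> is enough.\<close>

lemma nr_small: "\<exists>L::nat. L > 0 \<and> (ALL x:F. (\<forall>i<n. \<bar>co x i\<bar> \<le> 1 / of_nat L) --> nr x < 1)"
proof -
 define K :: rat where "K = (\<Sum>l<n. \<Sum>i<n. \<Sum>j<n. \<bar>co (w l * w i) j\<bar>) + 1"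
 have K1: "K \<ge> 1" unfolding K_def by (simp add: sum_nonneg)
 obtain L :: nat where L: "of_nat L > fact n * K" using reals_Archimedean2[of "fact n * K"] by blast
 have "1 * K \<le> fact n * K" using K1 by (intro mult_right_mono fact_ge_1) auto
 then have Lp: "(0::rat) < of_nat L" "K \<le> of_nat L" using L K1 by linarith+
 have "nr x < 1" if x: "x : F" and sm: "\<forall>i<n. \<bar>co x i\<bar> \<le> 1 / of_nat L" for x
 proof -
  have ent: "\<bar>R x $$ (i, j)\<bar> \<le> K / of_nat L" if ij: "i < n" "j < n" for i j
  proof -
   have e: "x * w i = (\<Sum>l<n. of_rat (co x l) * (w l * w i))"
    using expand[OF x] by (metis (no_types, lifting) mult.assoc sum.cong sum_distrib_right)
   have "co (x * w i) j = (\<Sum>l<n. co (of_rat (co x l) * (w l * w i)) j)"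
    unfolding e by (rule co_sum) (use ij in \<open>auto intro!: Fmul Frat w_in\<close>)
   also have "\<dots> = (\<Sum>l<n. co x l * co (w l * w i) j)" by (rule sum.cong) (use ij in \<open>auto simp: co_scale Fmul w_in\<close>)
   also have "\<bar>\<dots>\<bar> \<le> (\<Sum>l<n. \<bar>co x l * co (w l * w i) j\<bar>)" by (rule sum_abs)
   also have "\<dots> \<le> (\<Sum>l<n. 1 / of_nat L * (\<Sum>i<n. \<Sum>j<n. \<bar>co (w l * w i) j\<bar>))"
   proof (rule sum_mono)
    fix l assume l: "l : {..<n}"
    have "\<bar>co (w l * w i) j\<bar> \<le> (\<Sum>j<n. \<bar>co (w l * w i) j\<bar>)" using ij by (intro member_le_sum) auto
    also have "\<dots> \<le> (\<Sum>i<n. \<Sum>j<n. \<bar>co (w l * w i) j\<bar>)"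
     using ij by (intro member_le_sum[of i _ "%i. \<Sum>j<n. \<bar>co (w l * w i) j\<bar>"]) (auto simp: sum_nonneg)
    finally show "\<bar>co x l * co (w l * w i) j\<bar> \<le> 1 / of_nat L * (\<Sum>i<n. \<Sum>j<n. \<bar>co (w l * w i) j\<bar>)"
     unfolding abs_mult using sm l by (intro mult_mono) auto
   qed
   also have "\<dots> \<le> K / of_nat L" unfolding K_def using Lp by (simp add: sum_divide_distrib[symmetric] divide_right_mono)
   finally show ?thesis using ij by (simp add: R_def)
  qed
  let ?c = "K / of_nat L"
  have c: "0 \<le> ?c" "?c \<le> 1" using K1 Lp by (auto simp: divide_simps)
  have "\<bar>det (R x)\<bar> \<le> (\<Sum>p | p permutes {0..<n}. \<bar>signof p * (\<Prod>i = 0..<n. R x $$ (i, p i))\<bar>)"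
   unfolding det_def'[OF R_carrier] by (rule sum_abs)
  also have "\<dots> \<le> (\<Sum>p | p permutes {0..<n}. ?c)"
  proof (rule sum_mono)
   fix p assume "p : {p. p permutes {0..<n}}"
   then have p: "p i < n" if "i < n" for i using permutes_in_image[of p "{0..<n}" i] that by auto
   have "\<bar>signof p * (\<Prod>i = 0..<n. R x $$ (i, p i))\<bar> = (\<Prod>i = 0..<n. \<bar>R x $$ (i, p i)\<bar>)"
    by (simp add: abs_mult abs_prod sign_def)
   also have "\<dots> \<le> (\<Prod>i = 0..<n. ?c)" using ent p by (intro prod_mono) auto
   also have "\<dots> = ?c ^ n" by simp
   also have "\<dots> \<le> ?c ^ 1" using c n_pos by (intro power_decreasing) auto
   finally show "\<bar>signof p * (\<Prod>i = 0..<n. R x $$ (i, p i))\<bar> \<le> ?c" by simp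
  qed
  also have "\<dots> = fact n * ?c" using card_permutations[of "{0..<n}" n] by simp
  also have "\<dots> < 1" using L Lp by (simp add: divide_simps)
  finally show ?thesis by (simp add: nr_def)
 qed
 moreover have "L > 0" using Lp by simp
 ultimately show ?thesis by blast
qed

text \<open>Dirichlet's box principle for the fractional parts of \<open>t\<close> times the coordinates of \<open>x\<close>.\<close>

lemma hurwitz: "\<exists>M::nat. M > 0 \<and> (ALL x:F. EX t:{1..M}. EX z:Lam. nr (of_nat t * x - z) < 1)"
proof -
 obtain L :: nat where L: "L > 0" "!!x. x : F ==> \<forall>i<n. \<bar>co x i\<bar> \<le> 1 / of_nat L ==> nr x < 1" using nr_small by blast
 have "EX t:{1..L ^ n}. EX z:Lam. nr (of_nat t * x - z) < 1" if x: "x : F" for x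
 proof -
  \<comment> \<open>The multiples with \<open>t\<close> from \<open>0\<close> to \<open>L^n\<close>
    are \<open>L^n + 1\<close> points for \<open>L^n\<close> boxes of side
    \<open>1 / L\<close>.\<close>
  let ?g = "%t::nat. \<lambda>i\<in>{..<n}. nat \<lfloor>of_nat L * frac (of_nat t * co x i)\<rfloor>"
  have "?g ` {0..L ^ n} \<subseteq> ({..<n} \<rightarrow>\<^sub>E {..<L})"
  proof
   fix h assume "h : ?g ` {0..L ^ n}"
   then obtain t where h: "h = ?g t" by blast
   have "nat \<lfloor>of_nat L * frac (of_nat t * co x i)\<rfloor> < L" for i
   proof -
    have "of_nat L * frac (of_nat t * co x i) < of_nat L * 1" using L(1) frac_lt_1 by (intro mult_strict_left_mono) auto
    then have "\<lfloor>of_nat L * frac (of_nat t * co x i)\<rfloor> < int L" by (simp add: floor_less_iff)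
    then show ?thesis using L(1) by linarith
   qed
   then show "h : ({..<n} \<rightarrow>\<^sub>E {..<L})" unfolding h by auto
  qed
  then have "card (?g ` {0..L ^ n}) \<le> card ({..<n} \<rightarrow>\<^sub>E {..<L})" by (intro card_mono finite_PiE) auto
  also have "\<dots> = L ^ n" by (simp add: card_PiE)
  also have "\<dots> < card {0..L ^ n}" by simp
  finally have "\<not> inj_on ?g {0..L ^ n}" by (intro pigeonhole)
  then obtain t1 t2 where t: "t1 \<le> L ^ n" "t2 \<le> L ^ n" "t1 < t2" "?g t1 = ?g t2"
   unfolding inj_on_def by (metis atLeastAtMost_iff linorder_neqE_nat)
  define f where "f i = \<lfloor>of_nat t2 * co x i\<rfloor> - \<lfloor>of_nat t1 * co x i\<rfloor>" for i
  define z where "z = (\<Sum>i<n. of_rat (of_int (f i)) * w i)"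
  have zF: "z : F" unfolding z_def by (intro Fsum Fmul Frat w_in) auto
  have coz: "co z i = of_int (f i)" if "i < n" for i unfolding z_def by (rule co_comb[OF that])
  then have zL: "z : Lam" unfolding Lam_def using zF by simp
  have "\<bar>co (of_nat (t2 - t1) * x - z) i\<bar> \<le> 1 / of_nat L" if i: "i < n" for i
  proof -
   let ?a = "frac (of_nat t2 * co x i)" and ?b = "frac (of_nat t1 * co x i)"
   have "co (of_nat (t2 - t1) * x - z) i = of_nat (t2 - t1) * co x i - of_int (f i)"
    using co_diff[OF Fmul[OF Fnat x] zF i] co_int[OF x i, of "int (t2 - t1)"] coz[OF i] by simp
   also have "\<dots> = ?a - ?b" using t(3) by (simp add: f_def frac_def of_nat_diff algebra_simps)
   finally have e: "co (of_nat (t2 - t1) * x - z) i = ?a - ?b" .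
   have "nat \<lfloor>of_nat L * ?a\<rfloor> = nat \<lfloor>of_nat L * ?b\<rfloor>" using fun_cong[OF t(4), of i] i by simp
   moreover have "0 \<le> \<lfloor>of_nat L * ?a\<rfloor>" "0 \<le> \<lfloor>of_nat L * ?b\<rfloor>" by (simp_all add: frac_ge_0)
   ultimately have "\<lfloor>of_nat L * ?a\<rfloor> = \<lfloor>of_nat L * ?b\<rfloor>" by linarith
   then have "\<bar>of_nat L * ?a - of_nat L * ?b\<bar> \<le> 1" by linarith
   then have "of_nat L * \<bar>?a - ?b\<bar> \<le> 1" by (simp add: abs_mult flip: right_diff_distrib)
   then show ?thesis unfolding e using L(1) by (simp add: field_simps)
  qed
  then have "nr (of_nat (t2 - t1) * x - z) < 1" by (intro L(2) Fdiff Fmul Fnat x zF) blast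
  moreover have "t2 - t1 : {1..L ^ n}" using t by auto
  ultimately show ?thesis using zL by blast
 qed
 then show ?thesis using L(1) by (intro exI[of _ "L ^ n"]) auto
qed

end

section \<open>Group rings and relation modules\<close>

text \<open>The determinant trick behind Nakayama's lemma, with \<open>1 - b\<close> in the part of
  \<open>det (1 - a)\<close>. The last vector is eliminated after multiplication by
  \<open>1 - a m m\<close>, which avoids division as well as determinants. \<open>J\<close> is only
  closed under sums, products and negatives, so that it can be a proper ideal.\<close>

lemma module_elimination:
 fixes m :: nat and s :: "'r::comm_ring_1 => 'v::ab_group_add => 'v"
 assumes M: "Modules.module s" and Sp: "module.subspace s Sp"
  and J: "!!a b. a : J ==> b : J ==> a + b : J" "!!a b. a : J ==> b : J ==> a * b : J"
   "!!a. a : J ==> - a : J" "0 : J"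
 shows "(!!i. i < m ==> c i - (\<Sum>j<m. s (a i j) (c j)) : Sp) ==> (!!i j. i < m ==> j < m ==> a i j : J)
  ==> EX b:J. \<forall>i<m. s (1 - b) (c i) : Sp"
proof (induction m arbitrary: a)
 case 0
 then show ?case using J by auto
next
 case (Suc m)
 interpret M: Modules.module s by (rule M)
 let ?u = "1 - a m m"
 \<comment> \<open>Row \<open>i\<close> is multiplied by \<open>?u\<close>, then \<open>?u\<close>
   times the last vector is replaced by means of the last row, and \<open>a m m\<close> times the
   vector \<open>c i\<close> moves to the right-hand side.\<close>
 define a' where "a' i j = (if i = j then a m m else 0) + ((a i j - a m m * a i j) + a i m * a m j)" for i j
 have m: "s ?u (c m) - (\<Sum>j<m. s (a m j) (c j)) : Sp"
  using Suc.prems(1)[of m] by (simp add: M.scale_left_diff_distrib algebra_simps)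
 have "c i - (\<Sum>j<m. s (a' i j) (c j)) : Sp" if i: "i < m" for i
 proof -
  have 1: "s ?u (c i - (\<Sum>j<Suc m. s (a i j) (c j))) : Sp"
   using Suc.prems(1)[of i] i by (intro M.subspace_scale[OF Sp]) auto
  have 2: "s (a i m) (s ?u (c m) - (\<Sum>j<m. s (a m j) (c j))) : Sp"
   by (rule M.subspace_scale[OF Sp m])
  have d: "(\<Sum>j<m. s (if i = j then a m m else 0) (c j)) = s (a m m) (c i)"
  proof -
   have "(\<Sum>j<m. s (if i = j then a m m else 0) (c j)) = (\<Sum>j<m. if i = j then s (a m m) (c j) else 0)"
    by (intro sum.cong) auto
   then show ?thesis using i by simp
  qed
  have "(\<Sum>j<m. s (a' i j) (c j)) = s (a m m) (c i) + (s ?u (\<Sum>j<m. s (a i j) (c j)) + s (a i m) (\<Sum>j<m. s (a m j) (c j)))"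
   unfolding a'_def M.scale_left_distrib sum.distrib d
   by (simp add: M.scale_sum_right M.scale_left_diff_distrib sum_subtractf left_diff_distrib)
  then have "c i - (\<Sum>j<m. s (a' i j) (c j)) =
    s ?u (c i - (\<Sum>j<Suc m. s (a i j) (c j))) + s (a i m) (s ?u (c m) - (\<Sum>j<m. s (a m j) (c j)))"
   by (simp add: M.scale_left_diff_distrib M.scale_right_diff_distrib M.scale_right_distrib algebra_simps)
  then show ?thesis using M.subspace_add[OF Sp 1 2] by metis
 qed
 moreover have "a' i j : J" if "i < m" "j < m" for i j
  unfolding a'_def using Suc.prems(2) that J(4)
  by (intro J(1)) (auto intro!: J(2) J(3) J(1) simp: diff_conv_add_uminus simp del: add_uminus_conv_diff)
 ultimately obtain b where b: "b : J" "!!i. i < m ==> s (1 - b) (c i) : Sp"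
  using Suc.IH[of a'] by blast
 have "s (1 - b) (s ?u (c m)) : Sp"
 proof -
  have "s (1 - b) (\<Sum>j<m. s (a m j) (c j)) = (\<Sum>j<m. s (a m j) (s (1 - b) (c j)))"
   by (simp add: M.scale_sum_right mult.commute)
  also have "\<dots> : Sp" by (intro M.subspace_sum[OF Sp] M.subspace_scale[OF Sp] b(2)) auto
  finally have "s (1 - b) (s ?u (c m) - (\<Sum>j<m. s (a m j) (c j))) + s (1 - b) (\<Sum>j<m. s (a m j) (c j)) : Sp"
   by (intro M.subspace_add[OF Sp] M.subspace_scale[OF Sp m])
  then show ?thesis by (metis M.scale_right_diff_distrib diff_add_cancel)
 qed
 moreover have "s ?u (s (1 - b) (c i)) : Sp" if "i < m" for i by (intro M.subspace_scale[OF Sp] b(2) that)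
 moreover have eq: "1 - (b + (a m m + - (b * a m m))) = (1 - b) * ?u" by (simp add: algebra_simps)
 ultimately have "s (1 - (b + (a m m + - (b * a m m)))) (c i) : Sp" if "i < Suc m" for i
  unfolding eq using that by (cases "i = m") (auto simp: mult.commute)
 moreover have "b + (a m m + - (b * a m m)) : J" using b(1) Suc.prems(2)[of m m] by (intro J) auto
 ultimately show ?case by blast
qed

section \<open>The integral group ring and its left ideals containing a prime\<close>

abbreviation (input) sc :: "int => ('g => int) => ('g => int)" where
 "sc k b \<equiv> (%de. k * b de)"

lemma module_sc: "Modules.module sc"
 by unfold_locales (auto simp: fun_eq_iff algebra_simps)

locale fin_group = group Ga for Ga :: "('g, 'z) monoid_scheme" (structure) +
 assumes fin: "finite (carrier Ga)"
begin

text \<open>The integral group ring, as functions vanishing off the group so that equal elements are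
  equal functions. In it \<open>sh ga\<close> is left multiplication by \<open>ga\<close>,
  \<open>delta ga\<close> is a basis element and \<open>conv b f\<close> is the product of
  \<open>b\<close> and \<open>f\<close>.\<close>

definition W0 :: "('g => int) set" where
 "W0 = {b. ALL ga. ga \<notin> carrier Ga --> b ga = 0}"

definition sh :: "'g => ('g => int) => ('g => int)" where
 "sh ga b = (%de. if de : carrier Ga then b (inv ga \<otimes> de) else 0)"

definition delta :: "'g => 'g => int" where
 "delta ga = (%de. if de = ga then 1 else 0)"

definition conv :: "('g => int) => ('g => int) => ('g => int)" where
 "conv b f = (\<Sum>ga\<in>carrier Ga. sc (b ga) (sh ga f))"

text \<open>Endomorphisms of the group ring as a left module; by \<open>equivariant_conv\<close>
  they are the right multiplications by the image of \<open>1\<close>.\<close>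

definition equivariant :: "(('g => int) => ('g => int)) => bool" where
 "equivariant F \<longleftrightarrow> (ALL b:W0. F b : W0) \<and> (ALL b:W0. ALL c:W0. F (b - c) = F b - F c)
  \<and> (ALL ga:carrier Ga. ALL b:W0. F (sh ga b) = sh ga (F b))"

definition sub :: "('g => int) set => bool" where
 "sub J \<longleftrightarrow> 0 : J \<and> (ALL b:J. ALL c:J. b - c : J)"

definition stable_sub :: "('g => int) set => bool" where
 "stable_sub J \<longleftrightarrow> sub J \<and> (ALL ga:carrier Ga. ALL b:J. sh ga b : J)"

definition pmult :: "nat => ('g => int) set" where "pmult p = {sc (int p) b | b. b : W0}"

lemma W0_closed [simp, intro]: "0 : W0" "b : W0 ==> c : W0 ==> b - c : W0"
 "b : W0 ==> c : W0 ==> b + c : W0" "b : W0 ==> sc k b : W0" "sh ga b : W0"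
 "ga : carrier Ga ==> delta ga : W0"
 by (auto simp: W0_def sh_def delta_def)

lemma W0_sum [intro]: "(!!i. i : A ==> f i : W0) ==> sum f A : W0"
 by (induction A rule: infinite_finite_induct) auto

lemma sum_apply: "(sum f A) x = (\<Sum>i\<in>A. f i x)" for f :: "_ => _ => int"
 by (induction A rule: infinite_finite_induct) auto

lemma sub_closed:
 assumes "sub J" "b : J"
 shows "c : J ==> b + c : J" "sc k b : J"
proof -
 have neg: "- c : J" if "c : J" for c
 proof -
  have "0 - c : J" using assms(1) that unfolding sub_def by blast
  then show ?thesis by simp
 qed
 have add: "b + c : J" if "b : J" "c : J" for b c
 proof -
  have "b - (- c) : J" using assms(1) that neg unfolding sub_def by blast
  then show ?thesis by simp
 qed
 then show "c : J ==> b + c : J" using assms by blast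
 have n: "sc (int m) b : J" for m
 proof (induction m)
  case 0
  have "sc (int 0) b = 0" by (simp add: fun_eq_iff)
  then show ?case using assms(1) by (simp add: sub_def)
 next
  case (Suc m)
  have "sc (int (Suc m)) b = b + sc (int m) b" by (simp add: fun_eq_iff algebra_simps)
  then show ?case using add[OF assms(2) Suc] by simp
 qed
 show "sc k b : J"
 proof (cases "k \<ge> 0")
  case True
  then show ?thesis using n[of "nat k"] by simp
 next
  case False
  have "sc k b = - sc (int (nat (- k))) b" using False by (simp add: fun_eq_iff)
  then show ?thesis using neg[OF n] by metis
 qed
qed

lemma sub_sum: "sub J ==> (!!i. i : A ==> f i : J) ==> sum f A : J"
 by (induction A rule: infinite_finite_induct) (auto simp: sub_closed(1), auto simp: sub_def zero_fun_def)

lemma sub_diff: "sub J ==> b : J ==> c : J ==> b - c : J"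
 by (simp add: sub_def)

lemma sub_pmult: "sub (pmult p)"
proof -
 have "sc (int p) b - sc (int p) c = sc (int p) (b - c)" for b c :: "'g => int"
  by (simp add: fun_eq_iff algebra_simps)
 then have "ALL b:pmult p. ALL c:pmult p. b - c : pmult p" unfolding pmult_def by blast
 moreover have "0 = sc (int p) (0 :: 'g => int)" by (simp add: fun_eq_iff)
 then have "0 : pmult p" unfolding pmult_def using W0_closed(1) by blast
 ultimately show ?thesis unfolding sub_def by blast
qed

lemma sh_sh: "ga : carrier Ga ==> de : carrier Ga ==> sh ga (sh de b) = sh (ga \<otimes> de) b"
 by (auto simp: sh_def fun_eq_iff inv_mult_group m_assoc)

lemma sh_one: "b : W0 ==> sh \<one> b = b"
 by (auto simp: sh_def fun_eq_iff W0_def)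

lemma sh_lin: "sh ga (b - c) = sh ga b - sh ga c" "sh ga (b + c) = sh ga b + sh ga c"
 "sh ga (sc k b) = sc k (sh ga b)" "sh ga (sum f A) = (\<Sum>i\<in>A. sh ga (f i))"
 by (auto simp: sh_def fun_eq_iff sum_apply)

lemma sh_delta: "ga : carrier Ga ==> sh ga (delta \<one>) = delta ga"
proof
 fix x assume g: "ga : carrier Ga"
 have "inv ga \<otimes> x = \<one> \<longleftrightarrow> x = ga" if "x : carrier Ga"
  using g that by (metis inv_equality inv_inv inv_closed l_inv)
 then show "sh ga (delta \<one>) x = delta ga x" using g by (auto simp: sh_def delta_def)
qed

lemma W0_expand: "b : W0 ==> b = (\<Sum>ga\<in>carrier Ga. sc (b ga) (delta ga))"
proof
 fix x assume "b : W0"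
 then show "b x = (\<Sum>ga\<in>carrier Ga. sc (b ga) (delta ga)) x"
  unfolding sum_apply delta_def using fin by (auto simp: W0_def if_distrib[of "%x. _ * x"] cong: if_cong)
qed

lemma equivariant_lin:
 assumes "equivariant F"
 shows "F 0 = 0" "b : W0 ==> c : W0 ==> F (b + c) = F b + F c" "b : W0 ==> F (sc k b) = sc k (F b)"
  "(!!i. i : A ==> f i : W0) ==> F (sum f A) = (\<Sum>i\<in>A. F (f i))"
proof -
 have d: "F (b - c) = F b - F c" if "b : W0" "c : W0" for b c using assms that unfolding equivariant_def by blast
 show z: "F 0 = 0" using d[of 0 0] by simp
 have n: "F (- c) = - F c" if "c : W0" for c using d[of 0 c] that z by simp
 have a: "F (b + c) = F b + F c" if "b : W0" "c : W0" for b c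
 proof -
  have "- c : W0" using that by (auto simp: W0_def)
  then show ?thesis using d[of b "- c"] n[of c] that by simp
 qed
 show "b : W0 ==> c : W0 ==> F (b + c) = F b + F c" by (rule a)
 show "(!!i. i : A ==> f i : W0) ==> F (sum f A) = (\<Sum>i\<in>A. F (f i))"
  by (induction A rule: infinite_finite_induct) (auto simp: z a W0_sum)
 assume b: "b : W0"
 have nn: "F (sc (int m) b) = sc (int m) (F b)" for m
 proof (induction m)
  case 0
  then show ?case using z by (simp add: zero_fun_def)
 next
  case (Suc m)
  have "sc (int (Suc m)) b = b + sc (int m) b" by (simp add: fun_eq_iff algebra_simps)
  then have "F (sc (int (Suc m)) b) = F b + sc (int m) (F b)" using a[of b "sc (int m) b"] b Suc by simp
  then show ?case by (simp add: fun_eq_iff algebra_simps)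
 qed
 show "F (sc k b) = sc k (F b)"
 proof (cases "k \<ge> 0")
  case True
  then show ?thesis using nn[of "nat k"] by simp
 next
  case False
  have "sc k b = - sc (int (nat (- k))) b" using False by (simp add: fun_eq_iff)
  then have "F (sc k b) = F (- sc (int (nat (- k))) b)" by (rule arg_cong)
  also have "\<dots> = - sc (int (nat (- k))) (F b)" unfolding n[OF W0_closed(4)[OF b]] nn ..
  also have "\<dots> = sc k (F b)" using False by (simp add: fun_eq_iff)
  finally show ?thesis .
 qed
qed

lemma equivariant_conv:
 assumes F: "equivariant F" and b: "b : W0"
 shows "F b = conv b (F (delta \<one>))"
proof -
 have "F b = (\<Sum>ga\<in>carrier Ga. F (sc (b ga) (delta ga)))"
  by (subst W0_expand[OF b], rule equivariant_lin(4)[OF F]) auto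
 also have "\<dots> = conv b (F (delta \<one>))" unfolding conv_def
 proof (rule sum.cong[OF refl])
  fix ga assume g: "ga : carrier Ga"
  have "F (delta ga) = sh ga (F (delta \<one>))"
   using F g unfolding equivariant_def by (metis sh_delta one_closed W0_closed(6))
  then show "F (sc (b ga) (delta ga)) = sc (b ga) (sh ga (F (delta \<one>)))"
   using equivariant_lin(3)[OF F] g by simp
 qed
 finally show ?thesis .
qed

text \<open>Steinitz exchange in the group ring modulo \<open>p\<close>, phrased with subgroups that
  contain \<open>pmult p\<close>: a basis element that does not yet lie in \<open>C + J\<close> is
  adjoined to \<open>C\<close>.\<close>

lemma complement_mod_p:
 assumes J: "sub J" and JW: "J \<subseteq> W0" and pJ: "pmult p \<subseteq> J" and p: "Factorial_Ring.prime p"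
  and S: "finite S" "S \<subseteq> carrier Ga"
 shows "EX C. sub C \<and> C \<subseteq> W0 \<and> pmult p \<subseteq> C \<and> C \<inter> J \<subseteq> pmult p \<and>
  (ALL ga:S. EX c:C. EX j:J. delta ga = c + j)"
 using S
proof (induction S)
 case empty
 have "pmult p \<subseteq> W0" using pJ JW by blast
 then show ?case using sub_pmult by blast
next
 case (insert ga S)
 have "S \<subseteq> carrier Ga" using insert.prems by blast
 from insert.IH[OF this] obtain C where C: "sub C" "C \<subseteq> W0" "pmult p \<subseteq> C" "C \<inter> J \<subseteq> pmult p"
  "!!ga. ga : S ==> EX c:C. EX j:J. delta ga = c + j" by blast
 have g: "ga : carrier Ga" using insert by auto
 note Cadd = sub_closed(1)[OF C(1)] and Csc = sub_closed(2)[OF C(1)]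
 show ?case
 proof (cases "EX c:C. EX j:J. delta ga = c + j")
  case True
  then show ?thesis using C by (intro exI[of _ C]) blast
 next
  case False
  define C' where "C' = {c + sc k (delta ga) | c k. c : C}"
  have sub: "C \<subseteq> C'"
  proof
   fix c assume "c : C"
   moreover have "c = c + sc 0 (delta ga)" by (simp add: fun_eq_iff)
   ultimately show "c : C'" unfolding C'_def by blast
  qed
  have d: "b - c : C'" if bc: "b : C'" "c : C'" for b c
  proof -
   obtain b1 k1 where 1: "b = b1 + sc k1 (delta ga)" "b1 : C" using bc(1) unfolding C'_def by blast
   obtain c1 l1 where 2: "c = c1 + sc l1 (delta ga)" "c1 : C" using bc(2) unfolding C'_def by blast
   have "b - c = (b1 - c1) + sc (k1 - l1) (delta ga)" unfolding 1 2 by (simp add: fun_eq_iff algebra_simps)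
   then show ?thesis unfolding C'_def using sub_diff[OF C(1) 1(2) 2(2)] by blast
  qed
  have int: "C' \<inter> J \<subseteq> pmult p"
  proof
   fix x assume x: "x : C' \<inter> J"
   then obtain c k where c: "x = c + sc k (delta ga)" "c : C" unfolding C'_def by blast
   have pd: "sc (int p) (delta ga) : pmult p" unfolding pmult_def using g by blast
   show "x : pmult p"
   proof (cases "int p dvd k")
    case True
    then obtain l where "k = l * int p" by (metis dvdE mult.commute)
    then have "sc k (delta ga) = sc l (sc (int p) (delta ga))" by (simp add: fun_eq_iff)
    then have "x : C" using c Cadd Csc pd C(3) by (metis subsetD)
    then show ?thesis using x C(4) by blast
   next
    case False
    \<comment> \<open>If \<open>k\<close> is invertible modulo \<open>p\<close>, an element of
      \<open>J\<close> of the form \<open>c + k delta ga\<close> expresses \<open>delta ga\<close>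
      through \<open>C\<close> and \<open>J\<close>, against the choice of
      \<open>ga\<close>.\<close>
    have "coprime (int p) k" using False p by (simp add: prime_imp_coprime)
    then obtain s t where st: "s * int p + t * k = 1" by (metis coprime_iff_gcd_eq_1 bezout_int)
    have "delta ga = sc (- t) c + sc s (sc (int p) (delta ga)) + sc t x"
    proof
     fix y
     have "delta ga y = (s * int p + t * k) * delta ga y" using st by simp
     then show "delta ga y = (sc (- t) c + sc s (sc (int p) (delta ga)) + sc t x) y"
      unfolding c(1) by (simp add: algebra_simps)
    qed
    moreover have "sc (- t) c + sc s (sc (int p) (delta ga)) : C"
     by (rule Cadd[OF Csc[OF c(2)] Csc[OF subsetD[OF C(3) pd]]])
    moreover have "sc t x : J" using x J sub_closed(2) by blast
    ultimately show ?thesis using \<open>\<not> (EX c:C. EX j:J. delta ga = c + j)\<close> by blast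
   qed
  qed
  have "0 : C" "0 : J" using C(1) J by (simp_all add: sub_def)
  then have "sub C'" using sub d by (auto simp: sub_def simp del: zero_fun_def)
  moreover have "C' \<subseteq> W0" using C(2) g unfolding C'_def by auto
  moreover have "EX c:C'. EX j:J. delta be = c + j" if "be : insert ga S" for be
  proof (cases "be : S")
   case True
   then show ?thesis using C(5) sub by blast
  next
   case False
   then have "delta be = (0 + sc 1 (delta ga)) + 0" using that by (auto simp: fun_eq_iff)
   moreover have "0 + sc 1 (delta ga) : C'" unfolding C'_def using \<open>0 : C\<close> by blast
   ultimately show ?thesis using \<open>0 : J\<close> by blast
  qed
  moreover have "pmult p \<subseteq> C'" using sub C(3) by (rule order_trans[rotated])
  ultimately show ?thesis using int by (intro exI[of _ C'] conjI ballI) assumption+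
 qed
qed

lemma pmult_W0: "b : W0 ==> sc (int p) b : pmult p" unfolding pmult_def by blast

lemma stable_pmult: "stable_sub (pmult p)"
 unfolding stable_sub_def by (auto simp: sub_pmult) (auto simp: pmult_def sh_lin)

lemma pmultE: "x : pmult p ==> (!!b. b : W0 ==> x = sc (int p) b ==> R) ==> R"
 unfolding pmult_def by blast

text \<open>Maschke's theorem. A linear projection onto \<open>J\<close> modulo \<open>p\<close>
  comes from the complement; averaging its conjugates over the group, with \<open>g'\<close> an
  inverse of the group order modulo \<open>p\<close>, makes it equivariant.\<close>

lemma projection_mod_p:
 assumes J: "stable_sub J" and JW: "J \<subseteq> W0" and pJ: "pmult p \<subseteq> J" and p: "Factorial_Ring.prime p"
  and g: "\<not> p dvd card (carrier Ga)"
 shows "EX q. equivariant q \<and> (ALL b:W0. q b : J) \<and> (ALL b:J. q b - b : pmult p)"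
proof -
 have sJ: "sub J" and shJ: "!!ga b. ga : carrier Ga ==> b : J ==> sh ga b : J"
  using J by (auto simp: stable_sub_def)
 obtain C where C: "sub C" "C \<subseteq> W0" "pmult p \<subseteq> C" "C \<inter> J \<subseteq> pmult p"
  "ALL ga:carrier Ga. EX c:C. EX j:J. delta ga = c + j"
  using complement_mod_p[OF sJ JW pJ p fin] by blast
 then obtain c j where cj: "!!ga. ga : carrier Ga ==> c ga : C" "!!ga. ga : carrier Ga ==> j ga : J"
  "!!ga. ga : carrier Ga ==> delta ga = c ga + j ga" by metis
 \<comment> \<open>Each basis element goes to its component in \<open>J\<close>, so
   \<open>q1\<close> is linear over the integers but not yet equivariant.\<close>
 define q1 where "q1 b = (\<Sum>ga\<in>carrier Ga. sc (b ga) (j ga))" for b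
 have q1J: "q1 b : J" for b unfolding q1_def by (intro sub_sum[OF sJ] sub_closed(2)[OF sJ] cj)
 have q1d: "q1 (b - b') = q1 b - q1 b'" for b b'
  by (simp add: q1_def fun_eq_iff sum_apply left_diff_distrib sum_subtractf)
 have q1p: "q1 b - b : pmult p" if "b : J" for b
 proof -
  have b: "b : W0" using that JW by blast
  have "b = (\<Sum>ga\<in>carrier Ga. sc (b ga) (c ga)) + q1 b"
   unfolding q1_def sum.distrib[symmetric]
   by (subst W0_expand[OF b], rule sum.cong) (auto simp: cj(3) fun_eq_iff algebra_simps)
  then have "b - q1 b = (\<Sum>ga\<in>carrier Ga. sc (b ga) (c ga))" by (metis add_diff_cancel_right')
  moreover have "(\<Sum>ga\<in>carrier Ga. sc (b ga) (c ga)) : C" by (intro sub_sum[OF C(1)] sub_closed(2)[OF C(1)] cj)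
  ultimately have "b - q1 b : pmult p" using C(4) sub_diff[OF sJ that q1J[of b]] by auto
  then have "0 - (b - q1 b) : pmult p" using sub_pmult unfolding sub_def by blast
  then show ?thesis by simp
 qed
 have "coprime (int (card (carrier Ga))) (int p)" using g p by (metis coprime_commute coprime_int_iff prime_imp_coprime)
 then obtain g' t where gt: "g' * int (card (carrier Ga)) + t * int p = 1"
  by (metis coprime_iff_gcd_eq_1 bezout_int)
 define q where "q b = sc g' (\<Sum>ga\<in>carrier Ga. sh ga (q1 (sh (inv ga) b)))" for b
 have qJ: "q b : J" for b unfolding q_def by (intro sub_closed(2)[OF sJ] sub_sum[OF sJ] shJ q1J)
 have "equivariant q" unfolding equivariant_def
 proof (intro conjI ballI)
  fix b show "q b : W0" using qJ JW by blast
  fix b' show "q (b - b') = q b - q b'"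
   by (simp add: q_def sh_lin q1d sum_subtractf fun_eq_iff algebra_simps)
 next
  fix de b assume d: "de : carrier Ga"
  have bij: "bij_betw (%ga. de \<otimes> ga) (carrier Ga) (carrier Ga)"
   by (rule bij_betwI[where g = "%ga. inv de \<otimes> ga"]) (use d in \<open>auto simp: m_assoc[symmetric]\<close>)
  have "(\<Sum>ga\<in>carrier Ga. sh ga (q1 (sh (inv ga) (sh de b)))) =
    (\<Sum>ga\<in>carrier Ga. sh (de \<otimes> ga) (q1 (sh (inv (de \<otimes> ga)) (sh de b))))"
   by (rule sum.reindex_bij_betw[OF bij, symmetric])
  also have "\<dots> = (\<Sum>ga\<in>carrier Ga. sh de (sh ga (q1 (sh (inv ga) b))))"
   by (rule sum.cong) (use d in \<open>auto simp: sh_sh inv_mult_group m_assoc\<close>)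
  finally show "q (sh de b) = sh de (q b)" by (simp add: q_def sh_lin)
 qed
 moreover have "q b - b : pmult p" if b: "b : J" for b
 proof -
  have W: "b : W0" using b JW by blast
  have 1: "sh ga (q1 (sh (inv ga) b)) - b : pmult p" if ga: "ga : carrier Ga" for ga
  proof -
   have "sh ga (q1 (sh (inv ga) b) - sh (inv ga) b) : pmult p"
    using stable_pmult[of p] q1p[OF shJ[OF _ b, of "inv ga"]] ga unfolding stable_sub_def by blast
   then show ?thesis using ga W by (simp add: sh_lin sh_sh sh_one)
  qed
  \<comment> \<open>As \<open>g' |Ga| = 1 - t p\<close>, writing \<open>b\<close> for
    \<open>g' |Ga| b\<close> costs the correction \<open>t p b\<close>, which lies in
    \<open>pmult p\<close>.\<close>
  have "sc g' (\<Sum>ga\<in>carrier Ga. sh ga (q1 (sh (inv ga) b)) - b) + sc (- t) (sc (int p) b) : pmult p"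
   by (intro sub_closed[OF sub_pmult] sub_sum[OF sub_pmult] 1 pmult_W0[OF W])
  moreover have "sc g' (\<Sum>ga\<in>carrier Ga. sh ga (q1 (sh (inv ga) b)) - b) + sc (- t) (sc (int p) b) = q b - b"
  proof
   fix x
   have "b x = (g' * int (card (carrier Ga)) + t * int p) * b x" using gt by simp
   then show "(sc g' (\<Sum>ga\<in>carrier Ga. sh ga (q1 (sh (inv ga) b)) - b) + sc (- t) (sc (int p) b)) x = (q b - b) x"
    by (simp add: q_def sum_apply sum_subtractf algebra_simps)
  qed
  ultimately show ?thesis by simp
 qed
 ultimately show ?thesis using qJ by blast
qed

lemma conv_lin: "conv (b + c) f = conv b f + conv c f" "conv (sc k b) f = sc k (conv b f)"
 by (auto simp: conv_def sum_apply fun_eq_iff algebra_simps sum.distrib sum_distrib_left)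

text \<open>The polynomial \<open>3t\<^sup>2 - 2t\<^sup>3\<close> lifts an idempotent modulo \<open>p\<close> to one modulo \<open>p\<^sup>2\<close>.\<close>

lemma lift_projection:
 assumes q: "equivariant t" and tJ: "!!b. b : W0 ==> t b : J" and J: "sub J" "J \<subseteq> W0"
  and tp: "!!b. b : J ==> t b - b : pmult p"
 defines "q \<equiv> (%b. sc 3 (t (t b)) - sc 2 (t (t (t b))))"
 shows "equivariant q" "!!b. b : W0 ==> q b : J" "!!b. b : J ==> b - q b : pmult p"
  "!!b. b : W0 ==> q (q b) - q b : pmult (p ^ 2)"
proof -
 have tW [simp]: "t b : W0" if "b : W0" for b using tJ[OF that] J by blast
 note tl = equivariant_lin[OF q]
 have td: "t (b - c) = t b - t c" if "b : W0" "c : W0" for b c using q that unfolding equivariant_def by blast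
 have tsh: "t (sh ga b) = sh ga (t b)" if "b : W0" "ga : carrier Ga" for b ga using q that unfolding equivariant_def by blast
 show "equivariant q" unfolding equivariant_def q_def
 proof (intro conjI ballI)
  fix b c assume b: "b : W0" and c: "c : W0"
  show "sc 3 (t (t b)) - sc 2 (t (t (t b))) : W0" using b by (intro W0_closed tW)
  show "sc 3 (t (t (b - c))) - sc 2 (t (t (t (b - c)))) =
   sc 3 (t (t b)) - sc 2 (t (t (t b))) - (sc 3 (t (t c)) - sc 2 (t (t (t c))))"
   using b c by (simp add: td W0_closed(2)) (simp add: fun_eq_iff algebra_simps)
 qed (simp add: tsh sh_lin W0_closed)
 show qJ: "q b : J" if "b : W0" for b
  unfolding q_def by (intro sub_diff[OF J(1)] sub_closed(2)[OF J(1)] tJ tW that)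
 define N where "N b = t (t b) - t b" for b
 have Np: "N b : pmult p" if "b : W0" for b unfolding N_def by (rule tp[OF tJ[OF that]])
 show "b - q b : pmult p" if b: "b : J" for b
 proof -
  have W: "b : W0" using b J by blast
  have "b - q b = (sc (- 1) (t b - b) + sc (- 1) (N b)) + sc 2 (N (t b))"
   by (simp add: q_def N_def fun_eq_iff)
  also have "\<dots> : pmult p" by (intro sub_closed[OF sub_pmult] tp Np b tW W)
  finally show ?thesis .
 qed
 have NN: "N (N b) : pmult (p ^ 2)" if b: "b : W0" for b
 proof -
  obtain c where c: "c : W0" "N b = sc (int p) c" using Np[OF b] by (rule pmultE)
  obtain d where d: "d : W0" "N c = sc (int p) d" using Np[OF c(1)] by (rule pmultE)
  have "N (N b) = N (sc (int p) c)" unfolding c(2) ..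
  also have "\<dots> = sc (int p) (N c)" unfolding N_def using c(1) by (simp add: tl(3)) (simp add: fun_eq_iff algebra_simps)
  finally have "N (N b) = sc (int p) (N c)" .
  then have "N (N b) = sc (int (p ^ 2)) d" unfolding d(2) by (simp add: fun_eq_iff power2_eq_square)
  then show ?thesis using pmult_W0[OF d(1)] by metis
 qed
 show "q (q b) - q b : pmult (p ^ 2)" if b: "b : W0" for b
 proof -
  \<comment> \<open>As polynomials in \<open>t\<close>,
    \<open>q^2 - q = (t^2 - t)^2 (4 t^2 - 4 t - 3)\<close> for \<open>q = 3 t^2 - 2 t^3\<close>.
    Here \<open>x\<close> is the last factor applied to \<open>b\<close>, and \<open>N\<close> is
    \<open>t^2 - t\<close>.\<close>
  define x where "x = sc 4 (t (t b)) - sc 4 (t b) - sc 3 b"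
  have x: "x : W0" unfolding x_def using b by (intro W0_closed tW)
  have t1: "t x = sc 4 (t (t (t b))) - sc 4 (t (t b)) - sc 3 (t b)" unfolding x_def
   using b by (simp add: td tl(3) W0_closed(2,4) del: minus_apply)
  have t2: "t (t x) = sc 4 (t (t (t (t b)))) - sc 4 (t (t (t b))) - sc 3 (t (t b))" unfolding t1
   using b by (simp add: td tl(3) W0_closed(2,4) del: minus_apply)
  have t3: "t (t (t x)) = sc 4 (t (t (t (t (t b))))) - sc 4 (t (t (t (t b)))) - sc 3 (t (t (t b)))" unfolding t2
   using b by (simp add: td tl(3) W0_closed(2,4) del: minus_apply)
  have t4: "t (t (t (t x))) = sc 4 (t (t (t (t (t (t b)))))) - sc 4 (t (t (t (t (t b))))) - sc 3 (t (t (t (t b))))"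
   unfolding t3 using b by (simp add: td tl(3) W0_closed(2,4) del: minus_apply)
  have NNx: "N (N x) = t (t (t (t x))) - t (t (t x)) - (t (t (t x)) - t (t x))"
   unfolding N_def using x by (simp add: td W0_closed(2) del: minus_apply)
  have q1: "t (q b) = sc 3 (t (t (t b))) - sc 2 (t (t (t (t b))))" unfolding q_def
   using b by (simp add: td tl(3) W0_closed(2,4) del: minus_apply)
  have q2: "t (t (q b)) = sc 3 (t (t (t (t b)))) - sc 2 (t (t (t (t (t b)))))" unfolding q1
   using b by (simp add: td tl(3) W0_closed(2,4) del: minus_apply)
  have q3: "t (t (t (q b))) = sc 3 (t (t (t (t (t b))))) - sc 2 (t (t (t (t (t (t b))))))" unfolding q2
   using b by (simp add: td tl(3) W0_closed(2,4) del: minus_apply)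
  have qq: "q (q b) = sc 3 (t (t (q b))) - sc 2 (t (t (t (q b))))" unfolding q_def ..
  have "q (q b) - q b = N (N x)"
   unfolding NNx qq unfolding t4 unfolding t3 unfolding t2 unfolding q3 unfolding q2 by (simp add: q_def fun_eq_iff algebra_simps)
  then show ?thesis using NN[OF x] by simp
 qed
qed

text \<open>Modulo \<open>p\<close> the left ideal \<open>J\<close> is generated by an idempotent.
  With its lift \<open>q\<close> to an idempotent modulo \<open>p^2\<close>, the element
  \<open>q + p (1 - q)\<close> generates \<open>J\<close> modulo \<open>p^2\<close>. Since
  \<open>p\<close> lies in \<open>J\<close>, an error in \<open>pmult (p ^ 2)\<close> is
  \<open>p\<close> times an element of \<open>J\<close>, and Nakayama's lemma removes it at the
  price of the denominator \<open>e\<close>, which is \<open>1\<close> modulo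
  \<open>p\<close>.\<close>

lemma cyclic_relation:
 assumes J: "stable_sub J" and JW: "J \<subseteq> W0" and pJ: "pmult p \<subseteq> J" and p: "Factorial_Ring.prime p"
  and g: "\<not> p dvd card (carrier Ga)"
 shows "EX r:J. EX e. coprime e (int p) \<and> (ALL b:J. EX c:W0. sc e b = conv c r)"
proof -
 have sJ: "sub J" using J by (simp add: stable_sub_def)
 obtain t where t: "equivariant t" "!!b. b : W0 ==> t b : J" "!!b. b : J ==> t b - b : pmult p"
  using projection_mod_p[OF assms] by blast
 define q where "q = (%b. sc 3 (t (t b)) - sc 2 (t (t (t b))))"
 have q: "equivariant q" "!!b. b : W0 ==> q b : J" "!!b. b : J ==> b - q b : pmult p"
  "!!b. b : W0 ==> q (q b) - q b : pmult (p ^ 2)"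
  unfolding q_def using lift_projection[of t J p] t sJ JW by blast+
 have qW [simp]: "q b : W0" if "b : W0" for b using q(2)[OF that] JW by blast
 define \<rho> where "\<rho> b = q b + sc (int p) (b - q b)" for b
 have qd: "q (b - c) = q b - q c" if "b : W0" "c : W0" for b c using q(1) that unfolding equivariant_def by blast
 have qsh: "q (sh ga b) = sh ga (q b)" if "b : W0" "ga : carrier Ga" for b ga
  using q(1) that unfolding equivariant_def by blast
 have \<rho>: "equivariant \<rho>" unfolding equivariant_def \<rho>_def
 proof (intro conjI ballI)
  fix b c assume b: "b : W0" and c: "c : W0"
  show "q b + sc (int p) (b - q b) : W0" using b by (intro W0_closed qW)
  show "q (b - c) + sc (int p) (b - c - q (b - c)) = q b + sc (int p) (b - q b) - (q c + sc (int p) (c - q c))"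
   using b c by (simp add: qd) (simp add: fun_eq_iff algebra_simps)
 next
  fix ga b assume "ga : carrier Ga" "b : W0"
  then show "q (sh ga b) + sc (int p) (sh ga b - q (sh ga b)) = sh ga (q b + sc (int p) (b - q b))"
   by (simp only: qsh sh_lin)
 qed
 define r where "r = \<rho> (delta \<one>)"
 have \<rho>r: "\<rho> b = conv b r" if "b : W0" for b unfolding r_def by (rule equivariant_conv[OF \<rho> that])
 note P2 = sub_pmult[of "p ^ 2"]
 have close: "EX s:W0. b - \<rho> s : pmult (p ^ 2)" if b: "b : J" for b
 proof -
  have W: "b : W0" using b JW by blast
  obtain w where w: "w : W0" "b - q b = sc (int p) w" using q(3)[OF b] by (rule pmultE)
  \<comment> \<open>For an exact idempotent \<open>q\<close>, the map \<open>\<rho>\<close> is the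
    identity on the image of \<open>q\<close> and multiplication by \<open>p\<close> on the
    complement, so \<open>s\<close> would be an exact preimage of \<open>b = q b + p w\<close>. As
    \<open>q\<close> is idempotent only modulo \<open>p^2\<close>, there remains the defect computed
    below.\<close>
  define s where "s = q b + sc (int p) (q w) + (w - q w)"
  have s: "s : W0" unfolding s_def using W w by (intro W0_closed qW)
  have b_eq: "b = q b + sc (int p) w" using w(2) by (metis add_diff_cancel_left' diff_add_cancel add.commute)
  have qs: "q s = q (q b) + sc (int p) (q (q w)) + (q w - q (q w))"
   unfolding s_def using W w by (simp add: equivariant_lin[OF q(1)] qd W0_closed)
  have "b - \<rho> s = (sc (int p - 1) (q (q b) - q b) + sc (int p * (int p - 1)) (q (q w) - q w))
    + sc (1 - int p) (q (q w) - q w)"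
  proof -
   have "b - \<rho> s = q b + sc (int p) w - \<rho> s" using b_eq by metis
   also have "\<dots> = (sc (int p - 1) (q (q b) - q b) + sc (int p * (int p - 1)) (q (q w) - q w))
    + sc (1 - int p) (q (q w) - q w)"
    unfolding \<rho>_def qs unfolding s_def by (simp add: fun_eq_iff algebra_simps)
   finally show ?thesis .
  qed
  also have "\<dots> : pmult (p ^ 2)" by (intro sub_closed[OF P2] q(4) W w)
  finally show ?thesis using s by blast
 qed
 define Sp where "Sp = {conv c r | c. c : W0}"
 interpret sc: Modules.module sc by (rule module_sc)
 have SpI: "conv c r : Sp" if "c : W0" for c unfolding Sp_def by (rule CollectI, rule exI[of _ c]) (simp add: that)
 have SpE: "EX c:W0. x = conv c r" if "x : Sp" for x using that unfolding Sp_def mem_Collect_eq by metis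
 have Sp: "sc.subspace Sp"
 proof (rule sc.subspaceI)
  have "0 = conv 0 r" by (simp add: conv_def fun_eq_iff sum_apply)
  then show "0 : Sp" using SpI[OF W0_closed(1)] by simp
  show "x + y : Sp" if xy: "x : Sp" "y : Sp" for x y
  proof -
   from SpE[OF xy(1)] obtain b where b: "b : W0" "x = conv b r" ..
   from SpE[OF xy(2)] obtain c where c: "c : W0" "y = conv c r" ..
   show ?thesis using SpI[OF W0_closed(3)[OF b(1) c(1)]] unfolding b(2) c(2) conv_lin .
  qed
  show "sc k x : Sp" if x: "x : Sp" for k x
  proof -
   from SpE[OF x] obtain c where c: "c : W0" "x = conv c r" ..
   show ?thesis using SpI[OF W0_closed(4)[OF c(1)], of k] unfolding c(2) conv_lin .
  qed
 qed
 have \<rho>Sp: "\<rho> s : Sp" if "s : W0" for s unfolding \<rho>r[OF that] by (rule SpI[OF that])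
 obtain h where h: "bij_betw h {..<card (carrier Ga)} (carrier Ga)"
  using ex_bij_betw_nat_finite[OF fin] by (auto simp: atLeast0LessThan)
 let ?m = "card (carrier Ga)"
 define c where "c i = sc (int p) (delta (h i))" for i
 have hi: "h i : carrier Ga" if "i < ?m" for i using h that by (auto simp: bij_betw_def)
 have "EX w. w : W0 \<and> c i - sc (int p ^ 2) w : Sp" if "i < ?m" for i
 proof -
  have "c i : J" unfolding c_def using hi[OF that] pJ pmult_W0 W0_closed(6) by blast
  then obtain s where s: "s : W0" "c i - \<rho> s : pmult (p ^ 2)" using close by blast
  obtain w where w: "w : W0" "c i - \<rho> s = sc (int (p ^ 2)) w" using s(2) by (rule pmultE)
  have e: "sc (int p ^ 2) w = c i - \<rho> s" using w(2) by simp
  have "c i - sc (int p ^ 2) w = \<rho> s" unfolding e by simp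
  then show ?thesis using \<rho>Sp[OF s(1)] w(1) by metis
 qed
 then obtain w where w: "!!i. i < ?m ==> w i : W0" "!!i. i < ?m ==> c i - sc (int p ^ 2) (w i) : Sp" by metis
 \<comment> \<open>Modulo \<open>Sp\<close> each element \<open>p delta\<close> equals some
   \<open>p^2 w\<close>, which is a combination of the same elements with coefficients divisible by
   \<open>p\<close>.\<close>
 have "EX a:{k. int p dvd k}. \<forall>i<?m. sc (1 - a) (c i) : Sp"
 proof (rule module_elimination[OF module_sc Sp, where a = "%i j. int p * w i (h j)"])
  fix i assume i: "i < ?m"
  have "w i = (\<Sum>j<?m. sc (w i (h j)) (delta (h j)))"
   by (rule trans[OF W0_expand[OF w(1)[OF i]] sum.reindex_bij_betw[OF h, of "%ga. sc (w i ga) (delta ga)", symmetric]])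
  from fun_cong[OF this] have wx: "w i x = (\<Sum>j<?m. w i (h j) * delta (h j) x)" for x unfolding sum_apply .
  have "sc (int p ^ 2) (w i) x = (\<Sum>j<?m. sc (int p * w i (h j)) (c j)) x" for x
   unfolding sum_apply c_def wx[of x] sum_distrib_left by (intro sum.cong) (simp_all add: power2_eq_square mult_ac)
  then have e: "sc (int p ^ 2) (w i) = (\<Sum>j<?m. sc (int p * w i (h j)) (c j))" by blast
  show "c i - (\<Sum>j<?m. sc (int p * w i (h j)) (c j)) : Sp" using w(2)[OF i] unfolding e .
 qed auto
 then obtain a where a: "int p dvd a" "!!i. i < ?m ==> sc (1 - a) (c i) : Sp" by auto
 have aW: "sc (1 - a) (sc (int p) b) : Sp" if b: "b : W0" for b
 proof -
  have "b = (\<Sum>j<?m. sc (b (h j)) (delta (h j)))"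
   by (rule trans[OF W0_expand[OF b] sum.reindex_bij_betw[OF h, of "%ga. sc (b ga) (delta ga)", symmetric]])
  from fun_cong[OF this] have bx: "b x = (\<Sum>j<?m. b (h j) * delta (h j) x)" for x unfolding sum_apply .
  have "sc (1 - a) (sc (int p) b) = (\<Sum>j<?m. sc (b (h j)) (sc (1 - a) (c j)))"
  proof
   fix x show "sc (1 - a) (sc (int p) b) x = (\<Sum>j<?m. sc (b (h j)) (sc (1 - a) (c j))) x"
    unfolding sum_apply c_def bx[of x] sum_distrib_left by (intro sum.cong) (simp_all add: mult_ac)
  qed
  also have "\<dots> : Sp" by (intro sc.subspace_sum[OF Sp] sc.subspace_scale[OF Sp] a(2)) auto
  finally show ?thesis .
 qed
 have "EX c:W0. sc (1 - a) b = conv c r" if b: "b : J" for b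
 proof -
  obtain s where s: "s : W0" "b - \<rho> s : pmult (p ^ 2)" using close[OF b] by blast
  obtain w where w: "w : W0" "b - \<rho> s = sc (int (p ^ 2)) w" using s(2) by (rule pmultE)
  have e: "\<rho> s + sc (int (p ^ 2)) w = b" unfolding w(2)[symmetric] by simp
  have "sc (1 - a) b = sc (1 - a) (\<rho> s + sc (int (p ^ 2)) w)" unfolding e ..
  also have "\<dots> = sc (1 - a) (\<rho> s) + sc (1 - a) (sc (int p) (sc (int p) w))"
   by (rule ext) (simp only: plus_fun_apply distrib_left power2_eq_square of_nat_mult mult.assoc)
  also have "\<dots> : Sp"
   by (rule sc.subspace_add[OF Sp sc.subspace_scale[OF Sp \<rho>Sp[OF s(1)]] aW[OF W0_closed(4)[OF w(1)]]])
  finally show ?thesis by (rule SpE)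
 qed
 moreover have "coprime (1 - a) (int p)"
 proof (rule coprimeI)
  fix d assume "d dvd 1 - a" "d dvd int p"
  then have "d dvd (1 - a) + a" using a(1) dvd_add dvd_trans by blast
  then show "is_unit d" by simp
 qed
 moreover have "r : J"
 proof -
  have "delta \<one> - q (delta \<one>) : W0" by (intro W0_closed qW) auto
  then show ?thesis unfolding r_def \<rho>_def
   by (rule sub_closed(1)[OF sJ q(2)[OF W0_closed(6)[OF one_closed]] subsetD[OF pJ pmult_W0]])
 qed
 ultimately show ?thesis by blast
qed

end

section \<open>Modules generated under a finite group\<close>

lemma finprod_hom:
 assumes "comm_group G" "comm_group H" "h : hom G H" "f : A \<rightarrow> carrier G"
 shows "h (finprod G f A) = finprod H (%i. h (f i)) A"
proof -
 interpret G: comm_group G by fact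
 interpret H: comm_group H by fact
 interpret h: group_hom G H h using assms(3) by unfold_locales
 show ?thesis using assms(4)
  by (induction A rule: infinite_finite_induct) (auto simp: Pi_iff G.finprod_closed)
qed

lemma (in comm_group) finprod_int_pow:
 fixes k :: int
 assumes "f : A \<rightarrow> carrier G"
 shows "finprod G (%i. f i [^] k) A = finprod G f A [^] k"
 using assms
 by (induction A rule: infinite_finite_induct) (auto simp: Pi_iff int_pow_distrib finprod_closed)

lemma (in comm_group) finprod_subgroup:
 assumes "subgroup H G" "f : A \<rightarrow> H"
 shows "finprod G f A : H"
proof -
 have H: "H \<subseteq> carrier G" using assms(1) by (rule subgroup.subset)
 show ?thesis using assms(2)
 proof (induction A rule: infinite_finite_induct)
  case (insert i A)
  then have "finprod G f (insert i A) = f i \<otimes> finprod G f A" using H by (intro finprod_insert) auto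
  then show ?case using insert subgroup.m_closed[OF assms(1)] by auto
 qed (use subgroup.one_closed[OF assms(1)] in auto)
qed

locale group_act = Gam: group Ga + group M
 for Ga :: "('g, 'z) monoid_scheme" and M :: "('a, 'g, 'm) act_group_scheme" (structure) +
 assumes act_hom: "ga : carrier Ga ==> act M ga : hom M M"
  and act_mult: "ga : carrier Ga ==> de : carrier Ga ==> x : carrier M ==>
   act M (ga \<otimes>\<^bsub>Ga\<^esub> de) x = act M ga (act M de x)"
  and act_one: "x : carrier M ==> act M \<one>\<^bsub>Ga\<^esub> x = x"
begin

lemma act_closed [simp]: "ga : carrier Ga ==> x : carrier M ==> act M ga x : carrier M"
 using act_hom by (auto simp: hom_def)

lemma act_group_hom: "ga : carrier Ga ==> group_hom M M (act M ga)"
 using act_hom by (simp add: group_hom_def group_hom_axioms_def)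

lemma act_id [simp]: "ga : carrier Ga ==> act M ga \<one> = \<one>"
 by (rule group_hom.hom_one[OF act_group_hom])

lemma act_inv: "ga : carrier Ga ==> x : carrier M ==> act M ga (inv x) = inv (act M ga x)"
 by (rule group_hom.hom_inv[OF act_group_hom])

lemma act_m: "ga : carrier Ga ==> x : carrier M ==> y : carrier M ==> act M ga (x \<otimes> y) = act M ga x \<otimes> act M ga y"
 by (rule hom_mult[OF act_hom])

lemma act_pow: "ga : carrier Ga ==> x : carrier M ==> act M ga (x [^] (k::int)) = act M ga x [^] k"
 by (rule group_hom.hom_int_pow[OF act_group_hom])

end

section \<open>Formal relations in powers of the group ring\<close>

context fin_group begin

text \<open>The submodule of the \<open>n\<close>-th power of the integral group ring generated by
  the relations \<open>r\<close> and by the multiples of the norm element, that is, the vectors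
  constant in the group variable. It is inductive because it will be mapped both to
  \<open>B_module\<close> and to a profinite group by checking the four rules. Through
  \<open>spn_const\<close> the values outside the index range become irrelevant.\<close>

inductive_set spn :: "nat => (nat => nat => 'g => int) => (nat => 'g => int) set" for n r where
 spn_const: "(!!i ga. i : {1..n} ==> ga : carrier Ga ==> d i ga = c i) ==> d : spn n r"
| spn_base: "i : {1..n} ==> r i : spn n r"
| spn_diff: "d : spn n r ==> d' : spn n r ==> (%i ga. d i ga - d' i ga) : spn n r"
| spn_shift: "ga : carrier Ga ==> d : spn n r ==> (%i. sh ga (d i)) : spn n r"

lemma spn_zero: "(%i ga. 0) : spn n r"
 by (rule spn_const[where c = "%_. 0"]) simp

lemma spn_cong:
 assumes "d : spn n r" "!!i ga. i : {1..n} ==> ga : carrier Ga ==> d' i ga = d i ga"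
 shows "d' : spn n r"
proof -
 have "(%i ga. d i ga - d' i ga) : spn n r" by (rule spn_const[where c = "%_. 0"]) (simp add: assms(2))
 from spn_diff[OF assms(1) this] show ?thesis by simp
qed

lemma spn_add:
 assumes "d : spn n r" "d' : spn n r"
 shows "(%i ga. d i ga + d' i ga) : spn n r"
 using spn_diff[OF assms(1) spn_diff[OF spn_zero assms(2)]] by simp

lemma spn_scale:
 assumes "d : spn n r"
 shows "(%i ga. k * d i ga) : spn n r"
proof -
 have n: "(%i ga. int m * d i ga) : spn n r" for m
 proof (induction m)
  case 0
  then show ?case using spn_zero by simp
 next
  case (Suc m)
  from spn_add[OF assms this] show ?case by (simp add: algebra_simps)
 qed
 show ?thesis
 proof (cases "k \<ge> 0")
  case True
  then show ?thesis using n[of "nat k"] by simp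
 next
  case False
  then show ?thesis using spn_diff[OF spn_zero n[of "nat (- k)"]] by simp
 qed
qed

lemma spn_sum:
 assumes "!!j. j : A ==> f j : spn n r"
 shows "(%i ga. \<Sum>j\<in>A. f j i ga) : spn n r"
 using assms
proof (induction A rule: infinite_finite_induct)
 case (insert j A)
 have "(%i ga. f j i ga + (\<Sum>j\<in>A. f j i ga)) : spn n r"
  using insert by (intro spn_add) auto
 then show ?case using insert by simp
qed (simp_all add: spn_zero)

lemma conv_apply: "conv c f de = (\<Sum>ga\<in>carrier Ga. c ga * sh ga f de)"
 by (simp add: conv_def sum_apply)

lemma spn_conv: "d : spn n r ==> (%j. conv c (d j)) : spn n r"
 unfolding conv_apply[abs_def] by (intro spn_sum spn_scale spn_shift)

lemma spn_Suc:
 assumes "d : spn n r" and "!!i j ga. i : {1..n} ==> ga : carrier Ga ==> r' i j ga = (if j = Suc n then 0 else r i j ga)"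
 shows "(%j ga. if j = Suc n then 0 else d j ga) : spn (Suc n) r'"
 using assms(1)
proof induction
 case (spn_const d c)
 show ?case by (rule spn.spn_const[where c = "%j. if j = Suc n then 0 else c j"]) (auto simp: spn_const)
next
 case (spn_base i)
 have "r' i : spn (Suc n) r'" using spn_base by (intro spn.spn_base) auto
 then show ?case by (rule spn_cong) (use spn_base in \<open>simp add: assms(2)\<close>)
next
 case (spn_diff d d')
 show ?case by (rule spn_cong[OF spn.spn_diff[OF spn_diff.IH]]) auto
next
 case (spn_shift ga d)
 show ?case by (rule spn_cong[OF spn.spn_shift[OF spn_shift(1) spn_shift.IH]]) (auto simp: sh_def)
qed

end

section \<open>Evaluation of group ring vectors in a module\<close>

locale mod_act = group_act Ga M + comm_group M + Gam: fin_group Ga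
 for Ga :: "('g, 'z) monoid_scheme" and M :: "('a, 'g, 'm) act_group_scheme" (structure)
begin

text \<open>Module notation written multiplicatively: \<open>ev1 x b\<close> is the group ring
  element \<open>b\<close> applied to \<open>x\<close>, and \<open>ev n x\<close> is the
  homomorphism from the \<open>n\<close>-th power of the group ring that sends the basis to
  \<open>x\<close>.\<close>

definition ev1 :: "'a => ('g => int) => 'a" where
 "ev1 x b = finprod M (%ga. act M ga x [^] b ga) (carrier Ga)"

definition ev :: "nat => (nat => 'a) => (nat => 'g => int) => 'a" where
 "ev n x d = finprod M (%i. ev1 (x i) (d i)) {1..n}"

lemma ev1_closed [simp]: "x : carrier M ==> ev1 x b : carrier M"
 unfolding ev1_def by (rule finprod_closed) auto

lemma ev1_add: "x : carrier M ==> ev1 x (%ga. b ga + c ga) = ev1 x b \<otimes> ev1 x c"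
 unfolding ev1_def
 by (rule trans[OF _ finprod_multf], rule finprod_cong) (auto simp: int_pow_mult Pi_iff simp_implies_def)

lemma ev1_scale: "x : carrier M ==> ev1 x (%ga. k * b ga) = ev1 x b [^] k"
 unfolding ev1_def by (subst finprod_int_pow[symmetric]) (auto simp: int_pow_pow Pi_iff mult.commute intro!: finprod_cong)

lemma ev1_cong: "x : carrier M ==> (!!ga. ga : carrier Ga ==> b ga = c ga) ==> ev1 x b = ev1 x c"
 unfolding ev1_def by (rule finprod_cong) (auto simp: simp_implies_def)

lemma ev1_sh:
 assumes "x : carrier M" "ga : carrier Ga"
 shows "ev1 x (Gam.sh ga b) = act M ga (ev1 x b)"
proof -
 have bij: "bij_betw (%de. ga \<otimes>\<^bsub>Ga\<^esub> de) (carrier Ga) (carrier Ga)"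
  by (rule bij_betwI[where g = "%de. inv\<^bsub>Ga\<^esub> ga \<otimes>\<^bsub>Ga\<^esub> de"])
   (use assms in \<open>auto simp: Gam.m_assoc[symmetric]\<close>)
 have "ev1 x (Gam.sh ga b) = finprod M (%de. act M de x [^] Gam.sh ga b de) ((%de. ga \<otimes>\<^bsub>Ga\<^esub> de) ` carrier Ga)"
  using bij by (simp add: ev1_def bij_betw_def)
 also have "\<dots> = finprod M (%de. act M (ga \<otimes>\<^bsub>Ga\<^esub> de) x [^] Gam.sh ga b (ga \<otimes>\<^bsub>Ga\<^esub> de)) (carrier Ga)"
  by (rule finprod_reindex) (use bij assms in \<open>auto simp: bij_betw_def\<close>)
 also have "\<dots> = finprod M (%de. act M ga (act M de x [^] b de)) (carrier Ga)"
  by (rule finprod_cong)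
   (use assms in \<open>auto simp: Gam.sh_def act_mult act_pow simp_implies_def Gam.m_assoc[symmetric]\<close>)
 also have "\<dots> = act M ga (ev1 x b)" unfolding ev1_def
  by (rule finprod_hom[symmetric, OF comm_group_axioms comm_group_axioms act_hom]) (use assms in auto)
 finally show ?thesis .
qed

lemma ev1_delta:
 assumes "x : carrier M" "ga : carrier Ga"
 shows "ev1 x (Gam.delta ga) = act M ga x"
proof -
 have "ev1 x (Gam.delta ga) = finprod M (%de. if ga = de then act M de x else \<one>) (carrier Ga)"
  unfolding ev1_def Gam.delta_def by (rule finprod_cong) (use assms in \<open>auto simp: simp_implies_def\<close>)
 also have "\<dots> = act M ga x"
  by (rule finprod_singleton) (use assms Gam.fin in auto)
 finally show ?thesis .
qed

lemma ev1_arg: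
 assumes "x : carrier M"
 shows "ev1 (x [^] (k::int)) b = ev1 x b [^] k"
 unfolding ev1_def
 by (subst finprod_int_pow[symmetric])
  (use assms in \<open>auto simp: int_pow_pow Pi_iff act_pow mult.commute intro!: finprod_cong\<close>)

context
 fixes n :: nat and x :: "nat => 'a"
 assumes x: "x : {1..n} \<rightarrow> carrier M"
begin

lemma xi: "i : {1..n} ==> x i : carrier M" using x by blast

lemma ev_closed [simp]: "ev n x d : carrier M"
 unfolding ev_def by (rule finprod_closed) (use xi in auto)

lemma ev_add: "ev n x (%i ga. d i ga + d' i ga) = ev n x d \<otimes> ev n x d'"
 unfolding ev_def
 by (rule trans[OF _ finprod_multf], rule finprod_cong) (use x in \<open>auto simp: ev1_add Pi_iff simp_implies_def\<close>)

lemma ev_scale: "ev n x (%i ga. k * d i ga) = ev n x d [^] k"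
 unfolding ev_def by (subst finprod_int_pow[symmetric]) (use x in \<open>auto simp: ev1_scale Pi_iff intro!: finprod_cong\<close>)

lemma ev_cong:
 "(!!i ga. i : {1..n} ==> ga : carrier Ga ==> d i ga = d' i ga) ==> ev n x d = ev n x d'"
 unfolding ev_def by (rule finprod_cong) (use x in \<open>auto simp: simp_implies_def Pi_iff intro!: ev1_cong\<close>)

lemma ev_diff: "ev n x (%i ga. d i ga - d' i ga) = ev n x d \<otimes> inv (ev n x d')"
 using ev_add[of d "%i ga. (-1) * d' i ga"] ev_scale[of "-1" d'] by (simp add: int_pow_neg)

lemma ev_sh: "ga : carrier Ga ==> ev n x (%i. Gam.sh ga (d i)) = act M ga (ev n x d)"
 unfolding ev_def
 by (subst finprod_hom[OF comm_group_axioms comm_group_axioms act_hom])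
  (use x in \<open>auto simp: ev1_sh Pi_iff intro!: finprod_cong\<close>)

lemma ev_zero: "(!!i ga. i : {1..n} ==> ga : carrier Ga ==> d i ga = 0) ==> ev n x d = \<one>"
 using ev_cong[of d "%i ga. 0 * d i ga"] ev_scale[of 0 d] by simp

lemma ev_single:
 assumes "i : {1..n}"
 shows "ev n x (%j. if j = i then b else (%_. 0)) = ev1 (x i) b"
proof -
 have "ev n x (%j. if j = i then b else (%_. 0)) = finprod M (%j. if i = j then ev1 (x j) b else \<one>) {1..n}"
  unfolding ev_def by (rule finprod_cong) (use x assms in \<open>auto simp: simp_implies_def ev1_def Pi_iff\<close>)
 also have "\<dots> = ev1 (x i) b"
  by (rule finprod_singleton) (use xi assms in auto)
 finally show ?thesis .
qed

lemma ev_sum: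
 assumes "finite A"
 shows "ev n x (%i ga. \<Sum>j\<in>A. f j i ga) = finprod M (%j. ev n x (f j)) A"
 using assms by (induction A rule: finite_induct) (simp_all add: ev_zero ev_add)

end

lemma ev_Suc:
 assumes "x : {1..n} \<rightarrow> carrier M" "y : carrier M"
 shows "ev (Suc n) (x(Suc n := y)) d = ev1 y (d (Suc n)) \<otimes> ev n x d"
proof -
 have xi: "x i : carrier M" if "i : {1..n}" for i using assms(1) that by blast
 have "{1..Suc n} = insert (Suc n) {1..n}" by auto
 moreover have "finprod M (%i. ev1 ((x(Suc n := y)) i) (d i)) {1..n} = finprod M (%i. ev1 (x i) (d i)) {1..n}"
  by (rule finprod_cong) (use xi in \<open>auto simp: simp_implies_def\<close>)
 moreover have "finprod M (%i. ev1 ((x(Suc n := y)) i) (d i)) (insert (Suc n) {1..n}) =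
   ev1 ((x(Suc n := y)) (Suc n)) (d (Suc n)) \<otimes> finprod M (%i. ev1 ((x(Suc n := y)) i) (d i)) {1..n}"
  by (rule finprod_insert) (use xi assms(2) in auto)
 ultimately show ?thesis unfolding ev_def by simp
qed

end

section \<open>Presentations localised at sets of primes\<close>

locale norm_mod = mod_act Ga M
 for Ga :: "('g, 'z) monoid_scheme" and M :: "('a, 'g, 'm) act_group_scheme" (structure) +
 assumes norm_kills: "m : carrier M ==> ev1 m (%_. 1) = \<one>"
begin

lemma ev_const:
 assumes x: "x : {1..n} \<rightarrow> carrier M"
  and d: "!!i ga. i : {1..n} ==> ga : carrier Ga ==> d i ga = c i"
 shows "ev n x d = \<one>"
proof -
 have xi: "x i : carrier M" if "i : {1..n}" for i using x that by blast
 have "ev1 (x i) (d i) = \<one>" if i: "i : {1..n}" for i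
 proof -
  have "ev1 (x i) (d i) = ev1 (x i) (%ga. c i * 1)" by (rule ev1_cong) (use xi d i in auto)
  also have "\<dots> = ev1 (x i) (%_. 1) [^] c i" by (rule ev1_scale[OF xi[OF i]])
  finally show ?thesis using norm_kills[OF xi[OF i]] by simp
 qed
 then show ?thesis unfolding ev_def by (intro finprod_one_eqI) auto
qed

definition rng :: "nat => (nat => 'a) => 'a set" where "rng n x = range (ev n x)"

text \<open>After inverting the integers prime to \<open>P\<close>, the \<open>n\<close> elements
  \<open>r\<close> generate the kernel of \<open>ev n x\<close> modulo the norm. One denominator
  \<open>e\<close> serves the whole kernel and all primes of \<open>P\<close>, which matters when
  \<open>P\<close> is infinite.\<close>

definition presented :: "nat => (nat => 'a) => nat set => bool" where
 "presented n x P \<longleftrightarrow> (EX r e. (ALL i:{1..n}. ev n x (r i) = \<one>) \<and> (ALL p:P. \<not> int p dvd e) \<and>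
  (ALL d. ev n x d = \<one> --> (%i ga. e * d i ga) : Gam.spn n r))"

lemma rng_subgroup:
 assumes x: "x : {1..n} \<rightarrow> carrier M"
 shows "subgroup (rng n x) M"
proof (rule subgroupI)
 show "rng n x \<subseteq> carrier M" using ev_closed[OF x] by (auto simp: rng_def)
 show "rng n x ~= {}" by (simp add: rng_def)
 fix a assume "a : rng n x"
 then obtain d where d: "a = ev n x d" by (auto simp: rng_def)
 have "inv a = ev n x (%i ga. (-1) * d i ga)"
  using ev_scale[OF x, of "-1" d] ev_closed[OF x, of d] unfolding d by (simp add: int_pow_neg)
 then show "inv a : rng n x" by (simp add: rng_def)
 fix b assume "b : rng n x"
 then obtain d' where d': "b = ev n x d'" by (auto simp: rng_def)
 have "a \<otimes> b = ev n x (%i ga. d i ga + d' i ga)" unfolding d d' by (rule ev_add[OF x, symmetric])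
 then show "a \<otimes> b : rng n x" by (simp add: rng_def)
qed

lemma rng_act:
 assumes x: "x : {1..n} \<rightarrow> carrier M" and "ga : carrier Ga" "m : rng n x"
 shows "act M ga m : rng n x"
 using assms(2,3) ev_sh[OF x assms(2), symmetric] by (auto simp: rng_def)

text \<open>The annihilator of \<open>y\<close> modulo the earlier generators is, up to
  \<open>e1\<close>, the left ideal generated by \<open>s\<close>. Subtracting a multiple of the
  lift of \<open>s\<close> from \<open>e1\<close> times a given relation therefore removes its last
  coordinate, and a relation among the earlier generators remains. So one generator costs one
  relation.\<close>

lemma presented_Suc:
 assumes x: "x : {1..n} \<rightarrow> carrier M" and y: "y : carrier M"
  and P: "presented n x P" and prime: "!!p. p : P ==> Factorial_Ring.prime p"
  and s: "ev1 y s : rng n x" and e1: "!!p. p : P ==> \<not> int p dvd e1"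
  and cs: "!!b. b : Gam.W0 ==> ev1 y b : rng n x ==>
   EX c. ALL ga:carrier Ga. e1 * b ga = Gam.conv c s ga"
 shows "presented (Suc n) (x(Suc n := y)) P"
proof -
 let ?x = "x(Suc n := y)"
 obtain r e where r: "!!i. i : {1..n} ==> ev n x (r i) = \<one>" and e: "!!p. p : P ==> \<not> int p dvd e"
  and sp: "!!d. ev n x d = \<one> ==> (%i ga. e * d i ga) : Gam.spn n r"
  using P unfolding presented_def by blast
 obtain c0 where c0: "ev1 y s = ev n x c0" using s by (auto simp: rng_def)
 \<comment> \<open>The new relation says that \<open>s\<close> applied to \<open>y\<close> equals
   \<open>c0\<close> evaluated at the old generators; the old relations get the last coordinate
   \<open>0\<close>.\<close>
 define r' where "r' i = (if i = Suc n then (%j ga. if j = Suc n then s ga else - c0 j ga)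
  else (%j ga. if j = Suc n then 0 else r i j ga))" for i
 have x': "?x : {1..Suc n} \<rightarrow> carrier M" using x y by (auto simp: Pi_iff)
 note evS = ev_Suc[OF x y]
 have ev10: "ev1 y (%ga. 0) = \<one>" using ev1_scale[OF y, of 0 "%_. 0"] y by simp
 have r': "ev (Suc n) ?x (r' i) = \<one>" if i: "i : {1..Suc n}" for i
 proof (cases "i = Suc n")
  case True
  have "ev n x (r' i) = ev n x (%j ga. (-1) * c0 j ga)" by (rule ev_cong[OF x]) (auto simp: r'_def True)
  also have "\<dots> = inv (ev1 y s)" using ev_scale[OF x, of "-1" c0] y by (simp add: c0[symmetric] int_pow_neg)
  finally show ?thesis using y unfolding evS by (simp add: r'_def True)
 next
  case False
  have "ev n x (r' i) = ev n x (r i)" by (rule ev_cong[OF x]) (auto simp: r'_def False)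
  then show ?thesis unfolding evS using r[of i] i False by (simp add: r'_def ev10)
 qed
 have "(%i ga. (e * e1) * d i ga) : Gam.spn (Suc n) r'" if d: "ev (Suc n) ?x d = \<one>" for d
 proof -
  define b where "b ga = (if ga : carrier Ga then d (Suc n) ga else 0)" for ga
  have bW: "b : Gam.W0" by (simp add: b_def Gam.W0_def)
  have "ev1 y b = ev1 y (d (Suc n))" by (rule ev1_cong) (auto simp: b_def y)
  moreover have "ev1 y (d (Suc n)) = inv (ev n x d)"
   using d y ev_closed[OF x, of d] unfolding evS by (metis ev1_closed inv_equality)
  moreover have "inv (ev n x d) : rng n x" using rng_subgroup[OF x] by (rule subgroup.m_inv_closed) (simp add: rng_def)
  ultimately obtain c where c: "!!ga. ga : carrier Ga ==> e1 * b ga = Gam.conv c s ga" using cs[OF bW] by auto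
  have R: "(%j. Gam.conv c (r' (Suc n) j)) : Gam.spn (Suc n) r'" by (intro Gam.spn_conv Gam.spn_base) auto
  have "ev (Suc n) ?x (%j. Gam.conv c (r' (Suc n) j)) = \<one>"
  proof -
   have "ev (Suc n) ?x (%j. Gam.conv c (r' (Suc n) j)) =
     finprod M (%ga. ev (Suc n) ?x (%j de. c ga * Gam.sh ga (r' (Suc n) j) de)) (carrier Ga)"
    unfolding Gam.conv_apply[abs_def] by (rule ev_sum[OF x' Gam.fin])
   also have "\<dots> = \<one>"
    by (rule finprod_one_eqI) (use r'[of "Suc n"] in \<open>simp add: ev_scale[OF x'] ev_sh[OF x']\<close>)
   finally show ?thesis .
  qed
  moreover define d1 where "d1 j ga = e1 * d j ga - Gam.conv c (r' (Suc n) j) ga" for j ga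
  ultimately have "ev (Suc n) ?x d1 = \<one>"
   unfolding d1_def ev_diff[OF x'] using d by (simp add: ev_scale[OF x'])
  moreover have "ev1 y (d1 (Suc n)) = \<one>"
  proof -
   have "ev1 y (d1 (Suc n)) = ev1 y (%_. 0)"
    by (rule ev1_cong[OF y]) (use c in \<open>simp add: d1_def r'_def b_def\<close>)
   then show ?thesis using ev10 by simp
  qed
  ultimately have "ev n x d1 = \<one>" unfolding evS using ev_closed[OF x] by simp
  from Gam.spn_Suc[OF sp[OF this], of r'] have
   "(%j ga. if j = Suc n then 0 else e * d1 j ga) : Gam.spn (Suc n) r'" by (simp add: r'_def)
  from Gam.spn_add[OF this Gam.spn_scale[OF R, of e]] show ?thesis
  proof (rule Gam.spn_cong)
   fix i ga assume "ga : carrier Ga"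
   moreover have "Gam.conv c (r' (Suc n) (Suc n)) ga = e1 * d (Suc n) ga" if "ga : carrier Ga"
    using c[OF that] that by (simp add: b_def r'_def)
   ultimately show "e * e1 * d i ga = (if i = Suc n then 0 else e * d1 i ga) + e * Gam.conv c (r' (Suc n) i) ga"
    by (simp add: d1_def algebra_simps)
  qed
 qed
 moreover have "\<not> int p dvd e * e1" if "p : P" for p
  using e[OF that] e1[OF that] prime[OF that] by (simp add: prime_dvd_mult_iff)
 ultimately show ?thesis unfolding presented_def using r' by blast
qed

lemma rng_Suc:
 assumes x: "x : {1..n} \<rightarrow> carrier M" and y: "y : carrier M"
 shows "rng n x \<subseteq> rng (Suc n) (x(Suc n := y))" "y : rng (Suc n) (x(Suc n := y))"
proof -
 have ev10: "ev1 y (%ga. 0) = \<one>" using ev1_scale[OF y, of 0 "%_. 0"] y by simp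
 show "rng n x \<subseteq> rng (Suc n) (x(Suc n := y))"
 proof
  fix m assume "m : rng n x"
  then obtain d where d: "m = ev n x d" by (auto simp: rng_def)
  have "ev n x (%j. if j = Suc n then (%_. 0) else d j) = m" unfolding d by (rule ev_cong[OF x]) auto
  then have "m = ev (Suc n) (x(Suc n := y)) (%j. if j = Suc n then (%_. 0) else d j)"
   unfolding ev_Suc[OF x y] using ev10 ev_closed[OF x] d by simp
  then show "m : rng (Suc n) (x(Suc n := y))" by (simp add: rng_def)
 qed
 have "ev (Suc n) (x(Suc n := y)) (%j. if j = Suc n then Gam.delta \<one>\<^bsub>Ga\<^esub> else (%_. 0)) = y"
  unfolding ev_Suc[OF x y] using y ev_zero[OF x, of "%j. if j = Suc n then Gam.delta \<one>\<^bsub>Ga\<^esub> else (%_. 0)"]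
  by (simp add: ev1_delta act_one)
 then show "y : rng (Suc n) (x(Suc n := y))" unfolding rng_def by (metis rangeI)
qed

text \<open>For \<open>p\<close> outside \<open>P\<close> the number \<open>p\<close> itself may
  serve as denominator, and \<open>p\<close> times \<open>y\<close> gives the relation. For
  \<open>P = {p}\<close> the annihilator of \<open>y\<close> modulo the earlier generators is a left
  ideal containing \<open>p\<close>, to which \<open>cyclic_relation\<close> applies.\<close>

lemma presented_extend:
 assumes x: "x : {1..n} \<rightarrow> carrier M" and y: "y : carrier M"
  and P: "presented n x P" and prime: "!!q. q : P ==> Factorial_Ring.prime q"
  and p: "Factorial_Ring.prime p" "\<not> p dvd card (carrier Ga)" "p : P ==> P = {p}"
  and yp: "y [^] int p : rng n x"
 shows "presented (Suc n) (x(Suc n := y)) P"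
proof -
 interpret R: subgroup "rng n x" M by (rule rng_subgroup[OF x])
 have pb: "ev1 y (%ga. int p * b ga) : rng n x" for b
 proof -
  have "ev1 y (%ga. int p * b ga) = ev1 (y [^] int p) b" by (simp add: ev1_scale[OF y] ev1_arg[OF y])
  also have "\<dots> : rng n x" unfolding ev1_def
  proof (rule finprod_subgroup[OF rng_subgroup[OF x]])
   show "(%ga. act M ga (y [^] int p) [^] b ga) : carrier Ga \<rightarrow> rng n x"
    using rng_act[OF x _ yp] rng_subgroup[OF x] by (auto intro: subgroup_int_pow_closed)
  qed
  finally show ?thesis .
 qed
 show ?thesis
 proof (cases "p : P")
  case False
  show ?thesis
  proof (rule presented_Suc[OF x y P prime pb])
   show "\<not> int q dvd int p" if "q : P" for q using False p(1) prime[OF that] that by (metis int_dvd_int_iff primes_dvd_imp_eq)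
   fix b assume b: "b : Gam.W0"
   have "Gam.conv b (%ga. int p * Gam.delta \<one>\<^bsub>Ga\<^esub> ga) de = int p * b de" if "de : carrier Ga" for de
   proof -
    have "Gam.conv b (%ga. int p * Gam.delta \<one>\<^bsub>Ga\<^esub> ga) de = (\<Sum>ga\<in>carrier Ga. int p * (b ga * Gam.delta ga de))"
     unfolding Gam.conv_apply by (rule sum.cong) (auto simp: Gam.sh_lin(3) Gam.sh_delta)
    also have "\<dots> = int p * b de" using fun_cong[OF Gam.W0_expand[OF b], of de]
     by (simp add: Gam.sum_apply sum_distrib_left)
    finally show ?thesis .
   qed
   then show "EX c. ALL ga:carrier Ga. int p * b ga = Gam.conv c (%ga. int p * Gam.delta \<one>\<^bsub>Ga\<^esub> ga) ga" by metis
  qed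
 next
  case True
  then have Pp: "P = {p}" by (rule p(3))
  define J where "J = {b : Gam.W0. ev1 y b : rng n x}"
  have d: "ev1 y (b - c) = ev1 y b \<otimes> inv (ev1 y c)" for b c
  proof -
   have "ev1 y (b - c) = ev1 y (%ga. b ga + (-1) * c ga)" by (rule ev1_cong[OF y]) simp
   also have "\<dots> = ev1 y b \<otimes> inv (ev1 y c)" unfolding ev1_add[OF y] ev1_scale[OF y] using y by (simp add: int_pow_neg)
   finally show ?thesis .
  qed
  have "ev1 y 0 = \<one>" using ev1_scale[OF y, of 0 "%_. 0"] y by (simp add: zero_fun_def)
  then have "0 : J" unfolding J_def using Gam.W0_closed(1) R.one_closed by simp
  then have "Gam.stable_sub J" unfolding Gam.stable_sub_def Gam.sub_def
  proof (intro conjI ballI)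
   fix b c assume "b : J" "c : J"
   then show "b - c : J" unfolding J_def by (intro CollectI conjI Gam.W0_closed(2)) (auto simp: d)
  next
   fix ga b assume "ga : carrier Ga" "b : J"
   then show "Gam.sh ga b : J" unfolding J_def by (auto simp: ev1_sh[OF y] rng_act[OF x])
  qed
  moreover have "J \<subseteq> Gam.W0" unfolding J_def by blast
  moreover have "Gam.pmult p \<subseteq> J" unfolding J_def Gam.pmult_def using pb by auto
  ultimately have "EX r:J. EX e. coprime e (int p) \<and> (ALL b:J. EX c:Gam.W0. (%de. e * b de) = Gam.conv c r)"
   by (rule Gam.cyclic_relation[OF _ _ _ p(1,2)])
  then obtain r where r1: "r : J"
   and ex: "EX e. coprime e (int p) \<and> (ALL b:J. EX c:Gam.W0. (%de. e * b de) = Gam.conv c r)" ..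
  from ex obtain e where e: "coprime e (int p) \<and> (ALL b:J. EX c:Gam.W0. (%de. e * b de) = Gam.conv c r)" ..
  note r = r1 conjunct1[OF e] bspec[OF conjunct2[OF e]]
  show ?thesis
  proof (rule presented_Suc[OF x y P prime, where s = r and ?e1.0 = e])
   show "ev1 y r : rng n x" using r(1) by (simp add: J_def)
   show "\<not> int q dvd e" if "q : P" for q
    using that r(2) p(1) unfolding Pp by (auto dest: coprime_common_divisor)
   fix b assume "b : Gam.W0" "ev1 y b : rng n x"
   then have "b : J" by (simp add: J_def)
   from r(3)[OF this] obtain c where c: "(%de. e * b de) = Gam.conv c r" ..
   show "EX c. ALL ga:carrier Ga. e * b ga = Gam.conv c r ga"
    by (intro exI[of _ c] ballI) (rule fun_cong[OF c])
  qed
 qed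
qed

text \<open>A neutral generator together with the relation that it is trivial lets \<open>n\<close>
  grow, as presentations are wanted for all large \<open>n\<close>.\<close>

lemma presented_trivial:
 assumes x: "x : {1..n} \<rightarrow> carrier M" and P: "presented n x P"
  and prime: "!!q. q : P ==> Factorial_Ring.prime q"
 shows "presented (Suc n) (x(Suc n := \<one>)) P"
proof (rule presented_Suc[OF x one_closed P prime, where s = "Gam.delta \<one>\<^bsub>Ga\<^esub>" and ?e1.0 = 1])
 show "ev1 \<one> (Gam.delta \<one>\<^bsub>Ga\<^esub>) : rng n x"
  using rng_subgroup[OF x] by (simp add: ev1_delta subgroup.one_closed)
 show "\<not> int q dvd 1" if "q : P" for q using prime[OF that] by (metis not_prime_unit of_nat_1 int_dvd_int_iff)
 fix b assume b: "b : Gam.W0"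
 have "Gam.conv b (Gam.delta \<one>\<^bsub>Ga\<^esub>) = b"
  unfolding Gam.conv_def
  by (rule trans[OF _ Gam.W0_expand[OF b, symmetric]], rule sum.cong) (simp_all add: Gam.sh_delta)
 then show "EX c. ALL ga:carrier Ga. 1 * b ga = Gam.conv c (Gam.delta \<one>\<^bsub>Ga\<^esub>) ga"
  by (intro exI[of _ b]) simp
qed

text \<open>The sets \<open>P\<close> are the singletons of primes dividing the order and arbitrary
  sets of other primes. Different \<open>P\<close> may need different relations, which are glued
  later; a single \<open>P\<close> has to cover the infinitely many primes not dividing the
  order.\<close>

definition good_presentation :: "nat => (nat => 'a) => bool" where
 "good_presentation n x \<longleftrightarrow> x : {1..n} \<rightarrow> carrier M \<and>
  (ALL P. (ALL p:P. Factorial_Ring.prime p \<and> (p dvd Coset.order M --> P = {p})) --> presented n x P)"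

text \<open>A good presentation whose generators span as much as possible spans everything.
  Otherwise take \<open>m\<close> outside the span and a prime \<open>p\<close> dividing the least
  positive \<open>k0\<close> with \<open>m [^] k0\<close> inside. Then
  \<open>m [^] (k0 div p)\<close> lies outside, its \<open>p\<close>-th power lies inside, and
  \<open>presented_extend\<close> enlarges the span.\<close>

theorem exists_presentation:
 assumes finM: "finite (carrier M)" and cop: "coprime (Coset.order M) (card (carrier Ga))"
 shows "EX n0. \<forall>n\<ge>n0. EX x. good_presentation n x \<and> rng n x = carrier M"
proof -
 have "good_presentation 0 x" for x
  unfolding good_presentation_def presented_def
 proof (intro conjI allI impI)
  fix P assume P: "ALL p:P. Factorial_Ring.prime p \<and> (p dvd Coset.order M --> P = {p})"
  have 1: "\<not> int p dvd 1" if "p : P" for p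
   using P that by (metis not_prime_unit of_nat_1 int_dvd_int_iff)
  \<comment> \<open>For \<open>n = 0\<close> the rule \<open>spn_const\<close> has no condition to
    meet, so \<open>spn\<close> is everything.\<close>
  have 2: "(%i ga. 1 * d i ga) : Gam.spn 0 r" for d r by (rule Gam.spn_const) simp
  show "EX r e. (ALL i:{1..0}. ev 0 x (r i) = \<one>) \<and> (ALL p:P. \<not> int p dvd e) \<and>
    (ALL d. ev 0 x d = \<one> --> (%i ga. e * d i ga) : Gam.spn 0 r)"
   by (rule exI[of _ undefined], rule exI[of _ 1]) (use 1 2 in simp)
 qed simp
 then have "EX k n x. good_presentation n x \<and> card (rng n x) = k" by blast
 moreover have bound: "card (rng n x) \<le> card (carrier M)" if "good_presentation n x" for n x
 proof -
  have "x : {1..n} \<rightarrow> carrier M" using that unfolding good_presentation_def ..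
  from subgroup.subset[OF rng_subgroup[OF this]] show ?thesis by (rule card_mono[OF finM])
 qed
 ultimately obtain k where k: "EX n x. good_presentation n x \<and> card (rng n x) = k"
  and kmax: "!!k'. EX n x. good_presentation n x \<and> card (rng n x) = k' ==> k' \<le> k"
  using Nat.ex_has_greatest_nat[of "%k. EX n x. good_presentation n x \<and> card (rng n x) = k" _ "card (carrier M)"] by metis
 from k obtain n x where g: "good_presentation n x" and kc: "card (rng n x) = k" by blast
 have x: "x : {1..n} \<rightarrow> carrier M" using g by (simp add: good_presentation_def)
 interpret R: subgroup "rng n x" M by (rule rng_subgroup[OF x])
 have full: "rng n x = carrier M"
 proof (rule ccontr)
  assume "rng n x ~= carrier M"
  then obtain m where m: "m : carrier M" "m \<notin> rng n x" using R.subset by blast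
  define K where "K = {k::nat. k > 0 \<and> m [^] k : rng n x}"
  have o0: "Coset.order M > 0" using finM by (simp add: order_gt_0_iff_finite)
  have oK: "Coset.order M : K" using pow_order_eq_1[OF m(1)] o0 by (simp add: K_def)
  define k0 where "k0 = (LEAST k. k : K)"
  have k0: "k0 : K" unfolding k0_def using oK by (rule LeastI)
  have least: "k0 \<le> l" if "l : K" for l unfolding k0_def using that by (rule Least_le)
  have "k0 ~= 1" using k0 m by (auto simp: K_def)
  then obtain p where p: "Factorial_Ring.prime p" "p dvd k0" using prime_factor_nat by blast
  have "k0 dvd Coset.order M"
  proof -
   have "m [^] (Coset.order M mod k0) : rng n x"
   proof -
    have "m [^] Coset.order M = (m [^] k0) [^] (Coset.order M div k0) \<otimes> m [^] (Coset.order M mod k0)"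
     using m(1) by (simp add: nat_pow_pow nat_pow_mult)
    then have "m [^] (Coset.order M mod k0) = inv ((m [^] k0) [^] (Coset.order M div k0))"
     using pow_order_eq_1[OF m(1)] m(1) by (metis inv_equality inv_comm nat_pow_closed m_comm)
    moreover have "(m [^] k0) [^] (Coset.order M div k0) : rng n x"
     using k0 subgroup_int_pow_closed[OF rng_subgroup[OF x], of "m [^] k0" "int (Coset.order M div k0)"]
     by (simp add: K_def int_pow_int)
    ultimately show ?thesis by simp
   qed
   moreover have "Coset.order M mod k0 < k0" using k0 by (simp add: K_def)
   ultimately have "Coset.order M mod k0 = 0" using least[of "Coset.order M mod k0"] by (force simp: K_def)
   then show ?thesis by (simp add: dvd_eq_mod_eq_0)
  qed
  then have po: "p dvd Coset.order M" using p(2) dvd_trans by blast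
  have pg: "\<not> p dvd card (carrier Ga)" using cop po p(1) by (metis coprime_common_divisor_nat not_prime_1)
  define y where "y = m [^] (k0 div p)"
  have y: "y : carrier M" by (simp add: y_def m)
  have yp: "y [^] int p : rng n x" using k0 p(2) m(1) by (simp add: y_def int_pow_int nat_pow_pow K_def)
  have ynot: "y \<notin> rng n x"
  proof
   assume "y : rng n x"
   moreover have "k0 div p > 0" using k0 p by (auto simp: K_def elim!: dvdE)
   ultimately have "k0 \<le> k0 div p" by (intro least) (simp add: K_def y_def)
   moreover have "k0 div p < k0" using k0 prime_gt_1_nat[OF p(1)] by (intro div_less_dividend) (auto simp: K_def)
   ultimately show False by simp
  qed
  have "good_presentation (Suc n) (x(Suc n := y))" unfolding good_presentation_def
  proof (intro conjI allI impI)
   show "x(Suc n := y) : {1..Suc n} \<rightarrow> carrier M" using x y by (auto simp: Pi_iff)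
   fix P assume P: "ALL p:P. Factorial_Ring.prime p \<and> (p dvd Coset.order M --> P = {p})"
   show "presented (Suc n) (x(Suc n := y)) P"
   proof (rule presented_extend[OF x y _ _ p(1) pg _ yp])
    show "presented n x P" using g P unfolding good_presentation_def by blast
    show "Factorial_Ring.prime q" if "q : P" for q using P that by blast
    show "p : P ==> P = {p}" using P po by blast
   qed
  qed
  moreover from this have "card (rng (Suc n) (x(Suc n := y))) > k"
  proof -
   have x': "x(Suc n := y) : {1..Suc n} \<rightarrow> carrier M" using x y by (auto simp: Pi_iff)
   have "rng n x \<subset> rng (Suc n) (x(Suc n := y))" using rng_Suc[OF x y] ynot by blast
   moreover have "finite (rng (Suc n) (x(Suc n := y)))"
    using subgroup.subset[OF rng_subgroup[OF x']] finM by (rule finite_subset)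
   ultimately show ?thesis unfolding kc[symmetric] by (intro psubset_card_mono)
  qed
  ultimately show False using kmax by (metis not_less)
 qed
 have "EX x. good_presentation m x \<and> rng m x = carrier M" if "m \<ge> n" for m
  using that
 proof (induction m rule: dec_induct)
  case base
  then show ?case using g full by blast
 next
  case (step m)
  then obtain z where z: "good_presentation m z" "rng m z = carrier M" by blast
  have zP: "z : {1..m} \<rightarrow> carrier M" using z by (simp add: good_presentation_def)
  have z': "z(Suc m := \<one>) : {1..Suc m} \<rightarrow> carrier M" using zP by (auto simp: Pi_iff)
  have "good_presentation (Suc m) (z(Suc m := \<one>))" unfolding good_presentation_def
  proof (intro conjI allI impI z')
   fix P assume P: "ALL p:P. Factorial_Ring.prime p \<and> (p dvd Coset.order M --> P = {p})"
   show "presented (Suc m) (z(Suc m := \<one>)) P"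
   proof (rule presented_trivial[OF zP])
    show "presented m z P" using z(1) P unfolding good_presentation_def by blast
    show "Factorial_Ring.prime q" if "q : P" for q using P that by blast
   qed
  qed
  moreover have "rng (Suc m) (z(Suc m := \<one>)) = carrier M"
   using rng_Suc(1)[OF zP one_closed] z(2) subgroup.subset[OF rng_subgroup[OF z']] by blast
  ultimately show ?case by blast
 qed
 then show ?thesis by blast
qed

end

section \<open>The ring of integers away from the bad primes\<close>

lemma int_dvd_by_prime_powers:
 assumes "E > 0" and *: "!!p k. Factorial_Ring.prime p ==> p ^ k dvd E ==> int (p ^ k) dvd c"
 shows "int E dvd c"
proof (cases "c = 0")
 case False
 have "E dvd nat \<bar>c\<bar>"
 proof (rule multiplicity_le_imp_dvd)
  show "E ~= 0" using assms by simp
  fix p :: nat assume p: "Factorial_Ring.prime p"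
  have "int (p ^ multiplicity p E) dvd c" by (rule *[OF p multiplicity_dvd])
  then have "p ^ multiplicity p E dvd nat \<bar>c\<bar>" by (metis int_dvd_int_iff dvd_abs_iff nat_0_le abs_ge_zero)
  then show "multiplicity p E \<le> multiplicity p (nat \<bar>c\<bar>)"
   using False p by (intro multiplicity_geI) auto
 qed
 then show ?thesis by (metis int_dvd_int_iff dvd_abs_iff nat_0_le abs_ge_zero)
qed simp

text \<open>The Chinese remainder theorem is applied to the full prime powers dividing
  \<open>E\<close> only; compatibility of the family gives the lower powers.\<close>

lemma int_crt:
 fixes E :: nat and c :: "nat => nat => int"
 assumes E: "E > 0" and c: "!!p k. Factorial_Ring.prime p ==> p dvd E ==> [c p (Suc k) = c p k] (mod int (p ^ k))"
 shows "EX a. ALL p k. Factorial_Ring.prime p --> p ^ k dvd E --> [a = c p k] (mod int (p ^ k))"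
proof -
 let ?A = "{p. Factorial_Ring.prime p \<and> p dvd E}" and ?m = "%p. p ^ multiplicity p E"
 have "finite ?A" using E by (intro finite_subset[OF _ finite_atMost[of E]]) (auto dest: dvd_imp_le)
 moreover have "ALL i:?A. ALL j:?A. i ~= j --> coprime (?m i) (?m j)"
  by (auto intro!: coprime_power_left_iff[THEN iffD2] primes_coprime)
 ultimately obtain a where a: "ALL i:?A. [a = nat (c i (multiplicity i E) mod int (?m i))] (mod ?m i)"
  using chinese_remainder_nat[of ?A ?m "%p. nat (c p (multiplicity p E) mod int (?m p))"] by blast
 have mono: "[c p (k + j) = c p k] (mod int (p ^ k))" if "Factorial_Ring.prime p" "p dvd E" for p k j
 proof (induction j)
  case (Suc j)
  have "[c p (Suc (k + j)) = c p (k + j)] (mod int (p ^ k))"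
   by (rule cong_dvd_modulus[OF c[OF that]]) (simp add: le_imp_power_dvd)
  then show ?case using Suc by (auto intro: cong_trans)
 qed simp
 show ?thesis
 proof (intro exI[of _ "int a"] allI impI)
  fix p k assume p: "Factorial_Ring.prime p" and pk: "p ^ k dvd E"
  show "[int a = c p k] (mod int (p ^ k))"
  proof (cases "k = 0")
   case False
   then have pE: "p dvd E" using pk by (metis dvd_power dvd_trans gr0I)
   have kv: "k \<le> multiplicity p E" using pk E p by (intro multiplicity_geI) auto
   have m0: "int (?m p) > 0" using p by (simp add: prime_gt_0_nat)
   have "[int a = int (nat (c p (multiplicity p E) mod int (?m p)))] (mod int (?m p))"
    using a p pE unfolding cong_int_iff by blast
   moreover have "int (nat (c p (multiplicity p E) mod int (?m p))) = c p (multiplicity p E) mod int (?m p)"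
    using m0 by (intro nat_0_le pos_mod_sign)
   ultimately have "[int a = c p (multiplicity p E)] (mod int (?m p))"
    unfolding cong_def by simp
   then have "[int a = c p (multiplicity p E)] (mod int (p ^ k))"
    by (rule cong_dvd_modulus) (use kv in \<open>simp add: le_imp_power_dvd\<close>)
   moreover have "[c p (multiplicity p E) = c p k] (mod int (p ^ k))"
    using mono[OF p pE, of k "multiplicity p E - k"] kv by simp
   ultimately show ?thesis by (rule cong_trans)
  qed simp
 qed
qed

section \<open>The product of the p-adic integers for the primes not dividing
  \<open>d\<close>\<close>

context
 fixes d :: nat
begin

definition idx :: "nat set" where "idx = {p. Factorial_Ring.prime p \<and> \<not> p dvd d}"

text \<open>The element with the integer \<open>c p\<close> at the prime \<open>p\<close>, possibly
  a different integer at each prime. This is what glues relations found prime by prime.\<close>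

definition emb :: "(nat => int) => nat => nat => int" where
 "emb c = (\<lambda>p\<in>idx. %k. c p mod int p ^ k)"

lemma idx_pos: "p : idx ==> int p ^ k > 0"
 by (simp add: idx_def prime_gt_0_nat)

lemma Z_carrier: "z : carrier (Z_ring d) \<longleftrightarrow>
  z : extensional idx \<and> (ALL p:idx. ALL k. z p k : {0..<int p ^ k} \<and> z p (Suc k) mod int p ^ k = z p k)"
 by (auto simp: Z_ring_def product_ring_def padic_int_ring_def PiE_iff idx_def)

lemma Z_simps:
 "p : idx ==> (a \<oplus>\<^bsub>Z_ring d\<^esub> b) p k = (a p k + b p k) mod int p ^ k"
 "p : idx ==> (a \<otimes>\<^bsub>Z_ring d\<^esub> b) p k = (a p k * b p k) mod int p ^ k"
 "p : idx ==> \<zero>\<^bsub>Z_ring d\<^esub> p k = 0"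
 "p : idx ==> \<one>\<^bsub>Z_ring d\<^esub> p k = 1 mod int p ^ k"
 by (auto simp: Z_ring_def product_ring_def padic_int_ring_def idx_def)

lemma Z_eqI:
 assumes "a : carrier (Z_ring d)" "b : carrier (Z_ring d)" "!!p k. p : idx ==> [a p k = b p k] (mod int p ^ k)"
 shows "a = b"
proof
 fix p
 show "a p = b p"
 proof (cases "p : idx")
  case True
  have "a p k = b p k" for k
   using assms(1,2) assms(3)[OF True, of k] True by (force simp: Z_carrier cong_def)
  then show ?thesis by blast
 next
  case False
  then show ?thesis using assms(1,2) by (simp add: Z_carrier extensional_def)
 qed
qed

interpretation Z: cring "Z_ring d" by (rule Z_ring_cring)

lemma emb_closed [simp]: "emb c : carrier (Z_ring d)"
 using idx_pos by (auto simp: Z_carrier emb_def mod_mod_cancel)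

lemma emb_add: "emb (%p. c p + c' p) = emb c \<oplus>\<^bsub>Z_ring d\<^esub> emb c'"
 by (rule Z_eqI[OF emb_closed Z.a_closed[OF emb_closed emb_closed]]) (auto simp: Z_simps cong_def emb_def mod_simps)

lemma emb_mult: "emb (%p. c p * c' p) = emb c \<otimes>\<^bsub>Z_ring d\<^esub> emb c'"
 by (rule Z_eqI[OF emb_closed Z.m_closed[OF emb_closed emb_closed]]) (auto simp: Z_simps cong_def emb_def mod_simps)

lemma emb_0: "emb (%p. 0) = \<zero>\<^bsub>Z_ring d\<^esub>"
 by (rule Z_eqI[OF emb_closed Z.zero_closed]) (auto simp: Z_simps cong_def emb_def)

text \<open>Inverses modulo \<open>p^k\<close> are unique, so those chosen at the different levels
  form a compatible system.\<close>

lemma emb_unit: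
 assumes c: "!!p. p : idx ==> \<not> int p dvd c p"
 shows "EX u:carrier (Z_ring d). u \<otimes>\<^bsub>Z_ring d\<^esub> emb c = \<one>\<^bsub>Z_ring d\<^esub>"
proof -
 have cp: "coprime (c p) (int p ^ k)" if "p : idx" for p k
 proof -
  have "coprime (int p) (c p)" using c[OF that] that by (auto simp: idx_def intro: prime_imp_coprime)
  then show ?thesis by (simp add: coprime_commute)
 qed
 have "EX u. [c p * u = 1] (mod int p ^ k)" if "p : idx" for p k using cp[OF that] by (rule cong_solve_coprime_int)
 then obtain u where u: "!!p k. p : idx ==> [c p * u p k = 1] (mod int p ^ k)" by metis
 define w where "w = (\<lambda>p\<in>idx. %k. u p k mod int p ^ k)"
 have "[u p (Suc k) = u p k] (mod int p ^ k)" if p: "p : idx" for p k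
 proof -
  have "[c p * u p (Suc k) = 1] (mod int p ^ k)"
   by (rule cong_dvd_modulus[OF u[OF p]]) simp
  then have "[c p * u p (Suc k) = c p * u p k] (mod int p ^ k)" using u[OF p] by (metis cong_sym cong_trans)
  then show ?thesis using cp[OF p] by (simp add: cong_mult_lcancel)
 qed
 then have w: "w : carrier (Z_ring d)"
  using idx_pos by (auto simp: Z_carrier w_def mod_mod_cancel cong_def)
 have "w \<otimes>\<^bsub>Z_ring d\<^esub> emb c = \<one>\<^bsub>Z_ring d\<^esub>"
 proof (rule Z_eqI)
  fix p k assume p: "p : idx"
  have "u p k * c p mod int p ^ k = 1 mod int p ^ k" using u[OF p, of k] by (simp add: cong_def mult.commute)
  then show "[(w \<otimes>\<^bsub>Z_ring d\<^esub> emb c) p k = \<one>\<^bsub>Z_ring d\<^esub> p k] (mod int p ^ k)"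
   using p by (simp add: Z_simps cong_def emb_def w_def mod_simps)
 qed (use w in auto)
 then show ?thesis using w by blast
qed

text \<open>Division by \<open>p ^ v p\<close> loses \<open>v p\<close> digits, so level
  \<open>k\<close> of the quotient is read off at level \<open>k + v p\<close> of
  \<open>z\<close>.\<close>

lemma Z_div:
 assumes z: "z : carrier (Z_ring d)" and 0: "!!p. p : idx ==> z p (v p) = 0"
 shows "EX w:carrier (Z_ring d). z = w \<otimes>\<^bsub>Z_ring d\<^esub> emb (%p. int p ^ v p)"
proof -
 define w where "w = (\<lambda>p\<in>idx. %k. z p (k + v p) div int p ^ v p)"
 have zm: "z p (k + j) mod int p ^ k = z p k" if "p : idx" for p k j
 proof (induction j)
  case 0
  then show ?case using z that by (simp add: Z_carrier)
 next
  case (Suc j)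
  have "z p (k + Suc j) mod int p ^ k = (z p (Suc (k + j)) mod int p ^ (k + j)) mod int p ^ k"
   by (simp add: mod_mod_cancel le_imp_power_dvd)
  then show ?case using z that Suc by (simp add: Z_carrier)
 qed
 have dv: "z p (k + v p) = int p ^ v p * (z p (k + v p) div int p ^ v p)" if "p : idx" for p k
  using zm[OF that, of "v p" k] 0[OF that] by (metis add.commute dvd_mult_div_cancel mod_0_imp_dvd)
 have wc: "w : carrier (Z_ring d)" unfolding Z_carrier
 proof (intro conjI ballI allI)
  fix p k assume p: "p : idx"
  have r: "0 \<le> z p (k + v p)" "z p (k + v p) < int p ^ (k + v p)" using z p by (auto simp: Z_carrier)
  show "w p k : {0..<int p ^ k}"
  proof -
   have "int p ^ v p * (z p (k + v p) div int p ^ v p) < int p ^ v p * int p ^ k"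
    using r(2) dv[OF p, of k] by (simp add: power_add mult.commute)
   then have "z p (k + v p) div int p ^ v p < int p ^ k" using idx_pos[OF p, of "v p"] by simp
   moreover have "0 \<le> z p (k + v p) div int p ^ v p"
    using r(1) idx_pos[OF p, of "v p"] by (simp add: pos_imp_zdiv_nonneg_iff)
   ultimately show ?thesis using p by (simp add: w_def)
  qed
  have "int p ^ v p * (w p (Suc k) mod int p ^ k) = z p (Suc k + v p) mod (int p ^ v p * int p ^ k)"
   using dv[OF p, of "Suc k"] p by (simp add: w_def mult_mod_right del: add_Suc)
  also have "\<dots> = z p (k + v p)"
   using z p by (simp add: Z_carrier power_add[symmetric] add.commute)
  also have "\<dots> = int p ^ v p * w p k" using dv[OF p, of k] p by (simp add: w_def)
  finally show "w p (Suc k) mod int p ^ k = w p k" using idx_pos[OF p, of 1] by simp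
 qed (simp add: w_def)
 moreover have "z = w \<otimes>\<^bsub>Z_ring d\<^esub> emb (%p. int p ^ v p)"
 proof (rule Z_eqI[OF z])
  fix p k assume p: "p : idx"
  have "z p k mod int p ^ k = z p (k + v p) mod int p ^ k" using zm[OF p, of k "v p"] zm[OF p, of k 0] by simp
  then show "[z p k = (w \<otimes>\<^bsub>Z_ring d\<^esub> emb (%p. int p ^ v p)) p k] (mod int p ^ k)"
   using p dv[OF p, of k] by (simp add: Z_simps cong_def emb_def w_def mod_simps mult.commute)
 qed (use wc in auto)
 ultimately show ?thesis by blast
qed

end

lemma equivariant_iso_quot:
 assumes B: "group_act Ga B" and M: "group_act Ga M" and h: "\<Phi> : hom B M" and surj: "\<Phi> ` carrier B = carrier M"
  and eq: "!!ga b. ga : carrier Ga ==> b : carrier B ==> \<Phi> (act B ga b) = act M ga (\<Phi> b)"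
  and N: "N = kernel B M \<Phi>"
 shows "equivariant_iso (carrier Ga) M (act_quot B N)"
proof -
 interpret B: group_act Ga B by fact
 interpret M: group_act Ga M by fact
 interpret h: group_hom B M \<Phi> using h by unfold_locales
 let ?h = "%Y. the_elem (\<Phi> ` Y)"
 have iso: "?h : iso (B Mod N) M" unfolding N by (rule h.FactGroup_iso_set[OF surj])
 have grp: "group (B Mod N)" unfolding N by (rule normal.factorgroup_is_group[OF h.normal_kernel])
 have sub: "subgroup N B" unfolding N by (rule h.subgroup_kernel)
 define g where "g = inv_into (carrier (B Mod N)) ?h"
 have g: "g : iso M (B Mod N)" unfolding g_def by (rule group.iso_set_sym[OF grp iso])
 have hval: "?h (N #>\<^bsub>B\<^esub> b) = \<Phi> b" if b: "b : carrier B" for b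
 proof -
  have "\<Phi> ` (N #>\<^bsub>B\<^esub> b) = {\<Phi> b}"
  proof
   show "\<Phi> ` (N #>\<^bsub>B\<^esub> b) \<subseteq> {\<Phi> b}" using b by (auto simp: r_coset_def N kernel_def)
   have "b : N #>\<^bsub>B\<^esub> b" using B.rcos_self[OF b sub] .
   then show "{\<Phi> b} \<subseteq> \<Phi> ` (N #>\<^bsub>B\<^esub> b)" by blast
  qed
  then show ?thesis by simp
 qed
 have coset: "act B ga ` (N #>\<^bsub>B\<^esub> b) = N #>\<^bsub>B\<^esub> act B ga b" if ga: "ga : carrier Ga" and b: "b : carrier B" for ga b
 proof
  show "act B ga ` (N #>\<^bsub>B\<^esub> b) \<subseteq> N #>\<^bsub>B\<^esub> act B ga b"
   using ga b by (auto simp: r_coset_def N kernel_def B.act_m eq intro!: exI[of _ "act B ga _"])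
  show "N #>\<^bsub>B\<^esub> act B ga b \<subseteq> act B ga ` (N #>\<^bsub>B\<^esub> b)"
  proof
   fix y assume "y : N #>\<^bsub>B\<^esub> act B ga b"
   then obtain k where k: "k : N" "y = k \<otimes>\<^bsub>B\<^esub> act B ga b" by (auto simp: r_coset_def)
   let ?k = "act B (inv\<^bsub>Ga\<^esub> ga) k"
   have kB: "k : carrier B" "\<Phi> k = \<one>\<^bsub>M\<^esub>" using k by (auto simp: N kernel_def)
   have "act B ga ?k = k" using kB(1) ga B.act_mult[of ga "inv\<^bsub>Ga\<^esub> ga" k] by (simp add: B.act_one)
   then have "y = act B ga (?k \<otimes>\<^bsub>B\<^esub> b)" using k kB ga b by (simp add: B.act_m)
   moreover have "?k : N" using kB ga by (simp add: N kernel_def eq)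
   then have "?k \<otimes>\<^bsub>B\<^esub> b : N #>\<^bsub>B\<^esub> b" by (auto simp: r_coset_def)
   ultimately show "y : act B ga ` (N #>\<^bsub>B\<^esub> b)" by blast
  qed
 qed
 have "g (act M ga m) = act B ga ` g m" if ga: "ga : carrier Ga" and m: "m : carrier M" for ga m
 proof -
  from m[folded surj] obtain b where b': "m = \<Phi> b" "b : carrier B" by (rule imageE)
  note b = b'(2) b'(1)[symmetric]
  have c: "N #>\<^bsub>B\<^esub> c : carrier (B Mod N)" if "c : carrier B" for c
   using that by (auto simp: FactGroup_def RCOSETS_def)
  have gi: "g (\<Phi> c) = N #>\<^bsub>B\<^esub> c" if "c : carrier B" for c
  proof -
   have "inj_on ?h (carrier (B Mod N))" using iso by (simp add: iso_def bij_betw_def)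
   from inv_into_f_f[OF this c[OF that]] show ?thesis unfolding g_def hval[OF that] .
  qed
  have "g (act M ga m) = g (\<Phi> (act B ga b))" using b ga by (simp add: eq)
  also have "\<dots> = act B ga ` (N #>\<^bsub>B\<^esub> b)" using ga b by (simp add: gi coset)
  finally show ?thesis using gi[OF b(1)] b(2) by simp
 qed
 moreover have "g : iso M (act_quot B N)"
  using g by (simp add: act_quot_def iso_def hom_def monoid.defs)
 ultimately show ?thesis
  unfolding equivariant_iso_def by (intro bexI[of _ g]) (auto simp: act_quot_def monoid.defs act_group.defs)
qed

section \<open>Coefficients reduced to integers modulo the order of the module\<close>

locale presentation = norm_mod Ga M
 for Ga :: "'g monoid" and M :: "('a, 'g, 'm) act_group_scheme" (structure) +
 fixes d n :: nat and x :: "nat => 'a"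
 assumes finM: "finite (carrier M)" and cop: "coprime (Coset.order M) d"
  and good: "good_presentation n x" and full: "rng n x = carrier M"
begin

definition E where "E = Coset.order M"

lemma E_pos: "E > 0" using finM by (simp add: E_def order_gt_0_iff_finite)

lemma xP: "x : {1..n} \<rightarrow> carrier M" using good by (simp add: good_presentation_def)

lemma idx_E: "Factorial_Ring.prime p ==> p dvd E ==> p : idx d"
 using cop by (auto simp: idx_def E_def dest: coprime_common_divisor_nat)

lemma pow_mod_E:
 assumes "m : carrier M" "int E dvd a - b"
 shows "m [^] a = m [^] b"
proof -
 obtain t where t: "a = b + int E * t" using assms(2) by (metis add.commute diff_add_cancel dvdE)
 have "m [^] (int E * t) = (m [^] int E) [^] t" using assms(1) by (simp add: int_pow_pow)
 also have "m [^] int E = \<one>" using pow_order_eq_1[OF assms(1)] by (simp add: E_def int_pow_int)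
 finally show ?thesis unfolding t using assms(1) by (simp add: int_pow_mult)
qed

lemma ev_mod_E:
 assumes "!!i ga. i : {1..n} ==> ga : carrier Ga ==> int E dvd f i ga - f' i ga"
 shows "ev n x f = ev n x f'"
proof -
 have "ev n x (%i ga. f i ga - f' i ga) = ev n x (%i ga. int E * ((f i ga - f' i ga) div int E))"
  by (rule ev_cong[OF xP]) (simp add: assms)
 also have "\<dots> = \<one>"
  unfolding ev_scale[OF xP] using pow_mod_E[OF ev_closed[OF xP], of "int E" 0] by simp
 finally show ?thesis using ev_closed[OF xP] unfolding ev_diff[OF xP] by (metis inv_closed inv_inv inv_equality)
qed

text \<open>An integer \<open>a\<close> that acts on a group of order \<open>E\<close> as the
  coefficient \<open>z\<close> should: the primes dividing \<open>E\<close> do not divide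
  \<open>d\<close>, so \<open>z\<close> has residues there. It is a relation rather than a function
  because \<open>a\<close> matters only modulo \<open>E\<close>.\<close>

definition red :: "(nat => nat => int) => int => bool" where
 "red z a \<longleftrightarrow> (ALL p k. Factorial_Ring.prime p --> p ^ k dvd E --> [a = z p k] (mod int (p ^ k)))"

lemma redI:
 assumes "!!p k. p : idx d ==> p ^ k dvd E ==> [a = z p k] (mod int p ^ k)"
 shows "red z a"
 unfolding red_def
proof (intro allI impI)
 fix p k assume p: "Factorial_Ring.prime p" "p ^ k dvd E"
 show "[a = z p k] (mod int (p ^ k))"
 proof (cases "k = 0")
  case False
  then have "p dvd E" using p(2) by (metis dvd_power dvd_trans gr0I)
  then show ?thesis using assms[OF idx_E[OF p(1)] p(2)] by simp
 qed simp
qed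

lemma red_D: "red z a ==> p : idx d ==> p ^ k dvd E ==> [a = z p k] (mod int p ^ k)"
 by (auto simp: red_def idx_def)

lemma red_ex: "z : carrier (Z_ring d) ==> EX a. red z a"
 unfolding red_def
 by (rule int_crt[OF E_pos]) (use idx_E in \<open>force simp: Z_carrier cong_def\<close>)

lemma red_unique:
 assumes "red z a" "red z b" shows "int E dvd a - b"
proof (rule int_dvd_by_prime_powers[OF E_pos])
 fix p k assume "Factorial_Ring.prime p" "p ^ k dvd E"
 then have "[a = b] (mod int (p ^ k))" using assms unfolding red_def by (metis cong_sym cong_trans)
 then show "int (p ^ k) dvd a - b" by (simp add: cong_iff_dvd_diff)
qed

lemma red_add: "red z a ==> red w b ==> red (z \<oplus>\<^bsub>Z_ring d\<^esub> w) (a + b)"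
 by (rule redI) (auto simp: Z_simps cong_def mod_simps dest!: red_D intro: mod_add_cong)

lemma red_mult: "red z a ==> red w b ==> red (z \<otimes>\<^bsub>Z_ring d\<^esub> w) (a * b)"
 by (rule redI) (auto simp: Z_simps cong_def mod_simps dest!: red_D intro: mod_mult_cong)

lemma red_zero: "red \<zero>\<^bsub>Z_ring d\<^esub> 0"
 by (rule redI) (auto simp: Z_simps)

lemma red_emb: "(!!p k. p : idx d ==> p ^ k dvd E ==> [a = c p] (mod int p ^ k)) ==> red (emb d c) a"
 by (rule redI) (auto simp: emb_def cong_def)

interpretation Z: cring "Z_ring d" by (rule Z_ring_cring)
interpretation RG: ring "group_ring (Z_ring d) Ga"
 by (rule group_ring_ring[OF Z.ring_axioms Gam.is_group Gam.fin])

abbreviation "Zr \<equiv> Z_ring d"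
abbreviation "RG \<equiv> group_ring (Z_ring d) Ga"
abbreviation "NI \<equiv> norm_ideal (Z_ring d) Ga"

definition mk :: "('g => 'c) => 'g => 'c" where "mk f = restrict f (carrier Ga)"

lemma RG_carrier: "carrier RG = (\<Pi>\<^sub>E ga\<in>carrier Ga. carrier Zr)" by (simp add: group_ring_def)

lemma mk_closed: "(!!ga. ga : carrier Ga ==> f ga : carrier Zr) ==> mk f : carrier RG"
 by (auto simp: RG_carrier mk_def)

lemma mk_self: "c : carrier RG ==> mk c = c"
 by (auto simp: RG_carrier mk_def PiE_def extensional_restrict)

lemma mk_cong: "(!!ga. ga : carrier Ga ==> f ga = g ga) ==> mk f = mk g"
 by (auto simp: mk_def)

lemma mk_add: "mk f \<oplus>\<^bsub>RG\<^esub> mk g = mk (%ga. f ga \<oplus>\<^bsub>Zr\<^esub> g ga)"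
 by (auto simp: group_ring_def mk_def)

lemma mk_mult: "c \<otimes>\<^bsub>RG\<^esub> mk f = mk (%ga. \<Oplus>\<^bsub>Zr\<^esub>de\<in>carrier Ga. c de \<otimes>\<^bsub>Zr\<^esub> mk f (inv\<^bsub>Ga\<^esub> de \<otimes>\<^bsub>Ga\<^esub> ga))"
 by (simp add: group_ring_def mk_def)

lemma delta_mult:
 assumes t: "t : carrier Zr" and ga: "ga : carrier Ga" and f: "!!ga. ga : carrier Ga ==> f ga : carrier Zr"
 shows "mk (%de. if de = ga then t else \<zero>\<^bsub>Zr\<^esub>) \<otimes>\<^bsub>RG\<^esub> mk f = mk (%de. t \<otimes>\<^bsub>Zr\<^esub> f (inv\<^bsub>Ga\<^esub> ga \<otimes>\<^bsub>Ga\<^esub> de))"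
 unfolding mk_mult
proof (rule mk_cong)
 fix be assume be: "be : carrier Ga"
 have "(\<Oplus>\<^bsub>Zr\<^esub>de\<in>carrier Ga. mk (%de. if de = ga then t else \<zero>\<^bsub>Zr\<^esub>) de \<otimes>\<^bsub>Zr\<^esub> mk f (inv\<^bsub>Ga\<^esub> de \<otimes>\<^bsub>Ga\<^esub> be)) =
  (\<Oplus>\<^bsub>Zr\<^esub>de\<in>carrier Ga. if ga = de then t \<otimes>\<^bsub>Zr\<^esub> f (inv\<^bsub>Ga\<^esub> de \<otimes>\<^bsub>Ga\<^esub> be) else \<zero>\<^bsub>Zr\<^esub>)"
  by (rule Z.finsum_cong') (use t f be in \<open>auto simp: mk_def\<close>)
 also have "\<dots> = t \<otimes>\<^bsub>Zr\<^esub> f (inv\<^bsub>Ga\<^esub> ga \<otimes>\<^bsub>Ga\<^esub> be)"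
  by (rule Z.finsum_singleton) (use t f be ga Gam.fin in auto)
 finally show "(\<Oplus>\<^bsub>Zr\<^esub>de\<in>carrier Ga. mk (%de. if de = ga then t else \<zero>\<^bsub>Zr\<^esub>) de \<otimes>\<^bsub>Zr\<^esub> mk f (inv\<^bsub>Ga\<^esub> de \<otimes>\<^bsub>Ga\<^esub> be)) =
  t \<otimes>\<^bsub>Zr\<^esub> f (inv\<^bsub>Ga\<^esub> ga \<otimes>\<^bsub>Ga\<^esub> be)" .
qed

lemma group_elem_mk: "group_elem Zr Ga ga = mk (%de. if de = ga then \<one>\<^bsub>Zr\<^esub> else \<zero>\<^bsub>Zr\<^esub>)"
 by (simp add: group_elem_def mk_def)

lemma RG_zero: "\<zero>\<^bsub>RG\<^esub> = mk (%_. \<zero>\<^bsub>Zr\<^esub>)"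
 by (simp add: group_ring_def mk_def)

lemma finsum_mk:
 assumes "finite A" "!!i ga. i : A ==> ga : carrier Ga ==> f i ga : carrier Zr"
 shows "(\<Oplus>\<^bsub>RG\<^esub>i\<in>A. mk (f i)) = mk (%ga. \<Oplus>\<^bsub>Zr\<^esub>i\<in>A. f i ga)"
 using assms
proof (induction A)
 case empty
 then show ?case by (simp add: RG_zero)
next
 case (insert a A)
 have "(\<Oplus>\<^bsub>RG\<^esub>i\<in>insert a A. mk (f i)) = mk (f a) \<oplus>\<^bsub>RG\<^esub> mk (%ga. \<Oplus>\<^bsub>Zr\<^esub>i\<in>A. f i ga)"
  using insert by (subst RG.finsum_insert) (auto intro!: mk_closed)
 also have "\<dots> = mk (%ga. \<Oplus>\<^bsub>Zr\<^esub>i\<in>insert a A. f i ga)"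
  unfolding mk_add by (rule mk_cong) (use insert in \<open>auto simp: Z.finsum_insert Pi_iff\<close>)
 finally show ?case .
qed

lemma norm_elem: "(\<Oplus>\<^bsub>RG\<^esub>ga\<in>carrier Ga. group_elem Zr Ga ga) = mk (%_. \<one>\<^bsub>Zr\<^esub>)"
 unfolding group_elem_mk
proof (subst finsum_mk[OF Gam.fin])
 show "mk (%ga. \<Oplus>\<^bsub>Zr\<^esub>i\<in>carrier Ga. if ga = i then \<one>\<^bsub>Zr\<^esub> else \<zero>\<^bsub>Zr\<^esub>) = mk (%_. \<one>\<^bsub>Zr\<^esub>)"
  by (rule mk_cong) (use Gam.fin Z.finsum_singleton[of _ "carrier Ga" "%_. \<one>\<^bsub>Zr\<^esub>"] in auto)
qed auto

lemma NI_ideal: "ideal NI RG"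
proof -
 have "mk (%_. \<one>\<^bsub>Zr\<^esub>) : carrier RG" by (rule mk_closed) simp
 then show ?thesis unfolding norm_ideal_def Let_def norm_elem by (intro RG.genideal_ideal) simp
qed

lemma const_in_NI: "t : carrier Zr ==> mk (%_. t) : NI"
proof -
 assume t: "t : carrier Zr"
 have "mk (%_. \<one>\<^bsub>Zr\<^esub>) : carrier RG" by (rule mk_closed) simp
 then have "mk (%_. \<one>\<^bsub>Zr\<^esub>) : NI"
  unfolding norm_ideal_def Let_def norm_elem using RG.genideal_self'[of "mk (%_. \<one>\<^bsub>Zr\<^esub>)"] by simp
 moreover have "mk (%de. if de = \<one>\<^bsub>Ga\<^esub> then t else \<zero>\<^bsub>Zr\<^esub>) : carrier RG" using t by (intro mk_closed) auto
 ultimately have "mk (%de. if de = \<one>\<^bsub>Ga\<^esub> then t else \<zero>\<^bsub>Zr\<^esub>) \<otimes>\<^bsub>RG\<^esub> mk (%_. \<one>\<^bsub>Zr\<^esub>) : NI"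
  by (rule ideal.I_l_closed[OF NI_ideal])
 then show ?thesis using t by (subst (asm) delta_mult) auto
qed

text \<open>Multiplying a constant function by an element on either side multiplies the constant by
  the sum of the coefficients of that element, because translation permutes the group. So the
  constants already form a two-sided ideal containing the norm element.\<close>

lemma NI_const:
 assumes "c : NI"
 shows "EX t:carrier Zr. c = mk (%_. t)"
proof -
 let ?C = "(%t. mk (%_. t)) ` carrier Zr"
 have sub: "?C \<subseteq> carrier RG" by (auto intro!: mk_closed)
 have add: "a \<oplus>\<^bsub>RG\<^esub> b : ?C" if "a : ?C" "b : ?C" for a b
  using that by (auto simp: mk_add)
 have eqC: "mk f : ?C" if "!!ga. ga : carrier Ga ==> f ga = t" "t : carrier Zr" for f t
  using that by (auto intro!: image_eqI[of _ _ t] mk_cong)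
 have bij: "bij_betw (%de. inv\<^bsub>Ga\<^esub> de \<otimes>\<^bsub>Ga\<^esub> ga) (carrier Ga) (carrier Ga)" if "ga : carrier Ga" for ga
 proof (rule bij_betwI[where g = "%de. ga \<otimes>\<^bsub>Ga\<^esub> inv\<^bsub>Ga\<^esub> de"])
  fix de assume d: "de : carrier Ga"
  show "ga \<otimes>\<^bsub>Ga\<^esub> inv\<^bsub>Ga\<^esub> (inv\<^bsub>Ga\<^esub> de \<otimes>\<^bsub>Ga\<^esub> ga) = de"
   using d that by (simp add: Gam.inv_mult_group Gam.m_assoc[symmetric])
  show "inv\<^bsub>Ga\<^esub> (ga \<otimes>\<^bsub>Ga\<^esub> inv\<^bsub>Ga\<^esub> de) \<otimes>\<^bsub>Ga\<^esub> ga = de"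
   using d that by (simp add: Gam.inv_mult_group Gam.m_assoc)
 qed (use that in auto)
 have "ideal ?C RG"
 proof (rule idealI[OF RG.ring_axioms])
  show "subgroup ?C (add_monoid RG)"
  proof (rule group.subgroupI[OF RG.a_group])
   show "?C ~= {}" using Z.zero_closed by blast
   fix a assume "a : ?C"
   then obtain t where t: "t : carrier Zr" "a = mk (%_. t)" by blast
   have "\<ominus>\<^bsub>RG\<^esub> a = mk (%_. \<ominus>\<^bsub>Zr\<^esub> t)"
    using t by (intro RG.minus_equality) (auto simp: mk_add Z.l_neg RG_zero intro!: mk_closed)
   then have "\<ominus>\<^bsub>RG\<^esub> a : ?C" using Z.a_inv_closed[OF t(1)] by blast
   then show "inv\<^bsub>add_monoid RG\<^esub> a : ?C" unfolding a_inv_def .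
  next
   show "?C \<subseteq> carrier (add_monoid RG)" using sub by simp
   fix a b assume "a : ?C" "b : ?C"
   then show "a \<otimes>\<^bsub>add_monoid RG\<^esub> b : ?C" using add[of a b] by simp
  qed
  fix a c assume a: "a : ?C" and c: "c : carrier RG"
  then obtain t where t: "t : carrier Zr" "a = mk (%_. t)" by blast
  have cZ: "c de : carrier Zr" if "de : carrier Ga" for de using c that by (auto simp: RG_carrier)
  show "c \<otimes>\<^bsub>RG\<^esub> a : ?C" unfolding t(2) mk_mult
   by (rule eqC[of _ "\<Oplus>\<^bsub>Zr\<^esub>de\<in>carrier Ga. c de \<otimes>\<^bsub>Zr\<^esub> t"])
    (use t cZ in \<open>auto simp: mk_def intro!: Z.finsum_cong' Z.finsum_closed\<close>)
  have "a \<otimes>\<^bsub>RG\<^esub> c = mk (%ga. \<Oplus>\<^bsub>Zr\<^esub>de\<in>carrier Ga. mk (%_. t) de \<otimes>\<^bsub>Zr\<^esub> c (inv\<^bsub>Ga\<^esub> de \<otimes>\<^bsub>Ga\<^esub> ga))"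
   unfolding t(2) by (simp add: group_ring_def mk_def)
  also have "\<dots> : ?C"
  proof (rule eqC[of _ "\<Oplus>\<^bsub>Zr\<^esub>de\<in>carrier Ga. t \<otimes>\<^bsub>Zr\<^esub> c de"])
   fix ga assume ga: "ga : carrier Ga"
   have "(\<Oplus>\<^bsub>Zr\<^esub>de\<in>carrier Ga. mk (%_. t) de \<otimes>\<^bsub>Zr\<^esub> c (inv\<^bsub>Ga\<^esub> de \<otimes>\<^bsub>Ga\<^esub> ga)) =
     (\<Oplus>\<^bsub>Zr\<^esub>de\<in>carrier Ga. t \<otimes>\<^bsub>Zr\<^esub> c (inv\<^bsub>Ga\<^esub> de \<otimes>\<^bsub>Ga\<^esub> ga))"
    by (rule Z.finsum_cong') (use t cZ ga in \<open>auto simp: mk_def\<close>)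
   also have "\<dots> = (\<Oplus>\<^bsub>Zr\<^esub>de\<in>(%de. inv\<^bsub>Ga\<^esub> de \<otimes>\<^bsub>Ga\<^esub> ga) ` carrier Ga. t \<otimes>\<^bsub>Zr\<^esub> c de)"
    by (rule Z.finsum_reindex[symmetric]) (use bij[OF ga] t cZ in \<open>auto simp: bij_betw_def\<close>)
   finally show "(\<Oplus>\<^bsub>Zr\<^esub>de\<in>carrier Ga. mk (%_. t) de \<otimes>\<^bsub>Zr\<^esub> c (inv\<^bsub>Ga\<^esub> de \<otimes>\<^bsub>Ga\<^esub> ga)) =
     (\<Oplus>\<^bsub>Zr\<^esub>de\<in>carrier Ga. t \<otimes>\<^bsub>Zr\<^esub> c de)" using bij[OF ga] by (simp add: bij_betw_def)
  qed (use t cZ in \<open>auto intro!: Z.finsum_closed\<close>)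
  finally show "a \<otimes>\<^bsub>RG\<^esub> c : ?C" .
 qed
 moreover have "{mk (%_. \<one>\<^bsub>Zr\<^esub>)} \<subseteq> ?C" by blast
 ultimately have "NI \<subseteq> ?C" unfolding norm_ideal_def Let_def norm_elem by (rule RG.genideal_minimal)
 then show ?thesis using assms by blast
qed

end

section \<open>Presentations over the group ring\<close>

lemma prime_not_dvd_div_multiplicity:
 fixes p E :: nat
 assumes "E > 0" "Factorial_Ring.prime p"
 shows "\<not> p dvd E div p ^ multiplicity p E"
proof -
 have "\<not> is_unit p" using assms(2) not_prime_unit by blast
 then obtain y where y: "E = p ^ multiplicity p E * y" "\<not> p dvd y"
  using assms(1) multiplicity_decompose'[of E p] by blast
 have "E div p ^ multiplicity p E = y"
  using y(1) assms(2) by (metis nonzero_mult_div_cancel_left not_prime_0 power_not_zero)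
 then show ?thesis using y(2) by simp
qed

context presentation
begin

interpretation Z: cring "Z_ring d" by (rule Z_ring_cring)
interpretation RG: ring "group_ring (Z_ring d) Ga"
 by (rule group_ring_ring[OF Z.ring_axioms Gam.is_group Gam.fin])
interpretation NI: ideal "norm_ideal (Z_ring d) Ga" "group_ring (Z_ring d) Ga" by (rule NI_ideal)

text \<open>Elements of \<open>B_module\<close> are handled through families \<open>F\<close> of
  coefficients that represent them: \<open>kap\<close> passes to the class, and \<open>phi\<close>
  evaluates the family after replacing its coefficients by integers in the sense of
  \<open>red\<close>.\<close>

definition valid :: "(nat => 'g => nat => nat => int) => bool" where
 "valid F \<longleftrightarrow> (ALL i:{1..n}. ALL ga:carrier Ga. F i ga : carrier Zr)"

definition kap :: "(nat => 'g => nat => nat => int) => nat => ('g => nat => nat => int) set" where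
 "kap F = (\<lambda>i\<in>{1..n}. NI +>\<^bsub>RG\<^esub> mk (F i))"

definition rho :: "(nat => nat => int) => int" where "rho z = (SOME a. red z a)"

definition phi :: "(nat => 'g => nat => nat => int) => 'a" where
 "phi F = ev n x (%i ga. rho (F i ga))"

abbreviation "BM \<equiv> B_module Zr Ga n"

lemma rho: "z : carrier Zr ==> red z (rho z)"
 unfolding rho_def by (rule someI_ex[OF red_ex])

lemma phi_eq:
 assumes "!!i ga. i : {1..n} ==> ga : carrier Ga ==> red (F i ga) (f i ga)"
 shows "phi F = ev n x f"
 unfolding phi_def
proof (rule ev_mod_E)
 fix i ga assume "i : {1..n}" "ga : carrier Ga"
 then have r: "red (F i ga) (f i ga)" by (rule assms)
 then have "red (F i ga) (rho (F i ga))" unfolding rho_def by (rule someI)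
 then show "int E dvd rho (F i ga) - f i ga" using r by (rule red_unique)
qed

lemma B_simps:
 "carrier BM = (\<Pi>\<^sub>E i\<in>{1..n}. a_rcosets\<^bsub>RG\<^esub> NI)"
 "v \<otimes>\<^bsub>BM\<^esub> w = (\<lambda>i\<in>{1..n}. v i <+>\<^bsub>RG\<^esub> w i)"
 "\<one>\<^bsub>BM\<^esub> = (\<lambda>i\<in>{1..n}. NI)"
 "act BM ga = B_scalar Zr Ga n (group_elem Zr Ga ga)"
 by (simp_all add: B_module_def monoid.defs act_group.defs B_ring_def FactRing_def)

lemma B_group: "group BM"
 unfolding B_module_def
proof (rule group_extend, rule product_group)
 have "ring (B_ring Zr Ga)" unfolding B_ring_def by (rule NI.quotient_is_ring)
 then show "group (add_monoid (B_ring Zr Ga))" by (rule abelian_group.a_group[OF ring.is_abelian_group])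
qed

lemma valid_mk: "valid F ==> i : {1..n} ==> mk (F i) : carrier RG"
 by (rule mk_closed) (simp add: valid_def)

lemma kap_closed: "valid F ==> kap F : carrier BM"
 using valid_mk RG.a_rcosetsI[OF NI.a_subset] by (auto simp: B_simps kap_def)

lemma kap_surj:
 assumes "v : carrier BM"
 obtains F where "valid F" "v = kap F"
proof -
 have "EX c:carrier RG. v i = NI +>\<^bsub>RG\<^esub> c" if "i : {1..n}" for i
  using assms that by (auto simp: B_simps PiE_iff A_RCOSETS_def')
 then obtain F where F: "!!i. i : {1..n} ==> F i : carrier RG" "!!i. i : {1..n} ==> v i = NI +>\<^bsub>RG\<^esub> F i" by metis
 show ?thesis
 proof (rule that)
  show "valid F" using PiE_mem[OF F(1)[unfolded RG_carrier]] by (simp add: valid_def)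
  show "v = kap F"
  proof
   fix i show "v i = kap F i"
    using assms F mk_self[OF F(1)] by (cases "i : {1..n}") (auto simp: kap_def B_simps PiE_iff extensional_def)
  qed
 qed
qed

lemma kap_mult: "valid F ==> valid F' ==> kap F \<otimes>\<^bsub>BM\<^esub> kap F' = kap (%i ga. F i ga \<oplus>\<^bsub>Zr\<^esub> F' i ga)"
 using valid_mk by (auto simp: B_simps kap_def NI.a_rcos_sum mk_add fun_eq_iff)

lemma kap_scalar: "c : carrier RG ==> valid F ==> B_scalar Zr Ga n c (kap F) = (\<lambda>i\<in>{1..n}. NI +>\<^bsub>RG\<^esub> (c \<otimes>\<^bsub>RG\<^esub> mk (F i)))"
 using valid_mk by (auto simp: B_scalar_def kap_def B_ring_def FactRing_def NI.rcoset_mult_add fun_eq_iff)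

lemma kap_delta:
 assumes "t : carrier Zr" "ga : carrier Ga" "valid F"
 shows "B_scalar Zr Ga n (mk (%de. if de = ga then t else \<zero>\<^bsub>Zr\<^esub>)) (kap F) =
  kap (%i de. t \<otimes>\<^bsub>Zr\<^esub> F i (inv\<^bsub>Ga\<^esub> ga \<otimes>\<^bsub>Ga\<^esub> de))"
proof -
 have "mk (%de. if de = ga then t else \<zero>\<^bsub>Zr\<^esub>) : carrier RG" using assms by (intro mk_closed) auto
 then show ?thesis
  using assms by (subst kap_scalar) (auto simp: kap_def delta_mult valid_def fun_eq_iff)
qed

lemma kap_act:
 assumes "ga : carrier Ga" "valid F"
 shows "act BM ga (kap F) = kap (%i de. F i (inv\<^bsub>Ga\<^esub> ga \<otimes>\<^bsub>Ga\<^esub> de))"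
proof -
 have "act BM ga (kap F) = kap (%i de. \<one>\<^bsub>Zr\<^esub> \<otimes>\<^bsub>Zr\<^esub> F i (inv\<^bsub>Ga\<^esub> ga \<otimes>\<^bsub>Ga\<^esub> de))"
  unfolding B_simps group_elem_mk by (rule kap_delta) (use assms in auto)
 also have "\<dots> = kap (%i de. F i (inv\<^bsub>Ga\<^esub> ga \<otimes>\<^bsub>Ga\<^esub> de))"
  unfolding kap_def
  by (rule restrict_ext, rule arg_cong[where f = "%c. NI +>\<^bsub>RG\<^esub> c"], rule mk_cong) (use assms in \<open>auto simp: valid_def\<close>)
 finally show ?thesis .
qed

text \<open>Two families with the same class differ by a constant in each coordinate
  \<open>i\<close>, that is, by multiples of the norm, which kills the module. Hence
  \<open>Phi\<close> does not depend on the representative.\<close>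

lemma kap_eqD:
 assumes F: "valid F" and F': "valid F'" and eq: "kap F = kap F'"
 shows "phi F = phi F'"
proof -
 have "EX t. t : carrier Zr \<and> (ALL ga:carrier Ga. F i ga = t \<oplus>\<^bsub>Zr\<^esub> F' i ga)" if i: "i : {1..n}" for i
 proof -
  have "NI +>\<^bsub>RG\<^esub> mk (F i) = NI +>\<^bsub>RG\<^esub> mk (F' i)" using fun_cong[OF eq, of i] i by (simp add: kap_def)
  then have "mk (F i) : NI +>\<^bsub>RG\<^esub> mk (F' i)" using NI.a_rcos_self[OF valid_mk[OF F i]] by simp
  then obtain h where h: "h : NI" "mk (F i) = h \<oplus>\<^bsub>RG\<^esub> mk (F' i)" by (auto simp: a_r_coset_def')
  obtain t where t: "t : carrier Zr" "h = mk (%_. t)" using NI_const[OF h(1)] by (rule bexE)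
  have e: "mk (F i) = mk (%ga. t \<oplus>\<^bsub>Zr\<^esub> F' i ga)" using h(2) unfolding t(2) mk_add .
  have "F i ga = t \<oplus>\<^bsub>Zr\<^esub> F' i ga" if "ga : carrier Ga" for ga
   using fun_cong[OF e, of ga] that by (simp add: mk_def)
  then show ?thesis using t(1) by metis
 qed
 then obtain t where t: "!!i. i : {1..n} ==> t i : carrier Zr"
  "!!i ga. i : {1..n} ==> ga : carrier Ga ==> F i ga = t i \<oplus>\<^bsub>Zr\<^esub> F' i ga" by metis
 have "phi F = ev n x (%i ga. rho (t i) + rho (F' i ga))"
 proof (rule phi_eq)
  fix i ga assume i: "i : {1..n}" "ga : carrier Ga"
  have "F' i ga : carrier Zr" using F' i by (simp add: valid_def)
  then show "red (F i ga) (rho (t i) + rho (F' i ga))" unfolding t(2)[OF i] using t(1)[OF i(1)] by (intro red_add rho)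
 qed
 also have "\<dots> = phi F'"
  unfolding ev_add[OF xP] phi_def using ev_const[OF xP, of "%i _. rho (t i)" "%i. rho (t i)"] ev_closed[OF xP] by simp
 finally show ?thesis .
qed

definition Phi :: "(nat => ('g => nat => nat => int) set) => 'a" where
 "Phi v = phi (SOME F. valid F \<and> v = kap F)"

lemma Phi_kap:
 assumes "valid F" shows "Phi (kap F) = phi F"
proof -
 have "valid (SOME G. valid G \<and> kap F = kap G) \<and> kap F = kap (SOME G. valid G \<and> kap F = kap G)"
  by (rule someI[of _ F]) (simp add: assms)
 then show ?thesis unfolding Phi_def using kap_eqD[OF assms] by metis
qed

lemma valid_add: "valid F ==> valid F' ==> valid (%i ga. F i ga \<oplus>\<^bsub>Zr\<^esub> F' i ga)"
 by (simp add: valid_def)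

lemma valid_scale: "valid F ==> t : carrier Zr ==> valid (%i ga. t \<otimes>\<^bsub>Zr\<^esub> F i ga)"
 by (simp add: valid_def)

lemma valid_shift: "valid F ==> ga : carrier Ga ==> valid (%i de. F i (inv\<^bsub>Ga\<^esub> ga \<otimes>\<^bsub>Ga\<^esub> de))"
 by (simp add: valid_def)

lemma valid_emb: "valid (%i ga. emb d (c i ga))"
 by (simp add: valid_def)

lemma phi_closed: "phi F : carrier M" unfolding phi_def by (rule ev_closed[OF xP])

lemma phi_add: "valid F ==> valid F' ==> phi (%i ga. F i ga \<oplus>\<^bsub>Zr\<^esub> F' i ga) = phi F \<otimes> phi F'"
 unfolding phi_def[of F] phi_def[of F'] ev_add[OF xP, symmetric]
 by (rule phi_eq) (simp add: valid_def red_add rho)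

lemma phi_shift: "valid F ==> ga : carrier Ga ==> phi (%i de. F i (inv\<^bsub>Ga\<^esub> ga \<otimes>\<^bsub>Ga\<^esub> de)) = act M ga (phi F)"
 unfolding phi_def[of F] ev_sh[OF xP, symmetric]
 by (rule phi_eq) (auto simp: valid_def rho Gam.sh_def)

lemma Phi_hom: "Phi : hom BM M"
proof (rule homI)
 fix v w assume "v : carrier BM" "w : carrier BM"
 obtain F where F: "valid F" "v = kap F" using \<open>v : _\<close> by (rule kap_surj)
 obtain F' where F': "valid F'" "w = kap F'" using \<open>w : _\<close> by (rule kap_surj)
 show "Phi v : carrier M" unfolding F(2) Phi_kap[OF F(1)] by (rule phi_closed)
 show "Phi (v \<otimes>\<^bsub>BM\<^esub> w) = Phi v \<otimes> Phi w"
  unfolding F(2) F'(2) kap_mult[OF F(1) F'(1)] Phi_kap[OF F(1)] Phi_kap[OF F'(1)] Phi_kap[OF valid_add[OF F(1) F'(1)]]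
  by (rule phi_add[OF F(1) F'(1)])
qed

lemma Phi_act: "ga : carrier Ga ==> v : carrier BM ==> Phi (act BM ga v) = act M ga (Phi v)"
 by (erule kap_surj) (simp add: kap_act Phi_kap valid_shift phi_shift)

lemma phi_emb:
 "phi (%i ga. emb d (%_. f i ga)) = ev n x f"
 by (rule phi_eq, rule red_emb) simp

lemma Phi_surj: "Phi ` carrier BM = carrier M"
proof
 show "Phi ` carrier BM \<subseteq> carrier M" using Phi_hom by (auto simp: hom_def)
 show "carrier M \<subseteq> Phi ` carrier BM"
 proof
  fix m assume "m : carrier M"
  then obtain f where "m = ev n x f" using full by (auto simp: rng_def)
  then have "m = Phi (kap (%i ga. emb d (%_. f i ga)))" using phi_emb Phi_kap[OF valid_emb] by simp
  then show "m : Phi ` carrier BM" by (rule image_eqI[OF _ kap_closed[OF valid_emb]])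
 qed
qed

lemma B_act: "group_act Ga BM"
proof -
 interpret BM: group BM by (rule B_group)
 show ?thesis
 proof
  fix ga assume ga: "ga : carrier Ga"
  show "act BM ga : hom BM BM"
  proof (rule homI)
   fix v w assume "v : carrier BM" "w : carrier BM"
   obtain F where F: "valid F" "v = kap F" using \<open>v : _\<close> by (rule kap_surj)
   obtain F' where F': "valid F'" "w = kap F'" using \<open>w : _\<close> by (rule kap_surj)
   show "act BM ga v : carrier BM" unfolding F(2) kap_act[OF ga F(1)] by (rule kap_closed[OF valid_shift[OF F(1) ga]])
   show "act BM ga (v \<otimes>\<^bsub>BM\<^esub> w) = act BM ga v \<otimes>\<^bsub>BM\<^esub> act BM ga w"
    unfolding F(2) F'(2) kap_mult[OF F(1) F'(1)] kap_act[OF ga F(1)] kap_act[OF ga F'(1)]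
     kap_act[OF ga valid_add[OF F(1) F'(1)]] kap_mult[OF valid_shift[OF F(1) ga] valid_shift[OF F'(1) ga]] ..
  qed
  fix de v assume de: "de : carrier Ga" and v: "v : carrier BM"
  obtain F where F: "valid F" "v = kap F" using v by (rule kap_surj)
  show "act BM (ga \<otimes>\<^bsub>Ga\<^esub> de) v = act BM ga (act BM de v)"
   unfolding F(2) kap_act[OF de F(1)] kap_act[OF ga valid_shift[OF F(1) de]] kap_act[OF Gam.m_closed[OF ga de] F(1)]
   unfolding kap_def
   by (rule restrict_ext, rule arg_cong[where f = "%c. NI +>\<^bsub>RG\<^esub> c"], rule mk_cong)
    (use ga de in \<open>simp add: Gam.inv_mult_group Gam.m_assoc\<close>)
 next
  fix v assume v: "v : carrier BM"
  obtain F where F: "valid F" "v = kap F" using v by (rule kap_surj)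
  show "act BM \<one>\<^bsub>Ga\<^esub> v = v"
   unfolding F(2) kap_act[OF Gam.one_closed F(1)] unfolding kap_def
   by (rule restrict_ext, rule arg_cong[where f = "%c. NI +>\<^bsub>RG\<^esub> c"], rule mk_cong) simp
 qed
qed

text \<open>So far \<open>Phi\<close> is only additive and equivariant. A coefficient of
  \<open>c\<close> acts on the values of \<open>phi\<close> as the power with exponent its integer
  \<open>rho\<close>, so the kernel is stable under all scalars.\<close>

lemma kernel_scalar:
 assumes v: "v : kernel BM M Phi" and c: "c : carrier RG"
 shows "B_scalar Zr Ga n c v : kernel BM M Phi"
proof -
 obtain F where F: "valid F" "v = kap F" using v unfolding kernel_def by (blast elim: kap_surj)
 have v1: "phi F = \<one>" using v unfolding F(2) kernel_def by (simp add: Phi_kap[OF F(1)])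
 have cZ: "c de : carrier Zr" if "de : carrier Ga" for de using c that by (auto simp: RG_carrier)
 have FZ: "F i de : carrier Zr" if "i : {1..n}" "de : carrier Ga" for i de using F(1) that by (simp add: valid_def)
 define G where "G i ga = (\<Oplus>\<^bsub>Zr\<^esub>de\<in>carrier Ga. c de \<otimes>\<^bsub>Zr\<^esub> mk (F i) (inv\<^bsub>Ga\<^esub> de \<otimes>\<^bsub>Ga\<^esub> ga))" for i ga
 have G: "valid G" unfolding valid_def G_def
  by (auto intro!: Z.finsum_closed Z.m_closed cZ FZ simp: mk_def)
 have eq: "B_scalar Zr Ga n c v = kap G"
  unfolding F(2) kap_scalar[OF c F(1)] unfolding mk_mult kap_def G_def ..
 have sum: "red (\<Oplus>\<^bsub>Zr\<^esub>de\<in>A. f de) (\<Sum>de\<in>A. h de)"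
  if "finite A" "!!de. de : A ==> red (f de) (h de)" "!!de. de : A ==> f de : carrier Zr" for A :: "'g set" and f h
  using that by (induction A) (auto simp: red_zero red_add Pi_iff)
 have "phi G = ev n x (%i ga. \<Sum>de\<in>carrier Ga. rho (c de) * Gam.sh de (%be. rho (F i be)) ga)"
  unfolding G_def
  by (rule phi_eq, rule sum[OF Gam.fin]) (auto simp: mk_def Gam.sh_def intro!: red_mult rho cZ FZ)
 also have "\<dots> = finprod M (%de. act M de (phi F) [^] rho (c de)) (carrier Ga)"
  unfolding ev_sum[OF xP Gam.fin] by (rule finprod_cong) (auto simp: simp_implies_def ev_scale[OF xP] ev_sh[OF xP] phi_def ev_closed[OF xP])
 also have "\<dots> = \<one>" unfolding v1 by (rule finprod_one_eqI) simp
 finally show ?thesis unfolding eq kernel_def using kap_closed[OF G] by (simp add: Phi_kap[OF G])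
qed

lemma emb_cong: "(!!p. p : idx d ==> c p = c' p) ==> emb d c = emb d c'"
 by (auto simp: emb_def)

lemma kap_cong: "(!!i ga. i : {1..n} ==> ga : carrier Ga ==> F i ga = F' i ga) ==> kap F = kap F'"
 unfolding kap_def by (rule restrict_ext, rule arg_cong[where f = "%c. NI +>\<^bsub>RG\<^esub> c"], rule mk_cong)

lemma kap_const:
 assumes "!!i. i : {1..n} ==> t i : carrier Zr"
 shows "kap (%i ga. t i) = \<one>\<^bsub>BM\<^esub>"
 unfolding kap_def B_simps by (rule restrict_ext) (rule NI.a_rcos_const, rule const_in_NI, rule assms)

text \<open>The primes are divided into singletons for the divisors of \<open>E\<close> and one
  class of all others, matching the sets \<open>P\<close> of \<open>good_presentation\<close>. In
  \<open>rels\<close> both the relations and the denominators are indexed by these classes.\<close>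

definition cls :: "nat => nat set" where
 "cls p = (if p dvd E then {p} else {q. Factorial_Ring.prime q \<and> \<not> q dvd E})"

definition rels :: "(nat set => nat => nat => 'g => int) => (nat set => int) => bool" where
 "rels R e \<longleftrightarrow> (ALL p. Factorial_Ring.prime p --> (ALL i:{1..n}. ev n x (R (cls p) i) = \<one>) \<and>
  (ALL q:cls p. \<not> int q dvd e (cls p)) \<and>
  (ALL f. ev n x f = \<one> --> (%i ga. e (cls p) * f i ga) : Gam.spn n (R (cls p))))"

lemma cls_eq: "q : cls p ==> cls q = cls p"
 by (auto simp: cls_def split: if_splits)

lemma rels_ex: "EX R e. rels R e"
proof -
 have "EX r e. (ALL i:{1..n}. ev n x (r i) = \<one>) \<and> (ALL q:P. \<not> int q dvd e) \<and>
  (ALL f. ev n x f = \<one> --> (%i ga. e * f i ga) : Gam.spn n r)" if "P : cls ` {p. Factorial_Ring.prime p}" for P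
 proof -
  have "ALL q:P. Factorial_Ring.prime q \<and> (q dvd Coset.order M --> P = {q})"
   using that by (auto simp: cls_def E_def split: if_splits)
  then have "presented n x P" using good unfolding good_presentation_def by blast
  then show ?thesis unfolding presented_def .
 qed
 then have "ALL P:cls ` {p. Factorial_Ring.prime p}. EX r e. (ALL i:{1..n}. ev n x (r i) = \<one>) \<and> (ALL q:P. \<not> int q dvd e) \<and>
  (ALL f. ev n x f = \<one> --> (%i ga. e * f i ga) : Gam.spn n r)" by (rule ballI)
 from bchoice[OF this] obtain R where "ALL P:cls ` {p. Factorial_Ring.prime p}. EX e. (ALL i:{1..n}. ev n x (R P i) = \<one>) \<and>
  (ALL q:P. \<not> int q dvd e) \<and> (ALL f. ev n x f = \<one> --> (%i ga. e * f i ga) : Gam.spn n (R P))" ..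
 from bchoice[OF this] obtain e where "ALL P:cls ` {p. Factorial_Ring.prime p}. (ALL i:{1..n}. ev n x (R P i) = \<one>) \<and>
  (ALL q:P. \<not> int q dvd e P) \<and> (ALL f. ev n x f = \<one> --> (%i ga. e P * f i ga) : Gam.spn n (R P))" ..
 then have "rels R e" unfolding rels_def by blast
 then show ?thesis by blast
qed

text \<open>For a prime \<open>p\<close> dividing \<open>E\<close>, multiplication by
  \<open>E div p ^ multiplicity p E\<close> makes \<open>g\<close> and \<open>R p\<close> congruent
  modulo \<open>E\<close>. So the order of the value of \<open>g\<close> divides \<open>E\<close>
  and all these cofactors, which leaves no prime for it.\<close>

lemma glue_kills:
 assumes g: "!!p j ga. Factorial_Ring.prime p ==> p dvd E ==> j : {1..n} ==> ga : carrier Ga ==>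
   [g j ga = R p j ga] (mod int (p ^ multiplicity p E))"
  and R: "!!p. Factorial_Ring.prime p ==> p dvd E ==> ev n x (R p) = \<one>"
 shows "ev n x g = \<one>"
proof -
 let ?m = "ev n x g"
 have m: "?m : carrier M" by (rule ev_closed[OF xP])
 have dvdE: "ord ?m dvd E" using pow_order_eq_1[OF m] m by (simp add: E_def pow_eq_id)
 have dvd: "ord ?m dvd E div p ^ multiplicity p E" if p: "Factorial_Ring.prime p" "p dvd E" for p
 proof -
  let ?q = "int (E div p ^ multiplicity p E)"
  have Eq: "int E = ?q * int (p ^ multiplicity p E)"
   unfolding of_nat_mult[symmetric] by (simp add: dvd_div_mult_self multiplicity_dvd)
  have "ev n x (%j ga. ?q * g j ga) = ev n x (%j ga. ?q * R p j ga)"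
  proof (rule ev_mod_E)
   fix j ga assume "j : {1..n}" "ga : carrier Ga"
   then have "int (p ^ multiplicity p E) dvd g j ga - R p j ga" using g[OF p] by (simp add: cong_iff_dvd_diff)
   then have "?q * int (p ^ multiplicity p E) dvd ?q * (g j ga - R p j ga)" by (rule mult_dvd_mono[OF dvd_refl])
   then show "int E dvd ?q * g j ga - ?q * R p j ga" unfolding Eq[symmetric] right_diff_distrib .
  qed
  then have "?m [^] ?q = \<one>" unfolding ev_scale[OF xP] R[OF p] by simp
  then show ?thesis using m by (simp add: int_pow_int pow_eq_id)
 qed
 have "ord ?m = 1"
 proof (rule ccontr)
  assume "ord ?m ~= 1"
  then obtain q where q: "Factorial_Ring.prime q" "q dvd ord ?m" using prime_factor_nat by blast
  then have qE: "q dvd E" using dvdE dvd_trans by blast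
  have "q dvd E div q ^ multiplicity q E" using q(2) dvd[OF q(1) qE] by (rule dvd_trans)
  moreover have "\<not> q dvd E div q ^ multiplicity q E"
   using E_pos q(1) by (intro prime_not_dvd_div_multiplicity)
  ultimately show False by blast
 qed
 then have "?m [^] (1::nat) = \<one>" using pow_ord_eq_1[OF m] by simp
 then show ?thesis using m by simp
qed

section \<open>Submodules containing the glued relations contain the kernel\<close>

context
 fixes S R e
 assumes S: "subgroup S BM" and scal: "!!c v. c : carrier RG ==> v : S ==> B_scalar Zr Ga n c v : S"
  and R: "rels R e"
  and rS: "!!i. i : {1..n} ==> kap (%j ga. emb d (%p. R (cls p) i j ga)) : S"
begin

lemma T_add: "valid F ==> valid F' ==> kap F : S ==> kap F' : S ==> kap (%i ga. F i ga \<oplus>\<^bsub>Zr\<^esub> F' i ga) : S"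
 by (subst kap_mult[symmetric]) (simp_all add: subgroup.m_closed[OF S])

lemma T_scale:
 assumes "valid F" "t : carrier Zr" "kap F : S"
 shows "kap (%i ga. t \<otimes>\<^bsub>Zr\<^esub> F i ga) : S"
proof -
 have "mk (%de. if de = \<one>\<^bsub>Ga\<^esub> then t else \<zero>\<^bsub>Zr\<^esub>) : carrier RG" using assms by (intro mk_closed) auto
 from scal[OF this assms(3)] have "kap (%i de. t \<otimes>\<^bsub>Zr\<^esub> F i (inv\<^bsub>Ga\<^esub> \<one>\<^bsub>Ga\<^esub> \<otimes>\<^bsub>Ga\<^esub> de)) : S"
  by (simp only: kap_delta[OF assms(2) Gam.one_closed assms(1)])
 also have "kap (%i de. t \<otimes>\<^bsub>Zr\<^esub> F i (inv\<^bsub>Ga\<^esub> \<one>\<^bsub>Ga\<^esub> \<otimes>\<^bsub>Ga\<^esub> de)) = kap (%i ga. t \<otimes>\<^bsub>Zr\<^esub> F i ga)"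
  by (rule kap_cong) simp
 finally show ?thesis .
qed

lemma T_shift:
 assumes "valid F" "ga : carrier Ga" "kap F : S"
 shows "kap (%i de. F i (inv\<^bsub>Ga\<^esub> ga \<otimes>\<^bsub>Ga\<^esub> de)) : S"
proof -
 have "group_elem Zr Ga ga : carrier RG" unfolding group_elem_mk by (intro mk_closed) auto
 from scal[OF this assms(3)] show ?thesis using kap_act[OF assms(2,1)] by (simp add: B_simps)
qed

lemma T_const: "(!!i ga. i : {1..n} ==> ga : carrier Ga ==> F i ga = t i) ==> (!!i. t i : carrier Zr) ==> kap F : S"
 using kap_cong[of F "%i ga. t i"] kap_const[of t] subgroup.one_closed[OF S] by simp

text \<open>The indicator of \<open>cls p\<close> is an idempotent of the product ring. Multiplying
  a glued relation by it leaves the relation for that class alone, and the other rules of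
  \<open>spn\<close> hold in any submodule.\<close>

lemma spn_T:
 assumes p: "Factorial_Ring.prime p" and f: "f : Gam.spn n (R (cls p))"
 shows "kap (%i ga. emb d (%q. if q : cls p then f i ga else 0)) : S"
 using f
proof induction
 case (spn_const f c)
 show ?case by (rule T_const[of _ "%i. emb d (%q. if q : cls p then c i else 0)"], rule emb_cong) (use spn_const in auto)
next
 case (spn_base i)
 have "kap (%j ga. emb d (%q. if q : cls p then 1 else 0) \<otimes>\<^bsub>Zr\<^esub> emb d (%q. R (cls q) i j ga)) : S"
  by (rule T_scale[OF valid_emb emb_closed rS[OF spn_base]])
 also have "kap (%j ga. emb d (%q. if q : cls p then 1 else 0) \<otimes>\<^bsub>Zr\<^esub> emb d (%q. R (cls q) i j ga)) =
   kap (%j ga. emb d (%q. if q : cls p then R (cls p) i j ga else 0))"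
  unfolding emb_mult[symmetric] by (intro kap_cong emb_cong) (auto dest: cls_eq)
 finally show ?case .
next
 case (spn_diff f f')
 have "kap (%i ga. emb d (%q. if q : cls p then f i ga else 0) \<oplus>\<^bsub>Zr\<^esub>
   (emb d (%_. - 1) \<otimes>\<^bsub>Zr\<^esub> emb d (%q. if q : cls p then f' i ga else 0))) : S"
  by (intro T_add T_scale spn_diff.IH valid_emb valid_scale emb_closed)
 also have "kap (%i ga. emb d (%q. if q : cls p then f i ga else 0) \<oplus>\<^bsub>Zr\<^esub>
   (emb d (%_. - 1) \<otimes>\<^bsub>Zr\<^esub> emb d (%q. if q : cls p then f' i ga else 0))) =
  kap (%i ga. emb d (%q. if q : cls p then f i ga - f' i ga else 0))"
  unfolding emb_mult[symmetric] emb_add[symmetric] by (intro kap_cong emb_cong) auto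
 finally show ?case .
next
 case (spn_shift ga f)
 from T_shift[OF valid_emb spn_shift(1) spn_shift.IH] show ?case
  by (rule back_subst[of "%v. v : S"]) (intro kap_cong emb_cong, auto simp: Gam.sh_def)
qed

text \<open>The denominator \<open>e\<close> is a unit at the primes of its class. Completed by
  \<open>1\<close> at the other primes it becomes a unit of the product ring and can be divided
  out.\<close>

lemma rel_T:
 assumes p: "Factorial_Ring.prime p" and f: "ev n x f = \<one>"
 shows "kap (%i ga. emb d (%q. if q : cls p then f i ga else 0)) : S"
proof -
 have e: "!!q. q : cls p ==> \<not> int q dvd e (cls p)" and s: "(%i ga. e (cls p) * f i ga) : Gam.spn n (R (cls p))"
  using R p f unfolding rels_def by blast+
 have "\<not> int q dvd (if q : cls p then e (cls p) else 1)" if "q : idx d" for q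
  using e[of q] that prime_gt_1_nat[of q] by (auto simp: idx_def)
 then have "EX u:carrier Zr. u \<otimes>\<^bsub>Zr\<^esub> emb d (%q. if q : cls p then e (cls p) else 1) = \<one>\<^bsub>Zr\<^esub>"
  by (rule emb_unit)
 then obtain u where u: "u : carrier Zr" "u \<otimes>\<^bsub>Zr\<^esub> emb d (%q. if q : cls p then e (cls p) else 1) = \<one>\<^bsub>Zr\<^esub>"
  by (rule bexE)
 have "kap (%i ga. u \<otimes>\<^bsub>Zr\<^esub> emb d (%q. if q : cls p then e (cls p) * f i ga else 0)) : S"
  by (rule T_scale[OF valid_emb u(1) spn_T[OF p s]])
 also have "kap (%i ga. u \<otimes>\<^bsub>Zr\<^esub> emb d (%q. if q : cls p then e (cls p) * f i ga else 0)) =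
  kap (%i ga. emb d (%q. if q : cls p then f i ga else 0))"
 proof (rule kap_cong)
  fix i ga
  have "emb d (%q. if q : cls p then e (cls p) * f i ga else 0) =
   emb d (%q. if q : cls p then e (cls p) else 1) \<otimes>\<^bsub>Zr\<^esub> emb d (%q. if q : cls p then f i ga else 0)"
   unfolding emb_mult[symmetric] by (rule emb_cong) simp
  then show "u \<otimes>\<^bsub>Zr\<^esub> emb d (%q. if q : cls p then e (cls p) * f i ga else 0) =
   emb d (%q. if q : cls p then f i ga else 0)"
   using u by (simp add: Z.m_assoc[symmetric])
 qed
 finally show ?thesis .
qed

text \<open>The unit element of the product ring is the sum of the idempotents of finitely many
  classes, so the pieces from \<open>rel_T\<close> add up to \<open>f\<close>.\<close>

lemma int_T:
 assumes f: "ev n x f = \<one>"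
 shows "kap (%i ga. emb d (%_. f i ga)) : S"
proof -
 let ?A = "{p. Factorial_Ring.prime p \<and> p dvd E}"
 have add: "kap (%i ga. emb d (%q. if q : A \<union> B then f i ga else 0)) : S"
  if "kap (%i ga. emb d (%q. if q : A then f i ga else 0)) : S" "kap (%i ga. emb d (%q. if q : B then f i ga else 0)) : S"
   "A \<inter> B = {}" for A B
  using T_add[OF valid_emb valid_emb that(1,2)] unfolding emb_add[symmetric]
  by (rule back_subst[of "%v. v : S"]) (intro kap_cong emb_cong, use that(3) in auto)
 have finA: "finite ?A" using E_pos by (intro finite_subset[OF _ finite_atMost[of E]]) (auto dest: dvd_imp_le)
 have A: "kap (%i ga. emb d (%q. if q : A then f i ga else 0)) : S" if "A \<subseteq> ?A" for A
  using finite_subset[OF that finA] that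
 proof (induction A rule: finite_induct)
  case empty
  show ?case by (rule T_const[of _ "%_. emb d (%_. 0)"]) simp_all
 next
  case (insert p A)
  have p: "Factorial_Ring.prime p" "cls p = {p}" using insert by (auto simp: cls_def)
  from add[OF rel_T[OF p(1) f, unfolded p(2)] insert.IH] show ?case using insert by simp
 qed
 show ?thesis
 \<comment> \<open>The class of the primes not dividing \<open>E\<close> is named by one of its
   members, so the two cases are whether such a member is at hand.\<close>
 proof (cases "EX p. Factorial_Ring.prime p \<and> \<not> p dvd E")
  case True
  then obtain p where p: "Factorial_Ring.prime p" "\<not> p dvd E" by blast
  have "kap (%i ga. emb d (%q. if q : ?A \<union> cls p then f i ga else 0)) : S"
   by (rule add[OF A[OF order_refl] rel_T[OF p(1) f]]) (use p in \<open>auto simp: cls_def\<close>)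
  then show ?thesis
   by (rule back_subst[of "%v. v : S"]) (intro kap_cong emb_cong, use p in \<open>auto simp: cls_def idx_def\<close>)
 next
  case False
  show ?thesis using A[OF order_refl]
   by (rule back_subst[of "%v. v : S"]) (intro kap_cong emb_cong, use False in \<open>auto simp: idx_def\<close>)
 qed
qed

text \<open>The coefficients are split into integers and multiples of \<open>?\<pi>\<close>. The
  integers form a relation covered by \<open>int_T\<close>. Since \<open>E\<close> is a unit times
  \<open>?\<pi>\<close>, a multiple of \<open>?\<pi>\<close> is a multiple of \<open>E\<close>, and
  \<open>E\<close> times a basis vector is again an integer relation.\<close>

lemma kernel_T:
 assumes F: "valid F" and phi: "phi F = \<one>"
 shows "kap F : S"
proof -
 let ?v = "%p. multiplicity p E" and ?\<kappa> = "%i ga. rho (F i ga)"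
 let ?\<pi> = "emb d (%p. int p ^ ?v p)" and ?et = "emb d (%p. int (E div p ^ ?v p))"
 have k: "kap (%i ga. emb d (%_. ?\<kappa> i ga)) : S" using int_T[of ?\<kappa>] phi by (simp add: phi_def)
 have ex: "EX w:carrier Zr. F i ga \<oplus>\<^bsub>Zr\<^esub> emb d (%_. - ?\<kappa> i ga) = w \<otimes>\<^bsub>Zr\<^esub> ?\<pi>" if i: "i : {1..n}" "ga : carrier Ga" for i ga
 proof (rule Z_div)
  have FZ: "F i ga : carrier Zr" using F i by (simp add: valid_def)
  then show "F i ga \<oplus>\<^bsub>Zr\<^esub> emb d (%_. - ?\<kappa> i ga) : carrier Zr" by simp
  fix p assume p: "p : idx d"
  have "[?\<kappa> i ga = F i ga p (?v p)] (mod int p ^ ?v p)" using red_D[OF rho[OF FZ] p multiplicity_dvd] .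
  then have "(F i ga p (?v p) - ?\<kappa> i ga) mod int p ^ ?v p = 0" by (simp add: cong_iff_dvd_diff dvd_diff_commute mod_eq_0_iff_dvd)
  then show "(F i ga \<oplus>\<^bsub>Zr\<^esub> emb d (%_. - ?\<kappa> i ga)) p (?v p) = 0"
   using p by (simp add: Z_simps emb_def mod_simps)
 qed
 have "ALL a:{1..n} \<times> carrier Ga. EX w. w : carrier Zr \<and>
   F (fst a) (snd a) \<oplus>\<^bsub>Zr\<^esub> emb d (%_. - ?\<kappa> (fst a) (snd a)) = w \<otimes>\<^bsub>Zr\<^esub> ?\<pi>"
 proof
  fix a assume "a : {1..n} \<times> carrier Ga"
  then have "fst a : {1..n}" "snd a : carrier Ga" by auto
  from ex[OF this] show "EX w. w : carrier Zr \<and>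
   F (fst a) (snd a) \<oplus>\<^bsub>Zr\<^esub> emb d (%_. - ?\<kappa> (fst a) (snd a)) = w \<otimes>\<^bsub>Zr\<^esub> ?\<pi>" unfolding Bex_def .
 qed
 from bchoice[OF this] obtain W where W: "ALL a:{1..n} \<times> carrier Ga. W a : carrier Zr \<and>
   F (fst a) (snd a) \<oplus>\<^bsub>Zr\<^esub> emb d (%_. - ?\<kappa> (fst a) (snd a)) = W a \<otimes>\<^bsub>Zr\<^esub> ?\<pi>" ..
 define w where "w i ga = W (i, ga)" for i ga
 have w: "w i ga : carrier Zr" "F i ga \<oplus>\<^bsub>Zr\<^esub> emb d (%_. - ?\<kappa> i ga) = w i ga \<otimes>\<^bsub>Zr\<^esub> ?\<pi>"
  if "i : {1..n}" "ga : carrier Ga" for i ga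
  using bspec[OF W, of "(i, ga)"] that by (auto simp: w_def)
 have "\<not> int p dvd int (E div p ^ ?v p)" if "p : idx d" for p
  unfolding int_dvd_int_iff using E_pos that by (intro prime_not_dvd_div_multiplicity) (auto simp: idx_def)
 then have "EX u:carrier Zr. u \<otimes>\<^bsub>Zr\<^esub> ?et = \<one>\<^bsub>Zr\<^esub>" by (rule emb_unit)
 then obtain u where u: "u : carrier Zr" "u \<otimes>\<^bsub>Zr\<^esub> ?et = \<one>\<^bsub>Zr\<^esub>" by (rule bexE)
 have E\<pi>: "emb d (%_. int E) = ?et \<otimes>\<^bsub>Zr\<^esub> ?\<pi>" unfolding emb_mult[symmetric]
  by (rule emb_cong) (simp add: of_nat_mult[symmetric] of_nat_power[symmetric] dvd_div_mult_self multiplicity_dvd del: of_nat_mult of_nat_power)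
 have single: "kap (%j de. if (j, de) = a then z \<otimes>\<^bsub>Zr\<^esub> ?\<pi> else \<zero>\<^bsub>Zr\<^esub>) : S" if z: "z : carrier Zr" for a z
 proof -
  have "ev n x (%j de. if (j, de) = a then int E else 0) = ev n x (%j de. 0)" by (rule ev_mod_E) simp
  also have "\<dots> = \<one>" by (rule ev_zero[OF xP]) simp
  finally have "kap (%j de. (z \<otimes>\<^bsub>Zr\<^esub> u) \<otimes>\<^bsub>Zr\<^esub> emb d (%_. if (j, de) = a then int E else 0)) : S"
   by (intro T_scale[OF valid_emb] int_T Z.m_closed z u)
  then show ?thesis
  proof (rule back_subst[of "%v. v : S"], intro kap_cong)
   fix j de
   have "(z \<otimes>\<^bsub>Zr\<^esub> u) \<otimes>\<^bsub>Zr\<^esub> (?et \<otimes>\<^bsub>Zr\<^esub> ?\<pi>) = z \<otimes>\<^bsub>Zr\<^esub> ((u \<otimes>\<^bsub>Zr\<^esub> ?et) \<otimes>\<^bsub>Zr\<^esub> ?\<pi>)"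
    using z u(1) by (simp add: Z.m_assoc)
   then show "(z \<otimes>\<^bsub>Zr\<^esub> u) \<otimes>\<^bsub>Zr\<^esub> emb d (%_. if (j, de) = a then int E else 0) = (if (j, de) = a then z \<otimes>\<^bsub>Zr\<^esub> ?\<pi> else \<zero>\<^bsub>Zr\<^esub>)"
    using z u by (auto simp: E\<pi> emb_0)
  qed
 qed
 \<comment> \<open>Membership in \<open>S\<close> passes to sums of two elements, so the coordinates
   are added one at a time.\<close>
 define D where "D A j de = (if (j, de) : A then w j de \<otimes>\<^bsub>Zr\<^esub> ?\<pi> else \<zero>\<^bsub>Zr\<^esub>)" for A j de
 have D: "valid (D A)" for A using w(1) by (auto simp: valid_def D_def)
 have "kap (D A) : S" if "finite A" "A \<subseteq> {1..n} \<times> carrier Ga" for A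
  using that
 proof (induction A rule: finite_induct)
  case empty
  show ?case by (rule T_const[of _ "%_. \<zero>\<^bsub>Zr\<^esub>"]) (simp_all add: D_def)
 next
  case (insert a A)
  obtain i ga where a: "a = (i, ga)" "i : {1..n}" "ga : carrier Ga" using insert by auto
  have v: "valid (%j de. if (j, de) = a then w i ga \<otimes>\<^bsub>Zr\<^esub> ?\<pi> else \<zero>\<^bsub>Zr\<^esub>)" using w(1) a by (auto simp: valid_def)
  have "kap (D A) : S" using insert by simp
  from T_add[OF v D single[OF w(1)[OF a(2,3)]] this] show ?case
   by (rule back_subst[of "%v. v : S"], intro kap_cong) (use insert w(1) a in \<open>auto simp: D_def\<close>)
 qed
 then have "kap (D ({1..n} \<times> carrier Ga)) : S" using Gam.fin by simp
 from T_add[OF valid_emb D k this] show ?thesis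
 proof (rule back_subst[of "%v. v : S"], intro kap_cong)
  fix i ga assume i: "i : {1..n}" "ga : carrier Ga"
  have FZ: "F i ga : carrier Zr" using F i by (simp add: valid_def)
  have "emb d (%_. ?\<kappa> i ga) \<oplus>\<^bsub>Zr\<^esub> (F i ga \<oplus>\<^bsub>Zr\<^esub> emb d (%_. - ?\<kappa> i ga)) =
    F i ga \<oplus>\<^bsub>Zr\<^esub> (emb d (%_. ?\<kappa> i ga) \<oplus>\<^bsub>Zr\<^esub> emb d (%_. - ?\<kappa> i ga))" using FZ by (simp add: Z.add.m_lcomm)
  also have "\<dots> = F i ga" unfolding emb_add[symmetric] using FZ by (simp add: emb_0)
  finally show "emb d (%_. ?\<kappa> i ga) \<oplus>\<^bsub>Zr\<^esub> D ({1..n} \<times> carrier Ga) i ga = F i ga"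
   using i by (simp add: D_def w(2)[symmetric])
 qed
qed

end

theorem module_presentation:
 "EX r. (ALL i:{1..n}. r i : carrier BM) \<and> (\<forall>j>n. r j = \<one>\<^bsub>BM\<^esub>) \<and>
  equivariant_iso (carrier Ga) M (act_quot BM (B_span Zr Ga n (r ` {1..n + t})))"
proof -
 obtain R e where R: "rels R e" using rels_ex by blast
 define r where "r i = (if i \<le> n then kap (%j ga. emb d (%p. R (cls p) i j ga)) else \<one>\<^bsub>BM\<^esub>)" for i
 have rB: "r i : carrier BM" for i
  using kap_closed[OF valid_emb] monoid.one_closed[OF group.is_monoid[OF B_group]] by (simp add: r_def)
 interpret Ph: group_hom BM M Phi
  by (intro group_hom.intro group_hom_axioms.intro B_group group_axioms Phi_hom)
 have rker: "r i : kernel BM M Phi" if "i : {1..n + t}" for i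
 proof (cases "i \<le> n")
  case True
  define g where "g j ga = rho (emb d (%p. R (cls p) i j ga))" for j ga
  have g: "red (emb d (%p. R (cls p) i j ga)) (g j ga)" for j ga unfolding g_def by (rule rho[OF emb_closed])
  have "ev n x g = \<one>"
  proof (rule glue_kills[where R = "%p. R (cls p) i"])
   fix p j ga assume p: "Factorial_Ring.prime p" "p dvd E"
   show "[g j ga = R (cls p) i j ga] (mod int (p ^ multiplicity p E))"
    using red_D[OF g idx_E[OF p] multiplicity_dvd, of j ga] idx_E[OF p] by (simp add: emb_def cong_def)
  qed (use R that True in \<open>auto simp: rels_def\<close>)
  moreover have "phi (%j ga. emb d (%p. R (cls p) i j ga)) = ev n x g" by (rule phi_eq) (rule g)
  ultimately show ?thesis using True rB[of i] by (simp add: kernel_def r_def Phi_kap[OF valid_emb])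
 next
  case False
  then show ?thesis using Ph.hom_one by (simp add: kernel_def r_def)
 qed
 have "B_span Zr Ga n (r ` {1..n + t}) = kernel BM M Phi"
 proof
  have "kernel BM M Phi : {S. subgroup S BM \<and> r ` {1..n + t} \<subseteq> S \<and>
     (ALL c:carrier RG. ALL v:S. B_scalar Zr Ga n c v : S)}"
   using Ph.subgroup_kernel rker kernel_scalar by blast
  then show "B_span Zr Ga n (r ` {1..n + t}) \<subseteq> kernel BM M Phi" unfolding B_span_def by (rule Inter_lower)
  show "kernel BM M Phi \<subseteq> B_span Zr Ga n (r ` {1..n + t})" unfolding B_span_def
  proof (rule Inter_greatest)
   fix S assume "S : {S. subgroup S BM \<and> r ` {1..n + t} \<subseteq> S \<and>
     (ALL c:carrier RG. ALL v:S. B_scalar Zr Ga n c v : S)}"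
   then have S: "subgroup S BM" "r ` {1..n + t} \<subseteq> S" "!!c v. c : carrier RG ==> v : S ==> B_scalar Zr Ga n c v : S"
    by blast+
   have rS: "kap (%j ga. emb d (%p. R (cls p) i j ga)) : S" if i: "i : {1..n}" for i
   proof -
    have "r i : S" using S(2) i by auto
    then show ?thesis using i by (simp add: r_def)
   qed
   show "kernel BM M Phi \<subseteq> S"
   proof
    fix v assume v: "v : kernel BM M Phi"
    then obtain F where F: "valid F" "v = kap F" unfolding kernel_def by (blast elim: kap_surj)
    have ph: "phi F = \<one>" using v unfolding F(2) kernel_def by (simp add: Phi_kap[OF F(1)])
    show "v : S" unfolding F(2)
    proof (rule kernel_T[OF S(1) _ R _ F(1) ph])
     show "B_scalar Zr Ga n c u : S" if "c : carrier RG" "u : S" for c u using that by (rule S(3))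
     show "kap (%j ga. emb d (%p. R (cls p) i j ga)) : S" if "i : {1..n}" for i using that by (rule rS)
    qed
   qed
  qed
 qed
 from equivariant_iso_quot[OF B_act group_act_axioms Phi_hom Phi_surj Phi_act this]
 moreover have "\<forall>j>n. r j = \<one>\<^bsub>BM\<^esub>" by (simp add: r_def)
 ultimately show ?thesis using rB by blast
qed

end

section \<open>Presentations of profinite modules\<close>

text \<open>The exponents \<open>t\<close> with \<open>m [^] t\<close> in \<open>W\<close> form an
  ideal of the integers that is contained in no ideal generated by a prime.\<close>

lemma (in group) mem_subgroup_if_coprime_powers:
 assumes W: "subgroup W G" and m: "m : carrier G"
  and p: "!!p. Factorial_Ring.prime p ==> \<exists>t::int. \<not> int p dvd t \<and> m [^] t : W"
 shows "m : W"
proof -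
 define K where "K = {k::nat. k > 0 \<and> m [^] int k : W}"
 have neg: "m [^] (- t) : W" if "m [^] t : W" for t :: int
  using subgroup.m_inv_closed[OF W that] m by (simp add: int_pow_neg)
 \<comment> \<open>The prime \<open>2\<close> provides a nonzero exponent, without which there would
   be no least positive one.\<close>
 obtain t :: int where t: "\<not> int 2 dvd t" "m [^] t : W" using p[of 2] by auto
 have "m [^] int (nat \<bar>t\<bar>) : W" using t(2) neg[OF t(2)] by (simp add: abs_if)
 then have "nat \<bar>t\<bar> : K" using t(1) by (auto simp: K_def)
 then have k0: "(LEAST k. k : K) : K" by (rule LeastI)
 define k where "k = (LEAST k. k : K)"
 have k: "k : K" "!!l. l : K ==> k \<le> l" using k0 unfolding k_def by (auto intro: Least_le)
 have kt: "int k dvd t" if "m [^] t : W" for t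
 proof -
  have "m [^] (t - int k * (t div int k)) : W"
   using subgroup.m_closed[OF W that neg[OF subgroup_int_pow_closed[OF W, of "m [^] int k" "t div int k", unfolded int_pow_pow[OF m]]]] k(1) m
   by (simp add: int_pow_mult[symmetric] K_def)
  then have "m [^] (t mod int k) : W" by (simp add: minus_mult_div_eq_mod)
  moreover have kp: "int k > 0" using k(1) by (simp add: K_def)
  then have r: "0 \<le> t mod int k" "t mod int k < int k" by (simp_all add: pos_mod_sign pos_mod_bound)
  ultimately have "t mod int k = 0"
  proof (rule_tac ccontr)
   assume a: "m [^] (t mod int k) : W" "t mod int k ~= 0"
   have "nat (t mod int k) : K" using a r(1) by (simp add: K_def)
   from k(2)[OF this] r show False by simp
  qed
  then show ?thesis by (rule mod_0_imp_dvd)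
 qed
 have "k = 1"
 proof (rule ccontr)
  assume "k ~= 1"
  then obtain q where q: "Factorial_Ring.prime q" "q dvd k" using prime_factor_nat by blast
  from p[OF q(1)] obtain t :: int where t: "\<not> int q dvd t \<and> m [^] t : W" ..
  have "int q dvd int k" using q(2) by simp
  also have "int k dvd t" using kt t by blast
  finally show False using t by blast
 qed
 then show ?thesis using k(1) m by (simp add: K_def)
qed

lemma (in group) mem_subgroup_if_coprime_pows:
 assumes W: "subgroup W G" and m: "m : carrier G" and "m [^] int a : W" "m [^] int b : W" "coprime a b"
 shows "m : W"
proof (rule mem_subgroup_if_coprime_powers[OF W m])
 fix p :: nat assume "Factorial_Ring.prime p"
 then have "\<not> p dvd a \<or> \<not> p dvd b" using assms(5) by (auto dest: coprime_common_divisor_nat)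
 then show "\<exists>t::int. \<not> int p dvd t \<and> m [^] t : W" using assms(3,4) by (metis int_dvd_int_iff)
qed

text \<open>An axiomatic form of the prime-to-\<open>d\<close> abelianised group \<open>A\<close>.
  \<open>WW\<close> stands for its open stable subgroups: by \<open>Wexp\<close> their quotients
  have exponent prime to \<open>d\<close>, \<open>Wlim\<close> is compactness, and
  \<open>Wgen\<close> is density of the subgroup generated by the \<open>a\<close>. The
  \<open>y\<close> become generators once the group order is inverted, which is the content of
  \<open>ya\<close>.\<close>

locale profinite_cover = presentation Ga M d n x + A: mod_act Ga A
 for Ga :: "'g monoid" and M :: "('a, 'g, 'm) act_group_scheme" (structure)
  and d n :: nat and x :: "nat => 'a" and A :: "('b, 'g, 'l) act_group_scheme" +
 fixes fA :: "'b => 'a" and y :: "nat => 'b" and a :: "nat => 'g => 'g => 'b" and WW :: "'b set set"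
 assumes gd: "card (carrier Ga) dvd d"
  and Wsub: "W : WW ==> subgroup W A"
  and Wact: "W : WW ==> ga : carrier Ga ==> w : W ==> act A ga w : W"
  and Wint: "W : WW ==> W' : WW ==> W \<inter> W' : WW"
  and Wexp: "W : WW ==> \<exists>u>0. coprime u d \<and> (ALL m:carrier A. m [^]\<^bsub>A\<^esub> int u : W)"
  and Wlim: "(!!W. W : WW ==> c W : carrier A) ==>
   (!!W W'. W : WW ==> W' : WW ==> W \<subseteq> W' ==> inv\<^bsub>A\<^esub> c W' \<otimes>\<^bsub>A\<^esub> c W : W') ==>
   EX z:carrier A. ALL W:WW. inv\<^bsub>A\<^esub> c W \<otimes>\<^bsub>A\<^esub> z : W"
  and Wgen: "W : WW ==> subgroup S A ==> W \<subseteq> S ==>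
   (!!i ga de. i : {1..n} ==> ga : carrier Ga ==> de : carrier Ga ==> a i ga de : S) ==> carrier A \<subseteq> S"
  and aA: "i : {1..n} ==> ga : carrier Ga ==> de : carrier Ga ==> a i ga de : carrier A"
  and yA: "y : {1..n} \<rightarrow> carrier A"
  and ya: "i : {1..n} ==> ga : carrier Ga ==> de : carrier Ga ==>
   inv\<^bsub>A\<^esub> (act A ga (y i)) \<otimes>\<^bsub>A\<^esub> act A de (y i) = a i ga de [^]\<^bsub>A\<^esub> int (card (carrier Ga))"
  and ynorm: "i : {1..n} ==> A.ev1 (y i) (%_. 1) = \<one>\<^bsub>A\<^esub>"
  and fhom: "fA : hom A M"
  and feq: "ga : carrier Ga ==> z : carrier A ==> fA (act A ga z) = act M ga (fA z)"
  and fy: "i : {1..n} ==> fA (y i) = x i"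
  and fker: "kernel A M fA : WW"
begin

interpretation f: group_hom A M fA
 by (intro group_hom.intro group_hom_axioms.intro fhom A.group_axioms group_axioms)

lemma ev_f: "fA (A.ev n y c) = ev n x c"
proof -
 have yi: "y i : carrier A" if "i : {1..n}" for i using yA that by blast
 have "fA (A.ev1 (y i) b) = ev1 (x i) b" if i: "i : {1..n}" for i b
 proof -
  have "fA (A.ev1 (y i) b) = finprod M (%ga. fA (act A ga (y i) [^]\<^bsub>A\<^esub> b ga)) (carrier Ga)"
   unfolding A.ev1_def by (rule finprod_hom[OF A.comm_group_axioms comm_group_axioms fhom]) (use yi[OF i] in auto)
  also have "\<dots> = ev1 (x i) b" unfolding ev1_def
   by (rule finprod_cong) (use yi[OF i] i xP in \<open>auto simp: simp_implies_def f.hom_int_pow feq fy Pi_iff\<close>)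
  finally show ?thesis .
 qed
 moreover have "fA (A.ev n y c) = finprod M (%i. fA (A.ev1 (y i) (c i))) {1..n}"
  unfolding A.ev_def by (rule finprod_hom[OF A.comm_group_axioms comm_group_axioms fhom]) (use yi in auto)
 ultimately show ?thesis unfolding ev_def
  by (simp only:) (rule finprod_cong, use xP in \<open>auto simp: simp_implies_def Pi_iff\<close>)
qed

lemma exp_ev:
 assumes W: "W : WW" and u: "ALL m:carrier A. m [^]\<^bsub>A\<^esub> (u::int) : W"
  and c: "!!i ga. i : {1..n} ==> ga : carrier Ga ==> u dvd c i ga"
 shows "A.ev n y c : W"
proof -
 have "A.ev n y c = A.ev n y (%i ga. u * (c i ga div u))" by (rule A.ev_cong[OF yA]) (simp add: c)
 then show ?thesis unfolding A.ev_scale[OF yA] using u A.ev_closed[OF yA] by simp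
qed

text \<open>The translates of a coefficient function add up to a constant, so the norm of a value is
  a product of powers of the norms of the \<open>y i\<close>.\<close>

lemma ev_norm: "A.ev1 (A.ev n y c) (%_. 1) = \<one>\<^bsub>A\<^esub>"
proof -
 have "A.ev1 (A.ev n y c) (%_. 1) = finprod A (%ga. A.ev n y (%i. Gam.sh ga (c i))) (carrier Ga)"
  unfolding A.ev1_def
  by (rule A.finprod_cong) (use A.ev_closed[OF yA] in \<open>auto simp: simp_implies_def A.ev_sh[OF yA]\<close>)
 also have "\<dots> = A.ev n y (%i de. \<Sum>ga\<in>carrier Ga. Gam.sh ga (c i) de)" by (rule A.ev_sum[OF yA Gam.fin, symmetric])
 also have "\<dots> = A.ev n y (%i de. (\<Sum>ga\<in>carrier Ga. c i ga) * 1)"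
 proof (rule A.ev_cong[OF yA])
  fix i de assume d: "de : carrier Ga"
  have "bij_betw (%ga. inv\<^bsub>Ga\<^esub> ga \<otimes>\<^bsub>Ga\<^esub> de) (carrier Ga) (carrier Ga)"
  proof (rule bij_betwI[where g = "%ga. de \<otimes>\<^bsub>Ga\<^esub> inv\<^bsub>Ga\<^esub> ga"])
   fix ga assume g: "ga : carrier Ga"
   show "de \<otimes>\<^bsub>Ga\<^esub> inv\<^bsub>Ga\<^esub> (inv\<^bsub>Ga\<^esub> ga \<otimes>\<^bsub>Ga\<^esub> de) = ga"
    using d g by (simp add: Gam.inv_mult_group Gam.m_assoc[symmetric])
   show "inv\<^bsub>Ga\<^esub> (de \<otimes>\<^bsub>Ga\<^esub> inv\<^bsub>Ga\<^esub> ga) \<otimes>\<^bsub>Ga\<^esub> de = ga"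
    using d g by (simp add: Gam.inv_mult_group Gam.m_assoc)
  qed (use d in auto)
  from sum.reindex_bij_betw[OF this, of "c i"] d
  show "(\<Sum>ga\<in>carrier Ga. Gam.sh ga (c i) de) = (\<Sum>ga\<in>carrier Ga. c i ga) * 1" by (simp add: Gam.sh_def)
 qed
 also have "\<dots> = \<one>\<^bsub>A\<^esub>" unfolding A.ev_def
 proof (rule A.finprod_one_eqI)
  fix i assume i: "i : {1..n}"
  then have "y i : carrier A" using yA by blast
  then show "A.ev1 (y i) (%de. (\<Sum>ga\<in>carrier Ga. c i ga) * 1) = \<one>\<^bsub>A\<^esub>"
   using ynorm[OF i] by (simp only: A.ev1_scale A.int_pow_one)
 qed
 finally show ?thesis .
qed

context
 fixes R e
 assumes R: "rels R e"
begin

text \<open>An integer vector that approximates the glued relation modulo \<open>u\<close>. It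
  replaces coefficients in the product ring, of which no action on \<open>A\<close> is
  given.\<close>

definition G :: "nat => nat => nat => 'g => int" where
 "G u i j ga = (SOME a. ALL p k. Factorial_Ring.prime p --> p ^ k dvd u --> [a = R (cls p) i j ga] (mod int (p ^ k)))"

lemma G: "u > 0 ==> Factorial_Ring.prime p ==> p ^ k dvd u ==> [G u i j ga = R (cls p) i j ga] (mod int (p ^ k))"
 using someI_ex[OF int_crt[of u "%p _. R (cls p) i j ga"]] unfolding G_def by simp

text \<open>If \<open>u\<close>-th and \<open>v\<close>-th powers lie in \<open>W\<close>, so do
  powers with exponent \<open>gcd u v\<close> by Bezout, and modulo that gcd both approximations
  agree with the same relations.\<close>

lemma G_close:
 assumes W: "W : WW" and u: "u > 0" "ALL m:carrier A. m [^]\<^bsub>A\<^esub> int u : W"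
  and v: "v > 0" "ALL m:carrier A. m [^]\<^bsub>A\<^esub> int v : W"
 shows "inv\<^bsub>A\<^esub> A.ev n y (G u i) \<otimes>\<^bsub>A\<^esub> A.ev n y (G v i) : W"
proof -
 have g: "m [^]\<^bsub>A\<^esub> int (gcd u v) : W" if m: "m : carrier A" for m
 proof -
  obtain s t where st: "s * int u + t * int v = gcd (int u) (int v)" using bezout_int by blast
  have "m [^]\<^bsub>A\<^esub> int (gcd u v) = (m [^]\<^bsub>A\<^esub> int u) [^]\<^bsub>A\<^esub> s \<otimes>\<^bsub>A\<^esub> (m [^]\<^bsub>A\<^esub> int v) [^]\<^bsub>A\<^esub> t"
   using m st by (simp add: A.int_pow_pow A.int_pow_mult[symmetric] mult.commute gcd_int_int_eq)
  then show ?thesis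
   using A.subgroup_int_pow_closed[OF Wsub[OF W]] u(2) v(2) m subgroup.m_closed[OF Wsub[OF W]] by simp
 qed
 have "A.ev n y (%j ga. G v i j ga - G u i j ga) : W"
 proof (rule exp_ev[OF W, of "int (gcd u v)"])
  show "ALL m:carrier A. m [^]\<^bsub>A\<^esub> int (gcd u v) : W" using g by blast
  fix j ga
  show "int (gcd u v) dvd G v i j ga - G u i j ga"
  proof (rule int_dvd_by_prime_powers)
   show "gcd u v > 0" using u by simp
   fix p k assume p: "Factorial_Ring.prime p" "p ^ k dvd gcd u v"
   then have "[G v i j ga = G u i j ga] (mod int (p ^ k))"
    using G[OF u(1) p(1), of k i j ga] G[OF v(1) p(1), of k i j ga] by (metis cong_sym cong_trans gcd_nat.bounded_iff)
   then show "int (p ^ k) dvd G v i j ga - G u i j ga" by (simp add: cong_iff_dvd_diff)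
  qed
 qed
 then show ?thesis using A.ev_closed[OF yA] unfolding A.ev_diff[OF yA] by (simp add: A.m_comm)
qed

text \<open>One exponent is chosen for each \<open>W\<close>; the resulting approximations are
  coherent by \<open>G_close\<close> and have a limit by compactness. A second use of
  \<open>G_close\<close> extends the congruence to all exponents.\<close>

lemma limit_ex:
 "EX r:carrier A. ALL W:WW. \<forall>u>0. (ALL m:carrier A. m [^]\<^bsub>A\<^esub> int u : W) --> inv\<^bsub>A\<^esub> A.ev n y (G u i) \<otimes>\<^bsub>A\<^esub> r : W"
proof -
 define U where "U W = (SOME u. u > 0 \<and> (ALL m:carrier A. m [^]\<^bsub>A\<^esub> int u : W))" for W
 have U: "U W > 0 \<and> (ALL m:carrier A. m [^]\<^bsub>A\<^esub> int (U W) : W)" if "W : WW" for W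
  unfolding U_def by (rule someI_ex) (use Wexp[OF that] in blast)
 have "EX z:carrier A. ALL W:WW. inv\<^bsub>A\<^esub> A.ev n y (G (U W) i) \<otimes>\<^bsub>A\<^esub> z : W"
 proof (rule Wlim)
  show "A.ev n y (G (U W) i) : carrier A" for W by (rule A.ev_closed[OF yA])
  fix W W' assume W: "W : WW" "W' : WW" "W \<subseteq> W'"
  show "inv\<^bsub>A\<^esub> A.ev n y (G (U W') i) \<otimes>\<^bsub>A\<^esub> A.ev n y (G (U W) i) : W'"
   by (rule G_close[OF W(2)]) (use U[OF W(1)] U[OF W(2)] W(3) in auto)
 qed
 then obtain z where z: "z : carrier A" "!!W. W : WW ==> inv\<^bsub>A\<^esub> A.ev n y (G (U W) i) \<otimes>\<^bsub>A\<^esub> z : W" by blast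
 have "inv\<^bsub>A\<^esub> A.ev n y (G u i) \<otimes>\<^bsub>A\<^esub> z : W"
  if W: "W : WW" and u: "u > 0" "ALL m:carrier A. m [^]\<^bsub>A\<^esub> int u : W" for W u
 proof -
  note ec = A.ev_closed[OF yA]
  have "(inv\<^bsub>A\<^esub> A.ev n y (G u i) \<otimes>\<^bsub>A\<^esub> A.ev n y (G (U W) i)) \<otimes>\<^bsub>A\<^esub> (inv\<^bsub>A\<^esub> A.ev n y (G (U W) i) \<otimes>\<^bsub>A\<^esub> z) : W"
   by (rule subgroup.m_closed[OF Wsub[OF W] G_close[OF W u] z(2)[OF W]]) (use U[OF W] in auto)
  moreover have "(inv\<^bsub>A\<^esub> A.ev n y (G u i) \<otimes>\<^bsub>A\<^esub> A.ev n y (G (U W) i)) \<otimes>\<^bsub>A\<^esub> (inv\<^bsub>A\<^esub> A.ev n y (G (U W) i) \<otimes>\<^bsub>A\<^esub> z) =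
   inv\<^bsub>A\<^esub> A.ev n y (G u i) \<otimes>\<^bsub>A\<^esub> ((A.ev n y (G (U W) i) \<otimes>\<^bsub>A\<^esub> inv\<^bsub>A\<^esub> A.ev n y (G (U W) i)) \<otimes>\<^bsub>A\<^esub> z)"
   using ec z(1) by (simp only: A.m_assoc A.inv_closed A.m_closed)
  ultimately show ?thesis using ec z(1) by simp
 qed
 then show ?thesis using z(1) by blast
qed

text \<open>Membership in \<open>W\<close> is tested prime by prime. The elements
  \<open>r^-1 gamma(r)\<close> give back \<open>r\<close> and hence its approximations; for each
  prime \<open>p\<close> these put a power, with exponent prime to \<open>p\<close>, of every
  integer relation into \<open>W\<close>; and modulo a member of \<open>WW\<close> every element of
  \<open>A\<close> is an integer combination of the \<open>y\<close>.\<close>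

lemma kernel_generated:
 assumes W: "W : WW" and r: "!!i. i : {1..n} ==> r i : carrier A"
  and lim: "!!i W u. i : {1..n} ==> W : WW ==> u > 0 ==> ALL m:carrier A. m [^]\<^bsub>A\<^esub> int u : W ==>
   inv\<^bsub>A\<^esub> A.ev n y (G u i) \<otimes>\<^bsub>A\<^esub> r i : W"
  and gen: "!!i ga. i : {1..n} ==> ga : carrier Ga ==> inv\<^bsub>A\<^esub> r i \<otimes>\<^bsub>A\<^esub> act A ga (r i) : W"
 shows "kernel A M fA \<subseteq> W"
proof
 note ec = A.ev_closed[OF yA]
 note WG = Wsub[OF W]
 obtain u where u: "u > 0" "coprime u d" "ALL m:carrier A. m [^]\<^bsub>A\<^esub> int u : W" using Wexp[OF W] by blast
 let ?g = "card (carrier Ga)"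
 have ug: "coprime ?g u" using u(2) gd by (metis coprime_commute coprime_divisors dvd_refl)
 \<comment> \<open>The product of the \<open>r^-1 gamma(r)\<close> over the group is
   \<open>r^-|Ga|\<close> times the norm of \<open>r\<close>. That norm lies in \<open>W\<close>,
   because \<open>r\<close> is a value of \<open>A.ev\<close> times an element of \<open>W\<close>
   and values of \<open>A.ev\<close> have trivial norm. So \<open>r^|Ga|\<close> lies in
   \<open>W\<close>, as does \<open>r^u\<close> with \<open>u\<close> prime to \<open>|Ga|\<close>,
   and therefore \<open>r\<close>.\<close>
 have GW: "A.ev n y (G u i) : W" if i: "i : {1..n}" for i
 proof -
  let ?w = "inv\<^bsub>A\<^esub> A.ev n y (G u i) \<otimes>\<^bsub>A\<^esub> r i"
  have w: "?w : W" by (rule lim[OF i W u(1,3)])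
  have wA: "?w : carrier A" using w subgroup.subset[OF WG] by blast
  have rw: "r i = A.ev n y (G u i) \<otimes>\<^bsub>A\<^esub> ?w" using ec[of "G u i"] r[OF i] by (simp add: A.m_assoc[symmetric])
  have actr: "act A ga (r i) : carrier A" if "ga : carrier Ga" for ga using that r[OF i] by simp
  have "finprod A (%ga. act A ga (r i)) (carrier Ga) = finprod A (%ga. act A ga (A.ev n y (G u i)) \<otimes>\<^bsub>A\<^esub> act A ga ?w) (carrier Ga)"
   by (rule A.finprod_cong) (use ec wA in \<open>simp_all add: simp_implies_def A.act_m[symmetric] rw[symmetric] actr\<close>)
  also have "\<dots> = finprod A (%ga. act A ga (A.ev n y (G u i))) (carrier Ga) \<otimes>\<^bsub>A\<^esub> finprod A (%ga. act A ga ?w) (carrier Ga)"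
   by (rule A.finprod_multf) (use ec wA in auto)
  also have "finprod A (%ga. act A ga (A.ev n y (G u i))) (carrier Ga) = \<one>\<^bsub>A\<^esub>"
  proof -
   have "A.ev1 (A.ev n y (G u i)) (%_. 1) = finprod A (%ga. act A ga (A.ev n y (G u i))) (carrier Ga)"
    unfolding A.ev1_def by (rule A.finprod_cong) (use ec in \<open>auto simp: simp_implies_def\<close>)
   then show ?thesis using ev_norm[of "G u i"] by simp
  qed
  finally have N: "finprod A (%ga. act A ga (r i)) (carrier Ga) = \<one>\<^bsub>A\<^esub> \<otimes>\<^bsub>A\<^esub> finprod A (%ga. act A ga ?w) (carrier Ga)" .
  have Nw: "finprod A (%ga. act A ga ?w) (carrier Ga) : W"
   by (rule A.finprod_subgroup[OF WG]) (use Wact[OF W _ w] in auto)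
  have NW: "finprod A (%ga. act A ga (r i)) (carrier Ga) : W"
   unfolding N using Nw subgroup.subset[OF WG] by (simp add: subsetD)
  have "finprod A (%ga. inv\<^bsub>A\<^esub> r i \<otimes>\<^bsub>A\<^esub> act A ga (r i)) (carrier Ga) =
    finprod A (%ga. inv\<^bsub>A\<^esub> r i) (carrier Ga) \<otimes>\<^bsub>A\<^esub> finprod A (%ga. act A ga (r i)) (carrier Ga)"
   by (rule A.finprod_multf) (use r[OF i] actr in auto)
  also have "finprod A (%ga. inv\<^bsub>A\<^esub> r i) (carrier Ga) = inv\<^bsub>A\<^esub> r i [^]\<^bsub>A\<^esub> ?g"
   by (rule A.finprod_const) (use r[OF i] in auto)
  finally have "inv\<^bsub>A\<^esub> r i [^]\<^bsub>A\<^esub> ?g \<otimes>\<^bsub>A\<^esub> finprod A (%ga. act A ga (r i)) (carrier Ga) : W"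
   using A.finprod_subgroup[OF WG, of "%ga. inv\<^bsub>A\<^esub> r i \<otimes>\<^bsub>A\<^esub> act A ga (r i)" "carrier Ga"] gen[OF i] by auto
  from subgroup.m_closed[OF WG this subgroup.m_inv_closed[OF WG NW]]
  have "inv\<^bsub>A\<^esub> r i [^]\<^bsub>A\<^esub> ?g : W" using r[OF i] A.finprod_closed[of "%ga. act A ga (r i)" "carrier Ga"] actr
   by (simp add: A.m_assoc Pi_iff)
  from subgroup.m_inv_closed[OF WG this] have "r i [^]\<^bsub>A\<^esub> int ?g : W" using r[OF i] by (simp add: A.nat_pow_inv int_pow_int)
  then have "r i : W" by (rule A.mem_subgroup_if_coprime_pows[OF WG r[OF i] _ _ ug]) (use u r[OF i] in blast)
  from subgroup.m_closed[OF WG this subgroup.m_inv_closed[OF WG w]]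
  show ?thesis using ec[of "G u i"] r[OF i] by (simp add: A.inv_mult A.m_lcomm[of "r i" "A.ev n y (G u i)"])
 qed
 \<comment> \<open>At the primes of \<open>cls p\<close> the vector \<open>G u\<close> agrees with
   \<open>R (cls p)\<close> modulo the powers dividing \<open>u\<close>. The factor
   \<open>et\<close> absorbs the other primes, where \<open>G u\<close> follows other
   relations.\<close>
 have spnW: "A.ev n y (%i ga. et * c i ga) : W"
  if c: "c : Gam.spn n (R (cls p))" and p: "Factorial_Ring.prime p"
   and et: "!!q k. Factorial_Ring.prime q ==> q \<notin> cls p ==> q ^ k dvd u ==> int (q ^ k) dvd et" for c p et
  using c
 proof induction
  case (spn_const c b)
  have "A.ev n y (%i ga. et * c i ga) = \<one>\<^bsub>A\<^esub>" unfolding A.ev_def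
  proof (rule A.finprod_one_eqI)
   fix i assume i: "i : {1..n}"
   have yi: "y i : carrier A" using yA i by blast
   have "A.ev1 (y i) (%ga. et * c i ga) = A.ev1 (y i) (%ga. (et * b i) * 1)"
    by (rule A.ev1_cong[OF yi]) (simp only: spn_const[OF i] mult_1_right)
   then show "A.ev1 (y i) (%ga. et * c i ga) = \<one>\<^bsub>A\<^esub>" using ynorm[OF i] by (simp only: A.ev1_scale[OF yi] A.int_pow_one)
  qed
  then show ?case using subgroup.one_closed[OF WG] by simp
 next
  case (spn_base i)
  have "A.ev n y (%j ga. et * R (cls p) i j ga - et * G u i j ga) : W"
  proof (rule exp_ev[OF W u(3)])
   fix j ga
   show "int u dvd et * R (cls p) i j ga - et * G u i j ga"
   proof (rule int_dvd_by_prime_powers[OF u(1)])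
    fix q k assume q: "Factorial_Ring.prime q" "q ^ k dvd u"
    show "int (q ^ k) dvd et * R (cls p) i j ga - et * G u i j ga"
    proof (cases "q : cls p")
     case True
     have "[R (cls p) i j ga = G u i j ga] (mod int (q ^ k))" using G[OF u(1) q, of i j ga] cls_eq[OF True] by (simp add: cong_sym)
     then have "int (q ^ k) dvd R (cls p) i j ga - G u i j ga" by (simp add: cong_iff_dvd_diff)
     then show ?thesis unfolding right_diff_distrib[symmetric] by (rule dvd_mult)
    next
     case False
     then show ?thesis unfolding right_diff_distrib[symmetric] using et[OF q(1) False q(2)] by (rule_tac dvd_mult2)
    qed
   qed
  qed
  moreover have "A.ev n y (%j ga. et * G u i j ga) : W"
   unfolding A.ev_scale[OF yA] by (rule A.subgroup_int_pow_closed[OF WG GW[OF spn_base]])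
  ultimately have "A.ev n y (%j ga. et * R (cls p) i j ga - et * G u i j ga) \<otimes>\<^bsub>A\<^esub> A.ev n y (%j ga. et * G u i j ga) : W"
   by (rule subgroup.m_closed[OF WG])
  then have "(A.ev n y (%j ga. et * R (cls p) i j ga) \<otimes>\<^bsub>A\<^esub> inv\<^bsub>A\<^esub> A.ev n y (%j ga. et * G u i j ga)) \<otimes>\<^bsub>A\<^esub> A.ev n y (%j ga. et * G u i j ga) : W"
   unfolding A.ev_diff[OF yA] .
  then show ?case using ec by (simp add: A.m_assoc)
 next
  case (spn_diff c c')
  have "A.ev n y (%i ga. et * c i ga - et * c' i ga) : W"
   unfolding A.ev_diff[OF yA] by (intro subgroup.m_closed[OF WG] subgroup.m_inv_closed[OF WG] spn_diff.IH)
  then show ?case by (simp only: right_diff_distrib)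
 next
  case (spn_shift ga c)
  have "A.ev n y (%i. Gam.sh ga (%de. et * c i de)) : W"
   unfolding A.ev_sh[OF yA spn_shift(1)] by (rule Wact[OF W spn_shift(1) spn_shift.IH])
  then show ?case by (simp only: Gam.sh_lin(3))
 qed
 fix k assume k: "k : kernel A M fA"
 have kA: "k : carrier A" using k by (simp add: kernel_def)
 let ?W0 = "W \<inter> kernel A M fA"
 have W0: "?W0 : WW" by (rule Wint[OF W fker])
 note W0G = Wsub[OF W0]
 \<comment> \<open>These are the elements of \<open>A\<close> that are values of \<open>A.ev\<close>
   modulo \<open>?W0\<close>. Among them are \<open>a^|Ga|\<close> by \<open>ya\<close> and
   \<open>a^u0\<close> by the choice of \<open>u0\<close>, hence \<open>a\<close>, hence everything
   by \<open>Wgen\<close>. Intersecting \<open>W\<close> with the kernel allows \<open>fA\<close> to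
   be applied to the congruence.\<close>
 define S where "S = {s : carrier A. EX c. inv\<^bsub>A\<^esub> A.ev n y c \<otimes>\<^bsub>A\<^esub> s : ?W0}"
 obtain u0 where u0: "u0 > 0" "coprime u0 d" "ALL m:carrier A. m [^]\<^bsub>A\<^esub> int u0 : ?W0" using Wexp[OF W0] by blast
 have ug0: "coprime ?g u0" using u0(2) gd by (metis coprime_commute coprime_divisors dvd_refl)
 have Ssub: "subgroup S A"
 proof (rule A.subgroupI)
  show "S \<subseteq> carrier A" by (auto simp: S_def)
  have "inv\<^bsub>A\<^esub> A.ev n y (%_ _. 0) \<otimes>\<^bsub>A\<^esub> \<one>\<^bsub>A\<^esub> : ?W0"
   using A.ev_zero[OF yA, of "%_ _. 0"] subgroup.one_closed[OF W0G] by simp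
  then have "\<one>\<^bsub>A\<^esub> : S" unfolding S_def by blast
  then show "S ~= {}" by blast
  fix s assume "s : S"
  then obtain c where s: "s : carrier A" and c: "inv\<^bsub>A\<^esub> A.ev n y c \<otimes>\<^bsub>A\<^esub> s : ?W0" unfolding S_def by blast
  have "A.ev n y (%i ga. (-1) * c i ga) = inv\<^bsub>A\<^esub> A.ev n y c" unfolding A.ev_scale[OF yA] using ec by (simp add: A.int_pow_neg)
  then have "inv\<^bsub>A\<^esub> A.ev n y (%i ga. (-1) * c i ga) \<otimes>\<^bsub>A\<^esub> inv\<^bsub>A\<^esub> s = inv\<^bsub>A\<^esub> (inv\<^bsub>A\<^esub> A.ev n y c \<otimes>\<^bsub>A\<^esub> s)"
   using ec s by (simp add: A.inv_mult)
  then have "inv\<^bsub>A\<^esub> A.ev n y (%i ga. (-1) * c i ga) \<otimes>\<^bsub>A\<^esub> inv\<^bsub>A\<^esub> s : ?W0" using subgroup.m_inv_closed[OF W0G c] by simp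
  then show "inv\<^bsub>A\<^esub> s : S" unfolding S_def using s by blast
  fix s' assume "s' : S"
  then obtain c' where s': "s' : carrier A" and c': "inv\<^bsub>A\<^esub> A.ev n y c' \<otimes>\<^bsub>A\<^esub> s' : ?W0" unfolding S_def by blast
  have "inv\<^bsub>A\<^esub> A.ev n y (%i ga. c i ga + c' i ga) \<otimes>\<^bsub>A\<^esub> (s \<otimes>\<^bsub>A\<^esub> s') = (inv\<^bsub>A\<^esub> A.ev n y c \<otimes>\<^bsub>A\<^esub> s) \<otimes>\<^bsub>A\<^esub> (inv\<^bsub>A\<^esub> A.ev n y c' \<otimes>\<^bsub>A\<^esub> s')"
   unfolding A.ev_add[OF yA] using ec s s' by (simp add: A.inv_mult A.m_ac)
  then have "inv\<^bsub>A\<^esub> A.ev n y (%i ga. c i ga + c' i ga) \<otimes>\<^bsub>A\<^esub> (s \<otimes>\<^bsub>A\<^esub> s') : ?W0" using subgroup.m_closed[OF W0G c c'] by simp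
  then show "s \<otimes>\<^bsub>A\<^esub> s' : S" unfolding S_def using s s' by blast
 qed
 have "carrier A \<subseteq> S"
 proof (rule Wgen[OF W0 Ssub])
  show "?W0 \<subseteq> S"
  proof
   fix s assume s: "s : ?W0"
   have sA: "s : carrier A" using s subgroup.subset[OF W0G] by blast
   have "inv\<^bsub>A\<^esub> A.ev n y (%_ _. 0) \<otimes>\<^bsub>A\<^esub> s : ?W0" using A.ev_zero[OF yA, of "%_ _. 0"] s sA by simp
   then show "s : S" unfolding S_def using sA by blast
  qed
  fix i ga de assume i: "i : {1..n}" and g: "ga : carrier Ga" "de : carrier Ga"
  have aC: "a i ga de : carrier A" by (rule aA[OF i g])
  have yi: "y i : carrier A" using yA i by blast
  let ?c = "%ga j. if j = i then Gam.delta ga else (%_. 0)"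
  have "A.ev n y (?c de) = act A de (y i)" "A.ev n y (?c ga) = act A ga (y i)"
   using A.ev_single[OF yA i] A.ev1_delta[OF yi] g by simp_all
  then have "A.ev n y (%j ep. ?c de j ep - ?c ga j ep) = a i ga de [^]\<^bsub>A\<^esub> int ?g"
   unfolding A.ev_diff[OF yA] ya[OF i g, symmetric] using yi g by (simp add: A.m_comm)
  then have "inv\<^bsub>A\<^esub> A.ev n y (%j ep. ?c de j ep - ?c ga j ep) \<otimes>\<^bsub>A\<^esub> a i ga de [^]\<^bsub>A\<^esub> int ?g : ?W0"
   using subgroup.one_closed[OF W0G] aC by simp
  then have ag: "a i ga de [^]\<^bsub>A\<^esub> int ?g : S" unfolding S_def using aC by blast
  have "a i ga de [^]\<^bsub>A\<^esub> int u0 : ?W0" using u0(3) aC by blast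
  then have "a i ga de [^]\<^bsub>A\<^esub> int u0 : S" using \<open>?W0 \<subseteq> S\<close> by blast
  with ag show "a i ga de : S" by (rule A.mem_subgroup_if_coprime_pows[OF Ssub aC _ _ ug0])
 qed
 then obtain c where c: "inv\<^bsub>A\<^esub> A.ev n y c \<otimes>\<^bsub>A\<^esub> k : ?W0" using kA unfolding S_def by blast
 have "fA (inv\<^bsub>A\<^esub> A.ev n y c \<otimes>\<^bsub>A\<^esub> k) = \<one>" using c by (simp add: kernel_def)
 then have "inv (ev n x c) = \<one>" using k ec kA ev_closed[OF xP] by (simp add: kernel_def f.hom_inv ev_f)
 then have evc: "ev n x c = \<one>" using ev_closed[OF xP] by (metis inv_inv inv_one)
 have "A.ev n y c : W"
 proof (rule A.mem_subgroup_if_coprime_powers[OF WG ec])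
  fix p :: nat assume p: "Factorial_Ring.prime p"
  have e: "\<not> int p dvd e (cls p)" and sp: "(%i ga. e (cls p) * c i ga) : Gam.spn n (R (cls p))"
  proof -
   have "p : cls p" using p by (simp add: cls_def)
   then show "\<not> int p dvd e (cls p)" using R p unfolding rels_def by blast
   show "(%i ga. e (cls p) * c i ga) : Gam.spn n (R (cls p))" using R p evc unfolding rels_def by blast
  qed
  \<comment> \<open>It has to be prime to \<open>p\<close> and divisible by the part of
    \<open>u\<close> outside \<open>cls p\<close>. For \<open>p\<close> dividing \<open>E\<close>
    this is the part of \<open>u\<close> prime to \<open>p\<close>. Otherwise the primes outside the
    class divide \<open>E\<close> and occur in \<open>u\<close> with exponent below
    \<open>u\<close>, so \<open>E^u\<close> contains them.\<close>
  define et where "et = (if p dvd E then u div p ^ multiplicity p u else E ^ u)"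
  have pet: "\<not> p dvd et"
   using p prime_not_dvd_div_multiplicity[OF u(1) p] by (auto simp: et_def dest: prime_dvd_power)
  have uet: "int (q ^ k) dvd int et" if q: "Factorial_Ring.prime q" "q \<notin> cls p" "q ^ k dvd u" for q k
  proof (cases "p dvd E")
   case True
   have "coprime (q ^ k) (p ^ multiplicity p u)" using q True p by (auto simp: cls_def intro!: coprime_power_left_iff[THEN iffD2] primes_coprime)
   moreover have "q ^ k dvd p ^ multiplicity p u * (u div p ^ multiplicity p u)"
    using q(3) by (simp add: multiplicity_dvd)
   ultimately show ?thesis unfolding int_dvd_int_iff using True by (simp add: et_def coprime_dvd_mult_right_iff)
  next
   case False
   have qE: "q dvd E" using q(1,2) False by (simp add: cls_def)
   have "k \<le> u"
   proof -
    have "k < q ^ k" using q(1) by (intro less_exp[THEN less_le_trans] power_mono) (auto simp: prime_ge_2_nat)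
    also have "q ^ k \<le> u" using q(3) u(1) by (rule dvd_imp_le)
    finally show ?thesis by simp
   qed
   then have "q ^ k dvd E ^ u" using qE by (metis dvd_power_le)
   then show ?thesis unfolding int_dvd_int_iff using False by (simp add: et_def)
  qed
  have "A.ev n y (%i ga. int et * (e (cls p) * c i ga)) : W"
   by (rule spnW[OF sp p]) (rule uet)
  then have "A.ev n y c [^]\<^bsub>A\<^esub> (int et * e (cls p)) : W"
   unfolding A.ev_scale[OF yA, symmetric] mult.assoc .
  moreover have "\<not> int p dvd int et * e (cls p)" using e pet p by (simp add: prime_dvd_mult_iff)
  ultimately show "EX t. \<not> int p dvd t \<and> A.ev n y c [^]\<^bsub>A\<^esub> t : W" by blast
 qed
 from subgroup.m_closed[OF WG this] c have "A.ev n y c \<otimes>\<^bsub>A\<^esub> (inv\<^bsub>A\<^esub> A.ev n y c \<otimes>\<^bsub>A\<^esub> k) : W" by blast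
 then show "k : W" using ec[of c] kA by (simp add: A.m_assoc[symmetric])
qed

end

theorem profinite_presentation:
 "EX r. (ALL i:{1..n}. r i : kernel A M fA) \<and>
  (ALL W:WW. (ALL i:{1..n}. ALL ga:carrier Ga. inv\<^bsub>A\<^esub> r i \<otimes>\<^bsub>A\<^esub> act A ga (r i) : W) --> kernel A M fA \<subseteq> W)"
proof -
 obtain R e where R: "rels R e" using rels_ex by blast
 define r where "r i = (SOME r. r : carrier A \<and> (ALL W:WW. \<forall>u>0. (ALL m:carrier A. m [^]\<^bsub>A\<^esub> int u : W) -->
  inv\<^bsub>A\<^esub> A.ev n y (G R u i) \<otimes>\<^bsub>A\<^esub> r : W))" for i
 have r: "r i : carrier A \<and> (ALL W:WW. \<forall>u>0. (ALL m:carrier A. m [^]\<^bsub>A\<^esub> int u : W) -->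
  inv\<^bsub>A\<^esub> A.ev n y (G R u i) \<otimes>\<^bsub>A\<^esub> r i : W)" for i
  unfolding r_def by (rule someI_ex) (use limit_ex[OF R, of i] in blast)
 \<comment> \<open>The kernel is itself a member of \<open>WW\<close> and contains all
   \<open>E\<close>-th powers, so \<open>r i\<close> is compared there with the approximation for
   \<open>u = E\<close>, which \<open>glue_kills\<close> handles.\<close>
 have EK: "ALL m:carrier A. m [^]\<^bsub>A\<^esub> int E : kernel A M fA"
  using pow_mod_E[of _ "int E" 0] by (simp add: kernel_def f.hom_int_pow)
 have "r i : kernel A M fA" if i: "i : {1..n}" for i
 proof -
  note ec = A.ev_closed[OF yA]
  have "ev n x (G R E i) = \<one>"
  proof (rule glue_kills[where R = "%p. R (cls p) i"])
   fix p j ga assume p: "Factorial_Ring.prime p" "p dvd E"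
   show "[G R E i j ga = R (cls p) i j ga] (mod int (p ^ multiplicity p E))"
    by (rule G[OF R E_pos p(1) multiplicity_dvd])
  qed (use R i in \<open>auto simp: rels_def\<close>)
  moreover have "inv\<^bsub>A\<^esub> A.ev n y (G R E i) \<otimes>\<^bsub>A\<^esub> r i : kernel A M fA" using r[of i] fker E_pos EK by blast
  ultimately show ?thesis using r[of i] ec by (simp add: kernel_def ev_f f.hom_inv)
 qed
 moreover have "kernel A M fA \<subseteq> W"
  if W: "W : WW" and g: "ALL i:{1..n}. ALL ga:carrier Ga. inv\<^bsub>A\<^esub> r i \<otimes>\<^bsub>A\<^esub> act A ga (r i) : W" for W
  by (rule kernel_generated[OF R W, of r]) (use r g in blast)+
 ultimately show ?thesis by blast
qed

end

section \<open>Topological quotients\<close>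

lemma top_quot_simps:
 "carrier (top_quot G N) = rcosets\<^bsub>G\<^esub> N"
 "mult (top_quot G N) = set_mult G"
 "one (top_quot G N) = N"
 "act (top_quot G N) = (%ga C. act G ga ` C)"
 "topo (top_quot G N) = quot_topology G N"
 by (simp_all add: top_quot_def act_quot_def monoid.defs act_group.defs top_group.defs FactGroup_def)

locale top_normal = normal N G for N :: "'a set" and G :: "('a, 'g, 'm) top_group_scheme" (structure)
begin

abbreviation "prj x \<equiv> N #> x"

lemma prj_mult: "x : carrier G ==> y : carrier G ==> prj x <#> prj y = prj (x \<otimes> y)"
 by (rule rcos_sum)

lemma prj_hom: "prj : hom G (top_quot G N)"
 by (rule homI) (auto simp: top_quot_simps prj_mult intro!: rcosetsI subset)

lemma prj_surj: "carrier (top_quot G N) = prj ` carrier G"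
 by (auto simp: top_quot_simps RCOSETS_def)

lemma quot_group: "group (top_quot G N)"
proof -
 have "group (G Mod N)" by (rule factorgroup_is_group)
 then show ?thesis
  by (simp add: group_def monoid_def group_axioms_def Units_def top_quot_simps FactGroup_def)
qed

lemma openin_quot: "openin (topo (top_quot G N)) V \<longleftrightarrow>
  V \<subseteq> carrier (top_quot G N) \<and> openin (topo G) {x : carrier G. prj x : V}"
proof -
 have "\<Union>V = {x : carrier G. prj x : V}" if V: "V \<subseteq> carrier (top_quot G N)"
 proof
  show "\<Union>V \<subseteq> {x : carrier G. prj x : V}"
  proof
   fix x assume "x : \<Union>V"
   then obtain C where C: "C : V" "x : C" by blast
   then obtain b where b: "b : carrier G" "C = prj b" using V unfolding prj_surj by blast
   have "x : carrier G" using C(2) b r_coset_subset_G[OF subset b(1)] by blast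
   moreover have "prj x = C" using repr_independence[OF _ b(1) subgroup_axioms] C(2) b by simp
   ultimately show "x : {x : carrier G. prj x : V}" using C(1) by simp
  qed
  show "{x : carrier G. prj x : V} \<subseteq> \<Union>V" using rcos_self[OF _ subgroup_axioms] by blast
 qed
 then show ?thesis
  unfolding top_quot_simps openin_quot_topology[OF is_group subgroup_axioms] by (metis top_quot_simps(1))
qed

lemma prj_ker: "x : carrier G ==> prj x = \<one>\<^bsub>top_quot G N\<^esub> \<longleftrightarrow> x : N"
 unfolding top_quot_simps using coset_join1[OF _ _ subgroup_axioms] coset_join2[OF _ subgroup_axioms] subset by blast

end

locale act_normal = group_act Ga G + top_normal N G
 for Ga :: "('g, 'z) monoid_scheme" and G :: "('a, 'g, 'm) top_group_scheme" (structure) and N :: "'a set" +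
 assumes N_act: "ga : carrier Ga ==> k : N ==> act G ga k : N"
begin

lemma prj_act:
 assumes ga: "ga : carrier Ga" and b: "b : carrier G"
 shows "act (top_quot G N) ga (prj b) = prj (act G ga b)"
 unfolding top_quot_simps
proof
 show "act G ga ` (N #> b) \<subseteq> N #> act G ga b"
  using ga b N_act subset by (auto simp: r_coset_def act_m subsetD)
 show "N #> act G ga b \<subseteq> act G ga ` (N #> b)"
 proof
  fix y assume "y : N #> act G ga b"
  then obtain k where k: "k : N" "y = k \<otimes> act G ga b" by (auto simp: r_coset_def)
  let ?k = "act G (inv\<^bsub>Ga\<^esub> ga) k"
  have kG: "k : carrier G" using k subset by blast
  have "act G ga ?k = k" using kG ga act_mult[of ga "inv\<^bsub>Ga\<^esub> ga" k] by (simp add: act_one)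
  then have "y = act G ga (?k \<otimes> b)" using k kG ga b by (simp add: act_m)
  moreover have "?k : N" using k ga by (simp add: N_act)
  then have "?k \<otimes> b : N #> b" by (auto simp: r_coset_def)
  ultimately show "y : act G ga ` (N #> b)" by blast
 qed
qed

lemma quot_act: "group_act Ga (top_quot G N)"
proof -
 interpret Q: group "top_quot G N" by (rule quot_group)
 show ?thesis
 proof
  fix ga assume ga: "ga : carrier Ga"
  show "act (top_quot G N) ga : hom (top_quot G N) (top_quot G N)"
  proof (rule homI)
   fix v w assume "v : carrier (top_quot G N)" "w : carrier (top_quot G N)"
   then obtain x y where x: "x : carrier G" "v = prj x" and y: "y : carrier G" "w = prj y" unfolding prj_surj by blast
   show "act (top_quot G N) ga v : carrier (top_quot G N)"
    unfolding x(2) prj_act[OF ga x(1)] using ga x(1) by (simp add: prj_surj)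
   have "act (top_quot G N) ga (prj (x \<otimes> y)) = prj (act G ga x \<otimes> act G ga y)"
    using ga x y by (simp add: prj_act act_m)
   then show "act (top_quot G N) ga (v \<otimes>\<^bsub>top_quot G N\<^esub> w) =
     act (top_quot G N) ga v \<otimes>\<^bsub>top_quot G N\<^esub> act (top_quot G N) ga w"
    unfolding x(2) y(2) top_quot_simps(2) prj_mult[OF x(1) y(1)] prj_act[OF ga x(1)] prj_act[OF ga y(1)]
    using ga x y by (simp add: prj_mult)
  qed
  fix de v assume de: "de : carrier Ga" and "v : carrier (top_quot G N)"
  then obtain x where x: "x : carrier G" "v = prj x" unfolding prj_surj by blast
  show "act (top_quot G N) (ga \<otimes>\<^bsub>Ga\<^esub> de) v = act (top_quot G N) ga (act (top_quot G N) de v)"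
   unfolding x(2) using ga de x(1) by (simp add: prj_act act_mult)
 next
  fix v assume "v : carrier (top_quot G N)"
  then obtain x where x: "x : carrier G" "v = prj x" unfolding prj_surj by blast
  show "act (top_quot G N) \<one>\<^bsub>Ga\<^esub> v = v" unfolding x(2) using x(1) by (simp add: prj_act act_one)
 qed
qed

end

text \<open>Cauchy's theorem, taken from Sylow's with exponent \<open>1\<close>: a prime dividing
  the order is the order of an element and so divides \<open>u\<close>.\<close>

lemma (in group) exponent_coprime_order:
 assumes fin: "finite (carrier G)" and u: "!!x. x : carrier G ==> x [^] (u::nat) = \<one>" and "coprime u d"
 shows "coprime (Coset.order G) d"
proof (rule ccontr)
 assume "\<not> coprime (Coset.order G) d"
 then obtain q where q: "Factorial_Ring.prime q" "q dvd Coset.order G" "q dvd d"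
  by (metis coprime_iff_gcd_eq_1 gcd_nat.bounded_iff gcd_unique_nat prime_factor_nat dvd_refl)
 then obtain m where m: "Coset.order G = q ^ 1 * m" by auto
 obtain H where H: "subgroup H G" "card H = q ^ 1" using sylow_thm[OF q(1) is_group m fin] by blast
 have "card H > 1" using H(2) q(1) prime_gt_1_nat by simp
 then obtain h where h: "h : H" "h ~= \<one>" using subgroup.one_closed[OF H(1)]
  by (metis One_nat_def card_1_singleton_iff is_singletonI' is_singleton_altdef less_irrefl empty_iff)
 have hG: "h : carrier G" using h subgroup.subset[OF H(1)] by blast
 interpret H: group "G\<lparr>carrier := H\<rparr>" by (rule subgroup.subgroup_is_group[OF H(1) is_group])
 have "h [^]\<^bsub>G\<lparr>carrier := H\<rparr>\<^esub> Coset.order (G\<lparr>carrier := H\<rparr>) = \<one>" using H.pow_order_eq_1[of h] h by simp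
 then have "h [^] q = \<one>" using H(2) by (simp add: Coset.order_def nat_pow_consistent[symmetric])
 then have "ord h dvd q" using hG by (simp add: pow_eq_id)
 moreover have "ord h dvd u" using u[OF hG] hG by (simp add: pow_eq_id)
 moreover have "coprime q u" using assms(3) q(3) by (metis coprime_commute coprime_divisors dvd_refl)
 ultimately have "ord h = 1" by (metis coprime_common_divisor_nat)
 then show False using h(2) hG by (metis pow_ord_eq_1 nat_pow_one nat_pow_eone)
qed

section \<open>Abelianised prime-to-\<open>d\<close> quotients\<close>

lemma (in group) finite_image_rcosets:
 assumes "subgroup U G" and fin: "finite (rcosets U)"
  and f: "!!x u. x : carrier G ==> u : U ==> f (u \<otimes> x) = f x"
 shows "finite (f ` carrier G)"
proof (rule finite_subset)
 show "f ` carrier G \<subseteq> (%C. f (SOME x. x : C)) ` (rcosets U)"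
 proof
  fix v assume "v : f ` carrier G"
  then obtain x where x: "x : carrier G" "v = f x" by blast
  have "x : U #> x" using rcos_self[OF x(1) assms(1)] .
  then have "(SOME z. z : U #> x) : U #> x" by (rule someI)
  then obtain u where u: "u : U" "(SOME z. z : U #> x) = u \<otimes> x" by (auto simp: r_coset_def)
  have "v = f (SOME z. z : U #> x)" unfolding u(2) x(2) using f[OF x(1) u(1)] by simp
  moreover have "U #> x : rcosets U" using x(1) by (auto simp: RCOSETS_def)
  ultimately show "v : (%C. f (SOME x. x : C)) ` (rcosets U)" by blast
 qed
qed (simp add: fin)

text \<open>A compact group whose open sets are the unions of cosets of a base \<open>UU\<close> of
  stable normal subgroups of finite index; \<open>open_iff\<close> takes the place of the axioms of
  a topological group, and \<open>gen_min\<close> says that \<open>gen\<close> generates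
  topologically.\<close>

locale profin = group_act Ga G
 for Ga :: "('g, 'z) monoid_scheme" and G :: "('c, 'g, 'm) top_group_scheme" (structure) +
 fixes UU :: "'c set set" and gen :: "'c set" and d :: nat
 assumes UN: "U : UU ==> U \<lhd> G"
  and UU_ne: "UU ~= {}"
  and Uact: "U : UU ==> ga : carrier Ga ==> u : U ==> act G ga u : U"
  and Ufin: "U : UU ==> finite (rcosets U)"
  and open_iff: "openin (topo G) V \<longleftrightarrow> V \<subseteq> carrier G \<and> (ALL x:V. EX U:UU. U #> x \<subseteq> V)"
  and compact: "compact_space (topo G)"
  and gen: "gen \<subseteq> carrier G"
  and gen_min: "subgroup H G ==> closedin (topo G) H ==> gen \<subseteq> H ==> carrier G \<subseteq> H"
begin

lemma Usub: "U : UU ==> subgroup U G"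
 using UN by (rule normal_imp_subgroup)


lemma Usubset: "U : UU ==> U \<subseteq> carrier G"
 using Usub by (rule subgroup.subset)

lemma coset_in: "U : UU ==> x : carrier G ==> U #> x \<subseteq> carrier G"
 using Usubset by (rule r_coset_subset_G)

lemma self_in: "U : UU ==> x : carrier G ==> x : U #> x"
 using Usub by (intro rcos_self)

lemma topsp: "topspace (topo G) = carrier G"
proof
 show "topspace (topo G) \<subseteq> carrier G" using openin_topspace[of "topo G"] unfolding open_iff by blast
 have "openin (topo G) (carrier G)" unfolding open_iff using UU_ne coset_in by blast
 then show "carrier G \<subseteq> topspace (topo G)" by (rule openin_subset)
qed

lemma closed_iff: "closedin (topo G) C \<longleftrightarrow> C \<subseteq> carrier G \<and> (ALL x:carrier G - C. EX U:UU. (U #> x) \<inter> C = {})"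
proof -
 have "(U #> x \<subseteq> carrier G - C) \<longleftrightarrow> (U #> x) \<inter> C = {}" if "U : UU" "x : carrier G" for U x
  using coset_in[OF that] by blast
 then show ?thesis unfolding closedin_def topsp open_iff by blast
qed

lemma saturated:
 assumes U: "U : UU" and C: "C \<subseteq> carrier G" "!!u x. u : U ==> x : C ==> u \<otimes> x : C"
 shows "openin (topo G) C" "closedin (topo G) C"
proof -
 show "openin (topo G) C" unfolding open_iff
 proof (intro conjI ballI C(1))
  fix x assume "x : C"
  then have "U #> x \<subseteq> C" using C(2) by (auto simp: r_coset_def)
  then show "EX U:UU. U #> x \<subseteq> C" using U by (rule bexI)
 qed
 show "closedin (topo G) C" unfolding closed_iff
 proof (intro conjI ballI C(1))
  fix x assume x: "x : carrier G - C"
  have "(U #> x) \<inter> C = {}"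
  proof (rule ccontr)
   assume "(U #> x) \<inter> C ~= {}"
   then obtain u where u: "u : U" "u \<otimes> x : C" by (auto simp: r_coset_def)
   have "inv u \<otimes> (u \<otimes> x) : C" by (rule C(2)[OF subgroup.m_inv_closed[OF Usub[OF U] u(1)] u(2)])
   then show False using u(1) x Usubset[OF U] by (auto simp: m_assoc[symmetric])
  qed
  then show "EX U:UU. (U #> x) \<inter> C = {}" using U by blast
 qed
qed

lemma open_subgroup:
 assumes "subgroup W G" "openin (topo G) W"
 shows "EX U:UU. U \<subseteq> W"
proof -
 have "\<one> : W" by (rule subgroup.one_closed[OF assms(1)])
 then obtain U where U: "U : UU" "U #> \<one> \<subseteq> W" using assms(2) unfolding open_iff by blast
 have "U #> \<one> = U" using Usubset[OF U(1)] by (rule coset_mult_one)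
 then show ?thesis using U by blast
qed

lemma subgroup_open:
 assumes "subgroup W G" "U : UU" "U \<subseteq> W"
 shows "openin (topo G) W" "closedin (topo G) W"
 using saturated[OF assms(2) subgroup.subset[OF assms(1)]] subgroup.m_closed[OF assms(1)] assms(3) by blast+

lemma Uexp:
 assumes U: "U : UU"
 shows "\<exists>u>0. ALL x:carrier G. x [^] (u::nat) : U"
proof -
 interpret U: normal U G by (rule UN[OF U])
 interpret Q: group "G Mod U" by (rule U.factorgroup_is_group)
 let ?u = "Coset.order (G Mod U)"
 have "carrier (G Mod U) = rcosets U" by (simp add: FactGroup_def)
 then have pos: "?u > 0" using Q.order_gt_0_iff_finite Ufin[OF U] by simp
 have "x [^] ?u : U" if x: "x : carrier G" for x
 proof -
  have h: "(%x. U #> x) : hom G (G Mod U)" by (rule U.r_coset_hom_Mod)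
  interpret h: group_hom G "G Mod U" "%x. U #> x" by (intro group_hom.intro group_hom_axioms.intro h is_group Q.is_group)
  have "U #> (x [^] ?u) = (U #> x) [^]\<^bsub>G Mod U\<^esub> ?u" by (rule h.hom_nat_pow[OF x])
  also have "\<dots> = \<one>\<^bsub>G Mod U\<^esub>" by (rule Q.pow_order_eq_1) (use x in \<open>auto simp: FactGroup_def RCOSETS_def\<close>)
  finally have "U #> (x [^] ?u) = U" by (simp add: FactGroup_def)
  then show ?thesis using rcos_self[OF nat_pow_closed[OF x, of ?u] U.subgroup_axioms] by simp
 qed
 then show ?thesis using pos by blast
qed

lemma pow_mult_mem:
 assumes W: "subgroup W G" and x: "x : carrier G" and "x [^] (u::nat) : W"
 shows "x [^] (u * v) : W" "x [^] (v * u) : W"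
proof -
 have "(x [^] u) [^] v : W" using subgroup_int_pow_closed[OF W assms(3), of "int v"] by (simp add: int_pow_int)
 then show "x [^] (u * v) : W" "x [^] (v * u) : W" using x by (simp_all add: nat_pow_pow mult.commute)
qed

section \<open>The closed commutator subgroup and the abelianisation\<close>

definition D0 where "D0 = Abstract_Topology.closure_of (topo G) (derived G (carrier G))"

text \<open>The basic neighbourhoods of \<open>x\<close> are the cosets \<open>U #> x\<close>.
  Expressing the closure through them makes the proofs that \<open>D0\<close> is normal and stable
  purely algebraic.\<close>

lemma D0_iff: "x : D0 \<longleftrightarrow> x : carrier G \<and> (ALL U:UU. EX u:U. u \<otimes> x : derived G (carrier G))"
proof
 assume x: "x : D0"
 then have xG: "x : carrier G" using topsp by (simp add: D0_def in_closure_of)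
 have "EX u:U. u \<otimes> x : derived G (carrier G)" if U: "U : UU" for U
 proof -
  have "openin (topo G) (U #> x)"
   by (rule saturated(1)[OF U coset_in[OF U xG]])
    (use subgroup.m_closed[OF Usub[OF U]] Usubset[OF U] xG in \<open>auto simp: r_coset_def m_assoc[symmetric] subset_iff intro!: bexI\<close>)
  then obtain y where "y : derived G (carrier G)" "y : U #> x"
   using x self_in[OF U xG] unfolding D0_def in_closure_of by blast
  then show ?thesis by (auto simp: r_coset_def)
 qed
 then show "x : carrier G \<and> (ALL U:UU. EX u:U. u \<otimes> x : derived G (carrier G))" using xG by blast
next
 assume x: "x : carrier G \<and> (ALL U:UU. EX u:U. u \<otimes> x : derived G (carrier G))"
 show "x : D0" unfolding D0_def in_closure_of
 proof (intro conjI allI impI)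
  show "x : topspace (topo G)" using x topsp by simp
  fix T assume "x : T \<and> openin (topo G) T"
  then obtain U where U: "U : UU" "U #> x \<subseteq> T" unfolding open_iff by blast
  then obtain u where "u : U" "u \<otimes> x : derived G (carrier G)" using x by blast
  then show "EX y. y : derived G (carrier G) \<and> y : T" using U(2) by (auto simp: r_coset_def)
 qed
qed

lemma derived_act: "ga : carrier Ga ==> s : derived G (carrier G) ==> act G ga s : derived G (carrier G)"
 unfolding derived_def
proof (rule_tac generate.induct[of s G])
 assume ga: "ga : carrier Ga" and s: "s : generate G (derived_set G (carrier G))"
 let ?S = "derived_set G (carrier G)"
 have SG: "?S \<subseteq> carrier G" by auto
 have gG: "generate G ?S \<subseteq> carrier G" by (rule generate_incl[OF SG])
 have key: "act G ga h : ?S" if "h : ?S" for h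
  using that ga by (auto simp: act_m act_inv intro!: bexI)
 show "s : generate G ?S" by (rule s)
 show "act G ga \<one> : generate G ?S" using ga generate.one by simp
 show "act G ga h : generate G ?S" if "h : ?S" for h by (rule generate.incl[OF key[OF that]])
 show "act G ga (inv h) : generate G ?S" if h: "h : ?S" for h
  using generate.inv[OF key[OF h]] act_inv[OF ga, of h] h SG by auto
 show "act G ga (h1 \<otimes> h2) : generate G ?S"
  if "h1 : generate G ?S" "act G ga h1 : generate G ?S" "h2 : generate G ?S" "act G ga h2 : generate G ?S" for h1 h2
 proof -
  have "h1 : carrier G" "h2 : carrier G" using that(1,3) gG by blast+
  then show ?thesis using generate.eng[OF that(2,4)] by (simp add: act_m[OF ga])
 qed
qed

lemma D0_normal: "D0 \<lhd> G"
proof -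
 interpret S: normal "derived G (carrier G)" G by (rule derived_self_is_normal)
 have "subgroup D0 G"
 proof (rule subgroupI)
  show "D0 \<subseteq> carrier G" using D0_iff by blast
  have "\<one> : D0" unfolding D0_iff
   using subgroup.one_closed[OF Usub] S.one_closed by (auto intro!: bexI[of _ \<one>])
  then show "D0 ~= {}" by blast
  fix x assume x: "x : D0"
  then have xG: "x : carrier G" using D0_iff by blast
  have "EX u:U. u \<otimes> inv x : derived G (carrier G)" if U: "U : UU" for U
  proof -
   obtain u where u: "u : U" "u \<otimes> x : derived G (carrier G)" using x U unfolding D0_iff by blast
   have uG: "u : carrier G" using u(1) Usubset[OF U] by blast
   have "inv x \<otimes> inv u \<otimes> inv (inv x) : U"
    by (rule normal.inv_op_closed2[OF UN[OF U]]) (use xG subgroup.m_inv_closed[OF Usub[OF U] u(1)] in auto)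
   moreover have "(inv x \<otimes> inv u \<otimes> inv (inv x)) \<otimes> inv x = inv (u \<otimes> x)" using xG uG by (simp add: inv_mult_group m_assoc)
   ultimately show ?thesis using S.m_inv_closed[OF u(2)] by (intro bexI[of _ "inv x \<otimes> inv u \<otimes> inv (inv x)"]) auto
  qed
  then show "inv x : D0" unfolding D0_iff using xG by blast
  fix y assume y: "y : D0"
  then have yG: "y : carrier G" using D0_iff by blast
  have "EX u:U. u \<otimes> (x \<otimes> y) : derived G (carrier G)" if U: "U : UU" for U
  proof -
   obtain u where u: "u : U" "u \<otimes> x : derived G (carrier G)" using x U unfolding D0_iff by blast
   obtain v where v: "v : U" "v \<otimes> y : derived G (carrier G)" using y U unfolding D0_iff by blast
   have uG: "u : carrier G" "v : carrier G" using u(1) v(1) Usubset[OF U] by auto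
   have "u \<otimes> (x \<otimes> v \<otimes> inv x) : U"
    by (rule subgroup.m_closed[OF Usub[OF U] u(1) normal.inv_op_closed2[OF UN[OF U] xG v(1)]])
   moreover have "(u \<otimes> (x \<otimes> v \<otimes> inv x)) \<otimes> (x \<otimes> y) = (u \<otimes> x) \<otimes> (v \<otimes> y)"
   proof -
    have "inv x \<otimes> (x \<otimes> y) = y" using xG yG by (simp add: m_assoc[symmetric])
    then show ?thesis using xG yG uG by (simp add: m_assoc)
   qed
   ultimately show ?thesis using S.m_closed[OF u(2) v(2)] by (intro bexI[of _ "u \<otimes> (x \<otimes> v \<otimes> inv x)"]) auto
  qed
  then show "x \<otimes> y : D0" unfolding D0_iff using xG yG by blast
 qed
 moreover have "g \<otimes> x \<otimes> inv g : D0" if g: "g : carrier G" and x: "x : D0" for g x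
 proof -
  have xG: "x : carrier G" using x D0_iff by blast
  have "EX u:U. u \<otimes> (g \<otimes> x \<otimes> inv g) : derived G (carrier G)" if U: "U : UU" for U
  proof -
   obtain u where u: "u : U" "u \<otimes> x : derived G (carrier G)" using x U unfolding D0_iff by blast
   have uG: "u : carrier G" using u(1) Usubset[OF U] by blast
   have "(g \<otimes> u \<otimes> inv g) \<otimes> (g \<otimes> x \<otimes> inv g) = g \<otimes> (u \<otimes> x) \<otimes> inv g"
   proof -
    have "inv g \<otimes> (g \<otimes> (x \<otimes> inv g)) = x \<otimes> inv g" using xG g by (simp add: m_assoc[symmetric])
    then show ?thesis using xG g uG by (simp add: m_assoc)
   qed
   then show ?thesis using S.inv_op_closed2[OF g u(2)] normal.inv_op_closed2[OF UN[OF U] g u(1)]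
    by (intro bexI[of _ "g \<otimes> u \<otimes> inv g"]) auto
  qed
  then show ?thesis unfolding D0_iff using xG g by blast
 qed
 ultimately show ?thesis by (simp add: normal_inv_iff)
qed

lemma D0_act: "ga : carrier Ga ==> x : D0 ==> act G ga x : D0"
proof -
 assume ga: "ga : carrier Ga" and x: "x : D0"
 have xG: "x : carrier G" using x D0_iff by blast
 have "EX u:U. u \<otimes> act G ga x : derived G (carrier G)" if U: "U : UU" for U
 proof -
  obtain u where u: "u : U" "u \<otimes> x : derived G (carrier G)" using x U unfolding D0_iff by blast
  have "u : carrier G" using u(1) Usubset[OF U] by blast
  then have "act G ga u \<otimes> act G ga x = act G ga (u \<otimes> x)" using ga xG by (simp add: act_m)
  then show ?thesis using derived_act[OF ga u(2)] Uact[OF U ga u(1)] by (intro bexI[of _ "act G ga u"]) auto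
 qed
 then show ?thesis unfolding D0_iff using xG ga by simp
qed

lemma derived_D0: "derived G (carrier G) \<subseteq> D0"
proof
 fix s assume s: "s : derived G (carrier G)"
 have sG: "s : carrier G" using s subgroup.subset[OF normal_imp_subgroup[OF derived_self_is_normal]] by blast
 show "s : D0" unfolding D0_iff using s sG subgroup.one_closed[OF Usub] by (auto intro!: bexI[of _ \<one>])
qed

lemma D0_closed_min:
 assumes W: "subgroup W G" "openin (topo G) W" and "derived G (carrier G) \<subseteq> W"
 shows "D0 \<subseteq> W"
proof
 fix x assume x: "x : D0"
 obtain U where U: "U : UU" "U \<subseteq> W" using open_subgroup[OF W] by blast
 have xG: "x : carrier G" using x D0_iff by blast
 obtain u where u: "u : U" "u \<otimes> x : derived G (carrier G)" using x U unfolding D0_iff by blast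
 have "inv u \<otimes> (u \<otimes> x) : W"
  by (rule subgroup.m_closed[OF W(1) subgroup.m_inv_closed[OF W(1) subsetD[OF U(2) u(1)]] subsetD[OF assms(3) u(2)]])
 moreover have "u : carrier G" using u(1) Usubset[OF U(1)] by blast
 then have "inv u \<otimes> (u \<otimes> x) = x" using xG by (simp add: m_assoc[symmetric])
 ultimately show "x : W" by simp
qed

sublocale A0: act_normal Ga G D0
 by (intro act_normal.intro top_normal.intro act_normal_axioms.intro D0_normal group_act_axioms D0_act)

abbreviation "A0 \<equiv> abelianization G"

lemma A0_def: "A0 = top_quot G D0" by (simp add: abelianization_def D0_def)

lemma A0_comm: "comm_group A0"
proof -
 interpret Q: group A0 unfolding A0_def by (rule A0.quot_group)
 show ?thesis
 proof (rule Q.group_comm_groupI)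
  fix v w assume "v : carrier A0" "w : carrier A0"
  then obtain x y where x: "x : carrier G" "v = D0 #> x" and y: "y : carrier G" "w = D0 #> y"
   unfolding A0_def A0.prj_surj by blast
  have "x \<otimes> y \<otimes> inv x \<otimes> inv y : derived_set G (carrier G)" using x y by auto
  then have "x \<otimes> y \<otimes> inv x \<otimes> inv y : D0" using derived_D0 unfolding derived_def by (blast intro: generate.incl)
  moreover have "x \<otimes> y = (x \<otimes> y \<otimes> inv x \<otimes> inv y) \<otimes> (y \<otimes> x)"
  proof -
   have "inv x \<otimes> (inv y \<otimes> (y \<otimes> x)) = \<one>" using x(1) y(1) by (simp add: m_assoc[symmetric])
   then show ?thesis using x(1) y(1) by (simp add: m_assoc)
  qed
  ultimately have "x \<otimes> y : D0 #> (y \<otimes> x)" unfolding r_coset_def by blast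
  then have "D0 #> (x \<otimes> y) = D0 #> (y \<otimes> x)"
   using repr_independence[OF _ _ A0.subgroup_axioms, of "x \<otimes> y" "y \<otimes> x"] x(1) y(1) by simp
  then show "v \<otimes>\<^bsub>A0\<^esub> w = w \<otimes>\<^bsub>A0\<^esub> v"
   unfolding A0_def top_quot_simps x(2) y(2) using x(1) y(1) by (simp add: A0.prj_mult)
 qed
qed

text \<open>The open subgroups containing the closed commutator subgroup whose quotient has exponent
  prime to \<open>d\<close>. Their intersection \<open>Kr\<close> turns out to be the kernel of the
  projection to the prime-to-\<open>d\<close> abelianised quotient. Exponents are preferred to
  orders because they pass directly to preimages and finite intersections.\<close>

definition GG :: "'c set set" where
 "GG = {W. subgroup W G \<and> openin (topo G) W \<and> D0 \<subseteq> W \<and> (\<exists>u>0. coprime u d \<and> (ALL x:carrier G. x [^] (u::nat) : W))}"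

definition Kr :: "'c set" where "Kr = \<Inter>GG"

lemma carrier_GG: "carrier G : GG"
 unfolding GG_def using subgroup_self openin_topspace[of "topo G"] topsp A0.subset by (auto intro!: exI[of _ "1::nat"])

definition NF where "NF = {N. N \<lhd> A0 \<and> closedin (topo A0) N \<and> order_coprime (top_quot A0 N) d}"

lemma finite_image:
 assumes W: "subgroup W G" "openin (topo G) W" and f: "!!x w. x : carrier G ==> w : W ==> f (w \<otimes> x) = f x"
 shows "finite (f ` carrier G)"
proof -
 obtain U where U: "U : UU" "U \<subseteq> W" using open_subgroup[OF W] by blast
 show ?thesis by (rule finite_image_rcosets[OF Usub[OF U(1)] Ufin[OF U(1)]]) (use f U(2) in blast)
qed

lemma subset_derived: "W : GG ==> subgroup W G" "W : GG ==> openin (topo G) W" "W : GG ==> D0 \<subseteq> W"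
 by (auto simp: GG_def)

lemma top_normal_A0: "N \<lhd> A0 ==> top_normal N A0"
 by (rule top_normal.intro)

lemma openin_A0: "openin (topo A0) V \<longleftrightarrow> V \<subseteq> carrier A0 \<and> openin (topo G) {x : carrier G. D0 #> x : V}"
 unfolding A0_def by (rule A0.openin_quot)

lemma A0_surj: "carrier A0 = (%x. D0 #> x) ` carrier G"
 unfolding A0_def by (rule A0.prj_surj)

lemma A0_hom: "group_hom G A0 (%x. D0 #> x)"
 using comm_group.axioms(2)[OF A0_comm] A0.prj_hom
 by (simp add: A0_def group_hom_def group_hom_axioms_def is_group)

lemma topspace_A0: "topspace (topo A0) = carrier A0"
proof
 show "topspace (topo A0) \<subseteq> carrier A0" using openin_topspace[of "topo A0"] unfolding openin_A0 by blast
 have "{x : carrier G. D0 #> x : carrier A0} = carrier G" unfolding A0_surj by blast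
 then have "openin (topo A0) (carrier A0)" unfolding openin_A0 using openin_topspace[of "topo G"] topsp by simp
 then show "carrier A0 \<subseteq> topspace (topo A0)" by (rule openin_subset)
qed

context
 fixes N assumes N: "N \<lhd> A0"
begin

interpretation N: top_normal N A0 by (rule top_normal_A0[OF N])

lemma quot_comm: "comm_group (top_quot A0 N)"
proof -
 interpret A: comm_group A0 by (rule A0_comm)
 interpret Q: group "top_quot A0 N" by (rule N.quot_group)
 show ?thesis
 proof (rule Q.group_comm_groupI)
  fix v w assume "v : carrier (top_quot A0 N)" "w : carrier (top_quot A0 N)"
  then obtain x y where x: "x : carrier A0" "v = N.prj x" and y: "y : carrier A0" "w = N.prj y"
   unfolding N.prj_surj by blast
  show "v \<otimes>\<^bsub>top_quot A0 N\<^esub> w = w \<otimes>\<^bsub>top_quot A0 N\<^esub> v"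
   unfolding top_quot_simps x(2) y(2) N.prj_mult[OF x(1) y(1)] N.prj_mult[OF y(1) x(1)] using x(1) y(1) by (simp add: A.m_comm)
 qed
qed

definition qq where "qq x = N #>\<^bsub>A0\<^esub> (D0 #> x)"

lemma qq_hom: "group_hom G (top_quot A0 N) qq"
proof -
 interpret h: group_hom G A0 "%x. D0 #> x" by (rule A0_hom)
 have "(%x. N #>\<^bsub>A0\<^esub> x) \<circ> (%x. D0 #> x) : hom G (top_quot A0 N)"
  by (rule Group.hom_compose[OF h.homh N.prj_hom])
 then show ?thesis using N.quot_group by (simp add: group_hom_def group_hom_axioms_def is_group qq_def[abs_def] comp_def)
qed

lemma qq_surj: "carrier (top_quot A0 N) = qq ` carrier G"
 unfolding N.prj_surj A0_surj qq_def by blast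

lemma qq_one: "x : carrier G ==> qq x = \<one>\<^bsub>top_quot A0 N\<^esub> \<longleftrightarrow> D0 #> x : N"
 unfolding qq_def by (rule N.prj_ker) (simp add: A0_surj)

lemma openin_qq: "openin (topo (top_quot A0 N)) V \<longleftrightarrow> V \<subseteq> carrier (top_quot A0 N) \<and> openin (topo G) {x : carrier G. qq x : V}"
proof -
 have "{x : carrier G. D0 #> x : {z : carrier A0. N #>\<^bsub>A0\<^esub> z : V}} = {x : carrier G. qq x : V}"
  unfolding qq_def A0_surj by blast
 then show ?thesis unfolding N.openin_quot openin_A0 by auto
qed

end

text \<open>The quotient by the image of \<open>W\<close> is finite and killed by \<open>u\<close>,
  so all its quotients have order prime to \<open>d\<close>.\<close>

lemma GG_in_NF:
 assumes W: "W : GG"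
 shows "(%x. D0 #> x) ` W : NF"
proof -
 note Ws = subset_derived(1)[OF W] and Wo = subset_derived(2)[OF W] and WD = subset_derived(3)[OF W]
 obtain u where u: "u > 0" "coprime u d" "ALL x:carrier G. x [^] (u::nat) : W" using W unfolding GG_def by blast
 let ?N = "(%x. D0 #> x) ` W"
 interpret A: comm_group A0 by (rule A0_comm)
 interpret h: group_hom G A0 "%x. D0 #> x" by (rule A0_hom)
 have sub: "subgroup ?N A0" by (rule h.subgroup_img_is_subgroup[OF Ws])
 then have N: "?N \<lhd> A0" by (simp add: A.normal_iff_subgroup)
 have mem: "D0 #> x : ?N \<longleftrightarrow> x : W" if x: "x : carrier G" for x
 proof
  assume "D0 #> x : ?N"
  then obtain w where w: "w : W" "D0 #> x = D0 #> w" by blast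
  then have "x : D0 #> w" using rcos_self[OF x A0.subgroup_axioms] by simp
  then show "x : W" using w(1) WD subgroup.m_closed[OF Ws] by (auto simp: r_coset_def)
 qed blast
 obtain U where U: "U : UU" "U \<subseteq> W" using open_subgroup[OF Ws Wo] by blast
 have "{x : carrier G. D0 #> x : carrier A0 - ?N} = carrier G - W"
  using mem unfolding A0_surj by blast
 moreover have "openin (topo G) (carrier G - W)"
  using subgroup_open(2)[OF Ws U] by (simp add: closedin_def topsp)
 ultimately have cl: "closedin (topo A0) ?N"
  unfolding closedin_def topspace_A0 openin_A0 using subgroup.subset[OF sub] by auto
 interpret Q: comm_group "top_quot A0 ?N" by (rule quot_comm[OF N])
 interpret q: group_hom G "top_quot A0 ?N" "qq ?N" by (rule qq_hom[OF N])
 have oc: "order_coprime (top_quot A0 ?N) d" unfolding order_coprime_def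
 proof (intro allI impI)
  fix V assume V: "subgroup V (top_quot A0 ?N) \<and> openin (topo (top_quot A0 ?N)) V"
  have "V \<lhd> top_quot A0 ?N" using V by (simp add: Q.normal_iff_subgroup)
  then interpret V: normal V "top_quot A0 ?N" .
  interpret QV: group "top_quot A0 ?N Mod V" by (rule V.factorgroup_is_group)
  let ?f = "%x. V #>\<^bsub>top_quot A0 ?N\<^esub> qq ?N x"
  have car: "carrier (top_quot A0 ?N Mod V) = ?f ` carrier G"
   unfolding FactGroup_def RCOSETS_def qq_surj[OF N] by auto
  have hV: "group_hom (top_quot A0 ?N) (top_quot A0 ?N Mod V) (%z. V #>\<^bsub>top_quot A0 ?N\<^esub> z)"
   using V.r_coset_hom_Mod by (simp add: group_hom_def group_hom_axioms_def Q.is_group QV.is_group)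
  interpret hV: group_hom "top_quot A0 ?N" "top_quot A0 ?N Mod V" "%z. V #>\<^bsub>top_quot A0 ?N\<^esub> z" by (rule hV)
  have q1: "qq ?N w = \<one>\<^bsub>top_quot A0 ?N\<^esub>" if "w : W" for w
   using qq_one[OF N, of w] that subgroup.subset[OF Ws] by blast
  have "finite (carrier (top_quot A0 ?N Mod V))" unfolding car
  proof (rule finite_image[OF Ws Wo])
   fix x w assume x: "x : carrier G" and w: "w : W"
   have "w : carrier G" using w subgroup.subset[OF Ws] by blast
   then show "?f (w \<otimes> x) = ?f x" using q1[OF w] x by simp
  qed
  moreover have "z [^]\<^bsub>top_quot A0 ?N Mod V\<^esub> u = \<one>\<^bsub>top_quot A0 ?N Mod V\<^esub>" if z: "z : carrier (top_quot A0 ?N Mod V)" for z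
  proof -
   obtain x where x: "x : carrier G" "z = ?f x" using z unfolding car by blast
   have "z [^]\<^bsub>top_quot A0 ?N Mod V\<^esub> u = ?f (x [^] u)"
    unfolding x(2) using x(1) by (simp add: hV.hom_nat_pow q.hom_nat_pow)
   also have "\<dots> = \<one>\<^bsub>top_quot A0 ?N Mod V\<^esub>" using q1 u(3) x(1) hV.hom_one by simp
   finally show ?thesis .
  qed
  ultimately have "coprime (Coset.order (top_quot A0 ?N Mod V)) d" using QV.exponent_coprime_order u(2) by blast
  then show "coprime (card (rcosets\<^bsub>top_quot A0 ?N\<^esub> V)) d" by (simp add: Coset.order_def FactGroup_def)
 qed
 show ?thesis unfolding NF_def using N cl oc by blast
qed

text \<open>If the coset of \<open>x\<close> were not in the closed subgroup \<open>N\<close>, some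
  \<open>U #> x\<close> would miss the preimage \<open>?K\<close> of \<open>N\<close>. The product
  of \<open>U\<close> and \<open>?K\<close> is an open subgroup with quotient of exponent prime to
  \<open>d\<close>, so it belongs to \<open>GG\<close> and contains \<open>x\<close>, which makes
  \<open>U #> x\<close> meet \<open>?K\<close> after all.\<close>

lemma Kr_in_NF:
 assumes x: "x : Kr" and N: "N : NF"
 shows "D0 #> x : N"
proof (rule ccontr)
 assume n: "D0 #> x \<notin> N"
 have xG: "x : carrier G" using x carrier_GG unfolding Kr_def by blast
 have Nn: "N \<lhd> A0" and Nc: "closedin (topo A0) N" and No: "order_coprime (top_quot A0 N) d"
  using N unfolding NF_def by blast+
 interpret A: comm_group A0 by (rule A0_comm)
 interpret h: group_hom G A0 "%x. D0 #> x" by (rule A0_hom)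
 interpret Q: comm_group "top_quot A0 N" by (rule quot_comm[OF Nn])
 interpret q: group_hom G "top_quot A0 N" "qq N" by (rule qq_hom[OF Nn])
 let ?K = "{z : carrier G. D0 #> z : N}"
 have Ker: "?K = kernel G (top_quot A0 N) (qq N)" using qq_one[OF Nn] unfolding kernel_def by blast
 have Ks: "subgroup ?K G" unfolding Ker by (rule q.subgroup_kernel)
 have "{z : carrier G. D0 #> z : topspace (topo A0) - N} = carrier G - ?K"
  unfolding topspace_A0 A0_surj by blast
 then have "openin (topo G) (carrier G - ?K)" using Nc unfolding closedin_def openin_A0 by simp
 then obtain U where U: "U : UU" "U #> x \<subseteq> carrier G - ?K" unfolding open_iff using xG n by blast
 define W where "W = U <#> ?K"
 have Ws: "subgroup W G" unfolding W_def by (rule mult_norm_subgroup[OF UN[OF U(1)] Ks])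
 have UW: "U \<subseteq> W" unfolding W_def set_mult_def
 proof
  fix u assume u: "u : U"
  then have "u = u \<otimes> \<one>" using Usubset[OF U(1)] by auto
  then show "u : (\<Union>h\<in>U. \<Union>k\<in>?K. {h \<otimes> k})" using u subgroup.one_closed[OF Ks] by blast
 qed
 have KW: "?K \<subseteq> W" unfolding W_def set_mult_def
 proof
  fix k assume k: "k : ?K"
  then have "k = \<one> \<otimes> k" by auto
  then show "k : (\<Union>h\<in>U. \<Union>k\<in>?K. {h \<otimes> k})" using k subgroup.one_closed[OF Usub[OF U(1)]] by blast
 qed
 have D0W: "D0 \<subseteq> W"
 proof -
  have "z : ?K" if z: "z : D0" for z
  proof -
   have zG: "z : carrier G" using z A0.subset by blast
   have "D0 #> z = D0" using z by (rule A0.rcos_const[OF is_group])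
   also have "D0 = \<one>\<^bsub>A0\<^esub>" by (simp add: A0_def top_quot_simps)
   finally show ?thesis using zG subgroup.one_closed[OF normal_imp_subgroup[OF Nn]] by simp
  qed
  then show ?thesis using KW by blast
 qed
 note Wo = subgroup_open(1)[OF Ws U(1) UW]
 let ?V = "qq N ` W"
 have Vs: "subgroup ?V (top_quot A0 N)" by (rule q.subgroup_img_is_subgroup[OF Ws])
 have memV: "z : W" if z: "z : carrier G" "qq N z : ?V" for z
 proof -
  obtain w where w: "w : W" "qq N z = qq N w" using z(2) by blast
  have wG: "w : carrier G" using w(1) subgroup.subset[OF Ws] by blast
  have "qq N (z \<otimes> inv w) = \<one>\<^bsub>top_quot A0 N\<^esub>" using w(2) wG z(1) by (simp add: q.hom_inv)
  then have "z \<otimes> inv w : W" using qq_one[OF Nn, of "z \<otimes> inv w"] wG z(1) KW by auto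
  from subgroup.m_closed[OF Ws this w(1)] show ?thesis using wG z(1) by (simp add: m_assoc)
 qed
 have "{z : carrier G. qq N z : ?V} = W" using memV subgroup.subset[OF Ws] by blast
 then have Vo: "openin (topo (top_quot A0 N)) ?V"
  unfolding openin_qq[OF Nn] using subgroup.subset[OF Vs] Wo by simp
 let ?c = "card (rcosets\<^bsub>top_quot A0 N\<^esub> ?V)"
 have cop: "coprime ?c d" using No Vs Vo unfolding order_coprime_def by blast
 have "?V \<lhd> top_quot A0 N" using Vs by (simp add: Q.normal_iff_subgroup)
 then interpret V: normal ?V "top_quot A0 N" .
 interpret QV: group "top_quot A0 N Mod ?V" by (rule V.factorgroup_is_group)
 have hV: "group_hom (top_quot A0 N) (top_quot A0 N Mod ?V) (%z. ?V #>\<^bsub>top_quot A0 N\<^esub> z)"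
  using V.r_coset_hom_Mod by (simp add: group_hom_def group_hom_axioms_def Q.is_group QV.is_group)
 interpret hV: group_hom "top_quot A0 N" "top_quot A0 N Mod ?V" "%z. ?V #>\<^bsub>top_quot A0 N\<^esub> z" by (rule hV)
 have cW: "z [^] ?c : W" if z: "z : carrier G" for z
 proof -
  have c: "?c = Coset.order (top_quot A0 N Mod ?V)" by (simp add: Coset.order_def FactGroup_def)
  have "?V #>\<^bsub>top_quot A0 N\<^esub> (qq N (z [^] ?c)) = (?V #>\<^bsub>top_quot A0 N\<^esub> qq N z) [^]\<^bsub>top_quot A0 N Mod ?V\<^esub> ?c"
   using z by (simp add: q.hom_nat_pow hV.hom_nat_pow)
  also have "\<dots> = ?V" unfolding c
   using QV.pow_order_eq_1[OF hV.hom_closed[OF q.hom_closed[OF z]]] by (simp add: FactGroup_def)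
  finally have "?V #>\<^bsub>top_quot A0 N\<^esub> (qq N (z [^] ?c)) = ?V" .
  then have "qq N (z [^] ?c) : ?V"
   using Q.rcos_self[OF q.hom_closed[OF nat_pow_closed[OF z, of ?c]] Vs] by simp
  then show ?thesis by (rule memV[OF nat_pow_closed[OF z]])
 qed
 have "\<exists>u>0. coprime u d \<and> (ALL x:carrier G. x [^] (u::nat) : W)"
 \<comment> \<open>\<open>card\<close> of an infinite set is \<open>0\<close>, which is prime to
   \<open>d\<close> only if \<open>d = 1\<close>; then any positive exponent will do, and
   \<open>Uexp\<close> provides one.\<close>
 proof (cases "?c = 0")
  case False
  then show ?thesis using cop cW by blast
 next
  case True
  then have "d = 1" using cop by simp
  obtain u where "u > 0" "ALL x:carrier G. x [^] (u::nat) : U" using Uexp[OF U(1)] by blast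
  then show ?thesis using UW \<open>d = 1\<close> by auto
 qed
 then have "W : GG" unfolding GG_def using Ws Wo D0W by blast
 then have "x : W" using x unfolding Kr_def by blast
 then obtain u k where uk: "u : U" "k : ?K" "x = u \<otimes> k" unfolding W_def set_mult_def by blast
 have uG: "u : carrier G" using uk(1) Usubset[OF U(1)] by blast
 have "k = inv u \<otimes> x" using uk uG by (simp add: m_assoc[symmetric])
 then have "k : U #> x" using subgroup.m_inv_closed[OF Usub[OF U(1)] uk(1)] by (auto simp: r_coset_def)
 then show False using U(2) uk(2) by blast
qed

definition N0 where "N0 = \<Inter>NF"

text \<open>\<open>GG_in_NF\<close> and \<open>Kr_in_NF\<close> give the two directions. The
  quotient consists of cosets of cosets; this description lets its elements be treated as images of
  elements of \<open>G\<close> under a map with kernel \<open>Kr\<close>.\<close>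

lemma N0_iff: "x : carrier G ==> D0 #> x : N0 \<longleftrightarrow> x : Kr"
proof
 assume x: "x : carrier G" and "D0 #> x : N0"
 then have *: "D0 #> x : (%x. D0 #> x) ` W" if "W : GG" for W using GG_in_NF[OF that] unfolding N0_def by blast
 have "x : W" if W: "W : GG" for W
 proof -
  obtain w where w: "w : W" "D0 #> x = D0 #> w" using *[OF W] by blast
  then have "x : D0 #> w" using rcos_self[OF x A0.subgroup_axioms] by simp
  then show "x : W" using w(1) subset_derived[OF W] subgroup.m_closed[of W G] by (auto simp: r_coset_def)
 qed
 then show "x : Kr" unfolding Kr_def by blast
qed (use Kr_in_NF in \<open>auto simp: N0_def\<close>)

lemma prime_to_quot_A0: "prime_to_quot d A0 = top_quot A0 N0"
 by (simp add: prime_to_quot_def N0_def NF_def)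

end

context profin
begin

lemma Kr_subset: "Kr \<subseteq> carrier G" using carrier_GG unfolding Kr_def by blast

lemma Kr_act:
 assumes ga: "ga : carrier Ga" and x: "x : Kr"
 shows "act G ga x : Kr"
 unfolding Kr_def
proof (rule InterI)
 fix W assume W: "W : GG"
 let ?W = "{x : carrier G. act G ga x : W}"
 note Ws = subset_derived(1)[OF W]
 have sub: "subgroup ?W G"
  by (rule subgroupI) (use ga subgroup.one_closed[OF Ws] subgroup.m_inv_closed[OF Ws] subgroup.m_closed[OF Ws]
    in \<open>auto simp: act_inv act_m intro!: exI[of _ \<one>]\<close>)
 obtain U where U: "U : UU" "U \<subseteq> W" using open_subgroup[OF Ws subset_derived(2)[OF W]] by blast
 have "U \<subseteq> ?W" using U Uact[OF U(1) ga] Usubset[OF U(1)] by blast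
 then have "openin (topo G) ?W" by (rule subgroup_open(1)[OF sub U(1)])
 moreover have "D0 \<subseteq> ?W" using D0_act[OF ga] subset_derived(3)[OF W] A0.subset by blast
 moreover obtain u where u: "u > 0" "coprime u d" "ALL x:carrier G. x [^] (u::nat) : W" using W unfolding GG_def by blast
 have "x [^] u : ?W" if "x : carrier G" for x
 proof -
  have "act G ga (x [^] u) = act G ga x [^] u" using group_hom.hom_nat_pow[OF act_group_hom[OF ga] that] .
  then show ?thesis using u(3) ga that by simp
 qed
 ultimately have "?W : GG" unfolding GG_def using sub u(1,2) by blast
 then show "act G ga x : W" using x unfolding Kr_def by blast
qed

abbreviation "kq \<equiv> qq N0"
abbreviation "AA \<equiv> prime_to_quot d A0"

lemma N0_normal: "N0 \<lhd> A0"
proof -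
 interpret A: comm_group A0 by (rule A0_comm)
 have "NF ~= {}" using GG_in_NF[OF carrier_GG] by blast
 then have "subgroup N0 A0" unfolding N0_def
  by (intro A.subgroups_Inter) (auto simp: NF_def normal_imp_subgroup)
 then show ?thesis by (simp add: A.normal_iff_subgroup)
qed

lemma A0_act: "group_act Ga A0" unfolding A0_def by (rule A0.quot_act)

lemma A0_prj_act: "ga : carrier Ga ==> x : carrier G ==> act A0 ga (D0 #> x) = D0 #> act G ga x"
 unfolding A0_def by (rule A0.prj_act)

lemma N0_act: "act_normal Ga A0 N0"
proof (intro act_normal.intro top_normal.intro act_normal_axioms.intro N0_normal A0_act)
 fix ga k assume ga: "ga : carrier Ga" and k: "k : N0"
 have "k : carrier A0" using k normal_imp_subgroup[OF N0_normal] subgroup.subset by blast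
 then obtain x where x: "x : carrier G" "k = D0 #> x" unfolding A0_surj by blast
 have "x : Kr" using k x N0_iff by blast
 then have "act G ga x : Kr" by (rule Kr_act[OF ga])
 then show "act A0 ga k : N0" unfolding x(2) A0_prj_act[OF ga x(1)] using N0_iff x(1) ga by simp
qed

lemma AA_comm: "comm_group AA" unfolding prime_to_quot_A0 by (rule quot_comm[OF N0_normal])
lemma AA_act: "group_act Ga AA" unfolding prime_to_quot_A0 by (rule act_normal.quot_act[OF N0_act])
lemma kq_hom: "group_hom G AA kq" unfolding prime_to_quot_A0 by (rule qq_hom[OF N0_normal])
lemma kq_surj: "carrier AA = kq ` carrier G" unfolding prime_to_quot_A0 by (rule qq_surj[OF N0_normal])
lemma kq_one: "x : carrier G ==> kq x = \<one>\<^bsub>AA\<^esub> \<longleftrightarrow> x : Kr"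
 unfolding prime_to_quot_A0 using qq_one[OF N0_normal] N0_iff by simp
lemma openin_AA: "openin (topo AA) V \<longleftrightarrow> V \<subseteq> carrier AA \<and> openin (topo G) {x : carrier G. kq x : V}"
 unfolding prime_to_quot_A0 by (rule openin_qq[OF N0_normal])

lemma kq_act:
 assumes "ga : carrier Ga" "x : carrier G"
 shows "act AA ga (kq x) = kq (act G ga x)"
proof -
 have "D0 #> x : carrier A0" using assms by (simp add: A0_surj)
 from act_normal.prj_act[OF N0_act assms(1) this] show ?thesis
  unfolding prime_to_quot_A0 qq_def[OF N0_normal] A0_prj_act[OF assms] .
qed

interpretation AA: comm_group AA by (rule AA_comm)
interpretation AA: group_act Ga AA by (rule AA_act)
interpretation kq: group_hom G AA kq by (rule kq_hom)

lemma topspace_AA: "topspace (topo AA) = carrier AA"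
proof
 show "topspace (topo AA) \<subseteq> carrier AA" using openin_topspace[of "topo AA"] unfolding openin_AA by blast
 have "{x : carrier G. kq x : carrier AA} = carrier G" by auto
 then have "openin (topo AA) (carrier AA)" unfolding openin_AA using openin_topspace[of "topo G"] topsp by simp
 then show "carrier AA \<subseteq> topspace (topo AA)" by (rule openin_subset)
qed

section \<open>Open stable subgroups of the prime-to-\<open>d\<close> abelianised quotient\<close>

definition WW where
 "WW = {W. subgroup W AA \<and> openin (topo AA) W \<and> (ALL ga:carrier Ga. ALL w:W. act AA ga w : W)}"

definition pre where "pre W = {x : carrier G. kq x : W}"

lemma pre_sub: "subgroup W AA ==> subgroup (pre W) G"
 unfolding pre_def
 by (rule subgroupI) (auto simp: kq.hom_inv subgroup.one_closed subgroup.m_inv_closed subgroup.m_closed intro!: exI[of _ \<one>])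

lemma WW_D: "W : WW ==> subgroup W AA" "W : WW ==> openin (topo G) (pre W)"
 "W : WW ==> ga : carrier Ga ==> w : W ==> act AA ga w : W"
 by (auto simp: WW_def openin_AA pre_def)

lemma WW_int: "W : WW ==> W' : WW ==> W \<inter> W' : WW"
 unfolding WW_def by (auto intro: AA.subgroups_Inter_pair)

text \<open>The members of \<open>GG\<close> intersect in \<open>Kr\<close>, which lies in the
  preimage of \<open>W\<close>. By compactness finitely many of them already intersect inside that
  preimage, and the product of their exponents works.\<close>

lemma WW_exp:
 assumes W: "W : WW"
 shows "\<exists>u>0. coprime u d \<and> (ALL m:carrier AA. m [^]\<^bsub>AA\<^esub> int u : W)"
proof -
 let ?W = "pre W"
 note Ws = pre_sub[OF WW_D(1)[OF W]]
 have KW: "Kr \<subseteq> ?W"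
 proof
  fix x assume x: "x : Kr"
  then have xG: "x : carrier G" using Kr_subset by blast
  then have "kq x = \<one>\<^bsub>AA\<^esub>" using x kq_one by blast
  then show "x : ?W" using xG subgroup.one_closed[OF WW_D(1)[OF W]] unfolding pre_def by simp
 qed
 have "closedin (topo G) (carrier G - ?W)"
  using WW_D(2)[OF W] topsp by (metis openin_closedin_eq)
 then have comp: "compactin (topo G) (carrier G - ?W)" using compact by (rule closedin_compact_space[rotated])
 let ?C = "(%V. carrier G - V) ` GG"
 have "openin (topo G) C" if "C : ?C" for C
 proof -
  obtain V where V: "V : GG" "C = carrier G - V" using \<open>C : ?C\<close> by blast
  obtain U where U: "U : UU" "U \<subseteq> V" using open_subgroup[OF subset_derived(1,2)[OF V(1)]] by blast
  show ?thesis unfolding V(2) using subgroup_open(2)[OF subset_derived(1)[OF V(1)] U] by (simp add: closedin_def topsp)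
 qed
 moreover have "carrier G - ?W \<subseteq> \<Union>?C" using KW unfolding Kr_def by blast
 ultimately obtain F where F: "finite F" "F \<subseteq> ?C" "carrier G - ?W \<subseteq> \<Union>F" using compactinD[OF comp, of ?C] by blast
 obtain H where H: "finite H" "H \<subseteq> GG" "F = (%V. carrier G - V) ` H" using finite_subset_image[OF F(1,2)] by blast
 have "\<exists>u>0. coprime u d \<and> (ALL x:carrier G. ALL V:H. x [^] (u::nat) : V)" using H(1,2)
 proof (induction H rule: finite_induct)
  case empty
  show ?case by (rule exI[of _ 1]) simp
 next
  case (insert V H)
  have VH: "V : GG" "H \<subseteq> GG" using insert.prems by simp_all
  obtain u where u: "u > 0" "coprime u d" "ALL x:carrier G. ALL V:H. x [^] (u::nat) : V"
   using insert.IH[OF VH(2)] by (elim exE conjE)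
  obtain v where v: "v > 0" "coprime v d" "ALL x:carrier G. x [^] (v::nat) : V"
   using VH(1) unfolding GG_def by (elim CollectE exE conjE)
  have "ALL x:carrier G. ALL V':insert V H. x [^] (u * v) : V'"
  proof (intro ballI)
   fix x V' assume x: "x : carrier G" and V': "V' : insert V H"
   have "subgroup V' G" using V' insert.prems subset_derived(1) by blast
   then show "x [^] (u * v) : V'" using V' u(3) v(3) x pow_mult_mem[of V' x] by blast
  qed
  then show ?case using u(1,2) v(1,2) by (intro exI[of _ "u * v"]) simp
 qed
 then obtain u where u: "u > 0" "coprime u d" "!!x V. x : carrier G ==> V : H ==> x [^] (u::nat) : V" by blast
 have "m [^]\<^bsub>AA\<^esub> int u : W" if m: "m : carrier AA" for m
 proof -
  obtain x where x: "x : carrier G" "m = kq x" using m unfolding kq_surj by (rule imageE)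
  have "x [^] u : ?W"
  proof (rule ccontr)
   assume "x [^] u \<notin> ?W"
   then have "x [^] u : \<Union>F" using F(3) x(1) by blast
   then show False using u(3)[OF x(1)] unfolding H(3) by blast
  qed
  then show ?thesis using x by (simp add: pre_def kq.hom_nat_pow int_pow_int)
 qed
 then show ?thesis using u(1,2) by (intro exI[of _ u]) simp
qed

lemma WW_gen:
 assumes W: "W : WW" and S: "subgroup S AA" "W \<subseteq> S" "kq ` gen \<subseteq> S"
 shows "carrier AA \<subseteq> S"
proof -
 obtain U where U: "U : UU" "U \<subseteq> pre W" using open_subgroup[OF pre_sub[OF WW_D(1)[OF W]] WW_D(2)[OF W]] by blast
 have "U \<subseteq> pre S" using U(2) S(2) unfolding pre_def by blast
 then have "carrier G \<subseteq> pre S"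
  using gen S(3) by (intro gen_min[OF pre_sub[OF S(1)] subgroup_open(2)[OF pre_sub[OF S(1)] U(1)]]) (auto simp: pre_def)
 then show ?thesis unfolding kq_surj pre_def by blast
qed

text \<open>The product of \<open>H\<close> with the image of a small member of the base is open and
  stable and still misses \<open>z\<close>. So closed stable subgroups are intersections of members
  of \<open>WW\<close>.\<close>

lemma WW_sep:
 assumes H: "subgroup H AA" "closedin (topo AA) H" "!!ga h. ga : carrier Ga ==> h : H ==> act AA ga h : H"
  and z: "z : carrier AA" "z \<notin> H"
 shows "EX W:WW. H \<subseteq> W \<and> z \<notin> W"
proof -
 obtain x where x: "x : carrier G" "z = kq x" using z(1) unfolding kq_surj by blast
 have "{x : carrier G. kq x : topspace (topo AA) - H} = carrier G - pre H"
  unfolding topspace_AA pre_def by auto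
 then have "openin (topo G) (carrier G - pre H)" using H(2) unfolding closedin_def openin_AA by simp
 then obtain U where U: "U : UU" "U #> x \<subseteq> carrier G - pre H" unfolding open_iff using x z(2) by (auto simp: pre_def)
 define W where "W = kq ` U <#>\<^bsub>AA\<^esub> H"
 have KUs: "subgroup (kq ` U) AA" by (rule kq.subgroup_img_is_subgroup[OF Usub[OF U(1)]])
 have "kq ` U \<lhd> AA" using KUs by (simp add: AA.normal_iff_subgroup)
 then have Ws: "subgroup W AA" unfolding W_def by (rule AA.mult_norm_subgroup[OF _ H(1)])
 have HA: "H \<subseteq> carrier AA" using H(1) by (rule subgroup.subset)
 have UW: "kq ` U \<subseteq> W"
 proof
  fix u assume u: "u : kq ` U"
  then have "u = u \<otimes>\<^bsub>AA\<^esub> \<one>\<^bsub>AA\<^esub>" using subgroup.subset[OF KUs] by auto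
  then show "u : W" unfolding W_def set_mult_def using u subgroup.one_closed[OF H(1)] by blast
 qed
 have HW: "H \<subseteq> W"
 proof
  fix h assume h: "h : H"
  then have "h = \<one>\<^bsub>AA\<^esub> \<otimes>\<^bsub>AA\<^esub> h" using HA by auto
  then show "h : W" unfolding W_def set_mult_def using h subgroup.one_closed[OF KUs] by blast
 qed
 have "U \<subseteq> pre W" using UW Usubset[OF U(1)] unfolding pre_def by blast
 then have "openin (topo G) (pre W)" by (rule subgroup_open(1)[OF pre_sub[OF Ws] U(1)])
 then have Wo: "openin (topo AA) W" unfolding openin_AA pre_def using subgroup.subset[OF Ws] by simp
 have "act AA ga w : W" if ga: "ga : carrier Ga" and w: "w : W" for ga w
 proof -
  obtain u h where uh: "u : U" "h : H" "w = kq u \<otimes>\<^bsub>AA\<^esub> h" using w unfolding W_def set_mult_def by blast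
  have uG: "u : carrier G" using uh(1) Usubset[OF U(1)] by blast
  have "act AA ga w = kq (act G ga u) \<otimes>\<^bsub>AA\<^esub> act AA ga h"
   unfolding uh(3) using ga uG uh(2) HA by (simp add: AA.act_m kq_act subsetD)
  then show ?thesis unfolding W_def set_mult_def using Uact[OF U(1) ga uh(1)] H(3)[OF ga uh(2)] by blast
 qed
 moreover have "z \<notin> W"
 proof
  assume "z : W"
  then obtain u h where uh: "u : U" "h : H" "kq x = kq u \<otimes>\<^bsub>AA\<^esub> h" unfolding W_def set_mult_def x(2) by blast
  have uG: "u : carrier G" using uh(1) Usubset[OF U(1)] by blast
  have "kq (inv u \<otimes> x) = inv\<^bsub>AA\<^esub> kq u \<otimes>\<^bsub>AA\<^esub> (kq u \<otimes>\<^bsub>AA\<^esub> h)" using uG x(1) uh(3) by (simp add: kq.hom_inv)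
  also have "\<dots> = h" using uG uh(2) HA by (simp add: AA.m_assoc[symmetric] subsetD)
  finally have "inv u \<otimes> x : pre H" using uG x(1) uh(2) by (simp add: pre_def)
  moreover have "inv u \<otimes> x : U #> x" using subgroup.m_inv_closed[OF Usub[OF U(1)] uh(1)] by (auto simp: r_coset_def)
  ultimately show False using U(2) by blast
 qed
 ultimately show ?thesis using Ws Wo HW unfolding WW_def by blast
qed

lemma carrier_WW: "carrier AA : WW"
proof -
 have "openin (topo AA) (carrier AA)" using openin_topspace[of "topo AA"] unfolding topspace_AA .
 then show ?thesis unfolding WW_def using AA.subgroup_self by simp
qed

text \<open>The preimages in \<open>G\<close> of the prescribed cosets are closed. Finitely many
  members of \<open>WW\<close> contain a common one \<open>W0\<close>, and a preimage of
  \<open>c W0\<close> lies in all their sets, so the finite intersection property applies.\<close>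

lemma WW_lim:
 assumes c: "!!W. W : WW ==> c W : carrier AA"
  and cc: "!!W W'. W : WW ==> W' : WW ==> W \<subseteq> W' ==> inv\<^bsub>AA\<^esub> c W' \<otimes>\<^bsub>AA\<^esub> c W : W'"
 shows "EX z:carrier AA. ALL W:WW. inv\<^bsub>AA\<^esub> c W \<otimes>\<^bsub>AA\<^esub> z : W"
proof -
 let ?C = "%W. {x : carrier G. inv\<^bsub>AA\<^esub> c W \<otimes>\<^bsub>AA\<^esub> kq x : W}"
 have cl: "closedin (topo G) (?C W)" if W: "W : WW" for W
 proof -
  note Ws = WW_D(1)[OF W]
  obtain U where U: "U : UU" "U \<subseteq> pre W" using open_subgroup[OF pre_sub[OF Ws] WW_D(2)[OF W]] by blast
  show ?thesis
  proof (rule saturated(2)[OF U(1)])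
   fix u x assume u: "u : U" and x: "x : ?C W"
   have uG: "u : carrier G" "kq u : W" using u U by (auto simp: pre_def)
   have "kq u \<otimes>\<^bsub>AA\<^esub> (inv\<^bsub>AA\<^esub> c W \<otimes>\<^bsub>AA\<^esub> kq x) : W" using x by (intro subgroup.m_closed[OF Ws uG(2)]) simp
   then show "u \<otimes> x : ?C W" using uG(1) x c[OF W] by (simp add: AA.m_lcomm)
  qed blast
 qed
 have fin: "\<Inter>(?C ` F) ~= {} \<and> (EX W0:WW. ALL W:F. W0 \<subseteq> W)" if "finite F" "F \<subseteq> WW" for F
 proof -
  have "EX W0:WW. ALL W:F. W0 \<subseteq> W" using that
  proof (induction F rule: finite_induct)
   case empty
   then show ?case using carrier_WW by blast
  next
   case (insert W F)
   then obtain W0 where "W0 : WW" "ALL W:F. W0 \<subseteq> W" by blast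
   then show ?case using WW_int[of W0 W] insert.prems by blast
  qed
  then obtain W0 where W0: "W0 : WW" "ALL W:F. W0 \<subseteq> W" by blast
  obtain x where x: "x : carrier G" "c W0 = kq x" using c[OF W0(1)] unfolding kq_surj by blast
  have "x : ?C W" if W: "W : F" for W
  proof -
   have "inv\<^bsub>AA\<^esub> c W \<otimes>\<^bsub>AA\<^esub> c W0 : W" by (rule cc[OF W0(1)]) (use W W0(2) \<open>F \<subseteq> WW\<close> in auto)
   then show ?thesis using x by simp
  qed
  then show ?thesis using W0 by blast
 qed
 have "\<Inter>(?C ` WW) ~= {}"
 proof -
  have "ALL C:?C ` WW. closedin (topo G) C" using cl by blast
  moreover have "\<Inter>F ~= {}" if F: "finite F" "F \<subseteq> ?C ` WW" for F
  proof -
   obtain H where "finite H" "H \<subseteq> WW" "F = ?C ` H" using finite_subset_image[OF F] by blast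
   then show ?thesis using fin by blast
  qed
  ultimately show ?thesis using compact unfolding compact_space_fip by meson
 qed
 then obtain x where x: "x : \<Inter>(?C ` WW)" by blast
 have xC: "x : ?C W" if W: "W : WW" for W by (rule InterD[OF x imageI[OF W]])
 from xC[OF carrier_WW] have "kq x : carrier AA" by simp
 moreover have "ALL W:WW. inv\<^bsub>AA\<^esub> c W \<otimes>\<^bsub>AA\<^esub> kq x : W"
 proof
  fix W assume "W : WW"
  from xC[OF this] show "inv\<^bsub>AA\<^esub> c W \<otimes>\<^bsub>AA\<^esub> kq x : W" by (elim CollectE conjE)
 qed
 ultimately show ?thesis by (rule bexI[rotated])
qed

lemma WW_closed: "W : WW ==> closedin (topo AA) W"
proof -
 assume W: "W : WW"
 note Ws = WW_D(1)[OF W]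
 obtain U where U: "U : UU" "U \<subseteq> pre W" using open_subgroup[OF pre_sub[OF Ws] WW_D(2)[OF W]] by blast
 have "{x : carrier G. kq x : carrier AA - W} = carrier G - pre W" by (auto simp: pre_def)
 moreover have "openin (topo G) (carrier G - pre W)"
  using subgroup_open(2)[OF pre_sub[OF Ws] U] by (simp add: closedin_def topsp)
 ultimately show ?thesis unfolding closedin_def topspace_AA openin_AA using subgroup.subset[OF Ws] by simp
qed

end

text \<open>The elements \<open>ag i ga de\<close> stand for \<open>x_{i,ga}^-1 x_{i,de}\<close>.
  The map \<open>f\<close> is built from \<open>|Ga|\<close>-th roots \<open>s i\<close> of the
  generators \<open>x i\<close>, because \<open>y i\<close> is a product of \<open>|Ga|\<close> such
  quotients and goes to \<open>s i ^ |Ga|\<close> times the inverse norm of \<open>s i\<close>, that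
  is, to \<open>x i\<close>.\<close>

locale profin_presentation = P: presentation Ga M d n x + profin Ga G UU gen d
 for Ga :: "'g monoid" and M :: "('a, 'g, 'm) act_group_scheme"
  and d n :: nat and x :: "nat => 'a" and G :: "('c, 'g, 'l) top_group_scheme" (structure)
  and UU gen +
 fixes ag :: "nat => 'g => 'g => 'c" and s :: "nat => 'a" and f :: "'c => 'a"
 assumes gd: "card (carrier Ga) dvd d"
  and agG: "i : {1..n} ==> ga : carrier Ga ==> de : carrier Ga ==> ag i ga de : carrier G"
  and gen_ag: "gen \<subseteq> {ag i ga de | i ga de. i : {1..n} \<and> ga : carrier Ga \<and> de : carrier Ga}"
  and ag_act: "i : {1..n} ==> be : carrier Ga ==> ga : carrier Ga ==> de : carrier Ga ==>
   act G be (ag i ga de) = ag i (be \<otimes>\<^bsub>Ga\<^esub> ga) (be \<otimes>\<^bsub>Ga\<^esub> de)"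
  and ag_mult: "i : {1..n} ==> ga : carrier Ga ==> de : carrier Ga ==> ep : carrier Ga ==>
   ag i ga de \<otimes> ag i de ep = ag i ga ep"
  and f_hom: "f : hom G M"
  and f_act: "ga : carrier Ga ==> z : carrier G ==> f (act G ga z) = act M ga (f z)"
  and f_ker: "openin (topo G) (kernel G M f)"
  and sM: "i : {1..n} ==> s i : carrier M"
  and s_pow: "i : {1..n} ==> s i [^]\<^bsub>M\<^esub> card (carrier Ga) = x i"
  and f_ag: "i : {1..n} ==> ga : carrier Ga ==> de : carrier Ga ==>
   f (ag i ga de) = inv\<^bsub>M\<^esub> (act M ga (s i)) \<otimes>\<^bsub>M\<^esub> act M de (s i)"
begin

interpretation AA: comm_group AA by (rule AA_comm)
interpretation AA: group_act Ga AA by (rule AA_act)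
interpretation AA: mod_act Ga AA
 by (intro mod_act.intro AA_comm AA_act P.Gam.fin_group_axioms)
interpretation kq: group_hom G AA kq by (rule kq_hom)
interpretation f: group_hom G M f by (intro group_hom.intro group_hom_axioms.intro f_hom is_group P.is_group)

text \<open>The kernel of \<open>f\<close> is open, and its quotient is abelian of exponent dividing
  the order of \<open>M\<close>, so it is one of the subgroups in \<open>GG\<close>.\<close>

lemma Kr_kernel: "Kr \<subseteq> kernel G M f"
proof -
 let ?K = "kernel G M f"
 have sub: "subgroup ?K G" by (rule f.subgroup_kernel)
 have "h1 \<otimes> h2 \<otimes> inv h1 \<otimes> inv h2 : ?K" if h: "h1 : carrier G" "h2 : carrier G" for h1 h2
 proof -
  have "f h2 \<otimes>\<^bsub>M\<^esub> (inv\<^bsub>M\<^esub> f h1 \<otimes>\<^bsub>M\<^esub> inv\<^bsub>M\<^esub> f h2) = inv\<^bsub>M\<^esub> f h1"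
   using h P.m_lcomm[of "f h2" "inv\<^bsub>M\<^esub> f h1" "inv\<^bsub>M\<^esub> f h2"] by simp
  then have "f (h1 \<otimes> h2 \<otimes> inv h1 \<otimes> inv h2) = \<one>\<^bsub>M\<^esub>" using h by (simp add: f.hom_inv P.m_assoc)
  then show ?thesis using h by (simp add: kernel_def)
 qed
 then have "derived G (carrier G) \<subseteq> ?K" unfolding derived_def by (intro generate_subgroup_incl[OF _ sub]) blast
 then have "D0 \<subseteq> ?K" by (rule D0_closed_min[OF sub f_ker])
 moreover have "ALL z:carrier G. z [^] Coset.order M : ?K"
  by (auto simp: kernel_def f.hom_nat_pow P.pow_order_eq_1)
 moreover have "Coset.order M > 0" using P.order_gt_0_iff_finite P.finM by blast
 ultimately have "?K : GG" unfolding GG_def using sub f_ker P.cop by blast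
 then show ?thesis unfolding Kr_def by blast
qed

definition fA where "fA z = f (SOME u. u : carrier G \<and> kq u = z)"

lemma fA_kq: assumes u: "u : carrier G" shows "fA (kq u) = f u"
proof -
 define w where "w = (SOME w. w : carrier G \<and> kq w = kq u)"
 have w: "w : carrier G \<and> kq w = kq u" unfolding w_def by (rule someI[of _ u]) (simp add: u)
 then have "kq (w \<otimes> inv u) = \<one>\<^bsub>AA\<^esub>" using u by (simp add: kq.hom_inv)
 then have "w \<otimes> inv u : kernel G M f" using kq_one[of "w \<otimes> inv u"] w u Kr_kernel by auto
 then have "f w \<otimes>\<^bsub>M\<^esub> inv\<^bsub>M\<^esub> f u = \<one>\<^bsub>M\<^esub>" using w u by (simp add: kernel_def f.hom_inv)
 then have "f w = f u" using w u by (metis P.inv_equality P.inv_inv f.hom_closed P.inv_closed)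
 then show ?thesis unfolding fA_def w_def .
qed

definition a where "a i ga de = kq (ag i ga de)"
definition y where "y i = finprod AA (%de. a i de \<one>\<^bsub>Ga\<^esub>) (carrier Ga)"

context
 fixes i assumes i: "i : {1..n}"
begin

lemma a_closed [simp]: "ga : carrier Ga ==> de : carrier Ga ==> a i ga de : carrier AA"
 unfolding a_def using agG[OF i] by simp

lemma a_mult: "ga : carrier Ga ==> de : carrier Ga ==> ep : carrier Ga ==> a i ga de \<otimes>\<^bsub>AA\<^esub> a i de ep = a i ga ep"
 unfolding a_def using agG[OF i] ag_mult[OF i] by (simp flip: kq.hom_mult)

lemma a_self: "ga : carrier Ga ==> a i ga ga = \<one>\<^bsub>AA\<^esub>"
 using a_mult[of ga ga ga] by (metis AA.r_cancel_one a_closed)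

lemma a_act: "be : carrier Ga ==> ga : carrier Ga ==> de : carrier Ga ==>
  act AA be (a i ga de) = a i (be \<otimes>\<^bsub>Ga\<^esub> ga) (be \<otimes>\<^bsub>Ga\<^esub> de)"
 unfolding a_def by (simp add: kq_act agG[OF i] ag_act[OF i])

lemma y_closed: "y i : carrier AA" unfolding y_def by (rule AA.finprod_closed) auto

lemma act_y:
 assumes ga: "ga : carrier Ga"
 shows "act AA ga (y i) = finprod AA (%de. a i de ga) (carrier Ga)"
proof -
 have "act AA ga (y i) = finprod AA (%de. act AA ga (a i de \<one>\<^bsub>Ga\<^esub>)) (carrier Ga)"
  unfolding y_def by (rule finprod_hom[OF AA_comm AA_comm AA.act_hom[OF ga]]) auto
 also have "\<dots> = finprod AA (%de. a i (ga \<otimes>\<^bsub>Ga\<^esub> de) ga) (carrier Ga)"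
  by (rule AA.finprod_cong) (use ga in \<open>auto simp: simp_implies_def a_act\<close>)
 also have "\<dots> = finprod AA (%de. a i de ga) ((%de. ga \<otimes>\<^bsub>Ga\<^esub> de) ` carrier Ga)"
  by (rule AA.finprod_reindex[symmetric]) (use ga in \<open>auto simp: inj_on_def\<close>)
 also have "(%de. ga \<otimes>\<^bsub>Ga\<^esub> de) ` carrier Ga = carrier Ga"
 proof (intro equalityI subsetI)
  fix z assume z: "z : carrier Ga"
  then have "z = ga \<otimes>\<^bsub>Ga\<^esub> (inv\<^bsub>Ga\<^esub> ga \<otimes>\<^bsub>Ga\<^esub> z)" using ga by (simp add: P.Gam.m_assoc[symmetric])
  then show "z : (%de. ga \<otimes>\<^bsub>Ga\<^esub> de) ` carrier Ga" using ga z by (intro image_eqI[of _ _ "inv\<^bsub>Ga\<^esub> ga \<otimes>\<^bsub>Ga\<^esub> z"]) auto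
 qed (use ga in auto)
 finally show ?thesis .
qed

lemma inv_act_y:
 assumes ga: "ga : carrier Ga"
 shows "inv\<^bsub>AA\<^esub> (act AA ga (y i)) = finprod AA (%de. a i ga de) (carrier Ga)"
proof (rule AA.inv_equality)
 have "finprod AA (%de. a i ga de) (carrier Ga) \<otimes>\<^bsub>AA\<^esub> act AA ga (y i) = finprod AA (%de. a i ga de \<otimes>\<^bsub>AA\<^esub> a i de ga) (carrier Ga)"
  unfolding act_y[OF ga] by (rule AA.finprod_multf[symmetric]) (use ga in auto)
 also have "\<dots> = finprod AA (%de. \<one>\<^bsub>AA\<^esub>) (carrier Ga)"
  by (rule AA.finprod_cong) (use ga in \<open>auto simp: simp_implies_def a_mult a_self\<close>)
 finally show "finprod AA (%de. a i ga de) (carrier Ga) \<otimes>\<^bsub>AA\<^esub> act AA ga (y i) = \<one>\<^bsub>AA\<^esub>" by simp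
qed (use ga y_closed in \<open>auto intro!: AA.finprod_closed\<close>)

text \<open>The left side is the product over \<open>ep\<close> of \<open>a i ga ep\<close> times
  \<open>a i ep de\<close>, and each such factor telescopes to \<open>a i ga de\<close>.\<close>

lemma y_a:
 assumes ga: "ga : carrier Ga" and de: "de : carrier Ga"
 shows "inv\<^bsub>AA\<^esub> (act AA ga (y i)) \<otimes>\<^bsub>AA\<^esub> act AA de (y i) = a i ga de [^]\<^bsub>AA\<^esub> card (carrier Ga)"
proof -
 have "inv\<^bsub>AA\<^esub> (act AA ga (y i)) \<otimes>\<^bsub>AA\<^esub> act AA de (y i) = finprod AA (%ep. a i ga ep \<otimes>\<^bsub>AA\<^esub> a i ep de) (carrier Ga)"
  unfolding inv_act_y[OF ga] act_y[OF de] by (rule AA.finprod_multf[symmetric]) (use ga de in auto)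
 also have "\<dots> = finprod AA (%ep. a i ga de) (carrier Ga)"
  by (rule AA.finprod_cong) (use ga de in \<open>auto simp: simp_implies_def a_mult\<close>)
 also have "\<dots> = a i ga de [^]\<^bsub>AA\<^esub> card (carrier Ga)" using ga de by (simp add: AA.finprod_const)
 finally show ?thesis .
qed

text \<open>By \<open>y_a\<close> the translate by \<open>ga\<close> is \<open>y i\<close> times the
  \<open>|Ga|\<close>-th power of \<open>a i 1 ga\<close>, and the product of the
  \<open>a i 1 ga\<close> over the group is the inverse of \<open>y i\<close>.\<close>

lemma y_norm: "AA.ev1 (y i) (%_. 1) = \<one>\<^bsub>AA\<^esub>"
proof -
 let ?g = "card (carrier Ga)" and ?e = "\<one>\<^bsub>Ga\<^esub>"
 have act_e: "act AA ga (y i) = y i \<otimes>\<^bsub>AA\<^esub> a i ?e ga [^]\<^bsub>AA\<^esub> ?g" if ga: "ga : carrier Ga" for ga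
  using y_a[of ?e ga] ga y_closed by (simp add: AA.act_one AA.m_assoc[symmetric] flip: y_a)
 have "AA.ev1 (y i) (%_. 1) = finprod AA (%ga. y i \<otimes>\<^bsub>AA\<^esub> a i ?e ga [^]\<^bsub>AA\<^esub> ?g) (carrier Ga)"
  unfolding AA.ev1_def by (rule AA.finprod_cong)
   (use act_e y_closed in \<open>auto simp: simp_implies_def AA.int_pow_1\<close>)
 also have "\<dots> = y i [^]\<^bsub>AA\<^esub> ?g \<otimes>\<^bsub>AA\<^esub> finprod AA (%ga. a i ?e ga [^]\<^bsub>AA\<^esub> int ?g) (carrier Ga)"
  using y_closed by (subst AA.finprod_multf) (auto simp: AA.finprod_const int_pow_int)
 also have "finprod AA (%ga. a i ?e ga [^]\<^bsub>AA\<^esub> int ?g) (carrier Ga) = finprod AA (a i ?e) (carrier Ga) [^]\<^bsub>AA\<^esub> int ?g"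
  by (rule AA.finprod_int_pow) auto
 also have "finprod AA (a i ?e) (carrier Ga) = inv\<^bsub>AA\<^esub> (y i)"
  using inv_act_y[of ?e] y_closed by (simp add: AA.act_one)
 also have "y i [^]\<^bsub>AA\<^esub> ?g \<otimes>\<^bsub>AA\<^esub> (inv\<^bsub>AA\<^esub> (y i)) [^]\<^bsub>AA\<^esub> int ?g = \<one>\<^bsub>AA\<^esub>"
  using y_closed by (simp add: int_pow_int AA.nat_pow_inv)
 finally show ?thesis .
qed

lemma fA_y:
 assumes fA_hom: "fA : hom AA M"
 shows "fA (y i) = x i"
proof -
 note si = sM[OF i]
 have "fA (y i) = finprod M (%de. fA (a i de \<one>\<^bsub>Ga\<^esub>)) (carrier Ga)"
  unfolding y_def by (rule finprod_hom[OF AA_comm P.comm_group_axioms fA_hom]) auto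
 also have "\<dots> = finprod M (%de. act M de (s i) [^]\<^bsub>M\<^esub> (-1 :: int) \<otimes>\<^bsub>M\<^esub> s i) (carrier Ga)"
  by (rule P.finprod_cong)
   (use si in \<open>auto simp: simp_implies_def a_def fA_kq agG[OF i] f_ag[OF i] P.act_one P.int_pow_neg P.int_pow_1\<close>)
 also have "\<dots> = finprod M (%de. act M de (s i) [^]\<^bsub>M\<^esub> (-1 :: int)) (carrier Ga) \<otimes>\<^bsub>M\<^esub> s i [^]\<^bsub>M\<^esub> card (carrier Ga)"
  using si by (subst P.finprod_multf) (auto simp: P.finprod_const)
 also have "finprod M (%de. act M de (s i) [^]\<^bsub>M\<^esub> (-1 :: int)) (carrier Ga) = P.ev1 (s i) (%_. 1) [^]\<^bsub>M\<^esub> (-1 :: int)"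
  unfolding P.ev1_def using si by (subst P.finprod_int_pow) (auto simp: P.int_pow_1 cong: P.finprod_cong)
 also have "\<dots> = \<one>\<^bsub>M\<^esub>" using P.norm_kills[OF si] by simp
 also have "\<one>\<^bsub>M\<^esub> \<otimes>\<^bsub>M\<^esub> s i [^]\<^bsub>M\<^esub> card (carrier Ga) = x i" using s_pow[OF i] si by (metis P.l_one P.nat_pow_closed)
 finally show ?thesis .
qed

end

lemma fA_hom: "fA : hom AA M"
proof (rule homI)
 fix v assume "v : carrier AA"
 then obtain u where u: "u : carrier G" "v = kq u" unfolding kq_surj by blast
 then show "fA v : carrier M" by (simp add: fA_kq)
 fix v' assume "v' : carrier AA"
 then obtain u' where u': "u' : carrier G" "v' = kq u'" unfolding kq_surj by blast
 have "fA (kq (u \<otimes> u')) = fA v \<otimes>\<^bsub>M\<^esub> fA v'" using u u' by (simp add: fA_kq del: kq.hom_mult)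
 then show "fA (v \<otimes>\<^bsub>AA\<^esub> v') = fA v \<otimes>\<^bsub>M\<^esub> fA v'" using u u' by simp
qed

lemma fA_act: "ga : carrier Ga ==> z : carrier AA ==> fA (act AA ga z) = act M ga (fA z)"
proof -
 assume ga: "ga : carrier Ga" and "z : carrier AA"
 then obtain u where u: "u : carrier G" "z = kq u" unfolding kq_surj by blast
 then show ?thesis using ga by (simp add: kq_act fA_kq f_act)
qed

lemma fA_ker: "kernel AA M fA : WW"
proof -
 interpret fA: group_hom AA M fA by (intro group_hom.intro group_hom_axioms.intro fA_hom AA.is_group P.is_group)
 have "{u : carrier G. kq u : kernel AA M fA} = kernel G M f" by (auto simp: kernel_def fA_kq)
 then have "openin (topo AA) (kernel AA M fA)" unfolding openin_AA using f_ker by (auto simp: kernel_def)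
 moreover have "act AA ga w : kernel AA M fA" if "ga : carrier Ga" "w : kernel AA M fA" for ga w
  using that by (auto simp: kernel_def fA_act P.act_id)
 ultimately show ?thesis unfolding WW_def using fA.subgroup_kernel by blast
qed

lemma cover: "profinite_cover Ga M d n x AA fA y a WW"
proof (intro profinite_cover.intro P.presentation_axioms AA.mod_act_axioms profinite_cover_axioms.intro)
 show "y : {1..n} \<rightarrow> carrier AA" using y_closed by (rule Pi_I)
 fix W S assume W: "W : WW" and S: "subgroup S AA" "W \<subseteq> S"
  and aS: "!!i ga de. i : {1..n} ==> ga : carrier Ga ==> de : carrier Ga ==> a i ga de : S"
 have "kq ` gen \<subseteq> S" using gen_ag aS unfolding a_def by blast
 then show "carrier AA \<subseteq> S" by (rule WW_gen[OF W S])
next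
 fix i ga de assume "i : {1..n}" "ga : carrier Ga" "de : carrier Ga"
 then show "inv\<^bsub>AA\<^esub> (act AA ga (y i)) \<otimes>\<^bsub>AA\<^esub> act AA de (y i) = a i ga de [^]\<^bsub>AA\<^esub> int (card (carrier Ga))"
  unfolding int_pow_int by (rule y_a)
next
 fix c assume "!!W. W : WW ==> c W : carrier AA"
  and "!!W W'. W : WW ==> W' : WW ==> W \<subseteq> W' ==> inv\<^bsub>AA\<^esub> c W' \<otimes>\<^bsub>AA\<^esub> c W : W'"
 then show "EX z:carrier AA. ALL W:WW. inv\<^bsub>AA\<^esub> c W \<otimes>\<^bsub>AA\<^esub> z : W" by (rule WW_lim)
next
 fix W W' assume "W : WW" "W' : WW"
 then show "W \<inter> W' : WW" by (rule WW_int)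
next
 fix W ga w assume "W : WW" "ga : carrier Ga" "w : W"
 then show "act AA ga w : W" by (rule WW_D(3))
next
 fix i ga de assume "i : {1..n}" "ga : carrier Ga" "de : carrier Ga"
 then show "a i ga de : carrier AA" by (rule a_closed)
next
 fix ga z assume "ga : carrier Ga" "z : carrier AA"
 then show "fA (act AA ga z) = act M ga (fA z)" by (rule fA_act)
next
 fix W assume W: "W : WW"
 show "subgroup W AA" by (rule WW_D(1)[OF W])
 show "\<exists>u>0. coprime u d \<and> (ALL m:carrier AA. m [^]\<^bsub>AA\<^esub> int u : W)" by (rule WW_exp[OF W])
next
 fix i assume i: "i : {1..n}"
 show "AA.ev1 (y i) (%_. 1) = \<one>\<^bsub>AA\<^esub>" by (rule y_norm[OF i])
 show "fA (y i) = x i" by (rule fA_y[OF i fA_hom])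
next
 show "card (carrier Ga) dvd d" by (rule gd)
 show "fA : hom AA M" by (rule fA_hom)
 show "kernel AA M fA : WW" by (rule fA_ker)
qed

text \<open>By \<open>WW_sep\<close> the closed stable subgroup generated by the relators is an
  intersection of members of \<open>WW\<close>, and each member containing the relators contains the
  kernel of \<open>fA\<close>.\<close>

theorem free_presentation:
 "EX r. (ALL i:{1..n}. r i : carrier AA) \<and> (\<forall>j>n. r j = \<one>\<^bsub>AA\<^esub>) \<and>
  equivariant_iso (carrier Ga) M (act_quot AA (closed_stable_generate (carrier Ga) AA
   ({inv\<^bsub>AA\<^esub> (r i) \<otimes>\<^bsub>AA\<^esub> act AA ga (r i) | i ga. i : {1..n + 1} \<and> ga : carrier Ga} \<union> r ` {n + 2..n + t})))"
proof -
 obtain r0 where r0: "ALL i:{1..n}. r0 i : kernel AA M fA"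
  and r0W: "ALL W:WW. (ALL i:{1..n}. ALL ga:carrier Ga. inv\<^bsub>AA\<^esub> r0 i \<otimes>\<^bsub>AA\<^esub> act AA ga (r0 i) : W) --> kernel AA M fA \<subseteq> W"
  using profinite_cover.profinite_presentation[OF cover] by (elim exE conjE)
 define r where "r i = (if i : {1..n} then r0 i else \<one>\<^bsub>AA\<^esub>)" for i
 let ?K = "kernel AA M fA"
 let ?S = "{inv\<^bsub>AA\<^esub> (r i) \<otimes>\<^bsub>AA\<^esub> act AA ga (r i) | i ga. i : {1..n + 1} \<and> ga : carrier Ga} \<union> r ` {n + 2..n + t}"
 note Ks = WW_D(1)[OF fA_ker]
 have rK: "r i : ?K" for i unfolding r_def using r0 subgroup.one_closed[OF Ks] by auto
 have SK: "?S \<subseteq> ?K"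
 proof
  fix z assume "z : ?S"
  then consider i ga where "ga : carrier Ga" "z = inv\<^bsub>AA\<^esub> (r i) \<otimes>\<^bsub>AA\<^esub> act AA ga (r i)" | j where "z = r j" by fast
  then show "z : ?K"
  proof cases
   case (1 i ga)
   show ?thesis unfolding 1(2)
    by (rule subgroup.m_closed[OF Ks subgroup.m_inv_closed[OF Ks rK] WW_D(3)[OF fA_ker 1(1) rK]])
  qed (use rK in simp)
 qed
 have eq: "closed_stable_generate (carrier Ga) AA ?S = ?K"
 proof
  show "closed_stable_generate (carrier Ga) AA ?S \<subseteq> ?K"
   unfolding closed_stable_generate_def
   by (rule Inter_lower, rule CollectI, intro conjI ballI Ks WW_closed[OF fA_ker] SK) (rule WW_D(3)[OF fA_ker])
  have "?K \<subseteq> H" if H: "subgroup H AA" "closedin (topo AA) H" "ALL ga:carrier Ga. ALL x:H. act AA ga x : H" "?S \<subseteq> H" for H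
  proof
   fix z assume z: "z : ?K"
   show "z : H"
   proof (rule ccontr)
    assume "z \<notin> H"
    moreover have "z : carrier AA" using z by (simp add: kernel_def)
    ultimately obtain W where W: "W : WW" "H \<subseteq> W" "z \<notin> W" using WW_sep[OF H(1,2) H(3)[rule_format]] by blast
    have "inv\<^bsub>AA\<^esub> r0 i \<otimes>\<^bsub>AA\<^esub> act AA ga (r0 i) : W" if i: "i : {1..n}" and ga: "ga : carrier Ga" for i ga
    proof -
     have "inv\<^bsub>AA\<^esub> r i \<otimes>\<^bsub>AA\<^esub> act AA ga (r i) : ?S"
      by (intro UnI1 CollectI exI conjI refl) (use i ga in auto)
     then have "inv\<^bsub>AA\<^esub> r i \<otimes>\<^bsub>AA\<^esub> act AA ga (r i) : W" using H(4) W(2) by (elim set_mp[rotated]) (rule order_trans)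
     then show ?thesis unfolding r_def using i by simp
    qed
    then have "?K \<subseteq> W" by (intro r0W[THEN bspec, OF W(1), THEN mp] ballI)
    then show False using z W(3) by blast
   qed
  qed
  then show "?K \<subseteq> closed_stable_generate (carrier Ga) AA ?S"
   unfolding closed_stable_generate_def by (intro Inter_greatest) (elim CollectE conjE)
 qed
 have surj: "fA ` carrier AA = carrier M"
 proof
  show "fA ` carrier AA \<subseteq> carrier M" using fA_hom by (auto simp: hom_def)
  have "m : fA ` carrier AA" if m: "m : carrier M" for m
  proof -
   obtain c where c: "m = P.ev n x c" using m unfolding P.full[symmetric] P.rng_def by (rule imageE)
   have "AA.ev n y c : carrier AA" by (rule AA.ev_closed) (use y_closed in auto)
   then show ?thesis unfolding c profinite_cover.ev_f[OF cover, symmetric] by (rule imageI)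
  qed
  then show "carrier M \<subseteq> fA ` carrier AA" by blast
 qed
 have 1: "equivariant_iso (carrier Ga) M (act_quot AA (closed_stable_generate (carrier Ga) AA ?S))"
  by (rule equivariant_iso_quot[OF AA_act P.group_act_axioms fA_hom surj fA_act eq])
 show ?thesis
 proof (intro exI conjI 1 ballI)
  show "r i : carrier AA" for i using rK by (simp add: kernel_def)
  show "\<forall>j>n. r j = \<one>\<^bsub>AA\<^esub>" by (simp add: r_def)
 qed (rule 1)
qed

end

section \<open>The augmentation subgroup of the free group\<close>

lemma group_act_sub:
 assumes P: "group_act Ga P" and H: "subgroup H P"
  and st: "!!ga h. ga : carrier Ga ==> h : H ==> act P ga h : H"
  and G: "carrier G = H" "mult G = mult P" "\<one>\<^bsub>G\<^esub> = \<one>\<^bsub>P\<^esub>" "act G = act P"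
 shows "group_act Ga G"
proof -
 interpret P: group_act Ga P by fact
 interpret H: subgroup H P by fact
 have mem: "h : carrier P" if "h : H" for h using that H.subset by blast
 have grp: "group G"
 proof (rule groupI)
  fix z assume "z : carrier G"
  then show "EX y:carrier G. y \<otimes>\<^bsub>G\<^esub> z = \<one>\<^bsub>G\<^esub>" unfolding G by (intro bexI[of _ "inv\<^bsub>P\<^esub> z"]) (auto simp: mem)
 qed (auto simp: G mem P.m_assoc)
 show ?thesis
 proof (intro group_act.intro group_act_axioms.intro grp P.Gam.is_group)
  fix ga assume "ga : carrier Ga"
  then show "act G ga : hom G G" by (intro homI) (auto simp: G st mem P.act_m)
 qed (auto simp: G mem P.act_mult P.act_one)
qed

text \<open>The elements that \<open>h\<close> sends into the closed subgroup form a closed subgroup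
  themselves, so only generators have to be checked.\<close>

lemma closed_generate_mono_hom:
 assumes P: "group P" and top: "topspace (topo P) = carrier P" and S: "S \<subseteq> carrier P"
  and h: "h : hom P P" and c: "continuous_map (topo P) (topo P) h"
  and hS: "!!s. s : S ==> h s : closed_generate P S" and z: "z : closed_generate P S"
 shows "h z : closed_generate P S"
proof -
 let ?C = "closed_generate P S" let ?K = "{y : carrier P. h y : ?C}"
 interpret h: group_hom P P h by (intro group_hom.intro group_hom_axioms.intro P h)
 have C: "subgroup ?C P" by (rule subgroup_closed_generate[OF P top S])
 have "closedin (topo P) ?C" unfolding closed_generate_def
 proof (rule closedin_Inter)
  have "carrier P : {H. subgroup H P \<and> closedin (topo P) H \<and> S \<subseteq> H}"
   using S group.subgroup_self[OF P] closedin_topspace[of "topo P"] unfolding top by blast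
  then show "{H. subgroup H P \<and> closedin (topo P) H \<and> S \<subseteq> H} ~= {}" by (rule ne_empty)
 qed auto
 then have "closedin (topo P) {y : topspace (topo P). h y : ?C}" by (rule closedin_continuous_map_preimage[OF c])
 then have "closedin (topo P) ?K" unfolding top .
 moreover have "subgroup ?K P"
  by (rule h.G.subgroupI) (use C in \<open>auto simp: subgroup.one_closed subgroup.m_closed subgroup.m_inv_closed intro!: exI[of _ "\<one>\<^bsub>P\<^esub>"]\<close>)
 moreover have "S \<subseteq> ?K" using S hS by blast
 ultimately have "?C \<subseteq> ?K" unfolding closed_generate_def by (intro Inter_lower) simp
 then show ?thesis using z by blast
qed

section \<open>The group action on the free pro-prime-to-\<open>|Ga|\<close> group\<close>

locale free_act = fin_group Ga for Ga :: "'g monoid" +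
 fixes n :: nat
begin

abbreviation "m \<equiv> card (carrier Ga)"
definition "AA = {1..n} \<times> carrier Ga"
abbreviation "FI \<equiv> free_index m AA"
abbreviation "Amb \<equiv> free_ambient m AA (gen_shift Ga)"
abbreviation "Fr \<equiv> free_pro m AA (gen_shift Ga)"

lemma AA_iff [simp]: "(i, ga) : AA \<longleftrightarrow> i : {1..n} \<and> ga : carrier Ga" by (simp add: AA_def)

text \<open>The permutation of coordinates through which \<open>ga\<close> acts on the ambient
  product. It composes in the opposite order because it acts on maps by precomposition.\<close>

definition tau :: "'g => nat monoid \<times> (nat \<times> 'g => nat) => nat monoid \<times> (nat \<times> 'g => nat)" where
 "tau ga q = (fst q, \<lambda>x\<in>AA. snd q (gen_shift Ga ga x))"

lemma shift_in: "ga : carrier Ga ==> x : AA ==> gen_shift Ga ga x : AA"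
 by (auto simp: gen_shift_def AA_def)

lemma tau_in: "ga : carrier Ga ==> q : FI ==> tau ga q : FI"
 using shift_in by (fastforce simp: free_index_def tau_def PiE_iff)

lemma fst_tau [simp]: "fst (tau ga q) = fst q" by (simp add: tau_def)

lemma shift_shift: "x : AA ==> ga : carrier Ga ==> de : carrier Ga ==>
  gen_shift Ga ga (gen_shift Ga de x) = gen_shift Ga (ga \<otimes>\<^bsub>Ga\<^esub> de) x"
 by (auto simp: gen_shift_def AA_def m_assoc)

lemma tau_tau: "ga : carrier Ga ==> de : carrier Ga ==> tau de (tau ga q) = tau (ga \<otimes>\<^bsub>Ga\<^esub> de) q"
 by (auto simp: tau_def shift_in shift_shift fun_eq_iff restrict_def)

lemma tau_one: "q : FI ==> tau \<one>\<^bsub>Ga\<^esub> q = q"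
 by (auto simp: tau_def gen_shift_def AA_def free_index_def fun_eq_iff restrict_def PiE_iff extensional_def)

lemma act_Amb: "act Amb ga f = (\<lambda>q\<in>FI. f (tau ga q))"
 by (auto simp: free_ambient_simps(3) tau_def fun_eq_iff restrict_def cong: if_cong)

lemma grp: "q : FI ==> group (fst q)" and fin_q: "q : FI ==> finite (carrier (fst q))"
 by (auto simp: free_index_def)

lemma Amb_mem: "f : carrier Amb ==> q : FI ==> f q : carrier (fst q)"
 by (auto simp: free_ambient_simps)

lemma Amb_act: "group_act Ga Amb"
proof (intro group_act.intro group_act_axioms.intro free_ambient_group is_group)
 fix ga assume ga: "ga : carrier Ga"
 have mem: "f (tau ga q) : carrier (fst q)" if "f : carrier Amb" "q : FI" for f q
  using Amb_mem[OF that(1) tau_in[OF ga that(2)]] by simp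
 show "act Amb ga : hom Amb Amb"
 proof (rule homI)
  fix f assume f: "f : carrier Amb"
  show "act Amb ga f : carrier Amb" unfolding act_Amb using mem[OF f] by (auto simp: free_ambient_simps(1))
  fix g assume g: "g : carrier Amb"
  show "act Amb ga (f \<otimes>\<^bsub>Amb\<^esub> g) = act Amb ga f \<otimes>\<^bsub>Amb\<^esub> act Amb ga g"
   unfolding act_Amb free_ambient_simps(2) using tau_in[OF ga] by (auto simp: fun_eq_iff restrict_def)
 qed
 fix de f assume de: "de : carrier Ga"
 show "act Amb (ga \<otimes>\<^bsub>Ga\<^esub> de) f = act Amb ga (act Amb de f)"
  unfolding act_Amb using tau_in[OF ga] by (auto simp: fun_eq_iff restrict_def tau_tau[OF ga de])
next
 fix f assume f: "f : carrier Amb"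
 show "act Amb \<one>\<^bsub>Ga\<^esub> f = f"
  unfolding act_Amb using f tau_one by (auto simp: fun_eq_iff restrict_def free_ambient_simps(1) PiE_iff extensional_def)
qed

lemma act_cont: "ga : carrier Ga ==> continuous_map (topo Amb) (topo Amb) (act Amb ga)"
proof -
 assume ga: "ga : carrier Ga"
 show ?thesis unfolding free_ambient_simps(4) continuous_map_componentwise
 proof (intro conjI ballI)
  show "act Amb ga ` topspace (product_topology (%(H, \<phi>). discrete_topology (carrier H)) FI) \<subseteq> extensional FI"
   by (auto simp: act_Amb)
  fix q assume q: "q : FI"
  have "continuous_map (product_topology (%(H, \<phi>). discrete_topology (carrier H)) FI)
    ((%(H, \<phi>). discrete_topology (carrier H)) (tau ga q)) (%f. f (tau ga q))"
   by (rule continuous_map_product_projection[OF tau_in[OF ga q]])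
  then show "continuous_map (product_topology (%(H, \<phi>). discrete_topology (carrier H)) FI)
    ((%(H, \<phi>). discrete_topology (carrier H)) q) (%f. act Amb ga f q)"
   using q by (simp add: act_Amb case_prod_beta)
 qed
qed

interpretation Amb: group_act Ga Amb by (rule Amb_act)

definition "gn i ga = free_gen m AA (i, ga)"
definition "ag i ga de = inv\<^bsub>Amb\<^esub> gn i ga \<otimes>\<^bsub>Amb\<^esub> gn i de"

lemma gn_in: "i : {1..n} ==> ga : carrier Ga ==> gn i ga : carrier Fr" "i : {1..n} ==> ga : carrier Ga ==> gn i ga : carrier Amb"
 unfolding gn_def by (rule free_gen_in_free_pro free_gen_in_ambient, simp)+

lemma gn_act: "be : carrier Ga ==> i : {1..n} ==> ga : carrier Ga ==> act Amb be (gn i ga) = gn i (be \<otimes>\<^bsub>Ga\<^esub> ga)"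
 using act_free_gen[of "(i, ga)" AA "gen_shift Ga" be m] shift_in[of be]
 by (auto simp: gn_def free_pro_simps(3) gen_shift_def)

lemma ag_act: "i : {1..n} ==> be : carrier Ga ==> ga : carrier Ga ==> de : carrier Ga ==>
  act Amb be (ag i ga de) = ag i (be \<otimes>\<^bsub>Ga\<^esub> ga) (be \<otimes>\<^bsub>Ga\<^esub> de)"
 unfolding ag_def by (simp add: Amb.act_m Amb.act_inv gn_act gn_in)

lemma ag_mult: "i : {1..n} ==> ga : carrier Ga ==> de : carrier Ga ==> ep : carrier Ga ==>
  ag i ga de \<otimes>\<^bsub>Amb\<^esub> ag i de ep = ag i ga ep"
proof -
 assume a: "i : {1..n}" "ga : carrier Ga" "de : carrier Ga" "ep : carrier Ga"
 have "gn i de \<otimes>\<^bsub>Amb\<^esub> (inv\<^bsub>Amb\<^esub> gn i de \<otimes>\<^bsub>Amb\<^esub> gn i ep) = gn i ep"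
  using a gn_in(2) by (simp add: Amb.m_assoc[symmetric])
 then show ?thesis unfolding ag_def using a gn_in(2) by (simp add: Amb.m_assoc)
qed

definition "gens = {ag i ga de | i ga de. i : {1..n} \<and> ga : carrier Ga \<and> de : carrier Ga}"

lemma gensI: "i : {1..n} ==> ga : carrier Ga ==> de : carrier Ga ==> ag i ga de : gens"
 unfolding gens_def by (intro CollectI exI[of _ i] exI[of _ ga] exI[of _ de] conjI) (rule refl)

lemma Fr_sub: "subgroup (carrier Fr) Amb" by (rule subgroup_free_pro)
lemma Fr_one: "\<one>\<^bsub>Fr\<^esub> = \<one>\<^bsub>Amb\<^esub>" by (simp add: free_pro_def top_sub_def)

lemma Fr_act_closed: "ga : carrier Ga ==> z : carrier Fr ==> act Amb ga z : carrier Fr"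
 unfolding free_pro_simps(1)
proof (rule closed_generate_mono_hom[OF free_ambient_group topspace_free_ambient _ Amb.act_hom act_cont])
 fix s assume ga: "ga : carrier Ga" and "s : free_gen m AA ` AA"
 then obtain i de where i: "i : {1..n}" "de : carrier Ga" "s = gn i de" unfolding gn_def AA_def by auto
 show "act Amb ga s : closed_generate Amb (free_gen m AA ` AA)"
  unfolding i(3) gn_act[OF ga i(1,2)] using gn_in(1)[OF i(1), of "ga \<otimes>\<^bsub>Ga\<^esub> de"] ga i(2) by (simp add: free_pro_simps(1))
qed (auto intro: free_gen_in_ambient)

lemma Fr_act: "group_act Ga Fr"
 by (rule group_act_sub[OF Amb_act Fr_sub Fr_act_closed refl free_pro_simps(2) Fr_one free_pro_simps(3)])

interpretation Fr: group_act Ga Fr by (rule Fr_act)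

lemma Fr_top: "topspace (topo Fr) = carrier Fr"
 unfolding free_pro_simps(4) topspace_subtopology topspace_free_ambient using free_pro_ambient by blast

lemma Fr_inv: "z : carrier Fr ==> inv\<^bsub>Fr\<^esub> z = inv\<^bsub>Amb\<^esub> z"
proof (rule Fr.inv_equality)
 assume z: "z : carrier Fr"
 show "inv\<^bsub>Amb\<^esub> z \<otimes>\<^bsub>Fr\<^esub> z = \<one>\<^bsub>Fr\<^esub>" unfolding free_pro_simps(2) Fr_one
  using subgroup.mem_carrier[OF Fr_sub z] by simp
 show "inv\<^bsub>Amb\<^esub> z : carrier Fr" by (rule subgroup.m_inv_closed[OF Fr_sub z])
qed

lemma gens_Fr: "gens \<subseteq> carrier Fr"
proof
 fix z assume "z : gens"
 then obtain i ga de where z: "z = ag i ga de" and i: "i : {1..n}" "ga : carrier Ga" "de : carrier Ga"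
  unfolding gens_def by (elim CollectE exE conjE)
 show "z : carrier Fr" unfolding z ag_def
  by (rule subgroup.m_closed[OF Fr_sub subgroup.m_inv_closed[OF Fr_sub gn_in(1)[OF i(1,2)]] gn_in(1)[OF i(1,3)]])
qed

abbreviation "GG0 \<equiv> closed_generate Fr gens"
abbreviation "G \<equiv> F_group n Ga"

text \<open>The defining generator for \<open>ga\<close> and \<open>ga'\<close> is
  \<open>ag i ga\<close> at the product of \<open>ga'\<close> and \<open>ga\<close>, and every
  element of the group is such a product for fixed \<open>ga\<close>.\<close>

lemma G_def': "G = top_sub Fr GG0"
proof -
 have "{inv\<^bsub>Fr\<^esub> (gn i ga) \<otimes>\<^bsub>Fr\<^esub> act Fr ga' (gn i ga) | i ga ga'. i : {1..n} \<and> ga : carrier Ga \<and> ga' : carrier Ga} = gens"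
  (is "?L = _")
 proof
  have e: "inv\<^bsub>Fr\<^esub> (gn i ga) \<otimes>\<^bsub>Fr\<^esub> act Fr ga' (gn i ga) = ag i ga (ga' \<otimes>\<^bsub>Ga\<^esub> ga)"
   if "i : {1..n}" "ga : carrier Ga" "ga' : carrier Ga" for i ga ga'
   unfolding ag_def Fr_inv[OF gn_in(1)[OF that(1,2)]] free_pro_simps(2,3) gn_act[OF that(3,1,2)] by (rule refl)
  show "?L \<subseteq> gens"
  proof
   fix z assume "z : ?L"
   then obtain i ga ga' where z: "z = inv\<^bsub>Fr\<^esub> (gn i ga) \<otimes>\<^bsub>Fr\<^esub> act Fr ga' (gn i ga)" and i: "i : {1..n}" "ga : carrier Ga" "ga' : carrier Ga"
    by (elim CollectE exE conjE)
   show "z : gens" unfolding z e[OF i] by (rule gensI) (use i in auto)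
  qed
  show "gens \<subseteq> ?L"
  proof
   fix z assume "z : gens"
   then obtain i ga de where z: "z = ag i ga de" and i: "i : {1..n}" "ga : carrier Ga" "de : carrier Ga"
    unfolding gens_def by (elim CollectE exE conjE)
   have "de = (de \<otimes>\<^bsub>Ga\<^esub> inv\<^bsub>Ga\<^esub> ga) \<otimes>\<^bsub>Ga\<^esub> ga" using i by (simp add: m_assoc)
   then have "z = ag i ga ((de \<otimes>\<^bsub>Ga\<^esub> inv\<^bsub>Ga\<^esub> ga) \<otimes>\<^bsub>Ga\<^esub> ga)" using z by simp
   then have "z = inv\<^bsub>Fr\<^esub> (gn i ga) \<otimes>\<^bsub>Fr\<^esub> act Fr (de \<otimes>\<^bsub>Ga\<^esub> inv\<^bsub>Ga\<^esub> ga) (gn i ga)" using e[of i ga "de \<otimes>\<^bsub>Ga\<^esub> inv\<^bsub>Ga\<^esub> ga"] i by simp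
   then show "z : ?L"
    by (intro CollectI exI[of _ i] exI[of _ ga] exI[of _ "de \<otimes>\<^bsub>Ga\<^esub> inv\<^bsub>Ga\<^esub> ga"] conjI) (use i in auto)
  qed
 qed
 then show ?thesis unfolding F_group_def Let_def Coset.order_def gn_def AA_def by simp
qed

lemma G_subF: "subgroup GG0 Fr" by (rule subgroup_closed_generate[OF Fr.is_group Fr_top gens_Fr])
lemma GG0_Fr: "GG0 \<subseteq> carrier Fr" by (rule subgroup.subset[OF G_subF])
lemma G_simps: "carrier G = GG0" "mult G = mult Amb" "\<one>\<^bsub>G\<^esub> = \<one>\<^bsub>Amb\<^esub>" "act G = act Amb" "topo G = subtopology (topo Fr) GG0"
 unfolding G_def' by (simp_all add: top_sub_def Fr_one free_pro_simps(2,3))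
lemma G_topo: "topo G = subtopology (topo Amb) GG0"
 unfolding G_simps(5) free_pro_simps(4) subtopology_subtopology using GG0_Fr by (simp add: Int_absorb1)

lemma G_closedF: "closedin (topo Fr) GG0"
 unfolding closed_generate_def
proof (rule closedin_Inter)
 have "carrier Fr : {H. subgroup H Fr \<and> closedin (topo Fr) H \<and> gens \<subseteq> H}"
  using gens_Fr Fr.subgroup_self closedin_topspace[of "topo Fr"] unfolding Fr_top by blast
 then show "{H. subgroup H Fr \<and> closedin (topo Fr) H \<and> gens \<subseteq> H} ~= {}" by (rule ne_empty)
qed auto

lemma Fr_closed: "closedin (topo Amb) (carrier Fr)"
 unfolding free_pro_simps(1) closed_generate_def
proof (rule closedin_Inter)
 have "free_gen m AA ` AA \<subseteq> carrier Amb" by (auto intro: free_gen_in_ambient)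
 then have "carrier Amb : {H. subgroup H Amb \<and> closedin (topo Amb) H \<and> free_gen m AA ` AA \<subseteq> H}"
  using Amb.subgroup_self closedin_topspace[of "topo Amb"] unfolding topspace_free_ambient by blast
 then show "{H. subgroup H Amb \<and> closedin (topo Amb) H \<and> free_gen m AA ` AA \<subseteq> H} ~= {}" by (rule ne_empty)
qed auto

lemma G_closed: "closedin (topo Amb) GG0"
 using G_closedF Fr_closed unfolding free_pro_simps(4) by (rule closedin_trans_full)

lemma GG0_Amb: "GG0 \<subseteq> carrier Amb" using GG0_Fr free_pro_ambient by blast

lemma G_act_closed: "ga : carrier Ga ==> z : GG0 ==> act Fr ga z : GG0"
proof (rule closed_generate_mono_hom[OF Fr.is_group Fr_top gens_Fr Fr.act_hom])
 assume ga: "ga : carrier Ga"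
 show "continuous_map (topo Fr) (topo Fr) (act Fr ga)"
  unfolding free_pro_simps(3,4) continuous_map_in_subtopology
  using act_cont[OF ga] Fr_act_closed[OF ga] by (auto intro: continuous_map_from_subtopology)
 fix s assume "s : gens"
 then obtain i be de where s: "s = ag i be de" and i: "i : {1..n}" "be : carrier Ga" "de : carrier Ga"
  unfolding gens_def by (elim CollectE exE conjE)
 have "act Fr ga s : gens" unfolding s free_pro_simps(3) ag_act[OF i(1) ga i(2,3)]
  by (rule gensI) (use i ga in auto)
 then show "act Fr ga s : GG0" unfolding closed_generate_def by blast
qed

lemma G_act: "group_act Ga G"
 by (rule group_act_sub[OF Fr_act G_subF G_act_closed]) (simp_all add: G_simps free_pro_simps(2,3) Fr_one)

interpretation G: group_act Ga G by (rule G_act)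

text \<open>A finite set of coordinates stays finite when closed under the finite group. The kernels
  \<open>U J\<close> of the projections to such sets therefore form a base at the identity that
  consists of stable subgroups.\<close>

definition "stab = {J. finite J \<and> J \<subseteq> FI \<and> (ALL ga:carrier Ga. ALL q:J. tau ga q : J)}"
definition "U J = {y : carrier G. ALL q:J. y q = \<one>\<^bsub>fst q\<^esub>}"

lemma ev_hom: "q : FI ==> group_hom G (fst q) (%y. y q)"
proof (intro group_hom.intro group_hom_axioms.intro G.is_group grp homI)
 fix y z assume q: "q : FI" and y: "y : carrier G" "z : carrier G"
 show "y q : carrier (fst q)" using Amb_mem[OF subsetD[OF GG0_Amb] q] y by (simp add: G_simps)
 show "(y \<otimes>\<^bsub>G\<^esub> z) q = y q \<otimes>\<^bsub>fst q\<^esub> z q" using q by (simp add: G_simps free_ambient_simps(2))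
qed

lemma U_normal: "J : stab ==> U J \<lhd> G"
proof -
 assume J: "J : stab"
 have JF: "q : FI" if "q : J" for q using J that unfolding stab_def by blast
 have s: "subgroup (U J) G"
 proof (rule G.subgroupI)
  have "\<one>\<^bsub>G\<^esub> : U J" unfolding U_def using group_hom.hom_one[OF ev_hom[OF JF]] by simp
  then show "U J ~= {}" by blast
  fix y assume y: "y : U J"
  show "inv\<^bsub>G\<^esub> y : U J" unfolding U_def
  proof (intro CollectI conjI ballI)
   fix q assume q: "q : J"
   interpret group_hom G "fst q" "%y. y q" by (rule ev_hom[OF JF[OF q]])
   show "(inv\<^bsub>G\<^esub> y) q = \<one>\<^bsub>fst q\<^esub>" using y q hom_inv[of y] by (simp add: U_def)
  qed (use y in \<open>simp add: U_def\<close>)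
  fix z assume z: "z : U J"
  show "y \<otimes>\<^bsub>G\<^esub> z : U J" unfolding U_def
  proof (intro CollectI conjI ballI)
   fix q assume q: "q : J"
   interpret group_hom G "fst q" "%y. y q" by (rule ev_hom[OF JF[OF q]])
   show "(y \<otimes>\<^bsub>G\<^esub> z) q = \<one>\<^bsub>fst q\<^esub>" using y z q hom_mult[of y z] by (simp add: U_def)
  qed (use y z in \<open>simp add: U_def\<close>)
 qed (simp add: U_def)
 show ?thesis unfolding G.normal_inv_iff
 proof (intro conjI s ballI)
  fix x h assume x: "x : carrier G" and h: "h : U J"
  show "x \<otimes>\<^bsub>G\<^esub> h \<otimes>\<^bsub>G\<^esub> inv\<^bsub>G\<^esub> x : U J" unfolding U_def
  proof (intro CollectI conjI ballI)
   fix q assume q: "q : J"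
   interpret group_hom G "fst q" "%y. y q" by (rule ev_hom[OF JF[OF q]])
   have hG: "h : carrier G" "h q = \<one>\<^bsub>fst q\<^esub>" using h q by (auto simp: U_def)
   have "(x \<otimes>\<^bsub>G\<^esub> h \<otimes>\<^bsub>G\<^esub> inv\<^bsub>G\<^esub> x) q = x q \<otimes>\<^bsub>fst q\<^esub> h q \<otimes>\<^bsub>fst q\<^esub> inv\<^bsub>fst q\<^esub> x q"
    using x hG(1) hom_mult[of "x \<otimes>\<^bsub>G\<^esub> h" "inv\<^bsub>G\<^esub> x"] hom_mult[of x h] hom_inv[of x] by simp
   then show "(x \<otimes>\<^bsub>G\<^esub> h \<otimes>\<^bsub>G\<^esub> inv\<^bsub>G\<^esub> x) q = \<one>\<^bsub>fst q\<^esub>" using hG(2) hom_closed[OF x] by simp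
  qed (use x h in \<open>simp add: U_def\<close>)
 qed
qed

lemma U_coset: "J : stab ==> x : carrier G ==> U J #>\<^bsub>G\<^esub> x = {y : carrier G. ALL q:J. y q = x q}"
proof -
 assume J: "J : stab" and x: "x : carrier G"
 have JF: "q : FI" if "q : J" for q using J that unfolding stab_def by blast
 show ?thesis
 proof (intro equalityI subsetI)
  fix y assume "y : U J #>\<^bsub>G\<^esub> x"
  then obtain u where u: "u : U J" "y = u \<otimes>\<^bsub>G\<^esub> x" by (auto simp: r_coset_def)
  have "y q = x q" if q: "q : J" for q
  proof -
   interpret group_hom G "fst q" "%y. y q" by (rule ev_hom[OF JF[OF q]])
   show ?thesis using u x q hom_mult[of u x] hom_closed[OF x] by (simp add: U_def)
  qed
  then show "y : {y : carrier G. ALL q:J. y q = x q}" using u x by (simp add: U_def)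
 next
  fix y assume y: "y : {y : carrier G. ALL q:J. y q = x q}"
  have "(y \<otimes>\<^bsub>G\<^esub> inv\<^bsub>G\<^esub> x) q = \<one>\<^bsub>fst q\<^esub>" if q: "q : J" for q
  proof -
   interpret group_hom G "fst q" "%y. y q" by (rule ev_hom[OF JF[OF q]])
   show ?thesis using y x q hom_mult[of y "inv\<^bsub>G\<^esub> x"] hom_inv[of x] hom_closed[OF x] by simp
  qed
  then have "y \<otimes>\<^bsub>G\<^esub> inv\<^bsub>G\<^esub> x : U J" using x y by (simp add: U_def)
  moreover have "y = y \<otimes>\<^bsub>G\<^esub> inv\<^bsub>G\<^esub> x \<otimes>\<^bsub>G\<^esub> x" using x y by (simp add: G.m_assoc)
  ultimately show "y : U J #>\<^bsub>G\<^esub> x" unfolding r_coset_def by blast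
 qed
qed

lemma G_open_iff: "openin (topo G) V \<longleftrightarrow> V \<subseteq> carrier G \<and> (ALL x:V. EX U:U ` stab. U #>\<^bsub>G\<^esub> x \<subseteq> V)"
proof
 let ?X = "%(H, \<phi>). discrete_topology (carrier H) :: nat topology"
 assume "openin (topo G) V"
 then obtain W where W: "openin (product_topology ?X FI) W" "V = W \<inter> GG0"
  unfolding G_topo openin_subtopology free_ambient_simps(4) by blast
 have "EX U:U ` stab. U #>\<^bsub>G\<^esub> x \<subseteq> V" if x: "x : V" for x
 proof -
  have "x : W" using x W(2) by blast
  then obtain Y where Y: "finite {i : FI. Y i ~= topspace (?X i)}" "x : Pi\<^sub>E FI Y" "Pi\<^sub>E FI Y \<subseteq> W"
   using W(1)[unfolded openin_product_topology_alt, THEN bspec, OF \<open>x : W\<close>] by (elim exE conjE)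
  let ?Z = "{i : FI. Y i ~= topspace (?X i)}"
  let ?J = "\<Union>ga\<in>carrier Ga. tau ga ` ?Z"
  have "tau ga q : ?J" if ga: "ga : carrier Ga" and q: "q : ?J" for ga q
  proof -
   obtain de q0 where d: "de : carrier Ga" "q0 : ?Z" "q = tau de q0" using q by (elim UN_E imageE)
   have "tau ga q = tau (de \<otimes>\<^bsub>Ga\<^esub> ga) q0" unfolding d(3) by (rule tau_tau[OF d(1) ga])
   then show ?thesis by (intro UN_I[OF m_closed[OF d(1) ga]] image_eqI[OF _ d(2)])
  qed
  moreover have "?J \<subseteq> FI" using tau_in by auto
  moreover have "finite ?J" by (intro finite_UN_I finite_imageI fin Y(1))
  ultimately have J: "?J : stab" unfolding stab_def by (intro CollectI conjI ballI)
  have J0: "q : ?J" if "q : ?Z" for q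
  proof (rule UN_I[of "\<one>\<^bsub>Ga\<^esub>"])
   have "q = tau \<one>\<^bsub>Ga\<^esub> q" using tau_one that by auto
   then show "q : tau \<one>\<^bsub>Ga\<^esub> ` ?Z" using that by (rule image_eqI)
  qed simp
  have xG: "x : carrier G" using x W(2) by (simp add: G_simps)
  have "U ?J #>\<^bsub>G\<^esub> x \<subseteq> V"
  proof
   fix y assume "y : U ?J #>\<^bsub>G\<^esub> x"
   then have y0: "y : {y : carrier G. ALL q:?J. y q = x q}" unfolding U_coset[OF J xG] .
   then have "y : carrier G" by (elim CollectE conjE)
   moreover have "y q = x q" if "q : ?J" for q using y0 that by (elim CollectE conjE) (erule (1) bspec)
   ultimately have y: "y : carrier G" "!!q. q : ?J ==> y q = x q" .
   have yA: "y : carrier Amb" using y(1) GG0_Amb by (auto simp: G_simps)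
   have "y : Pi\<^sub>E FI Y"
   proof (rule PiE_I)
    fix q assume q: "q : FI"
    show "y q : Y q"
    proof (cases "q : ?Z")
     case True
     then have "y q = x q" by (intro y(2) J0)
     then show ?thesis using Y(2) q by (simp add: PiE_mem)
    next
     case False
     then have "Y q = carrier (fst q)" using q by (simp add: case_prod_beta)
     then show ?thesis using Amb_mem[OF yA q] by simp
    qed
   qed (use yA in \<open>auto simp: free_ambient_simps(1) PiE_iff extensional_def\<close>)
   then show "y : V" using Y(3) W(2) y(1) by (auto simp: G_simps)
  qed
  then show ?thesis by (intro bexI[of _ "U ?J"] imageI J)
 qed
 then show "V \<subseteq> carrier G \<and> (ALL x:V. EX U:U ` stab. U #>\<^bsub>G\<^esub> x \<subseteq> V)" using W(2) by (auto simp: G_simps)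
next
 let ?X = "%(H, \<phi>). discrete_topology (carrier H) :: nat topology"
 assume V: "V \<subseteq> carrier G \<and> (ALL x:V. EX U:U ` stab. U #>\<^bsub>G\<^esub> x \<subseteq> V)"
 show "openin (topo G) V"
 proof (subst openin_subopen, rule ballI)
  fix x assume x: "x : V"
  then obtain J where J: "J : stab" "U J #>\<^bsub>G\<^esub> x \<subseteq> V" using V by blast
  have xG: "x : carrier G" using x V by blast
  then have xA: "x : carrier Amb" using GG0_Amb by (auto simp: G_simps)
  let ?Y = "%q. if q : J then {x q} else carrier (fst q)"
  have "openin (product_topology ?X FI) (Pi\<^sub>E FI ?Y)"
   unfolding openin_PiE_gen
  proof (intro disjI2 conjI ballI)
   have "{i : FI. ?Y i ~= topspace (?X i)} \<subseteq> J" by (auto simp: case_prod_beta)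
   then show "finite {i : FI. ?Y i ~= topspace (?X i)}" using J(1) unfolding stab_def by (auto intro: finite_subset)
   fix q assume "q : FI"
   then show "openin (?X q) (?Y q)" using Amb_mem[OF xA] by (auto simp: case_prod_beta)
  qed
  then have "openin (topo G) (GG0 \<inter> Pi\<^sub>E FI ?Y)"
   unfolding G_topo free_ambient_simps(4) by (rule openin_subtopology_Int2)
  moreover have "x : GG0 \<inter> Pi\<^sub>E FI ?Y" using xG xA Amb_mem[OF xA]
   by (auto simp: G_simps free_ambient_simps(1) PiE_iff)
  moreover have "GG0 \<inter> Pi\<^sub>E FI ?Y \<subseteq> V"
  proof
   fix y assume y: "y : GG0 \<inter> Pi\<^sub>E FI ?Y"
   have "y q = x q" if "q : J" for q using y that J(1) unfolding stab_def by (auto dest!: PiE_mem[of y FI ?Y q])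
   then have "y : U J #>\<^bsub>G\<^esub> x" unfolding U_coset[OF J(1) xG] using y by (simp add: G_simps)
   then show "y : V" using J(2) by blast
  qed
  ultimately show "EX T. openin (topo G) T \<and> x : T \<and> T \<subseteq> V" by blast
 qed
qed

lemma U_fin: "J : stab ==> finite (rcosets\<^bsub>G\<^esub> U J)"
proof -
 assume J: "J : stab"
 then have JF: "J \<subseteq> FI" "finite J" by (auto simp: stab_def)
 have "rcosets\<^bsub>G\<^esub> U J \<subseteq> (%r. {y : carrier G. ALL q:J. y q = r q}) ` (\<Pi>\<^sub>E q\<in>J. carrier (fst q))"
 proof
  fix C assume "C : rcosets\<^bsub>G\<^esub> U J"
  then obtain x where x: "x : carrier G" "C = U J #>\<^bsub>G\<^esub> x" by (auto simp: RCOSETS_def)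
  have "C = {y : carrier G. ALL q:J. y q = restrict x J q}" unfolding x(2) U_coset[OF J x(1)] by simp
  moreover have "restrict x J : (\<Pi>\<^sub>E q\<in>J. carrier (fst q))"
   using Amb_mem[OF subsetD[OF GG0_Amb]] x(1) JF by (auto simp: G_simps)
  ultimately show "C : (%r. {y : carrier G. ALL q:J. y q = r q}) ` (\<Pi>\<^sub>E q\<in>J. carrier (fst q))" by (rule image_eqI)
 qed
 moreover have "finite (\<Pi>\<^sub>E q\<in>J. carrier (fst q))" using JF fin_q by (intro finite_PiE) auto
 ultimately show ?thesis by (rule finite_surj[rotated])
qed

lemma G_profin: "profin Ga G (U ` stab) gens"
proof (intro profin.intro profin_axioms.intro G_act)
 show "U ` stab ~= {}" unfolding stab_def by blast
 show "U0 \<lhd> G" "finite (rcosets\<^bsub>G\<^esub> U0)" if "U0 : U ` stab" for U0 using that U_normal U_fin by blast+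
 show "openin (topo G) V = (V \<subseteq> carrier G \<and> (ALL x:V. EX U:U ` stab. U #>\<^bsub>G\<^esub> x \<subseteq> V))" for V by (rule G_open_iff)
 fix U0 ga u assume U0: "U0 : U ` stab" and ga: "ga : carrier Ga" and u: "u : U0"
 obtain J where J: "J : stab" "U0 = U J" using U0 by blast
 have "act G ga u q = \<one>\<^bsub>fst q\<^esub>" if q: "q : J" for q
 proof -
  have "tau ga q : J" "q : FI" using q J(1) ga by (auto simp: stab_def)
  then show ?thesis using u unfolding J(2) U_def by (auto simp: G_simps(4) act_Amb)
 qed
 then show "act G ga u : U0" using u ga unfolding J(2) U_def by simp
next
 have "compact_space (topo Amb)" unfolding free_ambient_simps(4) compact_space_product_topology
  using fin_q by (auto simp: case_prod_beta compact_space_discrete_topology)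
 then show "compact_space (topo G)" unfolding G_topo
  by (intro compact_space_subtopology closedin_compact_space G_closed)
 show "gens \<subseteq> carrier G" by (auto simp: G_simps closed_generate_def)
 fix H assume H: "subgroup H G" "closedin (topo G) H" "gens \<subseteq> H"
 have "closedin (topo Fr) H" using H(2) G_closedF unfolding G_simps(5) by (rule closedin_trans_full)
 moreover have "subgroup H Fr"
 proof (rule Fr.subgroupI)
  show "H \<subseteq> carrier Fr" using subgroup.subset[OF H(1)] GG0_Fr by (auto simp: G_simps)
  show "H ~= {}" using subgroup.one_closed[OF H(1)] by blast
  fix y assume y: "y : H"
  then have yF: "y : carrier G" "y : carrier Fr" using subgroup.subset[OF H(1)] GG0_Fr by (auto simp: G_simps)
  have "inv\<^bsub>Fr\<^esub> y = inv\<^bsub>G\<^esub> y"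
  proof (rule Fr.inv_equality)
   show "inv\<^bsub>G\<^esub> y \<otimes>\<^bsub>Fr\<^esub> y = \<one>\<^bsub>Fr\<^esub>" using G.l_inv[OF yF(1)] by (simp add: G_simps free_pro_simps(2) Fr_one)
   show "inv\<^bsub>G\<^esub> y : carrier Fr" using G.inv_closed[OF yF(1)] GG0_Fr by (auto simp: G_simps)
  qed (rule yF)
  then show "inv\<^bsub>Fr\<^esub> y : H" using subgroup.m_inv_closed[OF H(1) y] by simp
  fix z assume "z : H"
  then show "y \<otimes>\<^bsub>Fr\<^esub> z : H" using subgroup.m_closed[OF H(1) y] by (simp add: G_simps free_pro_simps(2))
 qed
 ultimately show "carrier G \<subseteq> H" unfolding G_simps(1) closed_generate_def using H(3) by (intro Inter_lower) simp
qed

end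

theorem (in presentation) F_group_presentation:
 assumes gd: "card (carrier Ga) dvd d"
 shows "let A = prime_to_quot d (abelianization (F_group n Ga)) in
  EX r. (ALL i:{1..n}. r i : carrier A) \<and> (\<forall>j>n. r j = \<one>\<^bsub>A\<^esub>) \<and>
  equivariant_iso (carrier Ga) M (act_quot A (closed_stable_generate (carrier Ga) A
   ({inv\<^bsub>A\<^esub> (r i) \<otimes>\<^bsub>A\<^esub> act A ga (r i) | i ga. i : {1..n + 1} \<and> ga : carrier Ga} \<union> r ` {n + 2..n + t})))"
proof -
 interpret F: free_act Ga n by (intro free_act.intro Gam.fin_group_axioms)
 interpret Fr: group_act Ga F.Fr by (rule F.Fr_act)
 interpret G: group_act Ga F.G by (rule F.G_act)
 let ?g = "card (carrier Ga)" and ?o = "Coset.order M"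
 have cg: "coprime ?g ?o" using cop gd by (metis coprime_commute coprime_divisors dvd_refl)
 \<comment> \<open>An inverse of the group order modulo the order of \<open>M\<close>; the
   \<open>k\<close>-th powers of the \<open>x i\<close> are their \<open>|Ga|\<close>-th
   roots.\<close>
 then obtain k where k: "[?g * k = 1] (mod ?o)" using cong_solve_coprime_nat by auto
 have pow_mod: "z [^] l = z [^] (l mod ?o)" if z: "z : carrier M" for z and l :: nat
 proof -
  have "z [^] l = z [^] (?o * (l div ?o) + l mod ?o)" by simp
  also have "\<dots> = (z [^] ?o) [^] (l div ?o) \<otimes> z [^] (l mod ?o)" using z by (simp only: nat_pow_mult[symmetric] nat_pow_pow)
  finally show ?thesis using z by (simp add: pow_order_eq_1)
 qed
 define s where "s i = x i [^] k" for i
 have xM: "x i : carrier M" if "i : {1..n}" for i using xP that by auto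
 have sM: "s i : carrier M" if "i : {1..n}" for i using xM[OF that] by (simp add: s_def)
 have s_pow: "s i [^] ?g = x i" if i: "i : {1..n}" for i
 proof -
  have "s i [^] ?g = x i [^] (?g * k)" using xM[OF i] by (simp add: s_def nat_pow_pow mult.commute)
  also have "\<dots> = x i [^] ((?g * k) mod ?o)" by (rule pow_mod[OF xM[OF i]])
  also have "\<dots> = x i [^] ((1::nat) mod ?o)" using k by (simp add: Cong.cong_def)
  also have "\<dots> = x i [^] (1::nat)" by (rule pow_mod[OF xM[OF i], symmetric])
  finally show ?thesis using xM[OF i] by simp
 qed
 \<comment> \<open>The free generator with index \<open>(i, ga)\<close> goes to the translate of
   \<open>s i\<close> by \<open>ga\<close>. So \<open>f\<close> commutes with the action on
   generators, and then everywhere by uniqueness of extensions.\<close>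
 obtain f where f: "f : hom F.Fr M" "continuous_map (topo F.Fr) (discrete_topology (carrier M)) f"
   and fx: "ALL z:F.AA. f (free_gen F.m F.AA z) = act M (snd z) (s (fst z))"
  using free_pro_exists_hom[OF is_group finM, of F.m "%z. act M (snd z) (s (fst z))" F.AA "gen_shift Ga"] sM cg
  by (fastforce simp: coprime_commute F.AA_def)
 have fgn: "f (F.gn i ga) = act M ga (s i)" if "i : {1..n}" "ga : carrier Ga" for i ga
  unfolding F.gn_def using fx that by (simp add: F.AA_def)
 interpret f: group_hom F.Fr M f by (intro group_hom.intro group_hom_axioms.intro f(1) is_group Fr.is_group)
 have f_act: "f (act F.Fr ga z) = act M ga (f z)" if ga: "ga : carrier Ga" and z: "z : carrier F.Fr" for ga z
 proof (rule free_pro_unique_hom[OF is_group _ _ _ _ _ z, where f = "%z. f (act F.Fr ga z)" and f' = "%z. act M ga (f z)"])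
  show "(%z. f (act F.Fr ga z)) : hom F.Fr M" by (rule homI) (use ga in \<open>simp_all add: Fr.act_m\<close>)
  show "(%z. act M ga (f z)) : hom F.Fr M" by (rule homI) (use ga in \<open>simp_all add: act_m\<close>)
  have "continuous_map (topo F.Fr) (topo F.Fr) (act F.Fr ga)"
   unfolding free_pro_simps(3,4) continuous_map_in_subtopology
   using F.act_cont[OF ga] F.Fr_act_closed[OF ga] by (auto intro: continuous_map_from_subtopology)
  then show "continuous_map (topo F.Fr) (discrete_topology (carrier M)) (%z. f (act F.Fr ga z))"
   using continuous_map_compose[OF _ f(2)] by (auto simp only: comp_def)
  have "continuous_map (discrete_topology (carrier M)) (discrete_topology (carrier M)) (act M ga)" using ga by auto
  from continuous_map_compose[OF f(2) this]
  show "continuous_map (topo F.Fr) (discrete_topology (carrier M)) (%z. act M ga (f z))" by (simp only: comp_def)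
  fix w assume "w : F.AA"
  then obtain i de where i: "i : {1..n}" "de : carrier Ga" and w: "w = (i, de)" unfolding F.AA_def by blast
  have "f (act F.Fr ga (F.gn i de)) = act M ga (f (F.gn i de))"
   unfolding free_pro_simps(3) F.gn_act[OF ga i] using i ga sM by (simp add: fgn act_mult)
  then show "f (act F.Fr ga (free_gen F.m F.AA w)) = act M ga (f (free_gen F.m F.AA w))" unfolding F.gn_def w .
 qed
 interpret P: profin_presentation Ga M d n x F.G "F.U ` F.stab" F.gens F.ag s f
 proof (intro profin_presentation.intro profin_presentation_axioms.intro presentation_axioms F.G_profin gd)
  have gen: "z : F.gens ==> z : carrier F.G" for z by (auto simp: F.G_simps closed_generate_def)
  show "F.gens \<subseteq> {F.ag i ga de | i ga de. i : {1..n} \<and> ga : carrier Ga \<and> de : carrier Ga}" unfolding F.gens_def ..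
  show "f : hom F.G M" using F.GG0_Fr by (intro homI) (auto simp: F.G_simps free_pro_simps(2)[symmetric] subsetD)
  show "f (act F.G ga z) = act M ga (f z)" if "ga : carrier Ga" "z : carrier F.G" for ga z
   using f_act[OF that(1), of z] that(2) F.GG0_Fr by (auto simp: F.G_simps free_pro_simps(3))
  have "openin (topo F.Fr) {z : topspace (topo F.Fr). f z : {\<one>}}" by (rule openin_continuous_map_preimage[OF f(2)]) simp
  then have "openin (topo F.G) (F.GG0 \<inter> {z : topspace (topo F.Fr). f z : {\<one>}})"
   unfolding F.G_simps(5) by (rule openin_subtopology_Int2)
  moreover have "F.GG0 \<inter> {z : topspace (topo F.Fr). f z : {\<one>}} = kernel F.G M f"
   using F.GG0_Fr by (auto simp: kernel_def F.G_simps F.Fr_top)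
  ultimately show "openin (topo F.G) (kernel F.G M f)" by simp
  fix i assume i: "i : {1..n}"
  show "s i : carrier M" "s i [^] card (carrier Ga) = x i" by (rule sM[OF i] s_pow[OF i])+
  fix ga de assume ga: "ga : carrier Ga" and de: "de : carrier Ga"
  show "F.ag i ga de : carrier F.G" by (rule gen, rule F.gensI[OF i ga de])
  show "act F.G be (F.ag i ga de) = F.ag i (be \<otimes>\<^bsub>Ga\<^esub> ga) (be \<otimes>\<^bsub>Ga\<^esub> de)" if "be : carrier Ga" for be
   unfolding F.G_simps(4) by (rule F.ag_act[OF i that ga de])
  show "F.ag i ga de \<otimes>\<^bsub>F.G\<^esub> F.ag i de ep = F.ag i ga ep" if "ep : carrier Ga" for ep
   unfolding F.G_simps(2) by (rule F.ag_mult[OF i ga de that])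
  have "F.ag i ga de = inv\<^bsub>F.Fr\<^esub> F.gn i ga \<otimes>\<^bsub>F.Fr\<^esub> F.gn i de"
   unfolding F.ag_def F.Fr_inv[OF F.gn_in(1)[OF i ga]] free_pro_simps(2) ..
  then show "f (F.ag i ga de) = inv (act M ga (s i)) \<otimes> act M de (s i)"
   using F.gn_in(1)[OF i] ga de by (simp add: f.hom_inv fgn[OF i])
 qed
 show ?thesis unfolding Let_def by (rule P.free_presentation)
qed

section \<open>Fractional ideals\<close>

lemma im_snoc:
 assumes "x : ideal_mult I J" "p : I" "q : J"
 shows "x + p * q : ideal_mult I J"
proof -
 obtain m a b where x: "x = (\<Sum>i<m. a i * b i)" "\<forall>i<(m::nat). a i : I \<and> b i : J" using assms(1) unfolding ideal_mult_def by auto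
 have "(\<Sum>i<m. (a(m := p)) i * (b(m := q)) i) = x" unfolding x(1) by (rule sum.cong) auto
 then have "x + p * q = (\<Sum>i<Suc m. (a(m := p)) i * (b(m := q)) i)" by simp
 moreover have "\<forall>i<Suc m. (a(m := p)) i : I \<and> (b(m := q)) i : J" using x(2) assms by (auto simp: less_Suc_eq)
 ultimately show ?thesis unfolding ideal_mult_def by blast
qed

lemma im_zero: "0 : ideal_mult I J"
 unfolding ideal_mult_def by (auto intro!: exI[of _ "0::nat"])

lemma im_prod: "p : I ==> q : J ==> p * q : ideal_mult I J"
 using im_snoc[OF im_zero] by simp

lemma im_add: "x : ideal_mult I J ==> y : ideal_mult I J ==> x + y : ideal_mult I J"
proof -
 assume x: "x : ideal_mult I J" and "y : ideal_mult I J"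
 then obtain m a b where y: "y = (\<Sum>i<m. a i * b i)" "\<forall>i<(m::nat). a i : I \<and> b i : J" unfolding ideal_mult_def by auto
 have "x + (\<Sum>i<k. a i * b i) : ideal_mult I J" if "k \<le> m" for k using that
 proof (induction k)
  case (Suc k)
  then have "x + (\<Sum>i<k. a i * b i) + a k * b k : ideal_mult I J" using y(2) by (intro im_snoc) auto
  then show ?case by (simp add: add.assoc)
 qed (use x in simp)
 then show ?thesis using y(1) by blast
qed

lemma im_least:
 assumes "!!a b. a : I ==> b : J ==> a * b : S" "0 : S" "!!x y. x : S ==> y : S ==> x + y : S"
 shows "ideal_mult I J \<subseteq> S"
proof
 fix x assume "x : ideal_mult I J"
 then obtain m a b where x: "x = (\<Sum>i<m. a i * b i)" "\<forall>i<(m::nat). a i : I \<and> b i : J" unfolding ideal_mult_def by auto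
 have "(\<Sum>i<k. a i * b i) : S" if "k \<le> m" for k using that by (induction k) (use assms x(2) in auto)
 then show "x : S" using x(1) by blast
qed

lemma im_comm: "ideal_mult I J = ideal_mult J I"
proof -
 have "ideal_mult I J \<subseteq> ideal_mult J I" for I J :: "'a set"
 proof (rule im_least)
  fix a b assume "a : I" "b : J"
  then have "b * a : ideal_mult J I" by (intro im_prod)
  then show "a * b : ideal_mult J I" by (simp add: mult.commute)
 qed (auto intro: im_zero im_add)
 then show ?thesis by blast
qed

lemma im_assoc: "ideal_mult (ideal_mult I J) L = ideal_mult I (ideal_mult J L)"
proof -
 have 1: "ideal_mult (ideal_mult I J) L \<subseteq> ideal_mult I (ideal_mult J L)" for I J L :: "'a set"
 proof (rule im_least)
  fix a l assume a: "a : ideal_mult I J" and l: "l : L"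
  have "ideal_mult I J \<subseteq> {z. z * l : ideal_mult I (ideal_mult J L)}"
   by (rule im_least) (use l in \<open>auto simp: mult.assoc distrib_right intro: im_prod im_zero im_add\<close>)
  then show "a * l : ideal_mult I (ideal_mult J L)" using a by blast
 qed (auto intro: im_zero im_add)
 have "ideal_mult I (ideal_mult J L) = ideal_mult (ideal_mult L J) I" by (simp only: im_comm)
 also have "\<dots> \<subseteq> ideal_mult L (ideal_mult J I)" by (rule 1)
 also have "\<dots> = ideal_mult (ideal_mult I J) L" by (simp only: im_comm)
 finally show ?thesis using 1[of I J L] by blast
qed

lemma im_mono: "I \<subseteq> I' ==> J \<subseteq> J' ==> ideal_mult I J \<subseteq> ideal_mult I' J'"
 by (rule im_least) (auto intro: im_prod im_zero im_add)

definition sca :: "'a::field => 'a set => 'a set" where "sca a I = (%x. a * x) ` I"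

lemma sca_mem: "a ~= 0 ==> x : sca a I \<longleftrightarrow> x / a : I"
 unfolding sca_def by (auto simp: image_iff intro!: bexI[of _ "x / a"])
lemma sca_sca: "sca a (sca b I) = sca (a * b) I" by (auto simp: sca_def image_image mult.assoc)
lemma sca_one: "sca 1 I = I" by (simp add: sca_def)

lemma im_sca: "ideal_mult (sca a I) J = sca a (ideal_mult I J)"
proof
 show "ideal_mult (sca a I) J \<subseteq> sca a (ideal_mult I J)"
 proof (rule im_least)
  fix p q assume "p : sca a I" "q : J"
  then obtain z where z: "z : I" "p = a * z" unfolding sca_def by blast
  show "p * q : sca a (ideal_mult I J)"
   using imageI[OF im_prod[OF z(1) \<open>q : J\<close>], of "(*) a"] z(2) by (simp add: sca_def mult.assoc)
 next
  show "0 : sca a (ideal_mult I J)" unfolding sca_def by (rule image_eqI[OF _ im_zero]) simp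
  fix x y assume "x : sca a (ideal_mult I J)" "y : sca a (ideal_mult I J)"
  then obtain x' y' where z: "x = a * x'" "y = a * y'" "x' : ideal_mult I J" "y' : ideal_mult I J" unfolding sca_def by blast
  show "x + y : sca a (ideal_mult I J)" unfolding sca_def
   by (rule image_eqI[OF _ im_add[OF z(3,4)]]) (simp add: z distrib_left)
 qed
 have "ideal_mult I J \<subseteq> {z. a * z : ideal_mult (sca a I) J}"
 proof (rule im_least)
  fix p q assume pq: "p : I" "q : J"
  then have "(a * p) * q : ideal_mult (sca a I) J" by (intro im_prod) (auto simp: sca_def)
  then show "p * q : {z. a * z : ideal_mult (sca a I) J}" by (simp add: mult.assoc)
 qed (auto simp: im_zero distrib_left im_add)
 then show "sca a (ideal_mult I J) \<subseteq> ideal_mult (sca a I) J" unfolding sca_def by blast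
qed

context number_fld
begin

abbreviation "FI \<equiv> fractional_ideals F"

lemma FI_D:
 assumes "I : FI"
 shows "!!x. x : I ==> x : F" "0 : I" "!!x y. x : I ==> y : I ==> x + y : I"
  "!!c x. c : RO ==> x : I ==> c * x : I" "EX d:RO - {0}. ALL x:I. d * x : RO" "EX x:I. x ~= 0"
 using assms unfolding fractional_ideals_def by auto

lemma FI_I:
 assumes "!!x. x : I ==> x : F" "0 : I" "!!x y. x : I ==> y : I ==> x + y : I"
  "!!c x. c : RO ==> x : I ==> c * x : I" "d : RO" "d ~= 0" "!!x. x : I ==> d * x : RO" "z : I" "z ~= 0"
 shows "I : FI"
proof -
 have "EX d:RO - {0}. ALL x:I. d * x : RO" using assms(5-7) by blast
 then show ?thesis unfolding fractional_ideals_def using assms(1-4,8,9) by blast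
qed

lemma FI_diff: "I : FI ==> x : I ==> y : I ==> x - y : I"
 using FI_D(3)[of I x "- y"] FI_D(4)[of I "-1" y] RO_neg[OF RO_1] by simp
lemma FI_int: "I : FI ==> x : I ==> of_int k * x : I" by (rule FI_D(4)[OF _ RO_ofint])

lemma RO_FI: "RO : FI"
 by (rule FI_I[of _ 1 1]) (auto simp: RO_0 RO_1 RO_add RO_mul RO_F)

lemma sca_FI: assumes I: "I : FI" and a: "a : F" "a ~= 0" shows "sca a I : FI"
proof -
 obtain d where d: "d : RO" "d ~= 0" "!!x. x : I ==> d * x : RO" using FI_D(5)[OF I] by blast
 obtain z where z: "z : I" "z ~= 0" using FI_D(6)[OF I] by blast
 obtain s :: int where s: "s > 0" "of_int s * inverse a : Lam" using clear_denominator[OF Finv[OF a(1)]] by blast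
 show ?thesis
 proof (rule FI_I[of _ "of_int s * inverse a * d" "a * z"])
  fix x assume "x : sca a I"
  then obtain y where y: "y : I" "x = a * y" unfolding sca_def by blast
  show "x : F" unfolding y(2) by (rule Fmul[OF a(1) FI_D(1)[OF I y(1)]])
  have e: "of_int s * inverse a * d * x = of_int s * (d * y)" using a(2) y(2) by (simp add: field_simps)
  show "of_int s * inverse a * d * x : RO" unfolding e by (rule RO_mul[OF RO_ofint d(3)[OF y(1)]])
  fix c assume "c : RO"
  then have "c * y : I" by (rule FI_D(4)[OF I _ y(1)])
  then show "c * x : sca a I" unfolding sca_def y(2) by (intro image_eqI[of _ _ "c * y"]) auto
 next
  fix x y assume "x : sca a I" "y : sca a I"
  then show "x + y : sca a I" using FI_D(3)[OF I] a(2) by (simp add: sca_mem add_divide_distrib)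
 qed (use s d z a RO_mul[OF Lam_RO[OF s(2)] d(1)] FI_D(2)[OF I] in \<open>auto simp: sca_mem\<close>)
qed

lemma im_FI: assumes I: "I : FI" and J: "J : FI" shows "ideal_mult I J : FI"
proof -
 obtain d where d: "d : RO" "d ~= 0" "!!x. x : I ==> d * x : RO" using FI_D(5)[OF I] by blast
 obtain e where e: "e : RO" "e ~= 0" "!!x. x : J ==> e * x : RO" using FI_D(5)[OF J] by blast
 obtain z where z: "z : I" "z ~= 0" using FI_D(6)[OF I] by blast
 obtain y where y: "y : J" "y ~= 0" using FI_D(6)[OF J] by blast
 have 1: "ideal_mult I J \<subseteq> F" by (rule im_least) (auto intro: Fmul Fadd F0 FI_D(1)[OF I] FI_D(1)[OF J])
 have 2: "ideal_mult I J \<subseteq> {x. c * x : ideal_mult I J}" if c: "c : RO" for c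
 proof (rule im_least)
  fix a b assume "a : I" "b : J"
  then have "(c * a) * b : ideal_mult I J" by (intro im_prod FI_D(4)[OF I c])
  then show "a * b : {x. c * x : ideal_mult I J}" by (simp add: mult.assoc)
 qed (auto simp: im_zero distrib_left im_add)
 have 3: "ideal_mult I J \<subseteq> {x. (d * e) * x : RO}"
 proof (rule im_least)
  fix a b assume "a : I" "b : J"
  then have "(d * a) * (e * b) : RO" by (intro RO_mul d e)
  then show "a * b : {x. (d * e) * x : RO}" by (simp add: mult_ac)
 qed (auto simp: RO_0 distrib_left RO_add)
 show ?thesis
  by (rule FI_I[of _ "d * e" "z * y"])
   (use 1 2 3 d e z y in \<open>auto simp: im_zero im_add im_prod RO_mul\<close>)
qed

lemma im_one: assumes I: "I : FI" shows "ideal_mult RO I = I"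
proof
 show "ideal_mult RO I \<subseteq> I" by (rule im_least) (auto intro: FI_D[OF I])
 show "I \<subseteq> ideal_mult RO I" using im_prod[OF RO_1] by fastforce
qed

text \<open>Hurwitz's argument with the number \<open>M!\<close>, divisible by every
  \<open>t\<close> that occurs. For \<open>x\<close> in \<open>RO\<close> the difference
  \<open>t x - z\<close> is an algebraic integer of norm less than \<open>1\<close>, hence
  \<open>0\<close>. For an ideal, \<open>y\<close> is an element of least norm; then
  \<open>t (x / y) - z\<close> vanishes as well, since its product with \<open>y\<close> would have
  smaller norm. So \<open>M! / y\<close> scales the ideal into \<open>RO\<close> and
  \<open>y\<close> to \<open>M!\<close>.\<close>

lemma exists_mm: "\<exists>m::nat. m > 0 \<and> (ALL x:RO. of_nat m * x : Lam) \<and>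
  (ALL I:FI. EX a:F - {0}. (ALL x:I. a * x : RO) \<and> (EX y:I. a * y = of_nat m))"
proof -
 obtain M :: nat where M: "M > 0" "!!x. x : F ==> EX t:{1..M}. EX z:Lam. nr (of_nat t * x - z) < 1" using hurwitz by blast
 have Lam_mult: "of_nat k * z : Lam" if "z : Lam" for k z
  using that co_int[of z _ "int k"] by (simp add: Lam_def Fmul Fnat)
 have fact_mult: "of_nat (fact M) * x : Lam" if t: "t : {1..M}" "of_nat t * x : Lam" for t x
 proof -
  have "t dvd fact M" using t(1) by (intro dvd_fact) auto
  then obtain k :: nat where k: "fact M = t * k" by (rule dvdE)
  have "of_nat (t * k) * x = of_nat k * (of_nat t * x)" by (simp add: mult_ac)
  also have "\<dots> : Lam" by (rule Lam_mult[OF t(2)])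
  finally have "of_nat (t * k) * x : Lam" .
  then show "of_nat (fact M) * x : Lam" unfolding k .
 qed
 have nr_nat: "nr x = of_int \<lfloor>nr x\<rfloor>" if "x : RO" for x using nr_integral[OF that] by (auto elim: Ints_cases)
 have 1: "of_nat (fact M) * x : Lam" if x: "x : RO" for x
 proof -
  obtain t z where t: "t : {1..M}" "z : Lam" "nr (of_nat t * x - z) < 1" using M(2)[OF RO_F[OF x]] by blast
  let ?u = "of_nat t * x - z"
  have u: "?u : RO" using RO_diff[OF RO_mul[OF RO_ofint[of "int t"] x] Lam_RO[OF t(2)]] by simp
  have "?u = 0"
  proof (rule ccontr)
   assume "?u ~= 0"
   then have "nr ?u > 0" by (rule nr_pos[OF RO_F[OF u]])
   moreover obtain k where "nr ?u = of_int k" using nr_integral[OF u] by (rule Ints_cases)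
   ultimately show False using t(3) by simp
  qed
  then show ?thesis using fact_mult[OF t(1)] t(2) by simp
 qed
 have "EX a:F - {0}. (ALL x:I. a * x : RO) \<and> (EX y:I. a * y = of_nat (fact M))" if I: "I : FI" for I
 proof -
  obtain d where d: "d : RO" "d ~= 0" "!!x. x : I ==> d * x : RO" using FI_D(5)[OF I] by blast
  obtain z0 where z0: "z0 : I \<and> z0 ~= 0" using FI_D(6)[OF I] by blast
  \<comment> \<open>The factor \<open>d\<close> makes the norms integers, so that a least one
    exists.\<close>
  obtain y where y: "y : I" "y ~= 0" and min: "!!u. u : I ==> u ~= 0 ==> nat \<lfloor>nr (d * y)\<rfloor> \<le> nat \<lfloor>nr (d * u)\<rfloor>"
   using ex_has_least_nat[of "%u. u : I \<and> u ~= 0" z0 "%u. nat \<lfloor>nr (d * u)\<rfloor>"] z0 by blast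
  have yF: "y : F" by (rule FI_D(1)[OF I y(1)])
  have key: "of_nat (fact M) * (x / y) : Lam" if x: "x : I" for x
  proof -
   have xy: "x / y : F" by (rule Fdiv[OF FI_D(1)[OF I x] yF])
   obtain t z where t: "t : {1..M}" "z : Lam" "nr (of_nat t * (x / y) - z) < 1" using M(2)[OF xy] by blast
   let ?v = "of_nat t * (x / y) - z" let ?u = "of_nat t * x - z * y"
   have vF: "?v : F" by (intro Fdiff Fmul Fnat xy RO_F Lam_RO t(2))
   have u: "?u : I" using FI_diff[OF I FI_int[OF I x, of "int t"] FI_D(4)[OF I Lam_RO[OF t(2)] y(1)]] by simp
   have uv: "?u = y * ?v" using y(2) by (simp add: field_simps)
   have "?u = 0"
   proof (rule ccontr)
    assume nz: "?u ~= 0"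
    have dy: "d * y : F" "d * y ~= 0" using d y yF by (auto intro: Fmul RO_F)
    have e: "d * ?u = d * y * ?v" unfolding uv by simp
    have "nr (d * ?u) = nr (d * y) * nr ?v" unfolding e by (rule nr_mult[OF dy(1) vF])
    also have "\<dots> < nr (d * y) * 1" using nr_pos[OF dy] t(3) by (intro mult_strict_left_mono)
    finally have "of_int \<lfloor>nr (d * ?u)\<rfloor> < (of_int \<lfloor>nr (d * y)\<rfloor> :: rat)"
     unfolding nr_nat[OF d(3)[OF u], symmetric] nr_nat[OF d(3)[OF y(1)], symmetric] by simp
    then have "\<lfloor>nr (d * ?u)\<rfloor> < \<lfloor>nr (d * y)\<rfloor>" by simp
    moreover have "0 \<le> \<lfloor>nr (d * ?u)\<rfloor>" by (simp add: nr_def)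
    ultimately show False using min[OF u nz] by linarith
   qed
   then have "of_nat t * (x / y) = z" using uv y(2) by simp
   then show ?thesis using fact_mult[OF t(1), of "x / y"] t(2) by simp
  qed
  let ?a = "of_nat (fact M) / y"
  have "?a : F - {0}" using y(2) Fdiv[OF Fnat[of "fact M"] yF] by (simp del: of_nat_fact)
  moreover have "?a * x : RO" if "x : I" for x using Lam_RO[OF key[OF that]] by simp
  moreover have "?a * y = of_nat (fact M)" using y(2) by simp
  ultimately show ?thesis using y(1) by blast
 qed
 then show ?thesis using 1 by (intro exI[of _ "fact M"]) simp
qed

section \<open>Finiteness of ideal classes and invertibility of ideals\<close>

definition "mm = (SOME m::nat. m > 0 \<and> (ALL x:RO. of_nat m * x : Lam) \<and>
  (ALL I:FI. EX a:F - {0}. (ALL x:I. a * x : RO) \<and> (EX y:I. a * y = of_nat m)))"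

lemma mm: "mm > 0" "x : RO ==> of_nat mm * x : Lam"
  "I : FI ==> EX a:F - {0}. (ALL x:I. a * x : RO) \<and> (EX y:I. a * y = of_nat mm)"
 using someI_ex[OF exists_mm, folded mm_def] by blast+

text \<open>Closure under addition makes these sets unions of cosets of \<open>k RO\<close>, which
  is why there are finitely many of them for \<open>k > 0\<close>; every integral ideal containing
  \<open>k\<close> is among them.\<close>

definition AF :: "nat => 'a set set" where
 "AF k = {A. A \<subseteq> RO \<and> (ALL x:A. ALL y:A. x + y : A) \<and> (ALL x:RO. of_nat k * x : A)}"

text \<open>As \<open>mm x\<close> lies in \<open>Lam\<close>, its coordinates modulo
  \<open>k mm\<close> determine \<open>x\<close> modulo \<open>k Lam\<close>. They are a finite
  substitute for the residue class of \<open>x\<close> modulo \<open>k RO\<close>.\<close>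

definition res :: "nat => 'a => nat => int" where
 "res k x = (\<lambda>i\<in>{..<n}. \<lfloor>co (of_nat mm * x) i\<rfloor> mod (int k * int mm))"

lemma res_in: "k > 0 ==> res k x : {..<n} \<rightarrow>\<^sub>E {0..<int k * int mm}"
 unfolding res_def using mm(1) by auto

lemma res_eq:
 assumes k: "k > 0" and x: "x : RO" and y: "y : RO" and eq: "res k x = res k y"
 shows "EX u:Lam. x = y + of_nat k * u"
proof -
 let ?u = "(x - y) / of_nat k"
 have uF: "?u : F" by (intro Fdiv Fdiff Fnat RO_F x y)
 have "co ?u i : \<int>" if i: "i < n" for i
 proof -
  obtain a where a: "co (of_nat mm * x) i = of_int a" using mm(2)[OF x] i unfolding Lam_def by (auto elim: Ints_cases)
  obtain b where b: "co (of_nat mm * y) i = of_int b" using mm(2)[OF y] i unfolding Lam_def by (auto elim: Ints_cases)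
  have "a mod (int k * int mm) = b mod (int k * int mm)" using fun_cong[OF eq, of i] i a b by (simp add: res_def)
  then have "int k * int mm dvd a - b" by (simp add: mod_eq_dvd_iff)
  then obtain c where c: "a - b = int k * int mm * c" ..
  have e: "of_nat mm * x - of_nat mm * y = of_int (int k * int mm) * ?u" using k by (simp add: field_simps)
  have "of_int (int k * int mm) * co ?u i = co (of_nat mm * x - of_nat mm * y) i" unfolding e by (rule co_int[OF uF i, symmetric])
  also have "\<dots> = of_int (a - b)" using co_diff[OF Fmul[OF Fnat RO_F[OF x]] Fmul[OF Fnat RO_F[OF y]] i] a b by simp
  finally have "of_int (int k * int mm) * co ?u i = of_int (int k * int mm) * of_int c" unfolding c by simp
  then have "co ?u i = of_int c" using k mm(1) by simp
  then show ?thesis by simp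
 qed
 then have "?u : Lam" using uF by (simp add: Lam_def)
 moreover have "x = y + of_nat k * ?u" using k by simp
 ultimately show ?thesis by blast
qed

lemma AF_sub:
 assumes k: "k > 0" and A: "A : AF k" and B: "B : AF k" and im: "res k ` A \<subseteq> res k ` B"
 shows "A \<subseteq> B"
proof
 fix x assume x: "x : A"
 obtain y where y: "y : B" "res k x = res k y" using im x by blast
 have "x : RO" "y : RO" using x y A B by (auto simp: AF_def)
 then obtain u where "u : Lam" "x = y + of_nat k * u" using res_eq[OF k] y(2) by blast
 then show "x : B" using B y(1) Lam_RO by (auto simp: AF_def)
qed

lemma finite_AF: "k > 0 ==> finite (AF k)"
proof (rule inj_on_finite[of "%A. res k ` A" _ "Pow ({..<n} \<rightarrow>\<^sub>E {0..<int k * int mm})"])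
 assume k: "k > 0"
 show "inj_on (%A. res k ` A) (AF k)"
 proof (rule inj_onI)
  fix A B assume "A : AF k" "B : AF k" "res k ` A = res k ` B"
  then show "A = B" using AF_sub[OF k, of A B] AF_sub[OF k, of B A] by simp
 qed
 show "(%A. res k ` A) ` AF k \<subseteq> Pow ({..<n} \<rightarrow>\<^sub>E {0..<int k * int mm})" using res_in[OF k] by blast
 show "finite (Pow ({..<n} \<rightarrow>\<^sub>E {0..<int k * int mm}))" by (intro finite_Pow_iff[THEN iffD2] finite_PiE) auto
qed

lemma reduce: assumes I: "I : FI" shows "EX a:F - {0}. sca a I : AF mm"
proof -
 obtain a y where a: "a : F - {0}" "ALL x:I. a * x : RO" "y : I" "a * y = of_nat mm" using mm(3)[OF I] by blast
 have "sca a I : FI" using sca_FI[OF I] a(1) by blast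
 moreover have "of_nat mm : sca a I" unfolding sca_def using a(3,4) by (metis imageI)
 ultimately have "of_nat mm * x : sca a I" if "x : RO" for x using FI_D(4)[OF _ that] by (metis mult.commute)
 moreover have "x + y : sca a I" if "x : sca a I" "y : sca a I" for x y using FI_D(3)[OF \<open>sca a I : FI\<close>] that by blast
 moreover have "sca a I \<subseteq> RO" unfolding sca_def using a(2) by blast
 ultimately show ?thesis using a(1) unfolding AF_def by blast
qed

text \<open>After scaling into \<open>AF mm\<close>, representatives of the finitely many residues
  together with the multiples \<open>mm w_i\<close> of the basis generate additively.\<close>

lemma FI_fg: assumes I: "I : FI" shows "EX W. finite W \<and> W \<subseteq> I \<and> I \<subseteq> zspan W"
proof -
 obtain a where a: "a : F" "a ~= 0" "sca a I : AF mm" using reduce[OF I] by blast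
 let ?A = "sca a I"
 have AR: "?A \<subseteq> RO" using a(3) by (simp add: AF_def)
 have fin: "finite (res mm ` ?A)"
  by (rule finite_subset[of _ "{..<n} \<rightarrow>\<^sub>E {0..<int mm * int mm}"]) (use res_in[OF mm(1)] in \<open>auto intro!: finite_PiE\<close>)
 obtain Rp where Rp: "Rp \<subseteq> ?A" "finite Rp" "res mm ` ?A = res mm ` Rp" using finite_subset_image[OF fin subset_refl] by blast
 let ?W = "Rp \<union> (%i. of_nat mm * w i) ` {..<n}"
 have WA: "?W \<subseteq> ?A" using Rp(1) a(3) w_in w_int by (auto simp: AF_def integers_def)
 have finW: "finite ?W" using Rp(2) by simp
 have "?A \<subseteq> zspan ?W"
 proof
  fix x assume x: "x : ?A"
  obtain y where y: "y : Rp" "res mm x = res mm y" using Rp(3) x by (metis imageE imageI)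
  obtain u where u: "u : Lam" "x = y + of_nat mm * u" using res_eq[OF mm(1), of x y] x y Rp(1) AR by blast
  have "of_nat mm * (of_rat (co u i) * w i) : zspan ?W" if i: "i < n" for i
  proof -
   obtain c where "co u i = of_int c" using u(1) i unfolding Lam_def by (auto elim: Ints_cases)
   then have "of_nat mm * (of_rat (co u i) * w i) = of_int c * (of_nat mm * w i)" by simp
   also have "\<dots> : zspan ?W" by (rule zspan_scale[OF zspan_gen[OF finW]]) (use i in blast)
   finally show ?thesis .
  qed
  then have "(\<Sum>i<n. of_nat mm * (of_rat (co u i) * w i)) : zspan ?W" by (intro zspan_sum) auto
  also have "(\<Sum>i<n. of_nat mm * (of_rat (co u i) * w i)) = of_nat mm * u"
   using expand[of u] u(1) by (simp add: Lam_def flip: sum_distrib_left)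
  finally have mu: "of_nat mm * u : zspan ?W" .
  show "x : zspan ?W" unfolding u(2) by (rule zspan_add[OF zspan_gen[OF finW UnI1[OF y(1)]] mu])
 qed
 let ?V = "(%x. x / a) ` ?W"
 have "zspan ?W \<subseteq> {x. x / a : zspan ?V}"
 proof (rule zspan_least)
  show "?W \<subseteq> {x. x / a : zspan ?V}" by (intro subsetI CollectI zspan_gen finite_imageI finW imageI)
  show "of_int k * x : {x. x / a : zspan ?V}" if "x : {x. x / a : zspan ?V}" for k x
   using zspan_scale[of "x / a" ?V k] that by simp
 qed (auto simp: zspan_zero add_divide_distrib zspan_add)
 then have "I \<subseteq> zspan ?V"
 proof -
  assume s: "zspan ?W \<subseteq> {x. x / a : zspan ?V}"
  show ?thesis
  proof
   fix x assume "x : I"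
   then have "a * x : zspan ?W" using \<open>?A \<subseteq> zspan ?W\<close> by (auto simp: sca_def)
   then have "a * x / a : zspan ?V" using s by blast
   then show "x : zspan ?V" using a(2) by simp
  qed
 qed
 moreover have "?V \<subseteq> I" using WA a(2) by (auto simp: sca_mem)
 moreover have "finite ?V" using finW by blast
 ultimately show ?thesis by blast
qed

text \<open>The determinant trick shows that an ideal \<open>C\<close> with \<open>CB = B\<close> is integral and, applied once
 more in the form of Nakayama's lemma, that it contains \<open>1\<close>.\<close>

lemma cancel_one:
 assumes B: "B : FI" and C: "C : FI" and CB: "ideal_mult C B = B"
 shows "C = RO"
proof
 obtain W where W: "finite W" "W \<subseteq> B" "B \<subseteq> zspan W" using FI_fg[OF B] by blast
 obtain b where b: "b : B" "b ~= 0" using FI_D(6)[OF B] by blast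
 have nz: "EX w0:W. w0 ~= 0"
 proof (rule ccontr)
  assume "\<not> ?thesis"
  then have "zspan W \<subseteq> {0}" by (intro zspan_least) auto
  then show False using b W(3) by blast
 qed
 then obtain w0 where w0: "w0 : W" "w0 ~= 0" by blast
 show "C \<subseteq> RO"
 proof
  fix c assume c: "c : C"
  have "c * v : zspan W" if "v : W" for v using im_prod[OF c, of v B] that W(2,3) CB by blast
  then have "algebraic_int c" by (rule algebraic_int_stable[OF W(1) w0])
  then show "c : RO" using FI_D(1)[OF C c] by (simp add: integers_def)
 qed
 have CW: "EX a. (ALL v:W. a v : C) \<and> x = (\<Sum>v\<in>W. a v * v)" if x: "x : B" for x
 proof -
  have "ideal_mult C B \<subseteq> {x. EX a. (ALL v:W. a v : C) \<and> x = (\<Sum>v\<in>W. a v * v)}"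
  proof (rule im_least)
   fix c b assume c: "c : C" and "b : B"
   then obtain k where "b = (\<Sum>v\<in>W. of_int (k v) * v)" using W(3) unfolding zspan_def by blast
   then have "c * b = (\<Sum>v\<in>W. (of_int (k v) * c) * v)" by (simp add: sum_distrib_left mult_ac)
   moreover have "ALL v:W. of_int (k v) * c : C" using FI_int[OF C c] by blast
   ultimately show "c * b : {x. EX a. (ALL v:W. a v : C) \<and> x = (\<Sum>v\<in>W. a v * v)}"
    by (intro CollectI exI[of _ "%v. of_int (k v) * c"]) simp
  next
   show "0 : {x. EX a. (ALL v:W. a v : C) \<and> x = (\<Sum>v\<in>W. a v * v)}" using FI_D(2)[OF C] by (intro CollectI exI[of _ "%v. 0"]) simp
   fix x y assume "x : {x. EX a. (ALL v:W. a v : C) \<and> x = (\<Sum>v\<in>W. a v * v)}" "y : {x. EX a. (ALL v:W. a v : C) \<and> x = (\<Sum>v\<in>W. a v * v)}"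
   then obtain a a' where "ALL v:W. a v : C" "x = (\<Sum>v\<in>W. a v * v)" "ALL v:W. a' v : C" "y = (\<Sum>v\<in>W. a' v * v)" by (elim CollectE exE conjE)
   then show "x + y : {x. EX a. (ALL v:W. a v : C) \<and> x = (\<Sum>v\<in>W. a v * v)}"
    by (intro CollectI exI[of _ "%v. a v + a' v"]) (simp add: FI_D(3)[OF C] distrib_right sum.distrib)
  qed
  then show ?thesis using x CB by blast
 qed
 obtain e where e: "bij_betw e {..<card W} W" using ex_bij_betw_nat_finite[OF W(1)] by (auto simp: lessThan_atLeast0)
 have eW: "e i : W" if "i < card W" for i using e that by (auto simp: bij_betw_def)
 have "ALL v:W. EX a. (ALL u:W. a u : C) \<and> v = (\<Sum>u\<in>W. a u * u)" using CW W(2) by blast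
 from bchoice[OF this] obtain a where a: "ALL v:W. (ALL u:W. a v u : C) \<and> v = (\<Sum>u\<in>W. a v u * u)" ..
 have CR: "x : RO" if "x : C" for x using \<open>C \<subseteq> RO\<close> that by blast
 have "EX c:C. \<forall>i<card W. (1 - c) * e i : {0}"
 proof (rule module_elimination[where s = "(*)" and a = "%i j. a (e i) (e j)"])
  show "Modules.module ((*) :: 'a => 'a => 'a)" by unfold_locales (simp_all add: algebra_simps)
  then show "module.subspace ((*) :: 'a => 'a => 'a) {0}" by (rule module.subspace_single_0)
  show "0 : C" by (rule FI_D(2)[OF C])
  fix i assume i: "i < card W"
  have "e i = (\<Sum>u\<in>W. a (e i) u * u)" using a eW[OF i] by blast
  also have "\<dots> = (\<Sum>j<card W. a (e i) (e j) * e j)" by (rule sum.reindex_bij_betw[OF e, symmetric])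
  finally show "e i - (\<Sum>j<card W. a (e i) (e j) * e j) : {0}" by simp
  fix j assume "j < card W"
  then show "a (e i) (e j) : C" using a eW i by blast
 next
  fix x y assume x: "x : C" and y: "y : C"
  show "x + y : C" by (rule FI_D(3)[OF C x y])
  show "x * y : C" by (rule FI_D(4)[OF C CR[OF x] y])
  show "- x : C" using FI_diff[OF C FI_D(2)[OF C] x] by simp
 qed
 then obtain c where c: "c : C" "\<forall>i<card W. (1 - c) * e i = 0" by blast
 have "w0 : e ` {..<card W}" using e w0(1) by (simp add: bij_betw_def)
 then obtain i0 where "i0 < card W" "e i0 = w0" by auto
 then have "c = 1" using c(2) w0(2) by auto
 then show "RO \<subseteq> C" using FI_D(4)[OF C _ c(1)] by fastforce
qed

text \<open>The powers of \<open>I\<close>, scaled into the finite set \<open>AF mm\<close>, cannot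
  all be different. Cancelling the smaller of two powers with \<open>cancel_one\<close> shows that
  \<open>z\<close> times a positive power of \<open>I\<close> is \<open>RO\<close>, so
  \<open>z\<close> times the preceding power is an inverse.\<close>

lemma inverse_ex: assumes I: "I : FI" shows "EX J:FI. ideal_mult J I = RO"
proof -
 define pw where "pw k = ((ideal_mult I) ^^ k) RO" for k
 have pw0: "pw 0 = RO" and pwS: "pw (Suc k) = ideal_mult I (pw k)" for k by (simp_all add: pw_def)
 have pwF: "pw k : FI" for k by (induction k) (simp_all add: pw0 pwS RO_FI im_FI[OF I])
 have pw_add: "pw (k + l) = ideal_mult (pw k) (pw l)" for k l
  by (induction k) (simp_all add: pw0 pwS im_one[OF pwF] im_assoc)
 have "ALL k. EX a. a : F - {0} \<and> sca a (pw k) : AF mm" using reduce[OF pwF] by blast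
 from choice[OF this] obtain a where a: "ALL k. a k : F - {0} \<and> sca (a k) (pw k) : AF mm" ..
 have "\<not> inj (%k. sca (a k) (pw k))"
 proof
  assume "inj (%k. sca (a k) (pw k))"
  then have "infinite (range (%k. sca (a k) (pw k)))" by (rule range_inj_infinite)
  moreover have "range (%k. sca (a k) (pw k)) \<subseteq> AF mm" using a by blast
  ultimately show False using finite_AF[OF mm(1)] finite_subset by blast
 qed
 then obtain i j where ij: "i < j" "sca (a i) (pw i) = sca (a j) (pw j)" unfolding inj_def by (metis linorder_neqE_nat)
 obtain k where k: "j = Suc k + i" using ij(1) by (metis add.commute add_Suc_right less_iff_Suc_add)
 define z where "z = a j / a i"
 have zF: "z : F" "z ~= 0" using a Fdiv by (auto simp: z_def)
 have ai: "a i ~= 0" using a by blast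
 let ?C = "sca z (pw (Suc k))"
 have "ideal_mult ?C (pw i) = sca z (pw j)" unfolding im_sca k pw_add ..
 also have "\<dots> = sca (inverse (a i)) (sca (a j) (pw j))" by (simp add: sca_sca z_def field_simps)
 also have "\<dots> = pw i" unfolding ij(2)[symmetric] sca_sca using ai by (simp add: sca_one)
 finally have "?C = RO" by (rule cancel_one[OF pwF sca_FI[OF pwF zF]])
 then have "ideal_mult (sca z (pw k)) I = RO" unfolding im_sca by (simp only: pwS im_comm)
 then show ?thesis using sca_FI[OF pwF zF] by blast
qed

lemma ideal_comm_group: "comm_group (ideal_group F)"
 by (rule comm_groupI)
  (simp_all add: ideal_group_def im_FI RO_FI im_assoc im_one inverse_ex, rule im_comm)

lemma principal_sca: "principal_ideals F = {sca a RO | a. a : F - {0}}"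
 by (simp add: principal_ideals_def sca_def)

lemma principal_subgroup: "subgroup (principal_ideals F) (ideal_group F)"
proof -
 interpret G: comm_group "ideal_group F" by (rule ideal_comm_group)
 have mult: "ideal_mult (sca a RO) (sca b RO) = sca (a * b) RO" if "a : F - {0}" "b : F - {0}" for a b
  using that sca_FI[OF RO_FI, of b] by (simp add: im_sca im_one sca_sca)
 show ?thesis
 proof (rule G.subgroupI)
  show "principal_ideals F \<subseteq> carrier (ideal_group F)" unfolding principal_sca using sca_FI[OF RO_FI] by (auto simp: ideal_group_def)
  have "sca 1 RO : principal_ideals F" unfolding principal_sca using F1 by (intro CollectI exI[of _ 1]) simp
  then show "principal_ideals F ~= {}" by (rule ne_empty)
  fix I assume "I : principal_ideals F"
  then obtain a where a: "I = sca a RO" "a : F - {0}" unfolding principal_sca by blast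
  have i: "inverse a : F - {0}" using a(2) Finv by auto
  have "inv\<^bsub>ideal_group F\<^esub> I = sca (inverse a) RO"
  proof (rule G.inv_equality)
   show "sca (inverse a) RO \<otimes>\<^bsub>ideal_group F\<^esub> I = \<one>\<^bsub>ideal_group F\<^esub>"
    using mult[OF i a(2)] a by (simp add: ideal_group_def sca_one)
  qed (use a i sca_FI[OF RO_FI] in \<open>auto simp: ideal_group_def\<close>)
  then show "inv\<^bsub>ideal_group F\<^esub> I : principal_ideals F" unfolding principal_sca using i by blast
  fix J assume "J : principal_ideals F"
  then obtain b where b: "J = sca b RO" "b : F - {0}" unfolding principal_sca by blast
  have "a * b : F - {0}" using a(2) b(2) Fmul by auto
  then show "I \<otimes>\<^bsub>ideal_group F\<^esub> J : principal_ideals F"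
   unfolding principal_sca using mult[OF a(2) b(2)] a(1) b(1) by (auto simp: ideal_group_def)
 qed
qed

end

lemma comm_group_top_quot:
 assumes G: "comm_group G" and N: "subgroup N G"
 shows "top_normal N G" "comm_group (top_quot G N)"
proof -
 interpret G: comm_group G by fact
 show t: "top_normal N G" unfolding top_normal_def using N by (simp add: G.normal_iff_subgroup)
 interpret T: top_normal N G by (rule t)
 interpret Q: group "top_quot G N" by (rule T.quot_group)
 show "comm_group (top_quot G N)"
 proof (rule Q.group_comm_groupI)
  fix v w assume "v : carrier (top_quot G N)" "w : carrier (top_quot G N)"
  then obtain x y where "x : carrier G" "v = N #>\<^bsub>G\<^esub> x" "y : carrier G" "w = N #>\<^bsub>G\<^esub> y" unfolding T.prj_surj by blast
  then show "v \<otimes>\<^bsub>top_quot G N\<^esub> w = w \<otimes>\<^bsub>top_quot G N\<^esub> v" by (simp add: top_quot_simps T.prj_mult G.m_comm)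
 qed
qed

section \<open>Finite discrete modules and their prime-to-\<open>d\<close> quotients\<close>

definition discrete_group :: "('a, 'g, 'm) top_group_scheme => bool" where
 "discrete_group G \<longleftrightarrow> (ALL V. openin (topo G) V \<longleftrightarrow> V \<subseteq> carrier G)"

lemma discrete_top_quot:
 assumes "top_normal N G" "discrete_group G" shows "discrete_group (top_quot G N)"
 using assms(2) unfolding discrete_group_def top_normal.openin_quot[OF assms(1)] by auto

locale finite_module = group_act Ga C + comm_group C
 for Ga :: "('g, 'z) monoid_scheme" and C :: "('a, 'g, 'm) top_group_scheme" (structure) +
 fixes d :: nat
 assumes finC: "finite (carrier C)" and disc: "discrete_group C"
begin

definition "NN = {N. N \<lhd> C \<and> closedin (topo C) N \<and> order_coprime (top_quot C N) d}"

text \<open>As with \<open>GG\<close>, an order prime to \<open>d\<close> is traded for an exponent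
  prime to \<open>d\<close>. In one direction the discrete quotient is tested on its trivial
  subgroup, which is open and has the elements of the quotient as cosets.\<close>

lemma NN_iff: "N : NN \<longleftrightarrow> subgroup N C \<and> (EX u. coprime u d \<and> (ALL x:carrier C. x [^] (u::nat) : N))"
proof
 assume N: "N : NN"
 then have sub: "subgroup N C" by (simp add: NN_def normal_imp_subgroup)
 interpret T: top_normal N C by (rule comm_group_top_quot(1)[OF comm_group_axioms sub])
 interpret Q: group "top_quot C N" by (rule T.quot_group)
 interpret p: group_hom C "top_quot C N" "%x. N #> x"
  by (intro group_hom.intro group_hom_axioms.intro T.prj_hom is_group Q.is_group)
 have "openin (topo (top_quot C N)) {\<one>\<^bsub>top_quot C N\<^esub>}"
  using discrete_top_quot[OF T.top_normal_axioms disc] by (simp add: discrete_group_def)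
 then have "coprime (card (rcosets\<^bsub>top_quot C N\<^esub> {\<one>\<^bsub>top_quot C N\<^esub>})) d"
  using N Q.triv_subgroup unfolding NN_def order_coprime_def by blast
 moreover have "rcosets\<^bsub>top_quot C N\<^esub> {\<one>\<^bsub>top_quot C N\<^esub>} = (%x. {x}) ` carrier (top_quot C N)"
  by (auto simp: RCOSETS_def r_coset_def)
 then have "card (rcosets\<^bsub>top_quot C N\<^esub> {\<one>\<^bsub>top_quot C N\<^esub>}) = Coset.order (top_quot C N)"
  by (simp add: card_image Coset.order_def)
 moreover have "x [^] Coset.order (top_quot C N) : N" if x: "x : carrier C" for x
 proof -
  have "N #> (x [^] Coset.order (top_quot C N)) = \<one>\<^bsub>top_quot C N\<^esub>"
   using p.hom_nat_pow[OF x, of "Coset.order (top_quot C N)"] Q.pow_order_eq_1[of "N #> x"] x by simp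
  then show ?thesis using T.prj_ker[OF nat_pow_closed[OF x]] by simp
 qed
 ultimately show "subgroup N C \<and> (EX u. coprime u d \<and> (ALL x:carrier C. x [^] (u::nat) : N))" using sub by auto
next
 assume "subgroup N C \<and> (EX u. coprime u d \<and> (ALL x:carrier C. x [^] (u::nat) : N))"
 then obtain u where sub: "subgroup N C" and u: "coprime u d" "ALL x:carrier C. x [^] (u::nat) : N" by blast
 interpret T: top_normal N C by (rule comm_group_top_quot(1)[OF comm_group_axioms sub])
 interpret Q: comm_group "top_quot C N" by (rule comm_group_top_quot(2)[OF comm_group_axioms sub])
 interpret p: group_hom C "top_quot C N" "%x. N #> x"
  by (intro group_hom.intro group_hom_axioms.intro T.prj_hom is_group Q.is_group)
 have "topspace (topo C) = carrier C"
  using disc openin_topspace[of "topo C"] openin_subset[of "topo C" "carrier C"] unfolding discrete_group_def by blast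
 then have "closedin (topo C) N" using disc subgroup.subset[OF sub] unfolding closedin_def discrete_group_def by auto
 moreover have "order_coprime (top_quot C N) d" unfolding order_coprime_def
 proof (intro allI impI)
  fix U assume "subgroup U (top_quot C N) \<and> openin (topo (top_quot C N)) U"
  then have U: "subgroup U (top_quot C N)" ..
  interpret T2: top_normal U "top_quot C N" by (rule comm_group_top_quot(1)[OF Q.comm_group_axioms U])
  interpret Q2: group "top_quot (top_quot C N) U" by (rule T2.quot_group)
  interpret p2: group_hom "top_quot C N" "top_quot (top_quot C N) U" "%x. U #>\<^bsub>top_quot C N\<^esub> x"
   by (intro group_hom.intro group_hom_axioms.intro T2.prj_hom Q.is_group Q2.is_group)
  have "finite (carrier (top_quot (top_quot C N) U))" unfolding T2.prj_surj T.prj_surj using finC by blast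
  moreover have "z [^]\<^bsub>top_quot (top_quot C N) U\<^esub> u = \<one>\<^bsub>top_quot (top_quot C N) U\<^esub>"
   if z: "z : carrier (top_quot (top_quot C N) U)" for z
  proof -
   obtain x where x: "x : carrier C" "z = U #>\<^bsub>top_quot C N\<^esub> (N #> x)" using z unfolding T2.prj_surj T.prj_surj by blast
   have "N #> (x [^] u) = \<one>\<^bsub>top_quot C N\<^esub>" using T.prj_ker[OF nat_pow_closed[OF x(1)]] u(2) x(1) by blast
   then have "(N #> x) [^]\<^bsub>top_quot C N\<^esub> u = \<one>\<^bsub>top_quot C N\<^esub>" using p.hom_nat_pow[OF x(1), of u] by simp
   then show ?thesis unfolding x(2) using p2.hom_nat_pow[of "N #> x" u] x(1) p2.hom_one p.hom_closed by metis
  qed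
  ultimately have "coprime (Coset.order (top_quot (top_quot C N) U)) d" by (rule Q2.exponent_coprime_order[OF _ _ u(1)])
  then show "coprime (card (rcosets\<^bsub>top_quot C N\<^esub> U)) d" by (simp add: Coset.order_def top_quot_simps)
 qed
 ultimately show "N : NN" unfolding NN_def using sub by (simp add: normal_iff_subgroup)
qed

abbreviation "N1 \<equiv> \<Inter>NN"

lemma carrier_NN: "carrier C : NN"
 unfolding NN_iff using subgroup_self by (intro conjI exI[of _ 1]) auto

lemma N1_NN: "N1 : NN"
 unfolding NN_iff
proof
 show "subgroup N1 C" by (rule subgroups_Inter) (use NN_iff carrier_NN in blast)+
 have "NN \<subseteq> Pow (carrier C)" using NN_iff subgroup.subset by blast
 then have "finite NN" by (rule finite_subset) (simp add: finC)
 have fam: "EX u. coprime u d \<and> (ALL x:carrier C. ALL N:S. x [^] (u::nat) : N)" if "finite S" "S \<subseteq> NN" for S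
  using that
 proof (induction S rule: finite_induct)
  case empty
  show ?case by (rule exI[of _ 1]) simp
 next
  case (insert N S)
  have NS: "N : NN" "S \<subseteq> NN" using insert.prems by simp_all
  obtain u where u: "coprime u d" "ALL x:carrier C. ALL N:S. x [^] (u::nat) : N"
   using insert.IH[OF NS(2)] by (elim exE conjE)
  obtain v where v: "coprime v d" "ALL x:carrier C. x [^] (v::nat) : N"
   using NS(1)[unfolded NN_iff] by (elim exE conjE)
  have "x [^] (u * v) : N'" if x: "x : carrier C" and N': "N' : insert N S" for x N'
  proof (cases "N' = N")
   case True
   have "(x [^] u) [^] v : N" using v(2) x by blast
   then show ?thesis unfolding True using x by (simp add: nat_pow_pow)
  next
   case False
   have "(x [^] v) [^] u : N'" using u(2) x N' False by blast
   then show ?thesis using x by (simp add: nat_pow_pow mult.commute)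
  qed
  then show ?case using u(1) v(1) by (intro exI[of _ "u * v"]) simp
 qed
 from fam[OF \<open>finite NN\<close> subset_refl]
 obtain u where "coprime u d" "ALL x:carrier C. ALL N:NN. x [^] (u::nat) : N" by (elim exE conjE)
 then show "EX u. coprime u d \<and> (ALL x:carrier C. x [^] (u::nat) : N1)" by (intro exI[of _ u]) simp
qed

lemma N1_act: "act_normal Ga C N1"
proof (intro act_normal.intro act_normal_axioms.intro group_act_axioms)
 have sub: "subgroup N1 C" using N1_NN NN_iff by blast
 show "top_normal N1 C" by (rule comm_group_top_quot(1)[OF comm_group_axioms sub])
 fix ga k assume ga: "ga : carrier Ga" and k: "k : N1"
 interpret a: group_hom C C "act C ga" by (rule act_group_hom[OF ga])
 have "act C ga k : N" if N: "N : NN" for N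
 proof -
  let ?N = "{x : carrier C. act C ga x : N}"
  have sN: "subgroup N C" using N NN_iff by blast
  have "subgroup ?N C"
   by (rule subgroupI) (use sN in \<open>auto simp: subgroup.one_closed subgroup.m_closed subgroup.m_inv_closed intro!: exI[of _ \<one>]\<close>)
  moreover obtain u where u: "coprime u d" "ALL x:carrier C. x [^] (u::nat) : N" using N NN_iff by blast
  have "ALL x:carrier C. x [^] u : ?N" using u(2) by (simp add: a.hom_nat_pow)
  ultimately have "?N : NN" unfolding NN_iff using u(1) by blast
  then show ?thesis using k by blast
 qed
 then show "act C ga k : N1" by blast
qed

lemma ptq: "prime_to_quot d C = top_quot C N1" by (simp add: prime_to_quot_def NN_def)

lemma ptq_props:
 "comm_group (prime_to_quot d C)" "group_act Ga (prime_to_quot d C)" "finite (carrier (prime_to_quot d C))"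
 "coprime (Coset.order (prime_to_quot d C)) d"
 "group_hom C (prime_to_quot d C) (%x. N1 #> x)" "carrier (prime_to_quot d C) = (%x. N1 #> x) ` carrier C"
 "!!ga x. ga : carrier Ga ==> x : carrier C ==> act (prime_to_quot d C) ga (N1 #> x) = N1 #> act C ga x"
proof -
 interpret T: act_normal Ga C N1 by (rule N1_act)
 obtain u where u: "subgroup N1 C" "coprime u d" "ALL x:carrier C. x [^] (u::nat) : N1" using N1_NN NN_iff by blast
 show cg: "comm_group (prime_to_quot d C)" unfolding ptq by (rule comm_group_top_quot(2)[OF comm_group_axioms u(1)])
 interpret Q: comm_group "top_quot C N1" using cg unfolding ptq .
 show "group_act Ga (prime_to_quot d C)" unfolding ptq by (rule T.quot_act)
 show surj: "carrier (prime_to_quot d C) = (%x. N1 #> x) ` carrier C" unfolding ptq by (rule T.prj_surj)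
 show fin: "finite (carrier (prime_to_quot d C))" unfolding surj using finC by blast
 show h: "group_hom C (prime_to_quot d C) (%x. N1 #> x)"
  unfolding ptq by (intro group_hom.intro group_hom_axioms.intro T.prj_hom is_group Q.is_group)
 show "act (prime_to_quot d C) ga (N1 #> x) = N1 #> act C ga x" if "ga : carrier Ga" "x : carrier C" for ga x
  unfolding ptq by (rule T.prj_act[OF that])
 interpret h: group_hom C "top_quot C N1" "%x. N1 #> x" using h unfolding ptq .
 have "z [^]\<^bsub>top_quot C N1\<^esub> u = \<one>\<^bsub>top_quot C N1\<^esub>" if z: "z : carrier (top_quot C N1)" for z
 proof -
  obtain x where x: "x : carrier C" "z = N1 #> x" using z unfolding T.prj_surj by blast
  have "N1 #> (x [^] u) = \<one>\<^bsub>top_quot C N1\<^esub>" using T.prj_ker[OF nat_pow_closed[OF x(1)]] u(3) x(1) by blast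
  then show ?thesis unfolding x(2) using h.hom_nat_pow[OF x(1), of u] by simp
 qed
 then show "coprime (Coset.order (prime_to_quot d C)) d"
  unfolding ptq by (rule Q.exponent_coprime_order[OF fin[unfolded ptq] _ u(2)])
qed

end

section \<open>Prime ideals and class groups\<close>

context number_fld
begin

definition prm :: "'a set => bool" where
 "prm P \<longleftrightarrow> P : FI \<and> P \<subseteq> RO \<and> 1 \<notin> P \<and> (ALL x:RO. ALL y:RO. x * y : P --> x : P \<or> y : P)"

lemma integral_FI_AF: assumes A: "A : FI" "A \<subseteq> RO" shows "\<exists>k>0. A : AF k \<and> of_nat k : A"
proof -
 obtain a where a: "a : A" "a ~= 0" using FI_D(6)[OF A(1)] by blast
 obtain s :: int where s: "s > 0" "of_int s * inverse a : Lam" using clear_denominator[OF Finv[OF FI_D(1)[OF A(1) a(1)]]] by blast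
 have "of_int s * inverse a * a : A" by (rule FI_D(4)[OF A(1) Lam_RO[OF s(2)] a(1)])
 moreover have e: "of_int s * inverse a * a = of_int s" using a(2) by (simp add: field_simps)
 ultimately have "of_nat (nat s) : A" using s(1) by simp
 moreover have "A : AF (nat s)" unfolding AF_def
 proof (intro CollectI conjI ballI A(2))
  fix x assume "x : RO"
  then have "x * of_nat (nat s) : A" using \<open>of_nat (nat s) : A\<close> by (rule FI_D(4)[OF A(1)])
  then show "of_nat (nat s) * x : A" by (simp only: mult.commute)
 qed (rule FI_D(3)[OF A(1)])
 ultimately show ?thesis using s(1) by (intro exI[of _ "nat s"]) simp
qed

lemma RO_closed: "A : FI ==> 1 : A ==> A \<subseteq> RO ==> A = RO"
 using FI_D(4)[of A _ 1] by auto

lemma adjoin_FI: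
 assumes P: "P : FI" "P \<subseteq> RO" and x: "x : RO"
 shows "{p + c * x | p c. p : P \<and> c : RO} : FI" "{p + c * x | p c. p : P \<and> c : RO} \<subseteq> RO"
  "P \<subseteq> {p + c * x | p c. p : P \<and> c : RO}" "x : {p + c * x | p c. p : P \<and> c : RO}"
proof -
 let ?B = "{p + c * x | p c. p : P \<and> c : RO}"
 have I: "p + c * x : ?B" if "p : P" "c : RO" for p c using that by blast
 show sub: "?B \<subseteq> RO" using P(2) x by (auto intro!: RO_add RO_mul)
 show PB: "P \<subseteq> ?B" using I[OF _ RO_0] by fastforce
 show "x : ?B" using I[OF FI_D(2)[OF P(1)] RO_1] by simp
 obtain z where z: "z : P" "z ~= 0" using FI_D(6)[OF P(1)] by blast
 have subF: "u : F" "1 * u : RO" if "u : ?B" for u using subsetD[OF sub that] RO_F by simp_all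
 show "?B : FI"
 proof (rule FI_I[of _ 1 z])
  show "0 : ?B" by (rule subsetD[OF PB FI_D(2)[OF P(1)]])
  show "z : ?B" by (rule subsetD[OF PB z(1)])
 next
  fix u v assume "u : ?B" "v : ?B"
  then obtain p c p' c' where "u = p + c * x" "p : P" "c : RO" "v = p' + c' * x" "p' : P" "c' : RO" by blast
  then show "u + v : ?B" using I[OF FI_D(3)[OF P(1), of p p'] RO_add[of c c']] by (simp add: algebra_simps)
 next
  fix e u assume e: "e : RO" and "u : ?B"
  then obtain p c where "u = p + c * x" "p : P" "c : RO" by blast
  then show "e * u : ?B" using I[OF FI_D(4)[OF P(1) e, of p] RO_mul[OF e, of c]] by (simp add: algebra_simps)
 qed (rule subF z(2) RO_1 one_neq_zero, assumption?)+
qed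

text \<open>The integral ideals containing \<open>A\<close> lie in a finite set \<open>AF k\<close>,
  so among those without \<open>1\<close> there is a maximal one, and it is prime by the usual
  argument.\<close>

lemma max_ex: assumes A: "A : FI" "A \<subseteq> RO" "1 \<notin> A" shows "EX P. prm P \<and> A \<subseteq> P"
proof -
 obtain k where k: "k > 0" "A : AF k" using integral_FI_AF[OF A(1,2)] by blast
 let ?S = "{B : FI. B \<subseteq> RO \<and> A \<subseteq> B \<and> 1 \<notin> B}"
 have "?S \<subseteq> AF k" using k(2) FI_D(3) by (auto simp: AF_def)
 then have fin: "finite ?S" using finite_AF[OF k(1)] by (rule finite_subset)
 have "A : ?S" using A by simp
 from finite_has_maximal[OF fin ne_empty[OF this]] obtain P where P1: "P : ?S" and Pm: "ALL B:?S. P \<subseteq> B --> P = B" by (rule bexE)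
 have PB: "P = B" if "B : ?S" "P \<subseteq> B" for B using bspec[OF Pm that(1)] that(2) by (rule mp)
 have PF: "P : FI" "P \<subseteq> RO" "1 \<notin> P" "A \<subseteq> P" using P1 by auto
 have "x : P \<or> y : P" if x: "x : RO" and y: "y : RO" and xy: "x * y : P" for x y
 proof (rule ccontr)
  assume n: "\<not> (x : P \<or> y : P)"
  let ?B = "{p + c * x | p c. p : P \<and> c : RO}"
  note B = adjoin_FI[OF PF(1,2) x]
  have "1 : ?B"
  proof (rule ccontr)
   assume "1 \<notin> ?B"
   then have "?B : ?S" using B(1,2,3) PF(4) by (intro CollectI conjI) (auto intro: order_trans)
   then have "P = ?B" using B(3) by (rule PB)
   then show False using B(4) n by blast
  qed
  then obtain p c where pc: "p : P" "c : RO" "1 = p + c * x" by blast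
  have "y = y * p + c * (x * y)" using arg_cong[OF pc(3), of "%z. z * y"] by (simp add: algebra_simps)
  then have "y : P" using FI_D(3)[OF PF(1) FI_D(4)[OF PF(1) y pc(1)] FI_D(4)[OF PF(1) pc(2) xy]] by simp
  then show False using n by blast
 qed
 then show ?thesis using PF unfolding prm_def by blast
qed

lemma prm_pow: "prm P ==> x : RO ==> x ^ i : P ==> x : P"
proof (induction i)
 case (Suc i)
 then have "x : P \<or> x ^ i : P" using RO_pow unfolding prm_def power_Suc by blast
 then show ?case using Suc by blast
qed (simp add: prm_def)

text \<open>The ideals \<open>P + RO x^i\<close> all lie in a finite set, so two of them agree and
  \<open>x^i = p + c x^j\<close> with \<open>i < j\<close>. Then \<open>x^i (1 - c x^(j-i))\<close>
  lies in \<open>P\<close>, and \<open>x^i\<close> does not.\<close>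

lemma prm_maximal:
 assumes P: "prm P" and x: "x : RO" "x \<notin> P"
 shows "EX c:RO. 1 - c * x : P"
proof -
 have PF: "P : FI" "P \<subseteq> RO" using P by (auto simp: prm_def)
 obtain k where k: "k > 0" "P : AF k" using integral_FI_AF[OF PF] by blast
 let ?B = "%i. {p + c * x ^ i | p c. p : P \<and> c : RO}"
 have B: "?B i : AF k" for i
 proof -
  note A = adjoin_FI[OF PF RO_pow[OF x(1), of i]]
  show ?thesis unfolding AF_def
  proof (rule CollectI, intro conjI ballI A(2))
   show "u + v : ?B i" if "u : ?B i" "v : ?B i" for u v by (rule FI_D(3)[OF A(1) that])
   fix y assume "y : RO"
   then have "of_nat k * y : P" using k(2) unfolding AF_def by blast
   then show "of_nat k * y : ?B i" by (rule subsetD[OF A(3)])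
  qed
 qed
 have "\<not> inj ?B"
 proof
  assume "inj ?B"
  then have "infinite (range ?B)" by (rule range_inj_infinite)
  moreover have "range ?B \<subseteq> AF k" using B by blast
  ultimately show False using finite_AF[OF k(1)] finite_subset by blast
 qed
 then obtain i j where ij: "i < j" "?B i = ?B j" unfolding inj_def by (metis (no_types, lifting) linorder_neqE_nat)
 have "x ^ i : ?B j" using adjoin_FI(4)[OF PF RO_pow[OF x(1), of i]] ij(2) by blast
 then obtain p c where pc: "p : P" "c : RO" "x ^ i = p + c * x ^ j" by blast
 obtain l where l: "j = i + Suc l" using ij(1) less_iff_Suc_add by auto
 let ?c = "c * x ^ l"
 have cR: "?c : RO" by (intro RO_mul pc RO_pow x)
 have "x ^ i * (1 - ?c * x) = p" using pc(3) by (simp add: l power_add algebra_simps)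
 then have "x ^ i * (1 - ?c * x) : P" using pc(1) by simp
 then have "x ^ i : P \<or> 1 - ?c * x : P" using P RO_pow[OF x(1), of i] RO_diff[OF RO_1 RO_mul[OF cR x(1)]] unfolding prm_def by blast
 then show ?thesis using prm_pow[OF P x(1)] x(2) cR by blast
qed

lemma ring_RO: "cring (ring_on RO)"
proof (intro cringI abelian_groupI comm_monoidI)
 fix x assume "x : carrier (ring_on RO)"
 then show "EX y:carrier (ring_on RO). y \<oplus>\<^bsub>ring_on RO\<^esub> x = \<zero>\<^bsub>ring_on RO\<^esub>"
  using RO_neg by (intro bexI[of _ "- x"]) (auto simp: ring_on_def)
qed (auto simp: ring_on_def RO_add RO_mul RO_0 RO_1 algebra_simps)

lemma prime_ideals_prm: "P : prime_ideals F \<longleftrightarrow> prm P"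
proof
 assume "P : prime_ideals F"
 then have P: "primeideal P (ring_on RO)" "P ~= {0}" by (auto simp: prime_ideals_def)
 interpret P: primeideal P "ring_on RO" by fact
 have sub: "P \<subseteq> RO" using P.Icarr by (auto simp: ring_on_def)
 have 0: "0 : P" using additive_subgroup.zero_closed[OF ideal.axioms(1)[OF primeideal.axioms(1)[OF P(1)]]] by (simp add: ring_on_def)
 then obtain z where z: "z : P" "z ~= 0" using P(2) by blast
 have mul: "c * x : P" if "c : RO" "x : P" for c x using P.I_l_closed[of x c] that by (simp add: ring_on_def)
 have add: "x + y : P" if "x : P" "y : P" for x y
  using additive_subgroup.a_closed[OF ideal.axioms(1)[OF primeideal.axioms(1)[OF P(1)]] that] by (simp add: ring_on_def)
 have "P : FI"
 proof (rule FI_I[of _ 1 z])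
  show "x : F" "1 * x : RO" if "x : P" for x using subsetD[OF sub that] RO_F by simp_all
  show "x + y : P" if "x : P" "y : P" for x y by (rule add[OF that])
  show "c * x : P" if "c : RO" "x : P" for c x by (rule mul[OF that])
 qed (rule 0 z RO_1 one_neq_zero)+
 moreover have "1 \<notin> P"
 proof
  assume "1 : P"
  then have "P = RO" using mul[of _ 1] sub by auto
  then show False using P.I_notcarr by (simp add: ring_on_def)
 qed
 ultimately show "prm P" unfolding prm_def using sub P.I_prime by (auto simp: ring_on_def)
next
 assume P: "prm P"
 then have PF: "P : FI" "P \<subseteq> RO" "1 \<notin> P" by (auto simp: prm_def)
 interpret R: cring "ring_on RO" by (rule ring_RO)
 have "subgroup P (add_monoid (ring_on RO))"
 proof (rule R.add.subgroupI)
  show "P \<subseteq> carrier (ring_on RO)" using PF(2) by (simp add: ring_on_def)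
  show "P ~= {}" using FI_D(2)[OF PF(1)] by blast
  fix x assume x: "x : P"
  have "\<ominus>\<^bsub>ring_on RO\<^esub> x = - x"
   by (rule R.minus_equality) (use x PF(2) RO_neg in \<open>auto simp: ring_on_def\<close>)
  then show "\<ominus>\<^bsub>ring_on RO\<^esub> x : P" using FI_diff[OF PF(1) FI_D(2)[OF PF(1)] x] by simp
  fix y assume "y : P"
  then show "x \<oplus>\<^bsub>ring_on RO\<^esub> y : P" using FI_D(3)[OF PF(1) x] by (simp add: ring_on_def)
 qed
 moreover have mulP: "c * x : P" "x * c : P" if "c : RO" "x : P" for c x
  using FI_D(4)[OF PF(1) that] by (simp_all add: mult.commute)
 ultimately have "ideal P (ring_on RO)"
  by (intro idealI R.ring_axioms) (simp_all add: ring_on_def)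
 then have "primeideal P (ring_on RO)"
  by (intro primeidealI R.cring_axioms) (use P PF RO_1 in \<open>auto simp: ring_on_def prm_def\<close>)
 moreover have "P ~= {0}" using FI_D(6)[OF PF(1)] by blast
 ultimately show "P : prime_ideals F" by (simp add: prime_ideals_def)
qed

section \<open>Content ideals of polynomials\<close>

definition cont :: "'a poly => 'a set" where
 "cont f = {(\<Sum>i\<le>Polynomial.degree f. c i * Polynomial.coeff f i) | c. ALL i. c i : RO}"

lemma contI: "(!!i. c i : RO) ==> (\<Sum>i\<le>Polynomial.degree f. c i * Polynomial.coeff f i) : cont f" unfolding cont_def by blast

lemma cont_coeff: "Polynomial.coeff f i : cont f"
proof (cases "i \<le> Polynomial.degree f")
 case True
 have "(\<Sum>j\<le>Polynomial.degree f. (if j = i then 1 else 0) * Polynomial.coeff f j)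
   = (\<Sum>j\<le>Polynomial.degree f. if j = i then Polynomial.coeff f j else 0)" by (rule sum.cong) auto
 then show ?thesis using contI[of "%j. if j = i then 1 else 0" f] True RO_0 RO_1 by simp
next
 case False
 then show ?thesis using contI[of "%j. 0" f] RO_0 by (simp add: coeff_eq_0)
qed

lemma cont_add: "x : cont f ==> y : cont f ==> x + y : cont f"
proof -
 assume "x : cont f" "y : cont f"
 then obtain c c' where c: "x = (\<Sum>i\<le>Polynomial.degree f. c i * Polynomial.coeff f i)" "ALL i. c i : RO"
   "y = (\<Sum>i\<le>Polynomial.degree f. c' i * Polynomial.coeff f i)" "ALL i. c' i : RO" unfolding cont_def by blast
 have "x + y = (\<Sum>i\<le>Polynomial.degree f. (c i + c' i) * Polynomial.coeff f i)" unfolding c(1,3) by (simp add: sum.distrib distrib_right)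
 then show ?thesis using contI[of "%i. c i + c' i" f] c(2,4) RO_add by simp
qed

lemma cont_mul: "e : RO ==> x : cont f ==> e * x : cont f"
proof -
 assume e: "e : RO" and "x : cont f"
 then obtain c where c: "x = (\<Sum>i\<le>Polynomial.degree f. c i * Polynomial.coeff f i)" "ALL i. c i : RO" unfolding cont_def by blast
 have "e * x = (\<Sum>i\<le>Polynomial.degree f. (e * c i) * Polynomial.coeff f i)" unfolding c(1) by (simp add: sum_distrib_left mult.assoc)
 then show ?thesis using contI[of "%i. e * c i" f] c(2) RO_mul[OF e] by simp
qed

lemma cont_least:
 assumes "!!i. Polynomial.coeff f i : S" "0 : S" "!!x y. x : S ==> y : S ==> x + y : S" "!!c x. c : RO ==> x : S ==> c * x : S"
 shows "cont f \<subseteq> S"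
proof
 fix x assume "x : cont f"
 then obtain c where c: "x = (\<Sum>i\<le>Polynomial.degree f. c i * Polynomial.coeff f i)" "ALL i. c i : RO" unfolding cont_def by blast
 have sumS: "sum g I : S" if "!!i. i : I ==> g i : S" for g :: "nat => 'a" and I
  using that by (induction I rule: infinite_finite_induct) (auto simp: assms)
 show "x : S" unfolding c(1) by (rule sumS) (use c(2) assms(1,4) in blast)
qed

lemma cont_FI: assumes f: "f ~= 0" "!!i. Polynomial.coeff f i : F" shows "cont f : FI"
proof -
 have z: "0 : cont f" using cont_mul[OF RO_0 cont_coeff[of f 0]] by simp
 have "\<exists>s::int. s > 0 \<and> (\<forall>i\<le>k. of_int s * Polynomial.coeff f i : Lam)" for k
 proof (induction k)
  case 0
  then show ?case using clear_denominator[OF f(2), of 0] by simp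
 next
  case (Suc k)
  then obtain s where s: "s > 0" "\<forall>i\<le>k. of_int s * Polynomial.coeff f i : Lam" by blast
  obtain t :: int where t: "t > 0" "of_int t * Polynomial.coeff f (Suc k) : Lam" using clear_denominator[OF f(2)] by blast
  have L: "of_int c * x : Lam" if "x : Lam" for x and c :: int using that by (simp add: Lam_def Fmul Fint co_int)
  have "of_int (s * t) * Polynomial.coeff f i : Lam" if i: "i \<le> Suc k" for i
  proof (cases "i \<le> k")
   case True
   then have "of_int t * (of_int s * Polynomial.coeff f i) : Lam" using L s(2) by blast
   then show ?thesis by (simp add: mult_ac)
  next
   case False
   then have "i = Suc k" using i by simp
   then have "of_int s * (of_int t * Polynomial.coeff f i) : Lam" using L t(2) by blast
   then show ?thesis by (simp add: mult_ac)
  qed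
  then show ?case using s(1) t(1) by (intro exI[of _ "s * t"]) simp
 qed
 then obtain s :: int where s: "s > 0" "\<forall>i\<le>Polynomial.degree f. of_int s * Polynomial.coeff f i : Lam" by blast
 have sc: "of_int s * Polynomial.coeff f i : RO" for i
  using s(2) Lam_RO RO_0 by (cases "i \<le> Polynomial.degree f") (auto simp: coeff_eq_0)
 have 1: "cont f \<subseteq> F" by (rule cont_least) (auto simp: f(2) F0 Fadd Fmul RO_F)
 have 2: "cont f \<subseteq> {x. of_int s * x : RO}"
 proof (rule cont_least)
  fix c x assume c: "c : RO" and "x : {x. of_int s * x : RO}"
  then have "c * (of_int s * x) : RO" using RO_mul[OF c, of "of_int s * x"] by simp
  then show "c * x : {x. of_int s * x : RO}" by (simp add: mult_ac)
 qed (auto simp: sc RO_0 distrib_left RO_add)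
 show ?thesis
  by (rule FI_I[of _ "of_int s" "Polynomial.lead_coeff f"])
   (use 1 2 z s(1) f(1) RO_ofint in \<open>auto simp: cont_add cont_mul cont_coeff\<close>)
qed

text \<open>Gauss's lemma.  A prime containing \<open>cont (f * g)\<close> relative to \<open>cont f cont g\<close> would have to contain
 the product of the first coefficients of \<open>f\<close> and \<open>g\<close> that do not vanish modulo it.\<close>

lemma gauss:
 assumes f: "f ~= 0" "!!i. Polynomial.coeff f i : F" and g: "g ~= 0" "!!i. Polynomial.coeff g i : F"
 shows "cont (f * g) = ideal_mult (cont f) (cont g)"
proof -
 have fg: "f * g ~= 0" using f g by simp
 have fgF: "Polynomial.coeff (f * g) i : F" for i unfolding coeff_mult by (intro Fsum Fmul f g)
 note FIs = cont_FI[OF f] cont_FI[OF g] cont_FI[OF fg fgF]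
 let ?E = "ideal_mult (cont f) (cont g)"
 have EF: "?E : FI" by (rule im_FI[OF FIs(1,2)])
 have sub: "cont (f * g) \<subseteq> ?E"
 proof (rule cont_least)
  fix k
  have sumE: "sum h I : ?E" if "!!i. i : I ==> h i : ?E" for h :: "nat => 'a" and I
   using that by (induction I rule: infinite_finite_induct) (auto simp: im_zero im_add)
  show "Polynomial.coeff (f * g) k : ?E" unfolding coeff_mult by (rule sumE) (intro im_prod cont_coeff)
 qed (use FI_D[OF EF] in auto)
 obtain U where U: "U : FI" "ideal_mult U (cont f) = RO" using inverse_ex[OF FIs(1)] by blast
 obtain V where V: "V : FI" "ideal_mult V (cont g) = RO" using inverse_ex[OF FIs(2)] by blast
 \<comment> \<open>This is the inverse of the product of the contents, so the claim amounts to
   \<open>?D = RO\<close>, and it remains to exclude a prime above \<open>?D\<close>.\<close>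
 let ?J = "ideal_mult U V"
 have JE: "ideal_mult ?J ?E = RO"
 proof -
  have "ideal_mult ?J ?E = ideal_mult U (ideal_mult (ideal_mult V (cont g)) (cont f))" by (simp only: im_assoc im_comm[of "cont f" "cont g"])
  then show ?thesis using V(2) U(2) im_one[OF FIs(1)] by simp
 qed
 let ?D = "ideal_mult ?J (cont (f * g))"
 have DF: "?D : FI" by (intro im_FI U V FIs)
 have DR: "?D \<subseteq> RO" using im_mono[OF subset_refl sub, of ?J] JE by simp
 have "1 : ?D"
 proof (rule ccontr)
  assume "1 \<notin> ?D"
  then obtain P where P: "prm P" "?D \<subseteq> P" using max_ex[OF DF DR] by blast
  have PF: "P : FI" "P \<subseteq> RO" "1 \<notin> P" using P(1) by (auto simp: prm_def)
  have first: "EX i. (EX u:U. u * Polynomial.coeff h i \<notin> P) \<and> (\<forall>l<i. ALL u:U. u * Polynomial.coeff h l : P)"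
   if UF: "U : FI" "ideal_mult U (cont h) = RO" for U h
  proof -
   have "EX i. EX u:U. u * Polynomial.coeff h i \<notin> P"
   proof (rule ccontr)
    assume n: "\<not> ?thesis"
    have "ideal_mult U (cont h) \<subseteq> P"
    proof (rule im_least)
     fix u b assume u: "u : U" and b: "b : cont h"
     have "cont h \<subseteq> {x. u * x : P}"
     proof (rule cont_least)
      fix c x assume "c : RO" "x : {x. u * x : P}"
      then have "c * (u * x) : P" using FI_D(4)[OF PF(1)] by blast
      then show "c * x : {x. u * x : P}" by (simp add: mult_ac)
     qed (use n u FI_D[OF PF(1)] in \<open>auto simp: distrib_left\<close>)
     then show "u * b : P" using b by blast
    qed (use FI_D[OF PF(1)] in auto)
    then show False using UF(2) PF(3) RO_1 by blast
   qed
   from exists_least_iff[THEN iffD1, OF this] show ?thesis by blast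
  qed
  obtain i where "(EX u:U. u * Polynomial.coeff f i \<notin> P) \<and> (\<forall>l<i. ALL u:U. u * Polynomial.coeff f l : P)" using first[OF U] ..
  then obtain u where u: "u : U" "u * Polynomial.coeff f i \<notin> P" "!!l. l < i ==> u * Polynomial.coeff f l : P" by blast
  obtain j where "(EX v:V. v * Polynomial.coeff g j \<notin> P) \<and> (\<forall>l<j. ALL v:V. v * Polynomial.coeff g l : P)" using first[OF V] ..
  then obtain v where v: "v : V" "v * Polynomial.coeff g j \<notin> P" "!!l. l < j ==> v * Polynomial.coeff g l : P" by blast
  let ?a = "%l. u * Polynomial.coeff f l" and ?b = "%l. v * Polynomial.coeff g l"
  have aR: "?a l : RO" for l using im_prod[OF u(1) cont_coeff, of f l] U(2) by blast
  have bR: "?b l : RO" for l using im_prod[OF v(1) cont_coeff, of g l] V(2) by blast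
  have c1: "(u * v) * Polynomial.coeff (f * g) (i + j) : P" using P(2) im_prod[OF im_prod[OF u(1) v(1)] cont_coeff, of "f * g" "i + j"] by blast
  have c2: "(u * v) * Polynomial.coeff (f * g) (i + j) = (\<Sum>l\<le>i + j. ?a l * ?b (i + j - l))"
   unfolding coeff_mult by (simp add: sum_distrib_left mult_ac)
  have c3: "(\<Sum>l\<le>i + j. ?a l * ?b (i + j - l)) = ?a i * ?b j + (\<Sum>l\<in>{..i + j} - {i}. ?a l * ?b (i + j - l))"
   by (subst sum.remove[of _ i]) auto
  have c4: "(\<Sum>l\<in>{..i + j} - {i}. ?a l * ?b (i + j - l)) : P"
  proof -
   have sumP: "sum h I : P" if "!!i. i : I ==> h i : P" for h :: "nat => 'a" and I
    using that by (induction I rule: infinite_finite_induct) (auto simp: FI_D[OF PF(1)])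
   have lP: "?a l * ?b (i + j - l) : P" if l: "l : {..i + j} - {i}" for l
   proof (cases "l < i")
    case True
    have "?b (i + j - l) * ?a l : P" by (rule FI_D(4)[OF PF(1) bR u(3)[OF True]])
    then show ?thesis by (simp only: mult.commute)
   next
    case False
    then have "i + j - l < j" using l by auto
    then show ?thesis by (intro FI_D(4)[OF PF(1) aR v(3)])
   qed
   show ?thesis by (rule sumP) (rule lP)
  qed
  from FI_diff[OF PF(1) c1[unfolded c2 c3] c4] have "?a i * ?b j : P" by simp
  then show False using P(1) aR bR u(2) v(2) unfolding prm_def by blast
 qed
 then have "?D = RO" by (rule RO_closed[OF DF _ DR])
 then have "?E = ideal_mult ?D ?E" using im_one[OF EF] by simp
 also have "\<dots> = ideal_mult (ideal_mult ?J ?E) (cont (f * g))" by (simp only: im_assoc im_comm[of "cont (f * g)"])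
 also have "\<dots> = cont (f * g)" unfolding JE by (rule im_one[OF FIs(3)])
 finally show ?thesis ..
qed

end

section \<open>Class groups modulo the primes above \<open>T\<close>\<close>

locale t_class = number_fld F n w co for F :: "'k::field_char_0 set" and n w co +
 fixes Q :: "'k set" and T :: "'k place set"
begin

abbreviation "IG \<equiv> ideal_group F"
abbreviation "PF \<equiv> principal_ideals F"
abbreviation "CL \<equiv> class_group F"
abbreviation "TC \<equiv> T_class_group Q T F"
definition "S0 = {PF #>\<^bsub>IG\<^esub> P | P. P : prime_ideals F \<and> place_below Q (Finite_Place P) : T}"
definition "SS = generate CL S0"
definition "cls I = SS #>\<^bsub>CL\<^esub> (PF #>\<^bsub>IG\<^esub> I)"

sublocale IG: comm_group IG by (rule ideal_comm_group)
sublocale T1: top_normal PF IG by (rule comm_group_top_quot(1)[OF ideal_comm_group principal_subgroup])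

lemma CL_def': "CL = top_quot IG PF" by (simp add: class_group_def)
sublocale CL: comm_group CL unfolding CL_def' by (rule comm_group_top_quot(2)[OF ideal_comm_group principal_subgroup])

lemma CL_hom: "(%I. PF #>\<^bsub>IG\<^esub> I) : hom IG CL" unfolding CL_def' by (rule T1.prj_hom)
lemma CL_surj: "carrier CL = (%I. PF #>\<^bsub>IG\<^esub> I) ` carrier IG" unfolding CL_def' by (rule T1.prj_surj)
lemma CL_ker: "I : carrier IG ==> PF #>\<^bsub>IG\<^esub> I = \<one>\<^bsub>CL\<^esub> \<longleftrightarrow> I : PF" unfolding CL_def' by (rule T1.prj_ker)

lemma carrier_IG [simp]: "carrier IG = FI" by (simp add: ideal_group_def)

lemma S0_sub: "S0 \<subseteq> carrier CL"
 unfolding S0_def CL_surj using prime_ideals_prm by (auto simp: prm_def)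

lemma SS_sub: "subgroup SS CL" unfolding SS_def by (rule CL.generate_is_subgroup[OF S0_sub])

sublocale T2: top_normal SS CL by (rule comm_group_top_quot(1)[OF CL.comm_group_axioms SS_sub])

lemma TC_def': "TC = top_quot CL SS" by (simp add: T_class_group_def SS_def S0_def)
sublocale TC: comm_group TC unfolding TC_def' by (rule comm_group_top_quot(2)[OF CL.comm_group_axioms SS_sub])

lemma cls_hom: "cls : hom IG TC"
proof -
 have "(%c. SS #>\<^bsub>CL\<^esub> c) \<circ> (%I. PF #>\<^bsub>IG\<^esub> I) : hom IG TC"
  unfolding TC_def' by (rule hom_compose[OF CL_hom T2.prj_hom])
 then show ?thesis by (simp add: comp_def cls_def[abs_def])
qed

sublocale cls: group_hom IG TC cls by (intro group_hom.intro group_hom_axioms.intro cls_hom IG.is_group TC.is_group)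

lemma cls_surj: "carrier TC = cls ` FI"
proof -
 have "carrier TC = (%c. SS #>\<^bsub>CL\<^esub> c) ` carrier CL" unfolding TC_def' by (rule T2.prj_surj)
 then show ?thesis unfolding CL_surj by (simp add: image_image cls_def)
qed

lemma cls_principal: "I : PF ==> cls I = \<one>\<^bsub>TC\<^esub>"
proof -
 assume I: "I : PF"
 then have "I : carrier IG" using T1.subset by blast
 then have "PF #>\<^bsub>IG\<^esub> I = \<one>\<^bsub>CL\<^esub>" using CL_ker I by blast
 then show ?thesis unfolding cls_def TC_def' using T2.prj_ker[OF CL.one_closed] subgroup.one_closed[OF SS_sub] by simp
qed

lemma cls_prime: "P : prime_ideals F ==> place_below Q (Finite_Place P) : T ==> cls P = \<one>\<^bsub>TC\<^esub>"
proof -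
 assume "P : prime_ideals F" "place_below Q (Finite_Place P) : T"
 then have s: "PF #>\<^bsub>IG\<^esub> P : S0" unfolding S0_def by blast
 then have "PF #>\<^bsub>IG\<^esub> P : SS" unfolding SS_def by (rule generate.incl)
 then show ?thesis unfolding cls_def TC_def' using T2.prj_ker s S0_sub by blast
qed

text \<open>The kernel of \<open>cls\<close> is generated by the principal ideals and the primes
  above \<open>T\<close>. In this form it shows that a homomorphism on ideals, with kernel
  \<open>H\<close>, factors through the class group.\<close>

lemma cls_one_mem:
 assumes K: "subgroup H IG" "PF \<subseteq> H" "!!P. P : prime_ideals F ==> place_below Q (Finite_Place P) : T ==> P : H"
  and I: "I : FI" "cls I = \<one>\<^bsub>TC\<^esub>"
 shows "I : H"
proof -
 interpret p: group_hom IG CL "%I. PF #>\<^bsub>IG\<^esub> I" by (intro group_hom.intro group_hom_axioms.intro CL_hom IG.is_group CL.is_group)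
 let ?V = "(%I. PF #>\<^bsub>IG\<^esub> I) ` H"
 have V: "subgroup ?V CL" by (rule p.subgroup_img_is_subgroup[OF K(1)])
 have "S0 \<subseteq> ?V" unfolding S0_def using K(3) by blast
 then have "SS \<subseteq> ?V" unfolding SS_def by (rule CL.generate_subgroup_incl[OF _ V])
 moreover have "PF #>\<^bsub>IG\<^esub> I : carrier CL" using I(1) p.hom_closed by simp
 then have "PF #>\<^bsub>IG\<^esub> I : SS" using I(2) T2.prj_ker unfolding cls_def TC_def' by blast
 ultimately obtain J where J: "J : H" "PF #>\<^bsub>IG\<^esub> I = PF #>\<^bsub>IG\<^esub> J" by blast
 have JI: "J : carrier IG" "I : carrier IG" using J(1) subgroup.subset[OF K(1)] I(1) by auto
 have "I : PF #>\<^bsub>IG\<^esub> I" by (rule IG.rcos_self[OF JI(2) principal_subgroup])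
 then have "I : PF #>\<^bsub>IG\<^esub> J" unfolding J(2) .
 then obtain h where "h : PF" "I = h \<otimes>\<^bsub>IG\<^esub> J" by (auto simp: r_coset_def)
 then show ?thesis using K(2) J(1) subgroup.m_closed[OF K(1)] by blast
qed

lemma discrete_TC: "discrete_group TC"
proof -
 have "discrete_group IG" by (simp add: discrete_group_def ideal_group_def)
 then have "discrete_group CL" unfolding CL_def' by (rule discrete_top_quot[OF T1.top_normal_axioms])
 then show ?thesis unfolding TC_def' by (rule discrete_top_quot[OF T2.top_normal_axioms])
qed

lemma cls_sca: "I : FI ==> a : F - {0} ==> cls (sca a I) = cls I"
proof -
 assume I: "I : FI" and a: "a : F - {0}"
 have p: "sca a RO : PF" unfolding principal_sca using a by blast
 then have "sca a RO : FI" using T1.subset by auto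
 then have "cls (sca a RO \<otimes>\<^bsub>IG\<^esub> I) = cls I" using I cls_principal[OF p] by simp
 moreover have "sca a RO \<otimes>\<^bsub>IG\<^esub> I = sca a I" by (simp add: ideal_group_def im_sca im_one[OF I])
 ultimately show ?thesis by simp
qed

lemma finite_TC: "finite (carrier TC)"
proof (rule finite_subset)
 show "carrier TC \<subseteq> cls ` AF mm"
 proof
  fix c assume "c : carrier TC"
  then obtain I where I: "I : FI" "c = cls I" unfolding cls_surj by blast
  obtain a where "a : F - {0}" "sca a I : AF mm" using reduce[OF I(1)] by blast
  then show "c : cls ` AF mm" using cls_sca[OF I(1)] I(2) by (metis imageI)
 qed
qed (simp add: finite_AF mm(1))

end

section \<open>Galois action and the norm\<close>

locale gal = K: t_class UNIV nK wK coK Q T + q: t_class Q nQ wQ coQ Q T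
 for Q :: "'k::field_char_0 set" and T :: "'k place set" and nK wK coK nQ wQ coQ +
 assumes gal: "galois_ext Q"
begin

abbreviation "Gam \<equiv> galois_group Q"
abbreviation "RK \<equiv> integers (UNIV :: 'k set)"

lemma Gal_iff: "sg : carrier Gam \<longleftrightarrow> bij sg \<and> (ALL x y. sg (x + y) = sg x + sg y) \<and> (ALL x y. sg (x * y) = sg x * sg y) \<and> sg 1 = 1 \<and> (ALL x:Q. sg x = x)"
 by (auto simp: galois_group_def ring_iso_def Ring.ring_hom_def ring_on_def)

context
 fixes sg assumes s: "sg : carrier Gam"
begin
lemma s_add: "sg (x + y) = sg x + sg y" and s_mul: "sg (x * y) = sg x * sg y" and s_one: "sg 1 = 1"
 and s_fix: "x : Q ==> sg x = x" and s_bij: "bij sg"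
 using s unfolding Gal_iff by blast+
lemma s_zero: "sg 0 = 0" by (rule s_fix[OF q.F0])
lemma s_rat: "sg (of_rat r) = of_rat r" by (rule s_fix[OF q.Frat])
lemma s_int: "x : \<int> ==> sg x = x" by (auto elim!: Ints_cases intro: s_fix q.Fint)
lemma s_sum: "sg (sum f I) = (\<Sum>i\<in>I. sg (f i))"
 by (induction I rule: infinite_finite_induct) (auto simp: s_zero s_add)
lemma s_pow: "sg (x ^ k) = sg x ^ k" by (induction k) (auto simp: s_one s_mul)
lemma s_eq_zero: "sg x = 0 \<longleftrightarrow> x = 0" using s_zero injD[OF bij_is_inj[OF s_bij], of x 0] by auto
lemma s_poly: "(ALL i. Polynomial.coeff p i : \<int>) ==> poly p (sg x) = sg (poly p x)"
 by (simp add: poly_altdef s_sum s_mul s_pow s_int)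
lemma s_algint: "algebraic_int x ==> algebraic_int (sg x)"
proof -
 assume "algebraic_int x"
 then obtain p where p: "Polynomial.lead_coeff p = 1" "ALL i. Polynomial.coeff p i : \<int>" "poly p x = 0" by (auto elim: algebraic_int.cases)
 have "poly p (sg x) = 0" using s_poly[OF p(2)] p(3) s_zero by simp
 then show ?thesis by (rule algebraic_int.intros[OF p(1,2)])
qed
lemma s_RK: "x : RK ==> sg x : RK" by (simp add: integers_def s_algint)
end

lemma Gam_group: "group Gam"
proof (rule groupI)
 fix sg assume s: "sg : carrier Gam"
 let ?i = "inv_into UNIV sg"
 have b: "bij sg" by (rule s_bij[OF s])
 have l: "?i (sg x) = x" for x using b by (simp add: bij_is_inj)
 have r: "sg (?i x) = x" for x using b by (simp add: bij_is_surj surj_f_inv_f)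
 have "?i : carrier Gam" unfolding Gal_iff
 proof (intro conjI allI ballI)
  show "bij ?i" by (rule bij_imp_bij_inv[OF b])
  show "?i (x + y) = ?i x + ?i y" for x y using l[of "?i x + ?i y"] by (simp add: s_add[OF s] r)
  show "?i (x * y) = ?i x * ?i y" for x y using l[of "?i x * ?i y"] by (simp add: s_mul[OF s] r)
  show "?i 1 = 1" using l[of 1] by (simp add: s_one[OF s])
  show "?i x = x" if "x : Q" for x using l[of x] that by (simp add: s_fix[OF s])
 qed
 moreover have "?i \<circ> sg = id" using l by (simp add: fun_eq_iff)
 ultimately show "\<exists>\<tau>\<in>carrier Gam. \<tau> \<otimes>\<^bsub>Gam\<^esub> sg = \<one>\<^bsub>Gam\<^esub>" by (intro bexI[of _ ?i]) (simp_all add: galois_group_def)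
next
 fix sg \<tau> assume "sg : carrier Gam" "\<tau> : carrier Gam"
 then have "sg \<circ> \<tau> : carrier Gam" unfolding Gal_iff by (auto intro: bij_comp)
 then show "sg \<otimes>\<^bsub>Gam\<^esub> \<tau> : carrier Gam" by (simp add: galois_group_def)
next
 have "id : carrier Gam" unfolding Gal_iff by simp
 then show "\<one>\<^bsub>Gam\<^esub> : carrier Gam" by (simp add: galois_group_def)
qed (simp_all add: galois_group_def comp_assoc)

lemma Gam_mult: "sg \<otimes>\<^bsub>Gam\<^esub> \<tau> = sg \<circ> \<tau>" and Gam_one: "\<one>\<^bsub>Gam\<^esub> = id" by (simp_all add: galois_group_def)

interpretation Gam: group Gam by (rule Gam_group)

text \<open>An automorphism is determined by the images of the basis, and these are roots of fixed
  nonzero polynomials.\<close>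

lemma Gam_finite: "finite (carrier Gam)"
proof -
 have "ALL i. EX p. i < nK --> p ~= 0 \<and> (ALL j. Polynomial.coeff p j : \<int>) \<and> poly p (wK i) = 0"
 proof
  fix i
  show "EX p. i < nK --> p ~= 0 \<and> (ALL j. Polynomial.coeff p j : \<int>) \<and> poly p (wK i) = 0"
  proof (cases "i < nK")
   case True
   obtain p where p: "Polynomial.lead_coeff p = 1" "ALL j. Polynomial.coeff p j : \<int>" "poly p (wK i) = 0"
    using K.w_int[OF True] by (auto elim: algebraic_int.cases)
   then have "p ~= 0" by auto
   then show ?thesis using p by blast
  qed blast
 qed
 from choice[OF this] obtain p where p: "ALL i. i < nK --> p i ~= 0 \<and> (ALL j. Polynomial.coeff (p i) j : \<int>) \<and> poly (p i) (wK i) = 0" ..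
 let ?r = "%sg. \<lambda>i\<in>{..<nK}. sg (wK i)"
 show ?thesis
 proof (rule inj_on_finite[of ?r _ "\<Pi>\<^sub>E i\<in>{..<nK}. {y. poly (p i) y = 0}"])
  show "inj_on ?r (carrier Gam)"
  proof (rule inj_onI, rule ext)
   fix sg \<tau> x assume s: "sg : carrier Gam" and t: "\<tau> : carrier Gam" and eq: "?r sg = ?r \<tau>"
   have e: "sg (wK i) = \<tau> (wK i)" if "i < nK" for i using fun_cong[OF eq, of i] that by simp
   have x: "x = (\<Sum>i<nK. of_rat (coK x i) * wK i)" by (rule K.expand) simp
   have "sg (\<Sum>i<nK. of_rat (coK x i) * wK i) = \<tau> (\<Sum>i<nK. of_rat (coK x i) * wK i)"
    unfolding s_sum[OF s] s_sum[OF t] by (rule sum.cong) (simp_all add: s_mul[OF s] s_mul[OF t] s_rat[OF s] s_rat[OF t] e)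
   then show "sg x = \<tau> x" using x by simp
  qed
  show "?r ` carrier Gam \<subseteq> (\<Pi>\<^sub>E i\<in>{..<nK}. {y. poly (p i) y = 0})"
  proof (rule image_subsetI)
   fix sg assume s: "sg : carrier Gam"
   have "poly (p i) (sg (wK i)) = 0" if "i < nK" for i using s_poly[OF s, of "p i" "wK i"] s_zero[OF s] p that by simp
   then show "?r sg : (\<Pi>\<^sub>E i\<in>{..<nK}. {y. poly (p i) y = 0})" by (intro restrict_PiE_iff[THEN iffD2] ballI) simp
  qed
  show "finite (\<Pi>\<^sub>E i\<in>{..<nK}. {y. poly (p i) y = 0})" using p by (intro finite_PiE) (auto intro: poly_roots_finite)
 qed
qed

lemma fin_Gam: "fin_group Gam" by (intro fin_group.intro fin_group_axioms.intro Gam_group Gam_finite)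

lemma img_FI:
 assumes s: "sg : carrier Gam" and I: "I : K.FI" shows "sg ` I : K.FI"
proof -
 let ?i = "inv\<^bsub>Gam\<^esub> sg"
 have i: "?i : carrier Gam" using s by simp
 have r: "sg (?i x) = x" for x using Gam.r_inv[OF s] unfolding Gam_mult Gam_one by (simp add: fun_eq_iff)
 obtain d where d: "d : RK" "d ~= 0" "!!x. x : I ==> d * x : RK" using K.FI_D(5)[OF I] by blast
 obtain z where z: "z : I" "z ~= 0" using K.FI_D(6)[OF I] by blast
 show ?thesis
 proof (rule K.FI_I[of _ "sg d" "sg z"])
  show "0 : sg ` I" using imageI[OF K.FI_D(2)[OF I], of sg] s_zero[OF s] by simp
  fix x assume "x : sg ` I"
  then obtain x' where x': "x' : I" "x = sg x'" by blast
  show "sg d * x : RK" unfolding x'(2) s_mul[OF s, symmetric] by (rule s_RK[OF s d(3)[OF x'(1)]])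
  fix c assume c: "c : RK"
  have "sg (?i c * x') : sg ` I" by (rule imageI[OF K.FI_D(4)[OF I s_RK[OF i c] x'(1)]])
  then show "c * x : sg ` I" by (simp add: s_mul[OF s] r x'(2))
 next
  fix x y assume "x : sg ` I" "y : sg ` I"
  then obtain x' y' where xy: "x' : I" "x = sg x'" "y' : I" "y = sg y'" by blast
  show "x + y : sg ` I" using imageI[OF K.FI_D(3)[OF I xy(1,3)], of sg] by (simp add: s_add[OF s] xy(2,4))
 qed (use s_RK[OF s d(1)] d(2) z s_eq_zero[OF s] in auto)
qed

lemma img_im:
 assumes s: "sg : carrier Gam" shows "sg ` ideal_mult I J = ideal_mult (sg ` I) (sg ` J)"
proof
 have "ideal_mult I J \<subseteq> {x. sg x : ideal_mult (sg ` I) (sg ` J)}"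
  by (rule im_least) (auto simp: s_mul[OF s] s_add[OF s] s_zero[OF s] intro: im_prod im_zero im_add)
 then show "sg ` ideal_mult I J \<subseteq> ideal_mult (sg ` I) (sg ` J)" by blast
 show "ideal_mult (sg ` I) (sg ` J) \<subseteq> sg ` ideal_mult I J"
 proof (rule im_least)
  fix a b assume "a : sg ` I" "b : sg ` J"
  then obtain a' b' where ab: "a' : I" "a = sg a'" "b' : J" "b = sg b'" by blast
  show "a * b : sg ` ideal_mult I J" using imageI[OF im_prod[OF ab(1,3)], of sg] by (simp add: s_mul[OF s] ab(2,4))
 next
  show "0 : sg ` ideal_mult I J" using imageI[OF im_zero, of sg I J] by (simp add: s_zero[OF s])
  fix x y assume "x : sg ` ideal_mult I J" "y : sg ` ideal_mult I J"
  then obtain x' y' where xy: "x' : ideal_mult I J" "x = sg x'" "y' : ideal_mult I J" "y = sg y'" by blast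
  show "x + y : sg ` ideal_mult I J" using imageI[OF im_add[OF xy(1,3)], of sg] by (simp add: s_add[OF s] xy(2,4))
 qed
qed

lemma IG_act: "act K.IG sg I = sg ` I" by (simp add: ideal_group_def)

lemma IG_group_act: "group_act Gam K.IG"
 by (intro group_act.intro group_act_axioms.intro Gam_group K.IG.is_group homI)
  (simp_all add: IG_act img_FI img_im Gam_mult Gam_one image_image comp_def ideal_group_def)

lemma img_RK: "sg : carrier Gam ==> sg ` RK = RK"
proof -
 assume s: "sg : carrier Gam"
 have "1 : sg ` RK" using imageI[OF K.RO_1, of sg] by (simp add: s_one[OF s])
 moreover have "sg ` RK \<subseteq> RK" using s_RK[OF s] by blast
 ultimately show ?thesis by (intro K.RO_closed img_FI[OF s] K.RO_FI)
qed

lemma PF_act: "act_normal Gam K.IG K.PF"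
proof (intro act_normal.intro act_normal_axioms.intro IG_group_act K.T1.top_normal_axioms)
 fix sg I assume s: "sg : carrier Gam" and "I : K.PF"
 then obtain a where a: "I = sca a RK" "a ~= 0" unfolding K.principal_sca by blast
 have "sg ` sca a RK = sca (sg a) (sg ` RK)" by (simp add: sca_def image_image s_mul[OF s])
 then show "act K.IG sg I : K.PF" unfolding IG_act a(1) img_RK[OF s] K.principal_sca using a(2) s_eq_zero[OF s] by auto
qed

interpretation PA: act_normal Gam K.IG K.PF by (rule PF_act)

lemma CL_group_act: "group_act Gam K.CL" unfolding K.CL_def' by (rule PA.quot_act)
lemma CL_act: "sg : carrier Gam ==> I : K.FI ==> act K.CL sg (K.PF #>\<^bsub>K.IG\<^esub> I) = K.PF #>\<^bsub>K.IG\<^esub> (sg ` I)"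
 unfolding K.CL_def' using PA.prj_act[of sg I] by (simp add: IG_act)

lemma img_prm: "sg : carrier Gam ==> K.prm P ==> K.prm (sg ` P)"
proof -
 assume s: "sg : carrier Gam" and P: "K.prm P"
 let ?i = "inv\<^bsub>Gam\<^esub> sg"
 have i: "?i : carrier Gam" using s by simp
 have r: "sg (?i x) = x" for x using Gam.r_inv[OF s] unfolding Gam_mult Gam_one by (simp add: fun_eq_iff)
 have l: "?i (sg x) = x" for x using Gam.l_inv[OF s] unfolding Gam_mult Gam_one by (simp add: fun_eq_iff)
 have m: "x : sg ` P \<longleftrightarrow> ?i x : P" for x using l r by (metis imageE imageI)
 show ?thesis unfolding K.prm_def
 proof (intro conjI ballI impI)
  show "sg ` P : K.FI" using img_FI[OF s] P by (simp add: K.prm_def)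
  show "sg ` P \<subseteq> RK" using s_RK[OF s] P by (auto simp: K.prm_def)
  show "1 \<notin> sg ` P" unfolding m s_one[OF i] using P by (simp add: K.prm_def)
  fix x y assume "x : RK" "y : RK" "x * y : sg ` P"
  then show "x : sg ` P \<or> y : sg ` P" unfolding m s_mul[OF i] using P s_RK[OF i] by (simp add: K.prm_def)
 qed
qed

lemma S0_act: "sg : carrier Gam ==> c : K.S0 ==> act K.CL sg c : K.S0"
proof -
 assume s: "sg : carrier Gam" and "c : K.S0"
 then obtain P where P: "c = K.PF #>\<^bsub>K.IG\<^esub> P" "K.prm P" "Finite_Place (P \<inter> Q) : T"
  unfolding K.S0_def K.prime_ideals_prm by auto
 have "sg ` P \<inter> Q = P \<inter> Q"
 proof (intro equalityI subsetI)
  fix x assume "x : sg ` P \<inter> Q"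
  then obtain y where y: "y : P" "x = sg y" "x : Q" by blast
  have "sg x = sg y" using s_fix[OF s y(3)] y(2) by simp
  then have "x = y" by (rule injD[OF bij_is_inj[OF s_bij[OF s]]])
  then show "x : P \<inter> Q" using y by simp
 next
  fix x assume x: "x : P \<inter> Q"
  then have "x = sg x" using s_fix[OF s] by simp
  then show "x : sg ` P \<inter> Q" using x by blast
 qed
 then have "Finite_Place (sg ` P \<inter> Q) : T" using P(3) by simp
 moreover have "act K.CL sg c = K.PF #>\<^bsub>K.IG\<^esub> (sg ` P)" unfolding P(1) using P(2) by (intro CL_act s) (simp add: K.prm_def)
 ultimately show ?thesis unfolding K.S0_def K.prime_ideals_prm using img_prm[OF s P(2)]
  by (intro CollectI exI[of _ "sg ` P"]) simp
qed

lemma SS_act: "act_normal Gam K.CL K.SS"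
proof (intro act_normal.intro act_normal_axioms.intro CL_group_act K.T2.top_normal_axioms)
 interpret C: group_act Gam K.CL by (rule CL_group_act)
 fix sg c assume s: "sg : carrier Gam" and c: "c : K.SS"
 interpret a: group_hom K.CL K.CL "act K.CL sg" by (rule C.act_group_hom[OF s])
 let ?V = "{x : carrier K.CL. act K.CL sg x : K.SS}"
 have "subgroup ?V K.CL"
  by (rule K.CL.subgroupI) (use K.SS_sub in \<open>auto simp: subgroup.one_closed subgroup.m_closed subgroup.m_inv_closed intro!: exI[of _ "\<one>\<^bsub>K.CL\<^esub>"]\<close>)
 moreover have "K.S0 \<subseteq> ?V" using S0_act[OF s] K.S0_sub unfolding K.SS_def by (auto intro: generate.incl)
 ultimately have "K.SS \<subseteq> ?V" unfolding K.SS_def by (intro K.CL.generate_subgroup_incl)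
 then show "act K.CL sg c : K.SS" using c by blast
qed

interpretation SA: act_normal Gam K.CL K.SS by (rule SS_act)

lemma TC_group_act: "group_act Gam K.TC" unfolding K.TC_def' by (rule SA.quot_act)
lemma TC_act: "sg : carrier Gam ==> I : K.FI ==> act K.TC sg (K.cls I) = K.cls (sg ` I)"
proof -
 assume s: "sg : carrier Gam" and I: "I : K.FI"
 have "K.PF #>\<^bsub>K.IG\<^esub> I : carrier K.CL" unfolding K.CL_surj using I by simp
 then show ?thesis unfolding K.TC_def' K.cls_def using SA.prj_act[OF s] CL_act[OF s I] by simp
qed

lemma TC_finite_module: "finite_module Gam K.TC"
 by (intro finite_module.intro finite_module_axioms.intro TC_group_act K.TC.comm_group_axioms K.finite_TC K.discrete_TC)

section \<open>Norms of ideals and extension of ideals from \<open>Q\<close>\<close>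

abbreviation "mp \<equiv> %sg f. map_poly sg (f :: 'k poly)"

lemma mp_coeff: "sg : carrier Gam ==> Polynomial.coeff (mp sg f) i = sg (Polynomial.coeff f i)"
 by (simp add: coeff_map_poly s_zero)
lemma mp_mult: "sg : carrier Gam ==> mp sg (f * g) = mp sg f * mp sg g"
 by (rule poly_eqI) (simp add: mp_coeff coeff_mult s_sum s_mul)
lemma mp_one: "sg : carrier Gam ==> mp sg 1 = 1"
 by (rule poly_eqI) (simp add: mp_coeff coeff_1 s_one s_zero)
lemma mp_prod: "sg : carrier Gam ==> mp sg (prod h S) = (\<Prod>i\<in>S. mp sg (h i))"
 by (induction S rule: infinite_finite_induct) (simp_all add: mp_one mp_mult)
lemma mp_nz: "sg : carrier Gam ==> f ~= 0 ==> mp sg f ~= 0"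
proof
 assume s: "sg : carrier Gam" and f: "f ~= 0" and 0: "mp sg f = 0"
 have "Polynomial.coeff f i = 0" for i using mp_coeff[OF s, of f i] 0 s_eq_zero[OF s] by simp
 then show False using f by (simp add: poly_eq_iff)
qed

lemma cont_FIK: "f ~= 0 ==> K.cont f : K.FI" by (rule K.cont_FI) auto

lemma cont_mp: assumes s: "sg : carrier Gam" and f: "f ~= 0" shows "K.cont (mp sg f) = sg ` K.cont f"
proof
 note I = img_FI[OF s cont_FIK[OF f]]
 show "K.cont (mp sg f) \<subseteq> sg ` K.cont f"
  by (rule K.cont_least) (auto simp: mp_coeff[OF s] intro: imageI K.cont_coeff K.FI_D[OF I])
 have "K.cont f \<subseteq> {x. sg x : K.cont (mp sg f)}"
 proof (rule K.cont_least)
  show "Polynomial.coeff f i : {x. sg x : K.cont (mp sg f)}" for i using K.cont_coeff[of "mp sg f" i] by (simp add: mp_coeff[OF s])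
 qed (use K.FI_D[OF cont_FIK[OF mp_nz[OF s f]]] s_RK[OF s] in \<open>auto simp: s_zero[OF s] s_add[OF s] s_mul[OF s]\<close>)
 then show "sg ` K.cont f \<subseteq> K.cont (mp sg f)" by blast
qed

lemma cont_one: "K.cont 1 = RK"
proof (rule K.RO_closed[OF cont_FIK])
 show "1 : K.cont 1" using K.cont_coeff[of 1 0] by simp
 show "K.cont 1 \<subseteq> RK" by (rule K.cont_least) (auto simp: coeff_1 K.RO_0 K.RO_1 K.RO_add K.RO_mul)
qed simp

lemma cont_norm:
 assumes f: "f ~= 0" and S: "finite S" "S \<subseteq> carrier Gam"
 shows "finprod K.IG (%sg. sg ` K.cont f) S = K.cont (\<Prod>sg\<in>S. mp sg f) \<and> (\<Prod>sg\<in>S. mp sg f) ~= 0"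
 using S
proof (induction S rule: finite_induct)
 case empty
 then show ?case by (simp add: cont_one) (simp add: ideal_group_def)
next
 case (insert sg S)
 have s: "sg : carrier Gam" "S \<subseteq> carrier Gam" using insert.prems by auto
 note IH = insert.IH[OF s(2)]
 have fin: "finprod K.IG (%sg. sg ` K.cont f) (insert sg S) = sg ` K.cont f \<otimes>\<^bsub>K.IG\<^esub> finprod K.IG (%sg. sg ` K.cont f) S"
  by (rule K.IG.finprod_insert) (use insert.hyps s img_FI cont_FIK[OF f] in auto)
 have "K.cont (mp sg f * (\<Prod>sg\<in>S. mp sg f)) = ideal_mult (K.cont (mp sg f)) (K.cont (\<Prod>sg\<in>S. mp sg f))"
  by (rule K.gauss) (use mp_nz[OF s(1) f] IH in auto)
 then have "K.cont (\<Prod>sg\<in>insert sg S. mp sg f) = sg ` K.cont f \<otimes>\<^bsub>K.IG\<^esub> K.cont (\<Prod>sg\<in>S. mp sg f)"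
  using insert.hyps by (simp add: cont_mp[OF s(1) f] ideal_group_def)
 then show ?case unfolding fin using IH insert.hyps mp_nz[OF s(1) f] by simp
qed

abbreviation "ext J \<equiv> ideal_mult J RK"

lemma RQ_RK: "x : integers Q ==> x : RK" by (simp add: integers_def)

lemma ext_FI: assumes J: "J : q.FI" shows "ext J : K.FI"
proof -
 obtain d where d: "d : integers Q" "d ~= 0" "!!x. x : J ==> d * x : integers Q" using q.FI_D(5)[OF J] by blast
 obtain z where z: "z : J" "z ~= 0" using q.FI_D(6)[OF J] by blast
 have 1: "ext J \<subseteq> {x. c * x : ext J}" if c: "c : RK" for c
 proof (rule im_least)
  fix a b assume "a : J" "b : RK"
  then have "a * (c * b) : ext J" by (intro im_prod K.RO_mul c)
  then show "a * b : {x. c * x : ext J}" by (simp add: mult_ac)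
 qed (auto simp: im_zero distrib_left im_add)
 have 2: "ext J \<subseteq> {x. d * x : RK}"
 proof (rule im_least)
  fix a b assume "a : J" "b : RK"
  then have "(d * a) * b : RK" using K.RO_mul[OF RQ_RK[OF d(3)]] by blast
  then show "a * b : {x. d * x : RK}" by (simp add: mult_ac)
 qed (auto simp: K.RO_0 distrib_left K.RO_add)
 have zz: "z : ext J" using im_prod[OF z(1) K.RO_1] by simp
 show ?thesis
  by (rule K.FI_I[of _ d z]) (use 1 2 d RQ_RK z zz in \<open>auto simp: im_zero im_add\<close>)
qed

lemma RR: "ideal_mult RK RK = RK" by (rule K.im_one[OF K.RO_FI])

lemma ext_mult: "ext (ideal_mult I J) = ideal_mult (ext I) (ext J)"
proof -
 have "ideal_mult RK (ideal_mult J RK) = ideal_mult J (ideal_mult RK RK)" by (simp only: im_assoc im_comm[of RK "ideal_mult J RK"])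
 then show ?thesis by (simp add: im_assoc RR)
qed

lemma norm_ext: assumes I: "I : K.FI" shows "EX J:q.FI. finprod K.IG (%sg. sg ` I) (carrier Gam) = ext J"
proof -
 obtain W where W: "finite W" "W \<subseteq> I" "I \<subseteq> zspan W" using K.FI_fg[OF I] by blast
 obtain e where e: "bij_betw e {..<card W} W" using ex_bij_betw_nat_finite[OF W(1)] by (auto simp: lessThan_atLeast0)
 have eW: "e i : W" if "i < card W" for i using e that by (auto simp: bij_betw_def)
 define f where "f = (\<Sum>i<card W. Polynomial.monom (e i) i)"
 have cf: "Polynomial.coeff f i = (if i < card W then e i else 0)" for i
  by (simp add: f_def coeff_sum coeff_monom)
 have wc: "W \<subseteq> range (Polynomial.coeff f)"
 proof
  fix x assume "x : W"
  then have "x : e ` {..<card W}" using e by (simp add: bij_betw_def)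
  then obtain i where "i < card W" "x = e i" by auto
  then have "x = Polynomial.coeff f i" by (simp add: cf)
  then show "x : range (Polynomial.coeff f)" by blast
 qed
 have nz: "f ~= 0"
 proof
  assume "f = 0"
  then have "W \<subseteq> {0}" using wc by auto
  then have "zspan W \<subseteq> {0}" by (intro zspan_least) auto
  then show False using W(3) K.FI_D(6)[OF I] by blast
 qed
 have fI: "K.cont f = I"
 proof
  show "K.cont f \<subseteq> I" by (rule K.cont_least) (use eW W(2) K.FI_D[OF I] in \<open>auto simp: cf\<close>)
  have "zspan W \<subseteq> K.cont f"
   by (rule zspan_least) (use wc K.cont_coeff K.FI_D[OF cont_FIK[OF nz]] K.FI_int[OF cont_FIK[OF nz]] in auto)
  then show "I \<subseteq> K.cont f" using W(3) by blast
 qed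
 define N where "N = (\<Prod>sg\<in>carrier Gam. mp sg f)"
 have N: "finprod K.IG (%sg. sg ` I) (carrier Gam) = K.cont N" "N ~= 0"
  using cont_norm[OF nz Gam_finite subset_refl] unfolding fI N_def by blast+
 have "mp \<tau> N = N" if t: "\<tau> : carrier Gam" for \<tau>
 proof -
  have "mp \<tau> (mp sg f) = mp (\<tau> \<otimes>\<^bsub>Gam\<^esub> sg) f" if s: "sg : carrier Gam" for sg
   by (rule poly_eqI) (use t s Gam.m_closed[OF t s] in \<open>simp add: mp_coeff Gam_mult\<close>)
  then have "mp \<tau> N = (\<Prod>sg\<in>carrier Gam. mp (\<tau> \<otimes>\<^bsub>Gam\<^esub> sg) f)" unfolding N_def mp_prod[OF t] by (intro prod.cong) auto
  also have "\<dots> = N" unfolding N_def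
  proof (rule prod.reindex_bij_witness[of _ "%sg. inv\<^bsub>Gam\<^esub> \<tau> \<otimes>\<^bsub>Gam\<^esub> sg" "%sg. \<tau> \<otimes>\<^bsub>Gam\<^esub> sg"])
  qed (use t in \<open>auto simp flip: Gam.m_assoc\<close>)
  finally show ?thesis .
 qed
 then have "\<tau> (Polynomial.coeff N i) = Polynomial.coeff N i" if "\<tau> : carrier Gam" for \<tau> i using mp_coeff[OF that, of N i] that by simp
 \<comment> \<open>Since the extension is Galois, invariant coefficients lie in \<open>Q\<close>.
   The content of \<open>N\<close> can then be formed over \<open>Q\<close> too, and its extension
   is the content over the whole field, as both are generated by the same coefficients.\<close>
 then have NQ: "Polynomial.coeff N i : Q" for i using gal unfolding galois_ext_def by blast
 have J: "q.cont N : q.FI" by (rule q.cont_FI[OF N(2) NQ])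
 have "ext (q.cont N) = K.cont N"
 proof
  have "q.cont N \<subseteq> K.cont N" by (rule q.cont_least) (use K.cont_coeff K.FI_D[OF cont_FIK[OF N(2)]] RQ_RK in auto)
  then have "ext (q.cont N) \<subseteq> ideal_mult (K.cont N) RK" by (intro im_mono) auto
  also have "\<dots> = ideal_mult RK (K.cont N)" by (rule im_comm)
  also have "\<dots> = K.cont N" by (rule K.im_one[OF cont_FIK[OF N(2)]])
  finally show "ext (q.cont N) \<subseteq> K.cont N" .
  have c: "Polynomial.coeff N i : ext (q.cont N)" for i using im_prod[OF q.cont_coeff K.RO_1, of N i] by simp
  show "K.cont N \<subseteq> ext (q.cont N)" by (rule K.cont_least) (use c K.FI_D[OF ext_FI[OF J]] in auto)
 qed
 then show ?thesis using N(1) J by (intro bexI[of _ "q.cont N"]) simp_all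
qed

text \<open>A prime \<open>P\<close> containing \<open>A\<close> meets \<open>Q\<close> exactly in
  \<open>p\<close>, because \<open>p\<close> is maximal, so the class of \<open>P\<close> is
  trivial. Dividing \<open>A\<close> by \<open>P\<close> gives a strictly larger integral ideal, and
  the induction is on the number of members of the finite set \<open>AF k\<close> that contain
  \<open>A\<close>.\<close>

lemma cls_above:
 assumes p: "q.prm p" "Finite_Place p : T"
 shows "A : K.FI ==> A \<subseteq> RK ==> p \<subseteq> A ==> K.cls A = \<one>\<^bsub>K.TC\<^esub>"
proof -
 have pF: "p : q.FI" "p \<subseteq> integers Q" "1 \<notin> p" using p(1) by (auto simp: q.prm_def)
 obtain k where k: "k > 0" "of_nat k : p" using q.integral_FI_AF[OF pF(1,2)] by blast
 have AFk: "A : K.AF k" if A: "A : K.FI" "A \<subseteq> RK" "p \<subseteq> A" for A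
  unfolding K.AF_def
 proof (intro CollectI conjI ballI A(2))
  fix x assume "x : RK"
  then have "x * of_nat k : A" using k(2) A(3) by (intro K.FI_D(4)[OF A(1)]) auto
  then show "of_nat k * x : A" by (simp only: mult.commute)
 qed (rule K.FI_D(3)[OF A(1)])
 show "A : K.FI ==> A \<subseteq> RK ==> p \<subseteq> A ==> K.cls A = \<one>\<^bsub>K.TC\<^esub>"
 proof (induction "card {B : K.AF k. A \<subseteq> B}" arbitrary: A rule: less_induct)
  case (less A)
  show ?case
  proof (cases "1 : A")
   case True
   then have "A = sca 1 RK" using K.RO_closed[OF less.prems(1) _ less.prems(2)] by (simp add: sca_one)
   then have "A : K.PF" unfolding K.principal_sca by (intro CollectI exI[of _ 1]) simp
   then show ?thesis by (rule K.cls_principal)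
  next
   case False
   then obtain P where P: "K.prm P" "A \<subseteq> P" using K.max_ex[OF less.prems(1,2)] by blast
   have PF: "P : K.FI" "P \<subseteq> RK" "1 \<notin> P" using P(1) by (auto simp: K.prm_def)
   have "P \<inter> Q = p"
   proof (intro equalityI subsetI)
    fix x assume x: "x : P \<inter> Q"
    then have xQ: "x : integers Q" using PF(2) by (auto simp: integers_def)
    show "x : p"
    proof (rule ccontr)
     assume "x \<notin> p"
     then obtain c where c: "c : integers Q" "1 - c * x : p" using q.prm_maximal[OF p(1) xQ] by blast
     have "(1 - c * x) + c * x : P"
      by (rule K.FI_D(3)[OF PF(1)]) (use c less.prems(3) P(2) x in \<open>auto intro: K.FI_D(4)[OF PF(1)] RQ_RK\<close>)
     then show False using PF(3) by simp
    qed
   next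
    fix x assume "x : p"
    then show "x : P \<inter> Q" using less.prems(3) P(2) pF(2) q.RO_F by blast
   qed
   then have clP: "K.cls P = \<one>\<^bsub>K.TC\<^esub>" using p(2) P(1) by (intro K.cls_prime) (simp_all add: K.prime_ideals_prm)
   obtain V where V: "V : K.FI" "ideal_mult V P = RK" using K.inverse_ex[OF PF(1)] by blast
   have "ideal_mult V P \<subseteq> ideal_mult V RK" by (rule im_mono[OF subset_refl PF(2)])
   moreover have "ideal_mult V RK = V" using K.im_one[OF V(1)] by (simp only: im_comm[of V RK])
   ultimately have RV: "RK \<subseteq> V" using V(2) by simp
   let ?B = "ideal_mult V A"
   have BF: "?B : K.FI" by (rule K.im_FI[OF V(1) less.prems(1)])
   have AB: "A \<subseteq> ?B" using im_mono[OF RV subset_refl, of A] K.im_one[OF less.prems(1)] by simp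
   have BR: "?B \<subseteq> RK" using im_mono[OF subset_refl P(2), of V] V(2) by simp
   \<comment> \<open>If multiplication by \<open>V\<close> fixed \<open>A\<close>, then
     \<open>cancel_one\<close> would make \<open>V\<close>, and with it \<open>P\<close>, the unit
     ideal.\<close>
   have ne: "?B ~= A"
   proof
    assume "?B = A"
    then have "V = RK" by (rule K.cancel_one[OF less.prems(1) V(1)])
    then have "RK = P" using V(2) K.im_one[OF PF(1)] by simp
    then show False using PF(3) K.RO_1 by blast
   qed
   have "card {C : K.AF k. ?B \<subseteq> C} < card {C : K.AF k. A \<subseteq> C}"
   proof (rule psubset_card_mono)
    show "finite {C : K.AF k. A \<subseteq> C}" using K.finite_AF[OF k(1)] by simp
    have "A : {C : K.AF k. A \<subseteq> C}" "A \<notin> {C : K.AF k. ?B \<subseteq> C}" using AFk[OF less.prems] ne AB by auto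
    then show "{C : K.AF k. ?B \<subseteq> C} \<subset> {C : K.AF k. A \<subseteq> C}" using AB by blast
   qed
   then have clB: "K.cls ?B = \<one>\<^bsub>K.TC\<^esub>" using less.hyps BF BR less.prems(3) AB by blast
   have "ideal_mult ?B P = ideal_mult (ideal_mult V P) A" by (simp only: im_assoc im_comm[of A P])
   then have "?B \<otimes>\<^bsub>K.IG\<^esub> P = A" using V(2) K.im_one[OF less.prems(1)] by (simp add: ideal_group_def)
   then show ?thesis using K.cls.hom_mult[of ?B P] BF PF(1) clB clP by simp
  qed
 qed
qed

text \<open>The norm of an ideal is the extension of an ideal \<open>J\<close> of \<open>Q\<close>.
  Extension followed by \<open>cls\<close> kills principal ideals and, by \<open>cls_above\<close>,
  the primes in \<open>T\<close>, so it factors through the corresponding class group of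
  \<open>Q\<close>, in which the order of the group kills the class of \<open>J\<close>.\<close>

lemma norm_kills_class:
 assumes c: "c : carrier K.TC"
 shows "finprod K.TC (%sg. act K.TC sg c) (carrier Gam) [^]\<^bsub>K.TC\<^esub> Coset.order q.TC = \<one>\<^bsub>K.TC\<^esub>"
proof -
 obtain I where I: "I : K.FI" "c = K.cls I" using c unfolding K.cls_surj by blast
 obtain J where J: "J : q.FI" "finprod K.IG (%sg. sg ` I) (carrier Gam) = ext J" using norm_ext[OF I(1)] by blast
 have "K.cls (finprod K.IG (%sg. sg ` I) (carrier Gam)) = finprod K.TC (%sg. K.cls (sg ` I)) (carrier Gam)"
  by (rule finprod_hom[OF K.IG.comm_group_axioms K.TC.comm_group_axioms K.cls_hom]) (use img_FI I(1) in auto)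
 also have "\<dots> = finprod K.TC (%sg. act K.TC sg c) (carrier Gam)"
  by (rule K.TC.finprod_cong) (use I img_FI in \<open>auto simp: simp_implies_def TC_act\<close>)
 finally have N: "finprod K.TC (%sg. act K.TC sg c) (carrier Gam) = K.cls (ext J)" unfolding J(2) ..
 let ?E = "%J. K.cls (ext J)"
 have "?E : hom q.IG K.TC"
 proof (rule homI)
  fix I J assume IJ: "I : carrier q.IG" "J : carrier q.IG"
  then have "I : q.FI" "J : q.FI" by simp_all
  then have F: "ext I : K.FI" "ext J : K.FI" by (simp_all add: ext_FI)
  then show "?E I : carrier K.TC" using K.cls.hom_closed[of "ext I"] by simp
  have "?E (I \<otimes>\<^bsub>q.IG\<^esub> J) = K.cls (ext I \<otimes>\<^bsub>K.IG\<^esub> ext J)" by (simp add: ideal_group_def ext_mult)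
  then show "?E (I \<otimes>\<^bsub>q.IG\<^esub> J) = ?E I \<otimes>\<^bsub>K.TC\<^esub> ?E J" using F K.cls.hom_mult[of "ext I" "ext J"] by simp
 qed
 then interpret E: group_hom q.IG K.TC ?E by (intro group_hom.intro group_hom_axioms.intro q.IG.is_group K.TC.is_group)
 let ?H = "kernel q.IG K.TC ?E"
 let ?h = "Coset.order q.TC"
 have JG: "J : carrier q.IG" using J(1) by simp
 have "J [^]\<^bsub>q.IG\<^esub> ?h : ?H"
 proof (rule q.cls_one_mem[OF E.subgroup_kernel])
  show "q.PF \<subseteq> ?H"
  proof
   fix P assume P: "P : q.PF"
   then obtain a where a: "P = sca a (integers Q)" "a : Q - {0}" unfolding q.principal_sca by blast
   have "ideal_mult (integers Q) RK = RK"
   proof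
    show "ideal_mult (integers Q) RK \<subseteq> RK" by (rule im_least) (auto intro: K.RO_mul RQ_RK K.RO_0 K.RO_add)
    show "RK \<subseteq> ideal_mult (integers Q) RK" using im_prod[OF q.RO_1] by fastforce
   qed
   then have "ext P = sca a RK" unfolding a(1) im_sca by simp
   then have "ext P : K.PF" unfolding K.principal_sca using a(2) by blast
   then have "?E P = \<one>\<^bsub>K.TC\<^esub>" by (rule K.cls_principal)
   then show "P : ?H" using q.T1.subset P by (auto simp: kernel_def)
  qed
  fix p assume p: "p : prime_ideals Q" "place_below Q (Finite_Place p) : T"
  have pp: "q.prm p" using p(1) by (simp add: q.prime_ideals_prm)
  then have pF: "p : q.FI" "p \<subseteq> integers Q" by (auto simp: q.prm_def)
  have "p \<inter> Q = p" using pF(2) q.RO_F by blast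
  then have pT: "Finite_Place p : T" using p(2) by simp
  have "ext p \<subseteq> RK" by (rule im_least) (use pF(2) in \<open>auto intro: K.RO_mul RQ_RK K.RO_0 K.RO_add\<close>)
  moreover have "p \<subseteq> ext p" using im_prod[OF _ K.RO_1, of _ p] by fastforce
  ultimately have "?E p = \<one>\<^bsub>K.TC\<^esub>" by (intro cls_above[OF pp pT] ext_FI pF)
  then show "p : ?H" using pF(1) by (simp add: kernel_def)
 next
  show "J [^]\<^bsub>q.IG\<^esub> ?h : q.FI" using q.IG.nat_pow_closed[OF JG, of ?h] by simp
  have "q.cls (J [^]\<^bsub>q.IG\<^esub> ?h) = q.cls J [^]\<^bsub>q.TC\<^esub> ?h" by (rule q.cls.hom_nat_pow[OF JG])
  then show "q.cls (J [^]\<^bsub>q.IG\<^esub> ?h) = \<one>\<^bsub>q.TC\<^esub>" using q.TC.pow_order_eq_1[OF q.cls.hom_closed[OF JG]] by simp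
 qed
 then have "?E (J [^]\<^bsub>q.IG\<^esub> ?h) = \<one>\<^bsub>K.TC\<^esub>" by (simp add: kernel_def)
 then show ?thesis unfolding N using E.hom_nat_pow[OF JG, of ?h] by simp
qed

text \<open>The order of the norm of an element divides the order of the class group of
  \<open>Q\<close>, hence \<open>d\<close>; it also divides the order of the module, which is prime
  to \<open>d\<close>. So it is \<open>1\<close>.\<close>

lemma class_module:
 assumes d: "Coset.order q.TC dvd d"
 shows "norm_mod Gam (prime_to_quot d K.TC)" "finite (carrier (prime_to_quot d K.TC))"
  "coprime (Coset.order (prime_to_quot d K.TC)) d"
proof -
 interpret C: finite_module Gam K.TC d by (rule TC_finite_module)
 let ?M = "prime_to_quot d K.TC" and ?N = "\<Inter>C.NN"
 note M = C.ptq_props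
 show "finite (carrier ?M)" "coprime (Coset.order ?M) d" by (rule M)+
 interpret M: comm_group ?M by (rule M(1))
 interpret MA: group_act Gam ?M by (rule M(2))
 interpret MM: mod_act Gam ?M by (intro mod_act.intro M(1,2) fin_Gam)
 interpret p: group_hom K.TC ?M "%x. ?N #>\<^bsub>K.TC\<^esub> x" by (rule M(5))
 show "norm_mod Gam ?M"
 proof (intro norm_mod.intro norm_mod_axioms.intro MM.mod_act_axioms)
  fix m assume m: "m : carrier ?M"
  then obtain c where c: "c : carrier K.TC" "m = ?N #>\<^bsub>K.TC\<^esub> c" unfolding M(6) by blast
  let ?z = "finprod K.TC (%sg. act K.TC sg c) (carrier Gam)"
  have z: "?z : carrier K.TC" by (rule K.TC.finprod_closed) (use c C.act_closed in auto)
  have "MM.ev1 m (%_. 1) = finprod ?M (%sg. act ?M sg m) (carrier Gam)"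
   unfolding MM.ev1_def by (rule M.finprod_cong) (use m in \<open>auto simp: simp_implies_def M.int_pow_1\<close>)
  also have "\<dots> = finprod ?M (%sg. ?N #>\<^bsub>K.TC\<^esub> act K.TC sg c) (carrier Gam)"
   by (rule M.finprod_cong) (use c C.act_closed p.hom_closed in \<open>auto simp: simp_implies_def M(7)\<close>)
  also have "\<dots> = ?N #>\<^bsub>K.TC\<^esub> ?z"
   by (rule finprod_hom[OF K.TC.comm_group_axioms M(1) p.homh, symmetric]) (use c C.act_closed in auto)
  finally have e: "MM.ev1 m (%_. 1) = ?N #>\<^bsub>K.TC\<^esub> ?z" .
  let ?x = "MM.ev1 m (%_. 1)" let ?h = "Coset.order q.TC"
  have x: "?x : carrier ?M" using p.hom_closed[OF z] e by simp
  have "?x [^]\<^bsub>?M\<^esub> ?h = \<one>\<^bsub>?M\<^esub>" unfolding e using p.hom_nat_pow[OF z, of ?h] norm_kills_class[OF c(1)] by simp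
  then have "M.ord ?x dvd ?h" using M.pow_eq_id[OF x] by simp
  then have "M.ord ?x dvd d" using d by (rule dvd_trans)
  with M.ord_dvd_group_order[OF x] have "M.ord ?x = 1" by (rule coprime_common_divisor_nat[OF M(4)])
  then show "?x = \<one>\<^bsub>?M\<^esub>" using M.pow_ord_eq_1[OF x] x by simp
 qed
qed

end

lemma subfld_of_subfield:
 assumes "subfield Q (ring_on (UNIV :: 'k::field_char_0 set))"
 shows "subfld Q"
proof -
 let ?R = "ring_on (UNIV :: 'k set)"
 interpret S: subfield Q ?R by fact
 have R: "cring ?R"
 proof (intro cringI abelian_groupI comm_monoidI)
  fix x assume "x : carrier ?R"
  then show "EX y:carrier ?R. y \<oplus>\<^bsub>?R\<^esub> x = \<zero>\<^bsub>?R\<^esub>" by (intro bexI[of _ "- x"]) (auto simp: ring_on_def)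
 qed (auto simp: ring_on_def algebra_simps)
 interpret R: cring ?R by (rule R)
 have sr: "subring Q ?R" by unfold_locales
 note E = subringE[OF sr]
 show ?thesis
 proof
  show "0 : Q" "1 : Q" using E(2,3) by (simp_all add: ring_on_def)
  show "x + y : Q" "x * y : Q" if "x : Q" "y : Q" for x y using E(6,7)[OF that] by (simp_all add: ring_on_def)
  show "- x : Q" if "x : Q" for x
  proof -
   have "\<ominus>\<^bsub>?R\<^esub> x = - x" by (rule R.minus_equality) (auto simp: ring_on_def)
   then show ?thesis using E(5)[OF that] by simp
  qed
  show "inverse x : Q" if x: "x : Q" for x
  proof (cases "x = 0")
   case False
   then have "x : Units (?R\<lparr>carrier := Q\<rparr>)" using S.subfield_Units x by (simp add: ring_on_def)
   then obtain y where "y : Q" "y * x = 1" by (auto simp: Units_def ring_on_def)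
   then show ?thesis using False by (metis inverse_unique mult.commute)
  qed (use x in simp)
 qed
qed

lemma t_class_ex:
 assumes "subfld F" "number_field TYPE('k::field_char_0)"
 shows "EX n w co. t_class (F :: 'k set) n w co"
proof -
 obtain n w co where b: "based_field F n w co" "\<forall>i<n. algebraic_int (w i)" using subfld.exists_basis[OF assms] by blast
 then have "number_fld F n w co" by (intro number_fld.intro number_fld_axioms.intro) auto
 then show ?thesis unfolding t_class_def by blast
qed

lemma subfld_UNIV: "subfld UNIV" by unfold_locales auto

theorem proposition3p13:
  fixes Q :: "'k::field_char_0 set"
    and T :: "'k place set"
    and v w :: "nat \<Rightarrow> 'k place"
  defines "\<Gamma> \<equiv> galois_group Q"
  defines "\<Delta> \<equiv> order (T_class_group Q T Q) * card (roots_of_unity :: 'k set) * order \<Gamma>"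
  assumes "number_field TYPE('k)"
    and "subfield Q (ring_on UNIV)"
    and "galois_ext Q"
    and "T \<subseteq> places Q" and "finite T" and "arch_places Q \<subseteq> T"
    and "bij_betw v {1..card T} T"
    and "\<And>j. j \<in> {1..card T} \<Longrightarrow> w j \<in> places UNIV \<and> place_below Q (w j) = v j"
  shows "\<forall>\<^sub>F n in sequentially.
     (let Z = Z_ring \<Delta>; M = B_module Z \<Gamma> n in
      \<exists>r. (\<forall>i\<in>{1..n}. r i \<in> carrier M) \<and>
          (\<forall>j\<in>{n + 1..n + card T}. r j \<in> fixed_points M (decomposition_group Q (w (j - n)))) \<and>
          equivariant_iso (carrier \<Gamma>)
            (prime_to_quot \<Delta> (T_class_group Q T UNIV))
            (act_quot M (B_span Z \<Gamma> n (r ` {1..n + card T})))) \<and>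
     (let M = prime_to_quot \<Delta> (abelianization (F_group n \<Gamma>)) in
      \<exists>r. (\<forall>i\<in>{1..n}. r i \<in> carrier M) \<and>
          r (n + 1) \<in> fixed_points M (decomposition_group Q (w 1)) \<and>
          (\<forall>j\<in>{n + 2..n + card T}. r j \<in> fixed_points M (decomposition_group Q (w (j - n)))) \<and>
          equivariant_iso (carrier \<Gamma>)
            (prime_to_quot \<Delta> (T_class_group Q T UNIV))
            (act_quot M (closed_stable_generate (carrier \<Gamma>) M
              ({inv\<^bsub>M\<^esub> (r i) \<otimes>\<^bsub>M\<^esub> act M \<gamma> (r i) | i \<gamma>. i \<in> {1..n + 1} \<and> \<gamma> \<in> carrier \<Gamma>} \<union>
               r ` {n + 2..n + card T}))))"
proof -
  have sub: "subfld Q" by (rule subfld_of_subfield[OF assms(4)])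
  obtain nK :: nat and wK coK where tK: "t_class (UNIV :: 'k set) nK wK coK" using t_class_ex[OF subfld_UNIV assms(3)] by blast
  obtain nQ :: nat and wQ coQ where tQ: "t_class Q nQ wQ coQ" using t_class_ex[OF sub assms(3)] by blast
  interpret G: gal Q T nK wK coK nQ wQ coQ by (intro gal.intro gal_axioms.intro tK tQ assms(5))
  let ?M = "prime_to_quot \<Delta> (T_class_group Q T UNIV)"
  have d: "Coset.order (T_class_group Q T Q) dvd \<Delta>" "card (carrier \<Gamma>) dvd \<Delta>" unfolding \<Delta>_def Coset.order_def[of \<Gamma>] by simp_all
  note M = G.class_module[OF d(1), folded \<Gamma>_def]
  interpret M: norm_mod \<Gamma> ?M by (rule M(1))
  have "coprime (Coset.order ?M) (card (carrier \<Gamma>))" using M(3) d(2) by (metis coprime_divisors dvd_refl)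
  from M.exists_presentation[OF M(2) this] obtain n0 where n0: "\<forall>n\<ge>n0. \<exists>x. M.good_presentation n x \<and> M.rng n x = carrier ?M" ..
  \<comment> \<open>The neutral element is fixed by every automorphism, so trivial relators meet the
    conditions at all places, whatever the decomposition groups are.\<close>
  have fix1: "\<one>\<^bsub>B\<^esub> \<in> fixed_points B (decomposition_group Q u)" if B: "group_act \<Gamma> B" for B :: "('b, 'k \<Rightarrow> 'k, 'm) act_group_scheme" and u
  proof -
    interpret B: group_act \<Gamma> B by fact
    have "act B \<gamma> \<one>\<^bsub>B\<^esub> = \<one>\<^bsub>B\<^esub>" if "\<gamma> \<in> decomposition_group Q u" for \<gamma>
      using that B.act_id by (simp add: decomposition_group_def \<Gamma>_def)
    then show ?thesis by (simp add: fixed_points_def)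
  qed
  show ?thesis
    unfolding eventually_sequentially
  proof (intro exI[of _ n0] allI impI)
    fix n assume "n0 \<le> n"
    then obtain x where x: "M.good_presentation n x" "M.rng n x = carrier ?M" using n0 by blast
    interpret P: presentation \<Gamma> ?M \<Delta> n x by (intro presentation.intro presentation_axioms.intro M x)
    show "(let Z = Z_ring \<Delta>; M = B_module Z \<Gamma> n in
      \<exists>r. (\<forall>i\<in>{1..n}. r i \<in> carrier M) \<and>
          (\<forall>j\<in>{n + 1..n + card T}. r j \<in> fixed_points M (decomposition_group Q (w (j - n)))) \<and>
          equivariant_iso (carrier \<Gamma>) ?M (act_quot M (B_span Z \<Gamma> n (r ` {1..n + card T})))) \<and>
     (let M = prime_to_quot \<Delta> (abelianization (F_group n \<Gamma>)) in
      \<exists>r. (\<forall>i\<in>{1..n}. r i \<in> carrier M) \<and>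
          r (n + 1) \<in> fixed_points M (decomposition_group Q (w 1)) \<and>
          (\<forall>j\<in>{n + 2..n + card T}. r j \<in> fixed_points M (decomposition_group Q (w (j - n)))) \<and>
          equivariant_iso (carrier \<Gamma>) ?M
            (act_quot M (closed_stable_generate (carrier \<Gamma>) M
              ({inv\<^bsub>M\<^esub> (r i) \<otimes>\<^bsub>M\<^esub> act M \<gamma> (r i) | i \<gamma>. i \<in> {1..n + 1} \<and> \<gamma> \<in> carrier \<Gamma>} \<union>
               r ` {n + 2..n + card T}))))"
      unfolding Let_def
    proof (rule conjI)
      obtain r where r: "\<forall>i\<in>{1..n}. r i \<in> carrier (B_module (Z_ring \<Delta>) \<Gamma> n)" "\<forall>j>n. r j = \<one>\<^bsub>B_module (Z_ring \<Delta>) \<Gamma> n\<^esub>"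
          "equivariant_iso (carrier \<Gamma>) ?M (act_quot (B_module (Z_ring \<Delta>) \<Gamma> n) (B_span (Z_ring \<Delta>) \<Gamma> n (r ` {1..n + card T})))"
        using P.module_presentation[of "card T"] by (elim exE conjE)
      have "\<forall>j\<in>{n + 1..n + card T}. r j \<in> fixed_points (B_module (Z_ring \<Delta>) \<Gamma> n) (decomposition_group Q (w (j - n)))"
        using r(2) fix1[OF P.B_act] by simp
      then show "\<exists>r. (\<forall>i\<in>{1..n}. r i \<in> carrier (B_module (Z_ring \<Delta>) \<Gamma> n)) \<and>
          (\<forall>j\<in>{n + 1..n + card T}. r j \<in> fixed_points (B_module (Z_ring \<Delta>) \<Gamma> n) (decomposition_group Q (w (j - n)))) \<and>
          equivariant_iso (carrier \<Gamma>) ?M (act_quot (B_module (Z_ring \<Delta>) \<Gamma> n) (B_span (Z_ring \<Delta>) \<Gamma> n (r ` {1..n + card T})))"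
        using r(1,3) by (intro exI[of _ r] conjI)
      let ?A = "prime_to_quot \<Delta> (abelianization (F_group n \<Gamma>))"
      obtain r where r: "\<forall>i\<in>{1..n}. r i \<in> carrier ?A" "\<forall>j>n. r j = \<one>\<^bsub>?A\<^esub>"
          "equivariant_iso (carrier \<Gamma>) ?M (act_quot ?A (closed_stable_generate (carrier \<Gamma>) ?A
            ({inv\<^bsub>?A\<^esub> (r i) \<otimes>\<^bsub>?A\<^esub> act ?A \<gamma> (r i) | i \<gamma>. i \<in> {1..n + 1} \<and> \<gamma> \<in> carrier \<Gamma>} \<union> r ` {n + 2..n + card T})))"
        using P.F_group_presentation[OF d(2), of "card T"] unfolding Let_def by (elim exE conjE)
      interpret F: free_act \<Gamma> n by (intro free_act.intro G.fin_Gam[folded \<Gamma>_def])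
      have A: "group_act \<Gamma> ?A" by (rule profin.AA_act[OF F.G_profin])
      show "\<exists>r. (\<forall>i\<in>{1..n}. r i \<in> carrier ?A) \<and> r (n + 1) \<in> fixed_points ?A (decomposition_group Q (w 1)) \<and>
          (\<forall>j\<in>{n + 2..n + card T}. r j \<in> fixed_points ?A (decomposition_group Q (w (j - n)))) \<and>
          equivariant_iso (carrier \<Gamma>) ?M (act_quot ?A (closed_stable_generate (carrier \<Gamma>) ?A
            ({inv\<^bsub>?A\<^esub> (r i) \<otimes>\<^bsub>?A\<^esub> act ?A \<gamma> (r i) | i \<gamma>. i \<in> {1..n + 1} \<and> \<gamma> \<in> carrier \<Gamma>} \<union> r ` {n + 2..n + card T})))"
        using r fix1[OF A] by (intro exI[of _ r] conjI ballI) simp_all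
    qed
  qed
qed

end
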